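(* Let $E$ be a complete metric space. Then every acyclic normal one-dimensional real current $T\in\mathcal{M}_1(E)$ is decomposable in curves; in particular, there is a transport $\eta$ on $\Theta(E)$ such that $T=T_\eta$, $$\mathbb{M}(T_\eta)=\int_{\Theta}\mathbb{M}([\![\theta]\!])\,d\eta(\theta)=\int_\Theta \ell(\theta)\,d\eta(\theta),$$ $$\eta(1)=(\partial T)^+,\qquad \eta(0)=(\partial T)^-,$$ and $\eta$-a.e. $\theta\in\Theta$ is an arc.
   Context: Standing assumption: the density character (minimum cardinality of a dense subset) of every metric space is an Ulam number (a cardinal $\kappa$ such that every finite positive measure defined on all subsets of a set of cardinality $\kappa$ and vanishing on singletons is zero); hence every finite positive Borel measure on a complete metric space is tight and concentrated on a $\sigma$-compact set. Measures are Borel, signed, of finite total variation. Currents. For a metric space $E$, $\mathrm{Lip}(E)$ (resp. $\mathrm{Lip}_b(E)$) denotes the real (resp. bounded real) Lipschitz functions, and $D^k(E)$ is the set of $(f,\pi_1,\dots,\pi_k)$ with $f\in \mathrm{Lip}_b(E)$, $\pi_i\in\mathrm{Lip}(E)$, written $f\,d\pi$. A (real, $k$-dimensional) current is a functional $T:D^k(E)\to\mathbb{R}$ that is multilinear; satisfies $T(f\,d\pi_\nu)\to T(f\,d\pi)$ whenever $\pi_\nu\to\pi$ pointwise with uniformly bounded Lipschitz constants; satisfies $T(f\,d\pi)=0$ if some $\pi_i$ is constant in a neighborhood of $\{f\ne0\}$; and satisfies $|T(f\,d\pi)|\le\prod_i\mathrm{Lip}(\pi_i)\int_E|f|\,d\mu$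 for some finite positive Borel measure $\mu$ (empty product $=1$). The minimal such $\mu$ is the mass measure $\mu_T$; $\mathbb{M}(T):=\mu_T(E)$. $\mathcal{M}_k(E)$ is the set of these currents. Elements of $\mathcal{M}_0(E)$ are identified with signed measures. The boundary is $\partial T(f,\pi_1,\dots,\pi_{k-1}):=T(1,f,\pi_1,\dots,\pi_{k-1})$; $T$ is normal if $\mathbb{M}(T)<\infty$ and $\mathbb{M}(\partial T)<\infty$. For normal $T\in\mathcal{M}_1(E)$, $(\partial T)^\pm$ are the positive and negative parts of the signed measure $\partial T$. Subcurrents. $S\le T$ ($S$ is a subcurrent of $T$) means $\mathbb{M}(T-S)+\mathbb{M}(S)\le\mathbb{M}(T)$. $C$ is a cycle of $T$ if $C\le T$ and $\partial C=0$. $T$ is acyclic if $0$ is its only cycle. Curves. On Lipschitz curves $\theta:[0,1]\to E$ let $d_\Theta(\theta_1,\theta_2)=\inf_\phi\max_t d(\theta_1(t),\theta_2(\phi(t)))$ over increasing bijections $\phi$ of $[0,1]$. $\Theta=\Theta(E)$ is the metric space of equivalence classes ($d_\Theta=0$) of Lipschitz curves; classes are identified with their parameterizations. $\theta\in\Theta$ is an arc if it is injective (admits an injective parameterization). $[\![\theta]\!]\in\mathcal{M}_1(E)$ is $[\![\theta]\!](f\,d\pi)=\int_0^1 f(\theta(t))\,d\pi(\theta(t))$ and $\ell(\theta)=\int_0^1|\dot\theta(t)|\,dt$ is the parametric length. A transport is a finite positive Borel measure $\eta$ on $\Theta$; $T_\eta(\omega):=\int_\Theta[\![\theta]\!](\omega)\,d\eta(\theta)$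 for $\omega\in D^1(E)$; $\eta(i):=(e_i)_\#\eta$ with $e_i(\theta):=\theta(i)$, $i=0,1$. Decomposability. A normal $T\in\mathcal{M}_1(E)$ is decomposable in curves if there is a transport $\eta$ with $T=T_\eta+C$, where $C$ is a cycle of $T$, $T_\eta\le T$, $\mathbb{M}(T_\eta)=\int_\Theta\mathbb{M}([\![\theta]\!])\,d\eta=\int_\Theta\ell\,d\eta$, $\eta(1)=(\partial T)^+$ and $\eta(0)=(\partial T)^-$. *)

theory Defs
  imports "HOL-Analysis.Analysis"
begin

section \<open>Ulam numbers and density character\<close>

text \<open>Being an Ulam number depends only on the cardinality of the set, so cardinals are
  represented by sets. Measures whose \<open>\<sigma>\<close>-algebra is \<^term>\<open>Pow A\<close> automatically have space \<^term>\<open>A\<close>.\<close>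

definition ulam :: "'b set \<Rightarrow> bool" where
  "ulam A \<longleftrightarrow> (\<forall>M. finite_measure M \<and> sets M = Pow A \<and> (\<forall>x\<in>A. emeasure M {x} = 0)
     \<longrightarrow> emeasure M A = 0)"

text \<open>\<^term>\<open>D\<close> is a dense subset of minimum cardinality, i.e. its cardinality is the
  density character of the ambient space.\<close>

definition realizes_density_character :: "'a::metric_space set \<Rightarrow> bool" where
  "realizes_density_character D \<longleftrightarrow>
     closure D = UNIV \<and> (\<forall>D'::'a set. closure D' = UNIV \<longrightarrow> D \<lesssim> D')"


section \<open>Currents\<close>

definition Lip_funs :: "('a::metric_space \<Rightarrow> real) set" where
  "Lip_funs = {g. \<exists>L. L-lipschitz_on UNIV g}"

definition Lipb_funs :: "('a::metric_space \<Rightarrow> real) set" where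
  "Lipb_funs = {f \<in> Lip_funs. bounded (range f)}"

definition Lip :: "('a::metric_space \<Rightarrow> real) \<Rightarrow> real" where
  "Lip g = Inf {L. L-lipschitz_on UNIV g}"

text \<open>The forms \<open>f d\<pi>\<close> are the pairs of \<^term>\<open>f\<close> and a list \<^term>\<open>\<pi>\<close> of length \<^term>\<open>k\<close>.\<close>

definition Lip_tuples :: "nat \<Rightarrow> ('a::metric_space \<Rightarrow> real) list set" where
  "Lip_tuples k = {\<pi>. length \<pi> = k \<and> set \<pi> \<subseteq> Lip_funs}"

type_synonym 'a functional = "('a \<Rightarrow> real) \<Rightarrow> ('a \<Rightarrow> real) list \<Rightarrow> real"

definition multilinear_on_forms :: "nat \<Rightarrow> 'a::metric_space functional \<Rightarrow> bool" where
  "multilinear_on_forms k T \<longleftrightarrow>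
     (\<forall>f\<in>Lipb_funs. \<forall>g\<in>Lipb_funs. \<forall>\<pi>\<in>Lip_tuples k. \<forall>a b.
        T (\<lambda>x. a * f x + b * g x) \<pi> = a * T f \<pi> + b * T g \<pi>) \<and>
     (\<forall>f\<in>Lipb_funs. \<forall>\<pi>\<in>Lip_tuples k. \<forall>i<k. \<forall>p\<in>Lip_funs. \<forall>q\<in>Lip_funs. \<forall>a b.
        T f (\<pi>[i := (\<lambda>x. a * p x + b * q x)]) = a * T f (\<pi>[i := p]) + b * T f (\<pi>[i := q]))"

definition continuous_on_forms :: "nat \<Rightarrow> 'a::metric_space functional \<Rightarrow> bool" where
  "continuous_on_forms k T \<longleftrightarrow>
     (\<forall>f\<in>Lipb_funs. \<forall>\<pi>\<in>Lip_tuples k. \<forall>\<pi>s :: nat \<Rightarrow> ('a \<Rightarrow> real) list.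
        (\<forall>n. \<pi>s n \<in> Lip_tuples k) \<and>
        (\<exists>L. \<forall>n. \<forall>i<k. L-lipschitz_on UNIV (\<pi>s n ! i)) \<and>
        (\<forall>i<k. \<forall>x. (\<lambda>n. (\<pi>s n ! i) x) \<longlonglongrightarrow> (\<pi> ! i) x)
        \<longrightarrow> (\<lambda>n. T f (\<pi>s n)) \<longlonglongrightarrow> T f \<pi>)"

definition local_on_forms :: "nat \<Rightarrow> 'a::metric_space functional \<Rightarrow> bool" where
  "local_on_forms k T \<longleftrightarrow>
     (\<forall>f\<in>Lipb_funs. \<forall>\<pi>\<in>Lip_tuples k.
        (\<exists>i<k. \<exists>U c. open U \<and> {x. f x \<noteq> 0} \<subseteq> U \<and> (\<forall>x\<in>U. (\<pi> ! i) x = c))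
        \<longrightarrow> T f \<pi> = 0)"

definition controls :: "nat \<Rightarrow> 'a::metric_space functional \<Rightarrow> 'a measure \<Rightarrow> bool" where
  "controls k T \<mu> \<longleftrightarrow> finite_measure \<mu> \<and> sets \<mu> = sets borel \<and>
     (\<forall>f\<in>Lipb_funs. \<forall>\<pi>\<in>Lip_tuples k. \<bar>T f \<pi>\<bar> \<le> prod_list (map Lip \<pi>) * (\<integral>x. \<bar>f x\<bar> \<partial>\<mu>))"

text \<open>Functionals are total in HOL. We extend them by \<open>0\<close> outside the set of forms, so that
  equality of currents is equality of functions; all constructions below respect this.\<close>

definition currents :: "nat \<Rightarrow> 'a::metric_space functional set" where
  "currents k = {T.
     (\<forall>f \<pi>. \<not> (f \<in> Lipb_funs \<and> \<pi> \<in> Lip_tuples k) \<longrightarrow> T f \<pi> = 0) \<and>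
     multilinear_on_forms k T \<and> continuous_on_forms k T \<and> local_on_forms k T \<and>
     (\<exists>\<mu>. controls k T \<mu>)}"

text \<open>The order on measures having the same \<open>\<sigma>\<close>-algebra is setwise comparison of \<^const>\<open>emeasure\<close>.\<close>

definition mass_measure :: "nat \<Rightarrow> 'a::metric_space functional \<Rightarrow> 'a measure" where
  "mass_measure k T = (LEAST \<mu>. controls k T \<mu>)"

definition mass :: "nat \<Rightarrow> 'a::metric_space functional \<Rightarrow> ennreal" where
  "mass k T = (if \<exists>\<mu>. controls k T \<mu> then emeasure (mass_measure k T) UNIV else \<infinity>)"

definition boundary :: "'a::metric_space functional \<Rightarrow> 'a functional" where
  "boundary T = (\<lambda>f \<pi>. if f \<in> Lipb_funs then T (\<lambda>_. 1) (f # \<pi>) else 0)"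

definition normal_current :: "nat \<Rightarrow> 'a::metric_space functional \<Rightarrow> bool" where
  "normal_current k T \<longleftrightarrow> T \<in> currents k \<and> mass k T < \<infinity> \<and>
     (k \<ge> 1 \<longrightarrow> mass (k - 1) (boundary T) < \<infinity>)"

text \<open>The Jordan decomposition of the signed measure identified with a current of dimension \<open>0\<close>.\<close>

definition jordan_decomposition ::
  "'a::metric_space functional \<Rightarrow> 'a measure \<Rightarrow> 'a measure \<Rightarrow> bool" where
  "jordan_decomposition S P N \<longleftrightarrow>
     finite_measure P \<and> sets P = sets borel \<and> finite_measure N \<and> sets N = sets borel \<and>
     (\<exists>A\<in>sets borel. emeasure P (- A) = 0 \<and> emeasure N A = 0) \<and>
     (\<forall>f\<in>Lipb_funs. S f [] = (\<integral>x. f x \<partial>P) - (\<integral>x. f x \<partial>N))"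

definition pos_part :: "'a::metric_space functional \<Rightarrow> 'a measure" where
  "pos_part S = (THE P. \<exists>N. jordan_decomposition S P N)"

definition neg_part :: "'a::metric_space functional \<Rightarrow> 'a measure" where
  "neg_part S = (THE N. \<exists>P. jordan_decomposition S P N)"


section \<open>Subcurrents and cycles\<close>

definition subcurrent :: "nat \<Rightarrow> 'a::metric_space functional \<Rightarrow> 'a functional \<Rightarrow> bool" where
  "subcurrent k S T \<longleftrightarrow> S \<in> currents k \<and> T \<in> currents k \<and>
     mass k (\<lambda>f \<pi>. T f \<pi> - S f \<pi>) + mass k S \<le> mass k T"

definition cycle_of :: "nat \<Rightarrow> 'a::metric_space functional \<Rightarrow> 'a functional \<Rightarrow> bool" where
  "cycle_of k C T \<longleftrightarrow> subcurrent k C T \<and> boundary C = (\<lambda>f \<pi>. 0)"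

definition acyclic_current :: "nat \<Rightarrow> 'a::metric_space functional \<Rightarrow> bool" where
  "acyclic_current k T \<longleftrightarrow> (\<forall>C. cycle_of k C T \<longrightarrow> C = (\<lambda>f \<pi>. 0))"


section \<open>The metric space of curves\<close>

definition lip_curve :: "(real \<Rightarrow> 'a::metric_space) \<Rightarrow> bool" where
  "lip_curve \<theta> \<longleftrightarrow> (\<exists>L. L-lipschitz_on {0..1} \<theta>)"

definition increasing_bijections :: "(real \<Rightarrow> real) set" where
  "increasing_bijections = {\<phi>. strict_mono_on {0..1} \<phi> \<and> bij_betw \<phi> {0..1} {0..1}}"

definition curve_dist :: "(real \<Rightarrow> 'a::metric_space) \<Rightarrow> (real \<Rightarrow> 'a) \<Rightarrow> real" where
  "curve_dist \<theta>\<^sub>1 \<theta>\<^sub>2 =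
     (INF \<phi>\<in>increasing_bijections. SUP t\<in>{0..1}. dist (\<theta>\<^sub>1 t) (\<theta>\<^sub>2 (\<phi> t)))"

definition curve_equiv :: "(real \<Rightarrow> 'a::metric_space) \<Rightarrow> (real \<Rightarrow> 'a) \<Rightarrow> bool" where
  "curve_equiv \<theta>\<^sub>1 \<theta>\<^sub>2 \<longleftrightarrow> lip_curve \<theta>\<^sub>1 \<and> lip_curve \<theta>\<^sub>2 \<and> curve_dist \<theta>\<^sub>1 \<theta>\<^sub>2 = 0"

lemma increasing_bijections_id: "id \<in> increasing_bijections"
  by (simp add: increasing_bijections_def strict_mono_on_def)

lemma increasing_bijections_mem:
  "\<phi> \<in> increasing_bijections \<Longrightarrow> t \<in> {0..1} \<Longrightarrow> \<phi> t \<in> {0..1}"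
  unfolding increasing_bijections_def using bij_betw_apply by fastforce

lemma increasing_bijections_comp:
  assumes "\<phi> \<in> increasing_bijections" "\<psi> \<in> increasing_bijections"
  shows "\<psi> \<circ> \<phi> \<in> increasing_bijections"
proof -
  have "bij_betw (\<psi> \<circ> \<phi>) {0..1} {0..1}"
    using assms unfolding increasing_bijections_def by (auto intro: bij_betw_trans)
  moreover have "strict_mono_on {0..1} (\<psi> \<circ> \<phi>)"
    using assms increasing_bijections_mem[OF assms(1)]
    unfolding increasing_bijections_def strict_mono_on_def by auto
  ultimately show ?thesis by (simp add: increasing_bijections_def)
qed

lemma increasing_bijections_inv:
  assumes "\<phi> \<in> increasing_bijections"
  shows "inv_into {0..1} \<phi> \<in> increasing_bijections"
proof -
  let ?\<psi> = "inv_into {0..1} \<phi>"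
  have b: "bij_betw \<phi> {0..1} {0..1}" and m: "strict_mono_on {0..1} \<phi>"
    using assms by (auto simp: increasing_bijections_def)
  have b': "bij_betw ?\<psi> {0..1} {0..1}" by (rule bij_betw_inv_into[OF b])
  have "?\<psi> r < ?\<psi> s" if rs: "r \<in> {0..1}" "s \<in> {0..1}" "r < s" for r s
  proof (rule ccontr)
    assume "\<not> ?\<psi> r < ?\<psi> s"
    then have "?\<psi> s \<le> ?\<psi> r" by simp
    moreover have "?\<psi> r \<in> {0..1}" "?\<psi> s \<in> {0..1}"
      using bij_betw_apply[OF b'] rs by blast+
    ultimately have "\<phi> (?\<psi> s) \<le> \<phi> (?\<psi> r)"
      using m by (metis strict_mono_on_leD)
    moreover have "\<phi> (?\<psi> r) = r" "\<phi> (?\<psi> s) = s"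
      using b rs by (simp_all add: bij_betw_inv_into_right)
    ultimately show False using rs by simp
  qed
  then have "strict_mono_on {0..1} ?\<psi>" by (simp add: strict_mono_on_def)
  with b' show ?thesis by (simp add: increasing_bijections_def)
qed

lemma curve_dist_bdd:
  assumes "lip_curve \<theta>\<^sub>1" "lip_curve \<theta>\<^sub>2" "\<phi> \<in> increasing_bijections"
  shows "bdd_above ((\<lambda>t. dist (\<theta>\<^sub>1 t) (\<theta>\<^sub>2 (\<phi> t))) ` {0..1})"
proof -
  obtain L M where L: "L-lipschitz_on {0..1} \<theta>\<^sub>1" and M: "M-lipschitz_on {0..1} \<theta>\<^sub>2"
    using assms by (auto simp: lip_curve_def)
  have "dist (\<theta>\<^sub>1 t) (\<theta>\<^sub>2 (\<phi> t)) \<le> L + dist (\<theta>\<^sub>1 0) (\<theta>\<^sub>2 0) + M" if t: "t \<in> {0..1}" for t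
  proof -
    have p: "\<phi> t \<in> {0..1}" using increasing_bijections_mem assms(3) t by blast
    have "dist (\<theta>\<^sub>1 t) (\<theta>\<^sub>1 0) \<le> L * dist t 0"
      using L t by (intro lipschitz_onD) auto
    also have "\<dots> \<le> L * 1"
      using t lipschitz_on_nonneg[OF L] by (intro mult_left_mono) auto
    finally have 1: "dist (\<theta>\<^sub>1 t) (\<theta>\<^sub>1 0) \<le> L" by simp
    have "dist (\<theta>\<^sub>2 0) (\<theta>\<^sub>2 (\<phi> t)) \<le> M * dist 0 (\<phi> t)"
      using M p by (intro lipschitz_onD) auto
    also have "\<dots> \<le> M * 1"
      using p lipschitz_on_nonneg[OF M] by (intro mult_left_mono) auto
    finally have 2: "dist (\<theta>\<^sub>2 0) (\<theta>\<^sub>2 (\<phi> t)) \<le> M" by simp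
    show ?thesis
      using 1 2 dist_triangle[of "\<theta>\<^sub>1 t" "\<theta>\<^sub>2 (\<phi> t)" "\<theta>\<^sub>1 0"]
        dist_triangle[of "\<theta>\<^sub>1 0" "\<theta>\<^sub>2 (\<phi> t)" "\<theta>\<^sub>2 0"] by linarith
  qed
  then show ?thesis by (rule bdd_aboveI2)
qed

lemma curve_sup_nonneg:
  assumes "lip_curve \<theta>\<^sub>1" "lip_curve \<theta>\<^sub>2" "\<phi> \<in> increasing_bijections"
  shows "0 \<le> (SUP t\<in>{0..1}. dist (\<theta>\<^sub>1 t) (\<theta>\<^sub>2 (\<phi> t)))"
  by (rule cSUP_upper2[OF curve_dist_bdd[OF assms], of 0]) auto

lemma curve_dist_bdd_below:
  assumes "lip_curve \<theta>\<^sub>1" "lip_curve \<theta>\<^sub>2"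
  shows "bdd_below ((\<lambda>\<phi>. SUP t\<in>{0..1}. dist (\<theta>\<^sub>1 t) (\<theta>\<^sub>2 (\<phi> t))) ` increasing_bijections)"
  using curve_sup_nonneg[OF assms] by (auto intro!: bdd_belowI2[where m=0])

lemma curve_dist_nonneg:
  assumes "lip_curve \<theta>\<^sub>1" "lip_curve \<theta>\<^sub>2"
  shows "0 \<le> curve_dist \<theta>\<^sub>1 \<theta>\<^sub>2"
  unfolding curve_dist_def
  using increasing_bijections_id curve_sup_nonneg[OF assms] by (intro cINF_greatest) auto

lemma curve_dist_upper:
  assumes "lip_curve \<theta>\<^sub>1" "lip_curve \<theta>\<^sub>2" "\<phi> \<in> increasing_bijections"
    and "\<And>t. t \<in> {0..1} \<Longrightarrow> dist (\<theta>\<^sub>1 t) (\<theta>\<^sub>2 (\<phi> t)) \<le> c"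
  shows "curve_dist \<theta>\<^sub>1 \<theta>\<^sub>2 \<le> c"
  unfolding curve_dist_def
  by (rule cINF_lower2[OF curve_dist_bdd_below[OF assms(1,2)] assms(3)])
     (use assms(4) in \<open>auto intro!: cSUP_least\<close>)

lemma curve_dist_witness:
  assumes "lip_curve \<theta>\<^sub>1" "lip_curve \<theta>\<^sub>2" "curve_dist \<theta>\<^sub>1 \<theta>\<^sub>2 < c"
  obtains \<phi> where "\<phi> \<in> increasing_bijections"
    "\<And>t. t \<in> {0..1} \<Longrightarrow> dist (\<theta>\<^sub>1 t) (\<theta>\<^sub>2 (\<phi> t)) \<le> c"
proof -
  obtain \<phi> where \<phi>: "\<phi> \<in> increasing_bijections"
      "(SUP t\<in>{0..1}. dist (\<theta>\<^sub>1 t) (\<theta>\<^sub>2 (\<phi> t))) < c"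
    using assms(3) increasing_bijections_id unfolding curve_dist_def
    by (subst (asm) cINF_less_iff[OF _ curve_dist_bdd_below[OF assms(1,2)]]) auto
  have "dist (\<theta>\<^sub>1 t) (\<theta>\<^sub>2 (\<phi> t)) \<le> c" if "t \<in> {0..1}" for t
    using cSUP_upper[OF that curve_dist_bdd[OF assms(1,2) \<phi>(1)]] \<phi>(2) by linarith
  with \<phi>(1) that show thesis by blast
qed

lemma curve_dist_refl:
  assumes "lip_curve \<theta>" shows "curve_dist \<theta> \<theta> = 0"
proof (rule antisym)
  show "curve_dist \<theta> \<theta> \<le> 0"
    by (rule curve_dist_upper[OF assms assms increasing_bijections_id]) simp
qed (rule curve_dist_nonneg[OF assms assms])

lemma curve_dist_sym_le:
  assumes "lip_curve \<theta>\<^sub>1" "lip_curve \<theta>\<^sub>2"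
  shows "curve_dist \<theta>\<^sub>2 \<theta>\<^sub>1 \<le> curve_dist \<theta>\<^sub>1 \<theta>\<^sub>2"
proof (rule dense_ge)
  fix c assume "curve_dist \<theta>\<^sub>1 \<theta>\<^sub>2 < c"
  then obtain \<phi> where \<phi>: "\<phi> \<in> increasing_bijections"
      "\<And>t. t \<in> {0..1} \<Longrightarrow> dist (\<theta>\<^sub>1 t) (\<theta>\<^sub>2 (\<phi> t)) \<le> c"
    using curve_dist_witness[OF assms] by blast
  show "curve_dist \<theta>\<^sub>2 \<theta>\<^sub>1 \<le> c"
  proof (rule curve_dist_upper[OF assms(2,1) increasing_bijections_inv[OF \<phi>(1)]])
    fix t :: real assume t: "t \<in> {0..1}"
    have "\<phi> (inv_into {0..1} \<phi> t) = t"
      using \<phi>(1) t by (auto simp: increasing_bijections_def bij_betw_inv_into_right)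
    moreover have "inv_into {0..1} \<phi> t \<in> {0..1}"
      using increasing_bijections_mem[OF increasing_bijections_inv[OF \<phi>(1)] t] .
    ultimately show "dist (\<theta>\<^sub>2 t) (\<theta>\<^sub>1 (inv_into {0..1} \<phi> t)) \<le> c"
      using \<phi>(2) by (metis dist_commute)
  qed
qed

lemma curve_dist_sym:
  assumes "lip_curve \<theta>\<^sub>1" "lip_curve \<theta>\<^sub>2"
  shows "curve_dist \<theta>\<^sub>1 \<theta>\<^sub>2 = curve_dist \<theta>\<^sub>2 \<theta>\<^sub>1"
  using curve_dist_sym_le[OF assms] curve_dist_sym_le[OF assms(2,1)] by simp

lemma curve_dist_triangle:
  assumes "lip_curve \<theta>\<^sub>1" "lip_curve \<theta>\<^sub>2" "lip_curve \<theta>\<^sub>3"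
  shows "curve_dist \<theta>\<^sub>1 \<theta>\<^sub>3 \<le> curve_dist \<theta>\<^sub>1 \<theta>\<^sub>2 + curve_dist \<theta>\<^sub>2 \<theta>\<^sub>3"
proof (rule field_le_epsilon)
  fix e :: real assume "0 < e"
  then have "curve_dist \<theta>\<^sub>1 \<theta>\<^sub>2 < curve_dist \<theta>\<^sub>1 \<theta>\<^sub>2 + e / 2"
      "curve_dist \<theta>\<^sub>2 \<theta>\<^sub>3 < curve_dist \<theta>\<^sub>2 \<theta>\<^sub>3 + e / 2" by auto
  then obtain \<phi> \<psi> where
    \<phi>: "\<phi> \<in> increasing_bijections"
      "\<And>t. t \<in> {0..1} \<Longrightarrow> dist (\<theta>\<^sub>1 t) (\<theta>\<^sub>2 (\<phi> t)) \<le> curve_dist \<theta>\<^sub>1 \<theta>\<^sub>2 + e / 2" and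
    \<psi>: "\<psi> \<in> increasing_bijections"
      "\<And>t. t \<in> {0..1} \<Longrightarrow> dist (\<theta>\<^sub>2 t) (\<theta>\<^sub>3 (\<psi> t)) \<le> curve_dist \<theta>\<^sub>2 \<theta>\<^sub>3 + e / 2"
    using curve_dist_witness[OF assms(1,2)] curve_dist_witness[OF assms(2,3)] by metis
  show "curve_dist \<theta>\<^sub>1 \<theta>\<^sub>3 \<le> curve_dist \<theta>\<^sub>1 \<theta>\<^sub>2 + curve_dist \<theta>\<^sub>2 \<theta>\<^sub>3 + e"
  proof (rule curve_dist_upper[OF assms(1,3) increasing_bijections_comp[OF \<phi>(1) \<psi>(1)]])
    fix t :: real assume t: "t \<in> {0..1}"
    have "dist (\<theta>\<^sub>2 (\<phi> t)) (\<theta>\<^sub>3 (\<psi> (\<phi> t))) \<le> curve_dist \<theta>\<^sub>2 \<theta>\<^sub>3 + e / 2"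
      using \<psi>(2) increasing_bijections_mem[OF \<phi>(1) t] by blast
    with \<phi>(2)[OF t] dist_triangle[of "\<theta>\<^sub>1 t" "\<theta>\<^sub>3 (\<psi> (\<phi> t))" "\<theta>\<^sub>2 (\<phi> t)"]
    show "dist (\<theta>\<^sub>1 t) (\<theta>\<^sub>3 ((\<psi> \<circ> \<phi>) t)) \<le> curve_dist \<theta>\<^sub>1 \<theta>\<^sub>2 + curve_dist \<theta>\<^sub>2 \<theta>\<^sub>3 + e"
      by simp
  qed
qed

lemma part_equivp_curve_equiv: "part_equivp curve_equiv"
proof (rule part_equivpI)
  have "lip_curve (\<lambda>_. undefined :: 'a)"
    by (auto simp: lip_curve_def lipschitz_on_def)
  then show "\<exists>\<theta> :: real \<Rightarrow> 'a. curve_equiv \<theta> \<theta>"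
    using curve_dist_refl unfolding curve_equiv_def by blast
  show "symp (curve_equiv :: (real \<Rightarrow> 'a) \<Rightarrow> _)"
    by (auto simp: symp_def curve_equiv_def curve_dist_sym)
  show "transp (curve_equiv :: (real \<Rightarrow> 'a) \<Rightarrow> _)"
  proof (rule transpI)
    fix a b c :: "real \<Rightarrow> 'a"
    assume ab: "curve_equiv a b" and bc: "curve_equiv b c"
    then have l: "lip_curve a" "lip_curve b" "lip_curve c" by (auto simp: curve_equiv_def)
    have "curve_dist a c = 0"
      using curve_dist_triangle[OF l] curve_dist_nonneg[OF l(1,3)] ab bc
      by (simp add: curve_equiv_def)
    with l show "curve_equiv a c" by (simp add: curve_equiv_def)
  qed
qed

text \<open>The space \<open>\<Theta>(E)\<close>. Only values on \<open>[0,1]\<close> of the underlying functions matter.\<close>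

quotient_type (overloaded) 'a curve = "real \<Rightarrow> 'a::metric_space" / partial: curve_equiv
  by (rule part_equivp_curve_equiv)

instantiation curve :: (metric_space) metric_space
begin

lift_definition dist_curve :: "'a curve \<Rightarrow> 'a curve \<Rightarrow> real" is curve_dist
proof -
  fix a b c d :: "real \<Rightarrow> 'a"
  assume "curve_equiv a b" "curve_equiv c d"
  then have l: "lip_curve a" "lip_curve b" "lip_curve c" "lip_curve d"
    and z: "curve_dist a b = 0" "curve_dist b a = 0" "curve_dist c d = 0" "curve_dist d c = 0"
    using curve_dist_sym[of a b] curve_dist_sym[of c d] by (auto simp: curve_equiv_def)
  show "curve_dist a c = curve_dist b d"
    using curve_dist_triangle[OF l(1,2,3)] curve_dist_triangle[OF l(2,4,3)]
      curve_dist_triangle[OF l(2,1,4)] curve_dist_triangle[OF l(1,3,4)] z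
    by linarith
qed

definition uniformity_curve :: "('a curve \<times> 'a curve) filter" where
  "uniformity_curve = (INF e\<in>{0 <..}. principal {(x, y). dist x y < e})"

definition open_curve :: "'a curve set \<Rightarrow> bool" where
  "open_curve U \<longleftrightarrow> (\<forall>x\<in>U. eventually (\<lambda>(x', y). x' = x \<longrightarrow> y \<in> U) uniformity)"

instance
proof
  show "uniformity = (INF e\<in>{0 <..}. principal {(x, y :: 'a curve). dist x y < e})"
    by (rule uniformity_curve_def)
  show "open U \<longleftrightarrow> (\<forall>x\<in>U. eventually (\<lambda>(x', y). x' = x \<longrightarrow> y \<in> U) uniformity)"
    for U :: "'a curve set"
    by (rule open_curve_def)
  show "dist x y = 0 \<longleftrightarrow> x = y" for x y :: "'a curve"
    by transfer (simp add: curve_equiv_def)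
  show "dist x y \<le> dist x z + dist y z" for x y z :: "'a curve"
  proof transfer
    fix a b c :: "real \<Rightarrow> 'a"
    assume "curve_equiv a a" "curve_equiv b b" "curve_equiv c c"
    then have l: "lip_curve a" "lip_curve b" "lip_curve c" by (auto simp: curve_equiv_def)
    show "curve_dist a b \<le> curve_dist a c + curve_dist b c"
      using curve_dist_triangle[OF l(1,3,2)] curve_dist_sym[OF l(2,3)] by simp
  qed
qed

end


section \<open>Functionals of curves and transports\<close>

text \<open>The notions below are evaluated on the representative \<^const>\<open>rep_curve\<close>; endpoint, associated
  current and length do not depend on the choice of the parameterization within a class.\<close>

definition endpoint :: "real \<Rightarrow> 'a::metric_space curve \<Rightarrow> 'a" where
  "endpoint i \<theta> = rep_curve \<theta> i"

definition is_arc :: "'a::metric_space curve \<Rightarrow> bool" where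
  "is_arc \<theta> \<longleftrightarrow> (\<exists>c. curve_equiv (rep_curve \<theta>) c \<and> inj_on c {0..1})"

text \<open>For \<^term>\<open>\<theta>\<close> and \<^term>\<open>\<pi>\<close> Lipschitz, \<open>\<pi> \<circ> \<theta>\<close> is differentiable a.e. in \<open>[0,1]\<close> and
  \<open>d\<pi>(\<theta>(t)) = (\<pi> \<circ> \<theta>)'(t) dt\<close>; likewise the metric derivative exists a.e.
  The values of \<^const>\<open>deriv\<close> and \<^const>\<open>Lim\<close> on the exceptional null sets are irrelevant.\<close>

definition curve_current :: "'a::metric_space curve \<Rightarrow> 'a functional" where
  "curve_current \<theta> = (\<lambda>f \<pi>. if f \<in> Lipb_funs \<and> \<pi> \<in> Lip_tuples 1
     then LINT t:{0..1}|lebesgue. f (rep_curve \<theta> t) * deriv (\<lambda>s. (\<pi> ! 0) (rep_curve \<theta> s)) t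
     else 0)"

definition metric_derivative :: "(real \<Rightarrow> 'a::metric_space) \<Rightarrow> real \<Rightarrow> real" where
  "metric_derivative \<theta> t = Lim (at 0) (\<lambda>h. dist (\<theta> (t + h)) (\<theta> t) / \<bar>h\<bar>)"

definition curve_length :: "'a::metric_space curve \<Rightarrow> real" where
  "curve_length \<theta> = (LINT t:{0..1}|lebesgue. metric_derivative (rep_curve \<theta>) t)"

definition transport :: "'a::metric_space curve measure \<Rightarrow> bool" where
  "transport \<eta> \<longleftrightarrow> finite_measure \<eta> \<and> sets \<eta> = sets borel"

definition transport_current :: "'a::metric_space curve measure \<Rightarrow> 'a functional" where
  "transport_current \<eta> = (\<lambda>f \<pi>. \<integral>\<theta>. curve_current \<theta> f \<pi> \<partial>\<eta>)"

definition transport_marginal :: "real \<Rightarrow> 'a::metric_space curve measure \<Rightarrow> 'a measure" where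
  "transport_marginal i \<eta> = distr \<eta> borel (endpoint i)"

definition decomposable_in_curves :: "'a::metric_space functional \<Rightarrow> bool" where
  "decomposable_in_curves T \<longleftrightarrow> normal_current 1 T \<and>
     (\<exists>\<eta> C. transport \<eta> \<and>
        T = (\<lambda>f \<pi>. transport_current \<eta> f \<pi> + C f \<pi>) \<and>
        cycle_of 1 C T \<and>
        subcurrent 1 (transport_current \<eta>) T \<and>
        mass 1 (transport_current \<eta>) = (\<integral>\<^sup>+\<theta>. mass 1 (curve_current \<theta>) \<partial>\<eta>) \<and>
        (\<integral>\<^sup>+\<theta>. mass 1 (curve_current \<theta>) \<partial>\<eta>) = (\<integral>\<^sup>+\<theta>. ennreal (curve_length \<theta>) \<partial>\<eta>) \<and>
        transport_marginal 1 \<eta> = pos_part (boundary T) \<and>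
        transport_marginal 0 \<eta> = neg_part (boundary T))"

end

theory Submission
 imports Defs
begin

text \<open>By separation of convex cones, \<open>T\<close> is a limit of finite weighted families of
  \<open>\<epsilon>\<close>-chains of points, in the following sense: the averages of the discrete integrals
  \<open>\<Sum> f(x\<^sub>i) (\<pi>(x\<^sub>i\<^sub>+\<^sub>1) - \<pi>(x\<^sub>i))\<close> converge to \<open>T\<close>, the endpoints to \<open>\<partial>T\<close>, and the
  lengths are asymptotically bounded by the mass measure. The dual inequality needed for this
  holds because the least cost of a chain ending at \<open>x\<close> is a Lipschitz function of \<open>x\<close> whose
  local behaviour bounds \<open>T\<close>. The ultraproduct of the families of chains carries a Loeb measure.
  Edges of the chains that together have no boundary in the limit define a cycle of \<open>T\<close>, so by
  acyclicity their total length vanishes; applied to the very long chains and to the almost closed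
  loops inside chains, this shows that almost every chain of the ultraproduct has finite length
  and no loops. The Ulam hypothesis makes the mass measure tight, so almost every chain is nearly
  standard; its standard part, parameterized by arclength, is a Lipschitz curve without loops,
  hence an arc, and the image of the Loeb measure is the transport.\<close>

section \<open>Bounded Lipschitz functions and finite Borel measures\<close>

text \<open>The space has no linear structure, no separability and no local compactness, so neither
  smoothing of \<open>T\<close> nor compactness of approximating measures on curves is at hand. The
  limit over an ultrafilter always exists; compactness is recovered afterwards, chain by chain. The
  price is that length may concentrate on chains of vanishing weight, where no limit curve remembers
  it; the endpoints of such chains are negligible, hence together they form a cycle. All
  approximation conditions are one-sided: the separating functional needs nonnegative coefficients,
  so that the merged cost density is nonnegative, and equalities are recovered by testing with a
  form and its negative. Masses agree because a circle closes: limit curves are at most as long as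
  their chains, the chains are in total as long as the mass of \<open>T\<close>, and a superposition
  has at most the sum of the masses of its curves. Almost no curve is constant, because starts and
  ends are distributed by the two mutually singular parts of the boundary.\<close>

lemma LipbI:
 fixes f :: "'a::metric_space => real"
 assumes "!!x y. \<bar>f x - f y\<bar> <= L * dist x y" "!!x. \<bar>f x\<bar> <= B"
 shows "f : Lipb_funs"
proof -
 have "(max L 0)-lipschitz_on UNIV f"
 proof (rule lipschitz_onI)
  fix x y :: 'a
  have "L * dist x y <= max L 0 * dist x y" by (intro mult_right_mono) auto
  thus "dist (f x) (f y) <= max L 0 * dist x y" using assms(1)[of x y] by (simp add: dist_real_def)
 qed auto
 thus ?thesis using assms(2) by (auto simp: Lipb_funs_def Lip_funs_def bounded_iff)
qed

lemma LipbE: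
 assumes "f : Lipb_funs"
 obtains L B where "0 <= L" "0 <= B" "!!x y. \<bar>f x - f y\<bar> <= L * dist x y" "!!x. \<bar>f x\<bar> <= B"
proof -
 obtain L where L: "L-lipschitz_on UNIV f" using assms by (auto simp: Lipb_funs_def Lip_funs_def)
 obtain B where B: "ALL x. \<bar>f x\<bar> <= B" using assms by (auto simp: Lipb_funs_def bounded_iff)
 show ?thesis
 proof (rule that)
  show "0 <= L" by (rule lipschitz_on_nonneg[OF L])
  show "\<bar>f x - f y\<bar> <= L * dist x y" for x y using lipschitz_onD[OF L, of x y] by (simp add: dist_real_def)
  show "\<bar>f x\<bar> <= B" for x using B by simp
  show "0 <= B" using B[rule_format, of undefined] by linarith
 qed
qed

lemma Lipb_Lip: "f : Lipb_funs ==> f : Lip_funs"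
 by (simp add: Lipb_funs_def)

lemma Lipb_const [simp]: "(%_. c) : Lipb_funs"
 by (rule LipbI[of _ 0 "\<bar>c\<bar>"]) auto

lemma Lipb_lin:
 assumes "f : Lipb_funs" "g : Lipb_funs" shows "(%x. a * f x + b * g x) : Lipb_funs"
proof -
 obtain L B where f: "0 <= L" "0 <= B" "!!x y. \<bar>f x - f y\<bar> <= L * dist x y" "!!x. \<bar>f x\<bar> <= B"
  using assms(1) by (rule LipbE) blast
 obtain M C where g: "0 <= M" "0 <= C" "!!x y. \<bar>g x - g y\<bar> <= M * dist x y" "!!x. \<bar>g x\<bar> <= C"
  using assms(2) by (rule LipbE) blast
 show ?thesis
 proof (rule LipbI[of _ "\<bar>a\<bar> * L + \<bar>b\<bar> * M" "\<bar>a\<bar> * B + \<bar>b\<bar> * C"])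
  fix x y
  have "\<bar>(a * f x + b * g x) - (a * f y + b * g y)\<bar> = \<bar>a * (f x - f y) + b * (g x - g y)\<bar>"
   by (simp add: algebra_simps)
  also have "... <= \<bar>a\<bar> * \<bar>f x - f y\<bar> + \<bar>b\<bar> * \<bar>g x - g y\<bar>"
   by (metis abs_mult abs_triangle_ineq)
  also have "... <= \<bar>a\<bar> * (L * dist x y) + \<bar>b\<bar> * (M * dist x y)"
   by (intro add_mono mult_left_mono f g) auto
  finally show "\<bar>(a * f x + b * g x) - (a * f y + b * g y)\<bar> <= (\<bar>a\<bar> * L + \<bar>b\<bar> * M) * dist x y"
   by (simp add: algebra_simps)
 next
  fix x
  have "\<bar>a * f x + b * g x\<bar> <= \<bar>a\<bar> * \<bar>f x\<bar> + \<bar>b\<bar> * \<bar>g x\<bar>" by (metis abs_mult abs_triangle_ineq)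
  also have "... <= \<bar>a\<bar> * B + \<bar>b\<bar> * C" by (intro add_mono mult_left_mono f g) auto
  finally show "\<bar>a * f x + b * g x\<bar> <= \<bar>a\<bar> * B + \<bar>b\<bar> * C" .
 qed
qed

lemma Lipb_add: "f : Lipb_funs ==> g : Lipb_funs ==> (%x. f x + g x) : Lipb_funs"
 using Lipb_lin[of f g 1 1] by simp
lemma Lipb_diff: "f : Lipb_funs ==> g : Lipb_funs ==> (%x. f x - g x) : Lipb_funs"
 using Lipb_lin[of f g 1 "-1"] by simp
lemma Lipb_cmult: "f : Lipb_funs ==> (%x. a * f x) : Lipb_funs"
 using Lipb_lin[of f f a 0] by simp
lemma Lipb_uminus: "f : Lipb_funs ==> (%x. - f x) : Lipb_funs"
 using Lipb_lin[of f f "-1" 0] by simp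

lemma Lipb_comp1:
 assumes "f : Lipb_funs" "!!a b. \<bar>k a - k b\<bar> <= C * \<bar>a - b\<bar>"
 shows "(%x. k (f x)) : Lipb_funs"
proof -
 obtain L B where f: "0 <= L" "0 <= B" "!!x y. \<bar>f x - f y\<bar> <= L * dist x y" "!!x. \<bar>f x\<bar> <= B"
  using assms(1) by (rule LipbE) blast
 have C: "0 <= C" using assms(2)[of 0 1] abs_ge_zero[of "k 0 - k 1"] by simp
 show ?thesis
 proof (rule LipbI[of _ "C * L" "\<bar>k 0\<bar> + C * B"])
  show "\<bar>k (f x) - k (f y)\<bar> <= C * L * dist x y" for x y
   using assms(2)[of "f x" "f y"] mult_left_mono[OF f(3)[of x y] C] by (simp add: mult.assoc)
  show "\<bar>k (f x)\<bar> <= \<bar>k 0\<bar> + C * B" for x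
   using assms(2)[of "f x" 0] mult_left_mono[OF f(4)[of x] C] by simp
 qed
qed

lemma Lipb_abs: "f : Lipb_funs ==> (%x. \<bar>f x\<bar>) : Lipb_funs"
 by (rule Lipb_comp1[of _ _ 1]) auto

lemma Lipb_max: "f : Lipb_funs ==> g : Lipb_funs ==> (%x. max (f x) (g x)) : Lipb_funs"
proof -
 assume "f : Lipb_funs" "g : Lipb_funs"
 hence "(%x. (1/2) * (f x + g x) + (1/2) * \<bar>f x - g x\<bar>) : Lipb_funs"
  by (intro Lipb_lin Lipb_add Lipb_diff Lipb_abs)
 moreover have "(1/2) * (f x + g x) + (1/2) * \<bar>f x - g x\<bar> = max (f x) (g x)" for x by (auto simp: max_def field_simps)
 ultimately show ?thesis by simp
qed

lemma Lipb_min: "f : Lipb_funs ==> g : Lipb_funs ==> (%x. min (f x) (g x)) : Lipb_funs"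
 using Lipb_uminus[OF Lipb_max[OF Lipb_uminus Lipb_uminus, of f g]] by (simp add: minus_max_eq_min)

lemma Lipb_mult:
 assumes "f : Lipb_funs" "g : Lipb_funs" shows "(%x. f x * g x) : Lipb_funs"
proof -
 obtain L B where f: "0 <= L" "0 <= B" "!!x y. \<bar>f x - f y\<bar> <= L * dist x y" "!!x. \<bar>f x\<bar> <= B"
  using assms(1) by (rule LipbE) blast
 obtain M C where g: "0 <= M" "0 <= C" "!!x y. \<bar>g x - g y\<bar> <= M * dist x y" "!!x. \<bar>g x\<bar> <= C"
  using assms(2) by (rule LipbE) blast
 show ?thesis
 proof (rule LipbI[of _ "L * C + B * M" "B * C"])
  fix x y
  have "\<bar>f x * g x - f y * g y\<bar> = \<bar>(f x - f y) * g x + f y * (g x - g y)\<bar>" by (simp add: algebra_simps)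
  also have "... <= \<bar>f x - f y\<bar> * \<bar>g x\<bar> + \<bar>f y\<bar> * \<bar>g x - g y\<bar>" by (metis abs_mult abs_triangle_ineq)
  also have "... <= (L * dist x y) * C + B * (M * dist x y)"
   by (intro add_mono mult_mono f g) (use f g in auto)
  finally show "\<bar>f x * g x - f y * g y\<bar> <= (L * C + B * M) * dist x y" by (simp add: algebra_simps)
 next
  show "\<bar>f x * g x\<bar> <= B * C" for x unfolding abs_mult by (intro mult_mono f g) (use f g in auto)
 qed
qed

lemma Lipb_continuous: "f : Lip_funs ==> continuous_on UNIV f"
 unfolding Lip_funs_def using lipschitz_on_continuous_on by auto

lemma Lip_measurable: "f : Lip_funs ==> f : borel_measurable borel"
 using Lipb_continuous borel_measurable_continuous_onI by blast

lemma Lipb_measurable: "f : Lipb_funs ==> f : borel_measurable borel"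
 using Lip_measurable Lipb_Lip by blast

lemma Lipb_infdist_cut: "0 <= c ==> (%x. min 1 (c * infdist x A)) : Lipb_funs"
proof (rule LipbI[of _ c 1])
 fix x y :: 'a assume c: "0 <= c"
 have "\<bar>infdist x A - infdist y A\<bar> <= dist x y" by (rule infdist_triangle_abs)
 hence "c * \<bar>infdist x A - infdist y A\<bar> <= c * dist x y" using c by (rule mult_left_mono)
 hence "\<bar>c * infdist x A - c * infdist y A\<bar> <= c * dist x y"
  using c by (simp add: right_diff_distrib[symmetric] abs_mult)
 thus "\<bar>min 1 (c * infdist x A) - min 1 (c * infdist y A)\<bar> <= c * dist x y" by linarith
 show "\<bar>min 1 (c * infdist x A)\<bar> <= 1" using c infdist_nonneg[of x A] by (simp add: min_def)
qed

lemma Lip_dist_cut: "(%x. max 0 (r - dist x z)) : Lipb_funs"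
proof (rule LipbI[of _ 1 "\<bar>r\<bar>"])
 show "\<bar>max 0 (r - dist x z) - max 0 (r - dist y z)\<bar> <= 1 * dist x y" for x y :: 'a
  using dist_triangle2[of x z y] dist_triangle2[of y z x] by (simp add: dist_commute)
 show "\<bar>max 0 (r - dist x z)\<bar> <= \<bar>r\<bar>" for x using zero_le_dist[of x z] by linarith
qed

definition fbm :: "'a::metric_space measure => bool" where
 "fbm M \<longleftrightarrow> finite_measure M & sets M = sets borel"

lemma fbmD: assumes "fbm M"
 shows "finite_measure M" "sets M = sets borel" "space M = UNIV" "emeasure M A < \<infinity>"
  "borel_measurable M = borel_measurable borel"
proof -
 show 1: "finite_measure M" "sets M = sets borel" using assms by (auto simp: fbm_def)
 show "space M = UNIV" using 1(2) by (metis sets_eq_imp_space_eq space_borel)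
 interpret finite_measure M by fact
 show "emeasure M A < \<infinity>" using emeasure_finite[of A] by (simp add: less_top[symmetric])
 show "borel_measurable M = borel_measurable borel" using 1(2) by (auto intro: measurable_cong_sets)
qed

lemma fbm_integrable_bounded:
 assumes "fbm M" "f : borel_measurable borel" "!!x. \<bar>f x\<bar> <= B"
 shows "integrable M (f :: _ => real)"
proof -
 interpret finite_measure M using assms fbmD by blast
 show ?thesis by (rule integrable_const_bound[of _ B]) (use assms fbmD(5)[OF assms(1)] in auto)
qed

lemma fbm_integrable_Lipb:
 assumes "fbm M" "f : Lipb_funs" shows "integrable M f"
 using assms by (metis LipbE fbm_integrable_bounded Lipb_measurable)

lemma fbm_density:
 assumes "fbm M" "integrable M k" "!!x. 0 <= k x"
 shows "fbm (density M (%x. ennreal (k x)))"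
proof -
 have "emeasure (density M (%x. ennreal (k x))) (space M) < \<infinity>"
  using assms by (simp add: emeasure_density nn_integral_eq_integral cong: nn_integral_cong)
 thus ?thesis using fbmD[OF assms(1)] by (auto simp: fbm_def intro!: finite_measureI)
qed

text \<open>Induction on the generation of the Borel sets: truncated multiples of the distance to
  the complement for open sets, \<open>1 - f\<close> for complements, finite maxima for countable
  unions. One \<open>f\<close> serves a whole finite family of measures, since the uniqueness of
  Jordan decompositions compares four.\<close>

lemma Lipb_approx_indicator_finite:
 fixes \<K> :: "'a::metric_space measure set"
 assumes fin: "finite \<K>" and fbm: "!!K. K : \<K> ==> fbm K" and "A : sets borel" "e > 0"
 shows "EX f:Lipb_funs. (ALL x. 0 <= f x & f x <= 1) & (ALL K:\<K>. (LINT x|K. \<bar>f x - indicator A x\<bar>) < e)"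
proof -
 note [measurable] = Lipb_measurable
 have int: "integrable K (%x. \<bar>f x - indicator A x\<bar>)"
  if "K : \<K>" "f : Lipb_funs" "A : sets borel" for K and f :: "'a => real" and A
 proof -
  obtain B where B: "!!x. \<bar>f x\<bar> <= B" using LipbE[OF \<open>f : Lipb_funs\<close>] by metis
  have "\<bar>\<bar>f x - indicator A x\<bar>\<bar> <= B + 1" for x
   using B[of x] by (simp add: indicator_def split: if_splits) linarith
  moreover have "(%x. \<bar>f x - indicator A x\<bar>) : borel_measurable borel" using that by measurable
  ultimately show ?thesis by (intro fbm_integrable_bounded[OF fbm[OF that(1)]])
 qed
 have "A : sigma_sets UNIV {S. open S}" using assms(3) by (simp add: borel_def)
 thus ?thesis using \<open>e > 0\<close>
 proof (induct arbitrary: e rule: sigma_sets.induct)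
  case (Basic S)
  hence S: "open S" by simp
  \<comment> \<open>\<open>infdist\<close> to the empty set is \<open>0\<close>, so the whole space
    is treated apart.\<close>
  define f where "f n x = (if S = UNIV then 1 else min 1 (real n * infdist x (- S)))" for n x
  have fL: "f n : Lipb_funs" for n using Lipb_infdist_cut[of "real n" "- S"] by (cases "S = UNIV") (simp_all add: f_def[abs_def])
  have f01: "0 <= f n x & f n x <= 1" for n x unfolding f_def using infdist_nonneg[of x "- S"] by (auto simp: min_def)
  have lim: "(%n. \<bar>f n x - indicator S x\<bar>) \<longlonglongrightarrow> 0" for x
  proof (cases "S = UNIV")
   case False
   show ?thesis
   proof (cases "x : S")
    case True
    have "infdist x (- S) > 0"
     using True S False by (metis Compl_empty_eq ComplD closed_Compl double_complement infdist_pos_not_in_closed)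
    then obtain N where N: "1 / infdist x (- S) < real N" using reals_Archimedean2 by blast
    have "f n x = 1" if "n >= N" for n
    proof -
     have "1 <= real N * infdist x (- S)" using N \<open>infdist x (- S) > 0\<close> by (simp add: field_simps)
     also have "... <= real n * infdist x (- S)" using that infdist_nonneg by (intro mult_right_mono) auto
     finally show ?thesis by (simp add: f_def)
    qed
    thus ?thesis using True
     by (intro tendsto_eventually) (auto simp: eventually_sequentially)
   next
    case False thus ?thesis using \<open>S ~= UNIV\<close> by (simp add: f_def)
   qed
  qed (simp add: f_def)
  have conv: "(%n. \<integral>x. \<bar>f n x - indicator S x\<bar> \<partial>K) \<longlonglongrightarrow> 0" if K: "fbm K" for K
  proof -
   have S': "S : sets borel" using S by simp
   note K' = fbmD(5)[OF K]
   have "(%n. \<integral>x. \<bar>f n x - indicator S x\<bar> \<partial>K) \<longlonglongrightarrow> (LINT x|K. 0)"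
   proof (rule integral_dominated_convergence[where w="%_. 1"])
    show "(%x. \<bar>f i x - indicator S x\<bar>) : borel_measurable K" for i
     using fL[of i] S' unfolding K' by measurable
    show "integrable K (%_. 1::real)" using fbm_integrable_bounded[OF K, of "%_. 1" 1] by simp
    show "AE x in K. (%n. \<bar>f n x - indicator S x\<bar>) \<longlonglongrightarrow> 0" using lim by simp
    have "norm \<bar>f i x - indicator S x\<bar> <= 1" for i x using f01[of i x] by (auto simp: indicator_def)
    thus "AE x in K. norm \<bar>f i x - indicator S x\<bar> <= 1" for i by simp
   qed simp
   thus ?thesis by simp
  qed
  have "\<forall>\<^sub>F n in sequentially. ALL K:\<K>. (LINT x|K. \<bar>f n x - indicator S x\<bar>) < e"
   using order_tendstoD(2)[OF conv[OF fbm] Basic(2)] by (intro eventually_ball_finite fin) blast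
  then obtain n where "ALL K:\<K>. (LINT x|K. \<bar>f n x - indicator S x\<bar>) < e"
   using eventually_happens'[OF sequentially_bot] by fast
  thus ?case using fL f01 by blast
 next
  case Empty
  thus ?case by (intro bexI[of _ "%_. 0"]) auto
 next
  case (Compl A)
  then obtain f where f: "f : Lipb_funs" "ALL x. 0 <= f x & f x <= 1"
   "ALL K:\<K>. (LINT x|K. \<bar>f x - indicator A x\<bar>) < e" by blast
  have "\<bar>(1 - f x) - indicator (UNIV - A) x\<bar> = \<bar>f x - indicator A x\<bar>" for x by (auto simp: indicator_def)
  thus ?case using f by (intro bexI[of _ "%x. 1 - f x"] Lipb_diff) auto
 next
  case (Union A)
  have A: "A i : sets borel" for i using Union(1) by (simp add: borel_def)
  \<comment> \<open>The errors of the finite maxima add up to at most \<open>e / 2\<close>; the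
    other half pays for replacing the union by \<open>B n\<close>.\<close>
  define ee where "ee i = e / 2 ^ (i + 2)" for i
  define P where "P i f \<longleftrightarrow> f : Lipb_funs & (ALL x. 0 <= f x & f x <= 1) & (ALL K:\<K>. (LINT x|K. \<bar>f x - indicator (A i) x\<bar>) < ee i)"
   for i and f :: "'a => real"
  have "EX f. P i f" for i
   using Union(2)[of "ee i" i] Union(3) by (auto simp: ee_def P_def)
  then obtain f where "!!i. P i (f i)" by metis
  hence f: "!!i. f i : Lipb_funs" "!!i x. 0 <= f i x & f i x <= 1"
   "!!i K. K : \<K> ==> (LINT x|K. \<bar>f i x - indicator (A i) x\<bar>) < ee i"
   by (simp_all add: P_def)
  define F where "F = rec_nat (%_. 0) (%n g x. max (g x) (f n x))"
  have F0: "F 0 = (%_. 0)" and FS: "F (Suc n) = (%x. max (F n x) (f n x))" for n by (auto simp: F_def)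
  have FL: "F n : Lipb_funs" for n by (induct n) (auto simp: F0 FS intro!: Lipb_max f)
  have F01: "0 <= F n x & F n x <= 1" for n x by (induct n) (auto simp: F0 FS f max_def)
  define B where "B n = (\<Union>i<n. A i)" for n
  have Bm: "B n : sets borel" for n unfolding B_def using A by auto
  have part: "(LINT x|K. \<bar>F n x - indicator (B n) x\<bar>) <= (\<Sum>i<n. ee i)"
   if K: "K : \<K>" for K n
  proof (induct n)
   case 0 show ?case by (simp add: F0 B_def)
  next
   case (Suc n)
   have pt: "\<bar>F (Suc n) x - indicator (B (Suc n)) x\<bar> <= \<bar>F n x - indicator (B n) x\<bar> + \<bar>f n x - indicator (A n) x\<bar>" for x
    using F01[of n x] f(2)[of n x] by (auto simp: FS B_def lessThan_Suc indicator_def max_def split: if_splits)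
   have "(LINT x|K. \<bar>F (Suc n) x - indicator (B (Suc n)) x\<bar>) <=
     (LINT x|K. \<bar>F n x - indicator (B n) x\<bar> + \<bar>f n x - indicator (A n) x\<bar>)"
    by (intro integral_mono pt Bochner_Integration.integrable_add int K FL f Bm A)
   also have "... = (LINT x|K. \<bar>F n x - indicator (B n) x\<bar>) + (LINT x|K. \<bar>f n x - indicator (A n) x\<bar>)"
    by (intro Bochner_Integration.integral_add int K FL f Bm A)
   also have "... <= (\<Sum>i<n. ee i) + ee n" using Suc f(3)[OF K, of n] by simp
   finally show ?case by simp
  qed
  have geo: "(\<Sum>i<n. ee i) <= e / 2" for n
  proof -
   have "(\<Sum>i<n. ee i) = e / 2 * (1 - 1 / 2 ^ n)" by (induct n) (auto simp: ee_def field_simps)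
   also have "... <= e / 2 * 1" using Union(3) by (intro mult_left_mono) auto
   finally show ?thesis by simp
  qed
  have conv: "(%n. \<integral>x. \<bar>indicator (\<Union>i. A i) x - indicator (B n) x\<bar> \<partial>K) \<longlonglongrightarrow> (0::real)" if K: "fbm K" for K
  proof -
   have "(%n. \<integral>x. \<bar>indicator (\<Union>i. A i) x - indicator (B n) x\<bar> \<partial>K) \<longlonglongrightarrow> (LINT x|K. (0::real))"
   proof (rule integral_dominated_convergence[where w="%_. 1"])
    show "(%x. \<bar>indicator (\<Union>i. A i) x - indicator (B n) x\<bar> :: real) : borel_measurable K" for n
     unfolding fbmD(5)[OF K] using A Bm[of n] by measurable
    show "integrable K (%_. 1::real)" using fbm_integrable_bounded[OF K, of "%_. 1" 1] by simp
    have "(%n. \<bar>indicator (\<Union>i. A i) x - indicator (B n) x\<bar>) \<longlonglongrightarrow> (0::real)" for x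
    proof (cases "x : (\<Union>i. A i)")
     case True then obtain i where i: "x : A i" by auto
     have "\<bar>indicator (\<Union>i. A i) x - indicator (B n) x\<bar> = (0::real)" if "n > i" for n
      using i that by (auto simp: B_def indicator_def)
     thus ?thesis by (intro tendsto_eventually) (auto simp: eventually_sequentially intro!: exI[of _ "Suc i"])
    next
     case False thus ?thesis by (auto simp: B_def indicator_def)
    qed
    thus "AE x in K. (%n. \<bar>indicator (\<Union>i. A i) x - indicator (B n) x\<bar>) \<longlonglongrightarrow> (0::real)" by simp
    show "AE x in K. norm \<bar>indicator (\<Union>i. A i) x - indicator (B n) x :: real\<bar> <= 1" for n
     by (auto simp: indicator_def)
   qed simp
   thus ?thesis by simp
  qed
  have "\<forall>\<^sub>F n in sequentially. ALL K:\<K>. (LINT x|K. \<bar>indicator (\<Union>i. A i) x - indicator (B n) x\<bar>) < e/2"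
   using order_tendstoD(2)[OF conv[OF fbm], of _ "e/2"] Union(3) by (intro eventually_ball_finite fin) auto
  then obtain n where n: "ALL K:\<K>. (LINT x|K. \<bar>indicator (\<Union>i. A i) x - indicator (B n) x\<bar>) < e/2"
   using eventually_happens'[OF sequentially_bot] by fast
  have close: "(LINT x|K. \<bar>F n x - indicator (\<Union>i. A i) x\<bar>) < e"
   if K: "K : \<K>" for K
  proof -
   have i2: "integrable K (%x. \<bar>indicator (\<Union>i. A i) x - indicator (B n) x\<bar> :: real)"
    by (rule fbm_integrable_bounded[OF fbm[OF K], of _ 1]) (use A Bm[of n] in \<open>auto simp: indicator_def\<close>)
   have "(LINT x|K. \<bar>F n x - indicator (\<Union>i. A i) x\<bar>) <=
     (LINT x|K. \<bar>F n x - indicator (B n) x\<bar> + \<bar>indicator (\<Union>i. A i) x - indicator (B n) x\<bar>)"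
    by (intro integral_mono Bochner_Integration.integrable_add int K i2 FL Bm) (use A in auto)
   also have "... = (LINT x|K. \<bar>F n x - indicator (B n) x\<bar>) + (LINT x|K. \<bar>indicator (\<Union>i. A i) x - indicator (B n) x\<bar>)"
    by (intro Bochner_Integration.integral_add int K i2 FL Bm)
   also have "... < e/2 + e/2" using part[OF K, of n] geo[of n] bspec[OF n K] by linarith
   finally show ?thesis by simp
  qed
  show ?case using close FL F01 by blast
 qed
qed

lemma Lipb_approx_indicator:
 fixes M N :: "'a::metric_space measure"
 assumes "fbm M" "fbm N" "A : sets borel" "e > 0"
 shows "EX f:Lipb_funs. (ALL x. 0 <= f x & f x <= 1) & (LINT x|M. \<bar>f x - indicator A x\<bar>) < e &
  (LINT x|N. \<bar>f x - indicator A x\<bar>) < e"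
proof -
 have "EX f:Lipb_funs. (ALL x. 0 <= f x & f x <= 1) & (ALL K:{M, N}. (LINT x|K. \<bar>f x - indicator A x\<bar>) < e)"
  by (rule Lipb_approx_indicator_finite) (use assms in auto)
 thus ?thesis by auto
qed

lemma fbm_integrable_mult:
 assumes "fbm M" "integrable M k" "f : Lipb_funs"
 shows "integrable M (%x. f x * (k x :: real))"
proof -
 obtain B where B: "!!x. \<bar>f x\<bar> <= B" using LipbE[OF assms(3)] by metis
 show ?thesis
 proof (rule Bochner_Integration.integrable_bound)
  show "integrable M (%x. B * k x)" using assms(2) by simp
  show "(%x. f x * k x) : borel_measurable M"
   using Lipb_measurable[OF assms(3)] assms(2) unfolding fbmD(5)[OF assms(1), symmetric] by simp
  have "\<bar>f x * k x\<bar> <= \<bar>B * k x\<bar>" for x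
   unfolding abs_mult using B[of x] by (intro mult_right_mono) auto
  thus "AE x in M. norm (f x * k x) <= norm (B * k x)" by simp
 qed
qed

lemma fbm_integrable_indicator_mult:
 assumes "fbm M" "integrable M k" "A : sets borel"
 shows "integrable M (%x. indicator A x * (k x :: real))"
 using integrable_mult_indicator[of A M k] assms fbmD(2)[OF assms(1)] by simp

text \<open>Both sides are stated as integrals of densities, so that signed inequalities are covered.\<close>

lemma Lipb_integral_le_imp_set:
 fixes M N :: "'a::metric_space measure"
 assumes M: "fbm M" and N: "fbm N" and k: "integrable M k" and l: "integrable N l"
  and le: "!!f. f : Lipb_funs ==> (!!x. 0 <= f x) ==> (LINT x|M. f x * k x) <= (LINT x|N. f x * l x)"
  and A: "A : sets borel"
 shows "(LINT x|M. indicator A x * k x) <= (LINT x|N. indicator A x * l x)"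
proof (rule field_le_epsilon)
 fix e :: real assume "e > 0"
 \<comment> \<open>Approximating the indicator in \<open>L^1\<close> of the measures with densities
   \<open>|k|\<close> and \<open>|l|\<close> is exactly what makes the signed integrals of
   \<open>f k\<close> and \<open>f l\<close> close.\<close>
 let ?M = "density M (%x. ennreal \<bar>k x\<bar>)" and ?N = "density N (%x. ennreal \<bar>l x\<bar>)"
 have "fbm ?M" "fbm ?N" by (intro fbm_density M N; use k l in simp)+
 then obtain f where f: "f : Lipb_funs" "ALL x. 0 <= f x & f x <= 1"
  "(LINT x|?M. \<bar>f x - indicator A x\<bar>) < e/2" "(LINT x|?N. \<bar>f x - indicator A x\<bar>) < e/2"
  using Lipb_approx_indicator[of ?M ?N A "e/2"] A \<open>e > 0\<close> by auto
 have gen: "\<bar>(LINT x|M. f x * k x) - (LINT x|M. indicator A x * k x)\<bar> < e/2"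
  if M: "fbm M" and k: "integrable M k" and f': "(LINT x|(density M (%x. ennreal \<bar>k x\<bar>)). \<bar>f x - indicator A x\<bar>) < e/2"
  for M and k :: "'a => real"
 proof -
  have m: "(%x. \<bar>f x - indicator A x\<bar>) : borel_measurable M"
   unfolding fbmD(5)[OF M] using A Lipb_measurable[OF f(1)] by simp
  have "(LINT x|(density M (%x. ennreal \<bar>k x\<bar>)). \<bar>f x - indicator A x\<bar>) = (LINT x|M. \<bar>k x\<bar> * \<bar>f x - indicator A x\<bar>)"
   by (subst integral_density) (use k m in auto)
  moreover have "(LINT x|M. f x * k x) - (LINT x|M. indicator A x * k x) = (LINT x|M. f x * k x - indicator A x * k x)"
   by (intro Bochner_Integration.integral_diff[symmetric] fbm_integrable_mult fbm_integrable_indicator_mult M k f A)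
  moreover have "\<bar>\<integral>x. f x * k x - indicator A x * k x \<partial>M\<bar> <= (LINT x|M. \<bar>f x * k x - indicator A x * k x\<bar>)"
   by (rule integral_abs_bound)
  moreover have "(LINT x|M. \<bar>f x * k x - indicator A x * k x\<bar>) = (LINT x|M. \<bar>k x\<bar> * \<bar>f x - indicator A x\<bar>)"
   by (intro Bochner_Integration.integral_cong) (auto simp: abs_mult[symmetric] algebra_simps)
  ultimately show ?thesis using f' by linarith
 qed
 show "(LINT x|M. indicator A x * k x) <= (LINT x|N. indicator A x * l x) + e"
  using gen[OF M k f(3)] gen[OF N l f(4)] le[OF f(1) f(2)[rule_format, THEN conjunct1]] by linarith
qed

lemma Lipb_integral_eq_imp_measure_eq:
 fixes M N :: "'a::metric_space measure"
 assumes M: "fbm M" and N: "fbm N"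
  and eq: "!!f. f : Lipb_funs ==> (LINT x|M. f x) = (LINT x|N. f x)"
 shows "M = N"
proof (rule measure_eqI)
 show "sets M = sets N" using fbmD M N by metis
 interpret M: finite_measure M by (rule fbmD(1)[OF M])
 interpret N: finite_measure N by (rule fbmD(1)[OF N])
 fix A assume "A : sets M"
 hence A: "A : sets borel" using fbmD(2)[OF M] by simp
 have c: "integrable K (%x. 1::real)" if "fbm K" for K :: "'a measure"
  using fbm_integrable_bounded[OF that, of "%_. 1" 1] by simp
 have "(LINT x|M. indicator A x * 1) = (LINT x|N. indicator A x * (1::real))"
  by (intro antisym Lipb_integral_le_imp_set M N c A) (use eq in auto)
 hence "measure M A = measure N A" using fbmD(3)[OF M] fbmD(3)[OF N] by simp
 thus "emeasure M A = emeasure N A" by (simp add: M.emeasure_eq_measure N.emeasure_eq_measure)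
qed

lemma AE_le_of_Lipb:
 fixes M :: "'a::metric_space measure"
 assumes M: "fbm M" and k: "integrable M k" and l: "integrable M l"
  and le: "!!f. f : Lipb_funs ==> (!!x. 0 <= f x) ==> (LINT x|M. f x * k x) <= (LINT x|M. f x * l x)"
 shows "AE x in M. k x <= (l x :: real)"
proof -
 let ?A = "{x. l x < k x}"
 have km: "k : borel_measurable borel" "l : borel_measurable borel" using k l fbmD(5)[OF M] by auto
 hence A: "?A : sets borel" by measurable
 have int: "integrable M (%x. indicator ?A x * (k x - l x))"
  by (intro fbm_integrable_indicator_mult M A) (use k l in auto)
 have "(LINT x|M. indicator ?A x * (k x - l x)) = (LINT x|M. indicator ?A x * k x) - (LINT x|M. indicator ?A x * l x)"
  unfolding right_diff_distrib by (intro Bochner_Integration.integral_diff fbm_integrable_indicator_mult M k l A)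
 also have "... <= 0" using Lipb_integral_le_imp_set[OF M M k l le A] by simp
 finally have "(LINT x|M. indicator ?A x * (k x - l x)) = 0"
  by (intro antisym integral_nonneg_AE) (auto simp: indicator_def)
 hence "AE x in M. indicator ?A x * (k x - l x) = 0"
  by (subst (asm) integral_nonneg_eq_0_iff_AE[OF int]) (auto simp: indicator_def)
 thus ?thesis by eventually_elim (auto simp: indicator_def split: if_splits)
qed

lemma integral_square_zero_bound:
 fixes a b :: real
 assumes "!!t. 0 <= t * a + t\<^sup>2 * b" "0 <= b" shows "a = 0"
proof (rule ccontr)
 assume "a ~= 0"
 \<comment> \<open>The denominator \<open>1 + b\<close> stays positive for \<open>b = 0\<close>; the
   value at this \<open>t\<close> is \<open>- a^2 / (1 + b)^2\<close>.\<close>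
 define t where "t = - a / (1 + b)"
 have t: "t * (1 + b) = - a" using assms(2) by (simp add: t_def)
 have "0 <= (1 + b)\<^sup>2 * (t * a + t\<^sup>2 * b)" using assms(1)[of t] by simp
 also have "... = (t * (1 + b)) * a * (1 + b) + (t * (1 + b))\<^sup>2 * b" by (simp add: power2_eq_square algebra_simps)
 also have "... = - (a\<^sup>2)" unfolding t by (simp add: power2_eq_square algebra_simps)
 finally show False using \<open>a ~= 0\<close> by simp
qed

text \<open>The density minimises \<open>\<integral> f\<^sup>2 / 2 - S f\<close>; a minimising sequence is Cauchy in \<open>L\<^sup>2\<close> by the
  parallelogram identity, and truncation to \<open>[-1, 1]\<close> does not increase the functional.\<close>

lemma Riesz_dominated:
 fixes M :: "'a::metric_space measure" and S :: "('a => real) => real"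
 assumes M: "fbm M"
  and lin: "!!f g a b. f : Lipb_funs ==> g : Lipb_funs ==> S (%x. a * f x + b * g x) = a * S f + b * S g"
  and bd: "!!f. f : Lipb_funs ==> \<bar>S f\<bar> <= (LINT x|M. \<bar>f x\<bar>)"
 obtains rh where "rh : borel_measurable borel" "!!x. \<bar>rh x\<bar> <= 1" "!!f. f : Lipb_funs ==> S f = (LINT x|M. f x * rh x)"
proof -
 interpret finite_measure M by (rule fbmD(1)[OF M])
 note iL = fbm_integrable_Lipb[OF M]
 define I where "I f = (LINT x|M. (f x)\<^sup>2)" for f :: "'a => real"
 define J where "J f = I f / 2 - S f" for f
 have sq: "(%x. (f x)\<^sup>2) : Lipb_funs" if "f : Lipb_funs" for f :: "'a => real"
  using Lipb_mult[OF that that] by (simp add: power2_eq_square)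
 have Iexp: "I (%x. a * f x + b * g x) = a\<^sup>2 * I f + 2 * a * b * (LINT x|M. f x * g x) + b\<^sup>2 * I g"
  if "f : Lipb_funs" "g : Lipb_funs" for f g a b
 proof -
  have "I (%x. a * f x + b * g x) = (LINT x|M. (a\<^sup>2 * (f x)\<^sup>2 + 2 * a * b * (f x * g x)) + b\<^sup>2 * (g x)\<^sup>2)"
   unfolding I_def by (intro Bochner_Integration.integral_cong) (auto simp: power2_eq_square algebra_simps)
  also have "... = (LINT x|M. a\<^sup>2 * (f x)\<^sup>2 + 2 * a * b * (f x * g x)) + (LINT x|M. b\<^sup>2 * (g x)\<^sup>2)"
   by (rule Bochner_Integration.integral_add) (intro iL Lipb_lin Lipb_cmult sq Lipb_mult that)+
  also have "(LINT x|M. a\<^sup>2 * (f x)\<^sup>2 + 2 * a * b * (f x * g x)) = (LINT x|M. a\<^sup>2 * (f x)\<^sup>2) + (LINT x|M. 2 * a * b * (f x * g x))"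
   by (rule Bochner_Integration.integral_add) (intro iL Lipb_lin Lipb_cmult sq Lipb_mult that)+
  finally show ?thesis by (simp add: I_def mult.assoc)
 qed
 have Jexp: "J (%x. a * f x + b * g x) = a\<^sup>2 / 2 * I f + a * b * (LINT x|M. f x * g x) + b\<^sup>2 / 2 * I g - a * S f - b * S g"
  if "f : Lipb_funs" "g : Lipb_funs" for f g a b
  unfolding J_def Iexp[OF that] lin[OF that] by (simp add: field_simps)
 have Ipos: "0 <= I f" for f unfolding I_def by simp
 have Jlow: "- measure M UNIV / 2 <= J f" if f: "f : Lipb_funs" for f
 proof -
  have "(LINT x|M. \<bar>f x\<bar>) <= (LINT x|M. (1/2) * 1 + (1/2) * (f x)\<^sup>2)"
  proof (intro integral_mono iL Lipb_abs f Lipb_lin sq Lipb_const)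
   fix x
   have "0 <= (\<bar>f x\<bar> - 1)\<^sup>2" by simp
   also have "(\<bar>f x\<bar> - 1)\<^sup>2 = (f x)\<^sup>2 - 2 * \<bar>f x\<bar> + 1" by (simp add: power2_diff)
   finally show "\<bar>f x\<bar> <= (1/2) * 1 + (1/2) * (f x)\<^sup>2" by simp
  qed
  also have "... = measure M UNIV / 2 + I f / 2"
   unfolding I_def using iL[OF sq[OF f]] fbmD(3)[OF M] by (subst Bochner_Integration.integral_add) auto
  finally show ?thesis using bd[OF f] unfolding J_def by linarith
 qed
 define m where "m = Inf (J ` Lipb_funs)"
 have bb: "bdd_below (J ` Lipb_funs)" using Jlow by (auto intro!: bdd_belowI2)
 have mle: "m <= J f" if "f : Lipb_funs" for f unfolding m_def using that bb by (auto intro: cInf_lower)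
 have "EX f:Lipb_funs. J f < m + 1 / real (Suc n)" for n
 proof -
  have "Inf (J ` Lipb_funs) < m + 1 / real (Suc n)" by (simp add: m_def)
  moreover have "J ` Lipb_funs ~= {}" using Lipb_const by blast
  ultimately show ?thesis using cInf_less_iff[OF _ bb] by auto
 qed
 then obtain f where fL: "!!n. f n : Lipb_funs" and fJ: "!!n. J (f n) < m + 1 / real (Suc n)" by metis
 define k where "k n x = max (-1) (min 1 (f n x))" for n x
 have kL: "k n : Lipb_funs" for n unfolding k_def by (intro Lipb_max Lipb_min Lipb_const fL)
 have k1: "\<bar>k n x\<bar> <= 1" for n x unfolding k_def by linarith
 \<comment> \<open>Pointwise \<open>|f - k| <= (f^2 - k^2) / 2\<close>: what truncation loses in
   \<open>S\<close> it gains in the quadratic term.\<close>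
 have kJ: "J (k n) < m + 1 / real (Suc n)" for n
 proof -
  have "S (f n) - S (k n) <= (LINT x|M. \<bar>f n x - k n x\<bar>)"
   using bd[OF Lipb_diff[OF fL[of n] kL[of n]]] lin[OF fL kL, of 1 n "-1" n] by (simp add: abs_le_iff)
  also have "... <= (LINT x|M. (1/2) * (f n x)\<^sup>2 + (-1/2) * (k n x)\<^sup>2)"
  proof (intro integral_mono iL Lipb_abs Lipb_diff Lipb_lin sq fL kL)
   fix x
   have "0 <= (\<bar>f n x\<bar> - 1)\<^sup>2" by simp
   thus "\<bar>f n x - k n x\<bar> <= (1/2) * (f n x)\<^sup>2 + (-1/2) * (k n x)\<^sup>2"
    by (auto simp: k_def power2_eq_square algebra_simps max_def min_def abs_if split: if_splits)
  qed
  also have "... = I (f n) / 2 - I (k n) / 2"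
   unfolding I_def using iL[OF sq[OF fL]] iL[OF sq[OF kL]] by (subst Bochner_Integration.integral_add) auto
  finally show ?thesis using fJ[of n] by (simp add: J_def)
 qed
 \<comment> \<open>\<open>J\<close> at the midpoint is the mean of the two values minus an eighth of
   \<open>I (%x. k i x - k j x)\<close>, and it is at least \<open>m\<close>.\<close>
 have par: "I (%x. k i x - k j x) <= 4 / real (Suc i) + 4 / real (Suc j)" for i j
 proof -
  have "m <= J (%x. (1/2) * k i x + (1/2) * k j x)" by (intro mle Lipb_lin kL)
  thus ?thesis
   using Jexp[OF kL kL, of "1/2" i "1/2" j] Iexp[OF kL kL, of 1 i "-1" j] kJ[of i] kJ[of j]
   by (simp add: J_def power2_eq_square)
 qed
 \<comment> \<open>The passage from \<open>L^2\<close> to \<open>L^1\<close>, where a.e. Cauchy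
   subsequences are extracted: \<open>|d| <= s d^2 / 2 + 1 / (2 s)\<close>, with \<open>s\<close>
   large enough to make the constant term small.\<close>
 have L1: "(LINT x|M. \<bar>k i x - k j x\<bar>) <= s / 2 * I (%x. k i x - k j x) + measure M UNIV / (2 * s)" if s: "s > 0" for s i j
 proof -
  have d: "(%x. k i x - k j x) : Lipb_funs" by (intro Lipb_diff kL)
  have "(LINT x|M. \<bar>k i x - k j x\<bar>) <= (LINT x|M. (s/2) * (k i x - k j x)\<^sup>2 + (1/(2 * s)) * 1)"
  proof (intro integral_mono iL Lipb_abs d Lipb_lin sq[OF d] Lipb_const)
   fix x
   have "0 <= (s * \<bar>k i x - k j x\<bar> - 1)\<^sup>2 / (2 * s)" using s by simp
   also have "... = (s/2) * (k i x - k j x)\<^sup>2 + (1/(2 * s)) * 1 - \<bar>k i x - k j x\<bar>"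
    using s by (simp add: power2_diff power_mult_distrib) (simp add: field_simps power2_eq_square)
   finally show "\<bar>k i x - k j x\<bar> <= (s/2) * (k i x - k j x)\<^sup>2 + (1/(2 * s)) * 1" by simp
  qed
  also have "... = s / 2 * I (%x. k i x - k j x) + measure M UNIV / (2 * s)"
   unfolding I_def using iL[OF sq[OF d]] fbmD(3)[OF M] by (subst Bochner_Integration.integral_add) auto
  finally show ?thesis .
 qed
 have cauchy: "EX N. ALL i>=N. ALL j>=N. (LINT x|M. norm (k i x - k j x)) < e" if e: "e > 0" for e
 proof -
  define s where "s = (measure M UNIV + 1) / e"
  have s: "s > 0" using e by (simp add: s_def add_nonneg_pos)
  have "e * s = measure M UNIV + 1" using e by (simp add: s_def)
  hence sV: "measure M UNIV / (2 * s) < e / 2" using s by (simp add: divide_less_eq)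
  obtain N where N: "1 / real (Suc N) < e / (8 * s)" using nat_approx_posE[of "e / (8 * s)"] e s by auto
  have "(LINT x|M. norm (k i x - k j x)) < e" if ij: "N <= i" "N <= j" for i j
  proof -
   have "4 / real (Suc i) <= 4 * (1 / real (Suc N))" "4 / real (Suc j) <= 4 * (1 / real (Suc N))"
    using ij by (auto intro!: divide_left_mono)
   hence "I (%x. k i x - k j x) <= e / s" using par[of i j] N by simp
   hence "s / 2 * I (%x. k i x - k j x) <= s / 2 * (e / s)" using s by (intro mult_left_mono) auto
   thus ?thesis using L1[OF s, of i j] sV s by simp
  qed
  thus ?thesis by blast
 qed
 obtain q where q: "AE x in M. Cauchy (%i. k (q i) x)" "strict_mono q"
  using cauchy_L1_AE_cauchy_subseq[of M k, OF iL[OF kL] cauchy] by blast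
 define r where "r x = max (-1) (min 1 (lim (%i. k (q i) x)))" for x
 have rm: "r : borel_measurable borel" unfolding r_def using Lipb_measurable[OF kL] by measurable
 have r1: "\<bar>r x\<bar> <= 1" for x unfolding r_def by linarith
 have kr: "AE x in M. (%i. k (q i) x) \<longlonglongrightarrow> r x" using q(1)
 proof eventually_elim
  case (elim x)
  hence l: "(%i. k (q i) x) \<longlonglongrightarrow> lim (%i. k (q i) x)" by (simp add: Cauchy_convergent_iff convergent_LIMSEQ_iff)
  have "\<bar>lim (%i. k (q i) x)\<bar> <= 1" by (rule LIMSEQ_le_const2[OF tendsto_rabs[OF l]]) (use k1 in auto)
  hence "r x = lim (%i. k (q i) x)" unfolding r_def by linarith
  thus ?case using l by simp
 qed
 have Sg: "S g = (LINT x|M. g x * r x)" if g: "g : Lipb_funs" for g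
 proof -
  have conv: "(%n. \<integral>x. k (q n) x * g x \<partial>M) \<longlonglongrightarrow> (LINT x|M. r x * g x)"
  proof (rule integral_dominated_convergence[where w = "%x. \<bar>g x\<bar>"])
   show "(%x. r x * g x) : borel_measurable M" "(%x. k (q n) x * g x) : borel_measurable M" for n
    unfolding fbmD(5)[OF M] using rm Lipb_measurable[OF kL] Lipb_measurable[OF g] by measurable
   show "AE x in M. (%n. k (q n) x * g x) \<longlonglongrightarrow> r x * g x" using kr by eventually_elim (rule tendsto_mult_right)
   show "AE x in M. norm (k (q n) x * g x) <= \<bar>g x\<bar>" for n
    by (intro AE_I2) (simp add: abs_mult k1 mult_left_le_one_le)
  qed (rule iL[OF Lipb_abs[OF g]])
  \<comment> \<open>The competitor is \<open>k (q n) + t g\<close>. In the limit a quadratic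
    polynomial in \<open>t\<close> is nonnegative, so its linear coefficient, the first variation,
    vanishes.\<close>
  have "0 <= t * ((LINT x|M. r x * g x) - S g) + t\<^sup>2 * (I g / 2)" for t
  proof (rule LIMSEQ_le_const)
   have "(%n. t * ((LINT x|M. k (q n) x * g x) - S g) + t\<^sup>2 * (I g / 2) + 1 / real (Suc n)) \<longlonglongrightarrow>
     t * ((LINT x|M. r x * g x) - S g) + t\<^sup>2 * (I g / 2) + 0"
    by (intro tendsto_intros conv LIMSEQ_Suc[OF lim_1_over_n])
   thus "(%n. t * ((LINT x|M. k (q n) x * g x) - S g) + t\<^sup>2 * (I g / 2) + 1 / real (Suc n)) \<longlonglongrightarrow>
     t * ((LINT x|M. r x * g x) - S g) + t\<^sup>2 * (I g / 2)" by (simp only: add_0_right)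
   have "0 <= t * ((LINT x|M. k (q n) x * g x) - S g) + t\<^sup>2 * (I g / 2) + 1 / real (Suc n)" for n
   proof -
    have "m <= J (%x. 1 * k (q n) x + t * g x)" by (intro mle Lipb_lin kL g)
    also have "... = J (k (q n)) + (t * ((LINT x|M. k (q n) x * g x) - S g) + t\<^sup>2 * (I g / 2))"
     unfolding Jexp[OF kL g] by (simp add: J_def algebra_simps)
    moreover have "1 / real (Suc (q n)) <= 1 / real (Suc n)" using seq_suble[OF q(2), of n] by (auto intro!: divide_left_mono)
    ultimately show ?thesis using kJ[of "q n"] by linarith
   qed
   thus "EX N. ALL n>=N. 0 <= t * ((LINT x|M. k (q n) x * g x) - S g) + t\<^sup>2 * (I g / 2) + 1 / real (Suc n)" by blast
  qed
  hence "(LINT x|M. r x * g x) - S g = 0" by (rule integral_square_zero_bound) (simp add: Ipos)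
  thus ?thesis by (simp add: mult.commute)
 qed
 show ?thesis by (rule that[OF rm r1 Sg])
qed

text \<open>Positivity gives \<open>|S f| <= S |f|\<close>, so domination on nonnegative functions
  already yields a density. It is nonnegative a.e., and \<open>max 0\<close> makes it so everywhere,
  as \<open>fbm_density\<close> asks.\<close>

lemma Riesz_positive:
 fixes M :: "'a::metric_space measure" and S :: "('a => real) => real"
 assumes M: "fbm M"
  and lin: "!!f g a b. f : Lipb_funs ==> g : Lipb_funs ==> S (%x. a * f x + b * g x) = a * S f + b * S g"
  and pos: "!!f. f : Lipb_funs ==> (!!x. 0 <= f x) ==> 0 <= S f"
  and bd: "!!f. f : Lipb_funs ==> (!!x. 0 <= f x) ==> S f <= (LINT x|M. f x)"
 obtains N where "fbm N" "!!f. f : Lipb_funs ==> S f = (LINT x|N. f x)"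
proof -
 have bd': "\<bar>S f\<bar> <= (LINT x|M. \<bar>f x\<bar>)" if f: "f : Lipb_funs" for f
 proof -
  have a: "(%x. \<bar>f x\<bar>) : Lipb_funs" using Lipb_abs[OF f] .
  have "0 <= S (%x. 1 * \<bar>f x\<bar> + (-1) * f x)" "0 <= S (%x. 1 * \<bar>f x\<bar> + 1 * f x)"
   by (rule pos, rule Lipb_lin[OF a f], simp)+
  hence "\<bar>S f\<bar> <= S (%x. \<bar>f x\<bar>)" unfolding lin[OF a f] by linarith
  also have "... <= (LINT x|M. \<bar>f x\<bar>)" by (rule bd[OF a]) simp
  finally show ?thesis .
 qed
 obtain rh where rh: "rh : borel_measurable borel" "!!x. \<bar>rh x\<bar> <= 1" "!!f. f : Lipb_funs ==> S f = (LINT x|M. f x * rh x)"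
  using Riesz_dominated[of M S, OF M lin bd'] by blast
 have i: "integrable M rh" using fbm_integrable_bounded[OF M rh(1,2)] .
 have nn: "AE x in M. 0 <= rh x"
  by (rule AE_le_of_Lipb[OF M _ i]) (use pos rh(3) in auto)
 let ?N = "density M (%x. ennreal (max 0 (rh x)))"
 show ?thesis
 proof (rule that[of ?N])
  show "fbm ?N" by (rule fbm_density[OF M]) (use i in auto)
  fix f :: "'a => real" assume f: "f : Lipb_funs"
  have "(LINT x|?N. f x) = (LINT x|M. max 0 (rh x) * f x)"
   by (subst integral_density) (use rh(1) Lipb_measurable[OF f] in \<open>auto simp: fbmD(5)[OF M]\<close>)
  also have "... = (LINT x|M. f x * rh x)"
   by (rule integral_cong_AE) (use nn rh(1) Lipb_measurable[OF f] in \<open>auto simp: fbmD(5)[OF M] mult.commute\<close>)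
  finally show "S f = (LINT x|?N. f x)" using rh(3)[OF f] by simp
 qed
qed

section \<open>Ulam density characters and tightness\<close>

text \<open>Cardinals of dense sets are well ordered, so a minimum is attained; this supplies a
  dense set to which the Ulam hypothesis applies.\<close>

lemma ex_density_character: "EX D :: 'a::metric_space set. realizes_density_character D"
proof -
 let ?R = "card_of ` {D :: 'a set. closure D = UNIV}"
 have "?R ~= {}" using closure_UNIV by blast
 moreover have "ALL r:?R. Well_order r" using card_of_Well_order by blast
 ultimately have "EX r:?R. ALL r':?R. ordLeq3 r r'" by (rule exists_minim_Well_order)
 then obtain D :: "'a set" where D: "closure D = UNIV" "!!D' :: 'a set. closure D' = UNIV ==> ordLeq3 (card_of D) (card_of D')"
  by auto
 have "D \<lesssim> D'" if "closure D' = UNIV" for D' :: "'a set"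
  using D(2)[OF that] unfolding lepoll_def card_of_ordLeq[symmetric] by blast
 thus ?thesis using D(1) unfolding realizes_density_character_def by blast
qed

text \<open>A family of uniformly separated sets can be indexed injectively by a dense set, and all
  its subunions are closed; so an Ulam density character leaves only countably many non-null members.\<close>

lemma ulam_separated_family:
 fixes M :: "'a::metric_space measure" and E :: "'b => 'a set" and D :: "'a set"
 assumes M: "fbm M" and D: "closure D = UNIV" "ulam D" and dl: "dl > 0"
  and sep: "!!x z y y'. x ~= z ==> y : E x ==> y' : E z ==> dl <= dist y y'"
  and closed: "!!x. closed (E x)"
 obtains C where "countable C" "closed (\<Union>x\<in>-C. E x)" "emeasure M (\<Union>x\<in>-C. E x) = 0"
proof -
 interpret M: finite_measure M by (rule fbmD(1)[OF M])
 have unions: "closed (\<Union>x\<in>S. E x)" for S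
 proof (unfold closed_sequential_limits, intro allI impI, elim conjE)
  fix y l assume y: "ALL n. y n : (\<Union>x\<in>S. E x)" and l: "y \<longlonglongrightarrow> l"
  have "ALL n. EX x. x : S & y n : E x" using y by auto
  then obtain x where x: "!!n. x n : S" "!!n. y n : E (x n)" by metis
  have "Cauchy y" using l by (rule LIMSEQ_imp_Cauchy)
  then obtain N where N: "!!m n. m >= N ==> n >= N ==> dist (y m) (y n) < dl" using dl unfolding Cauchy_def by blast
  have "x n = x N" if "n >= N" for n
   using sep[OF _ x(2)[of n] x(2)[of N]] N[OF that, of N] by fastforce
  hence "!!n. y (n + N) : E (x N)" using x(2) by (metis le_add2)
  moreover have "(%n. y (n + N)) \<longlonglongrightarrow> l" using l by (rule LIMSEQ_ignore_initial_segment)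
  ultimately have "l : E (x N)" by (rule closed_sequentially[OF closed])
  thus "l : (\<Union>x\<in>S. E x)" using x(1) by blast
 qed
 \<comment> \<open>Points of \<open>D\<close> within \<open>dl / 2\<close> of different members are
   different, so \<open>D\<close> indexes the nonempty members injectively.\<close>
 have "EX d. d : D & (EX e:E x. dist d e < dl / 2)" if ne: "E x ~= {}" for x
 proof -
  obtain e where e: "e : E x" using ne by blast
  have "e : closure D" using D(1) by simp
  thus ?thesis using e dl unfolding closure_approachable by (metis half_gt_zero)
 qed
 then obtain d where d: "!!x. E x ~= {} ==> d x : D" "!!x. E x ~= {} ==> EX e:E x. dist (d x) e < dl / 2" by metis
 have dinj: "x = z" if xz: "E x ~= {}" "E z ~= {}" "d x = d z" for x z
 proof (rule ccontr)
  assume "x ~= z"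
  obtain e e' where e: "e : E x" "dist (d x) e < dl / 2" "e' : E z" "dist (d z) e' < dl / 2" using d(2) xz by meson
  have "dist e e' < dl" using dist_triangle3[of e e' "d x"] e xz(3) by simp
  thus False using sep[OF \<open>x ~= z\<close> e(1,3)] by simp
 qed
 define A where "A = {x. E x ~= {} & measure M (E x) ~= 0}"
 have disj: "disjoint_family_on E UNIV" unfolding disjoint_family_on_def using sep dl
  by (metis disjoint_iff dist_self linorder_not_less UNIV_I)
 have Em: "E x : sets M" for x using closed fbmD(2)[OF M] by simp
 \<comment> \<open>Only finitely many disjoint members can have measure above
   \<open>1 / (n + 1)\<close>.\<close>
 have cA: "countable A"
 proof -
  have fin: "finite {x : A. measure M (E x) > 1 / real (Suc n)}" for n
  proof (rule ccontr)
   assume inf: "infinite {x : A. measure M (E x) > 1 / real (Suc n)}"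
   obtain m :: nat where m: "measure M (space M) * real (Suc n) < real m" using reals_Archimedean2 by blast
   obtain F where F: "F \<subseteq> {x : A. measure M (E x) > 1 / real (Suc n)}" "finite F" "card F = m"
    using infinite_arbitrarily_large[OF inf] by blast
   have "real m * (1 / real (Suc n)) <= (\<Sum>x\<in>F. measure M (E x))"
    using sum_bounded_below[of F "1 / real (Suc n)" "%x. measure M (E x)"] F by (force intro: less_imp_le)
   also have "... = measure M (\<Union>x\<in>F. E x)"
    by (rule M.finite_measure_finite_Union[symmetric]) (use F Em disj in \<open>auto simp: disjoint_family_on_def\<close>)
   also have "... <= measure M (space M)" by (rule M.bounded_measure)
   finally show False using m by (simp add: field_simps)
  qed
  have "A = (\<Union>n. {x : A. measure M (E x) > 1 / real (Suc n)})"
  proof (intro set_eqI iffI)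
   fix x assume x: "x : A"
   hence "measure M (E x) > 0" by (auto simp: A_def zero_less_measure_iff)
   then obtain n where "1 / real (Suc n) < measure M (E x)" using nat_approx_posE by blast
   thus "x : (\<Union>n. {x : A. measure M (E x) > 1 / real (Suc n)})" using x by blast
  qed auto
  moreover have "countable (\<Union>n. {x : A. measure M (E x) > 1 / real (Suc n)})"
   by (intro countable_UN countableI_type countable_finite fin)
  ultimately show ?thesis by simp
 qed
 let ?U = "\<Union>x\<in>-A. E x"
 define ix where "ix y = (THE x. y : E x)" for y
 have ix: "ix y = x" if "y : E x" for x y
  unfolding ix_def using that sep dl by (intro the_equality) (auto, metis dist_self linorder_not_less)
 let ?g = "%y. d (ix y)"
 have Um: "?U : sets M" using unions fbmD(2)[OF M] by simp
 let ?R = "restrict_space M ?U"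
 \<comment> \<open>Measurable for the full power set of \<open>D\<close>: each preimage is a union
   of members, hence closed.\<close>
 have gm: "?g : measurable ?R (count_space D)"
 proof (rule measurableI)
  fix y assume "y : space ?R"
  thus "?g y : space (count_space D)" using ix d(1) by (auto simp: space_restrict_space)
 next
  fix S assume "S : sets (count_space D)"
  have "?g -` S \<inter> space ?R = (\<Union>x\<in>{x. x ~: A & d x : S}. E x)"
   using ix fbmD(3)[OF M] by (auto simp: space_restrict_space)
  thus "?g -` S \<inter> space ?R : sets ?R"
   using unions[of "{x. x ~: A & d x : S}"] Um fbmD(2)[OF M]
   by (auto simp: sets_restrict_space_iff)
 qed
 let ?N = "distr ?R (count_space D) ?g"
 have fR: "finite_measure ?R" by (rule finite_measure_restrict_space[OF fbmD(1)[OF M] Um])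
 have at: "emeasure ?N {x} = 0" if "x : D" for x
 proof -
  have "emeasure ?N {x} = emeasure ?R (?g -` {x} \<inter> space ?R)" by (rule emeasure_distr[OF gm]) (use that in auto)
  also have "... = emeasure M (?g -` {x} \<inter> space ?R)"
   by (rule emeasure_restrict_space) (use Um in \<open>auto simp: space_restrict_space\<close>)
  also have "... = 0"
  proof (cases "EX z. z ~: A & E z ~= {} & d z = x")
   case True
   then obtain z where z: "z ~: A" "E z ~= {}" "d z = x" by blast
   have "?g -` {x} \<inter> space ?R \<subseteq> E z" using ix dinj z by (auto simp: space_restrict_space) (metis empty_iff)
   moreover have "emeasure M (E z) = 0" using z by (auto simp: A_def M.emeasure_eq_measure)
   ultimately show ?thesis using emeasure_mono[OF _ Em, of _ z] by (metis le_zero_eq)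
  next
   case False
   hence "?g -` {x} \<inter> space ?R = {}" using ix by (auto simp: space_restrict_space)
   thus ?thesis by simp
  qed
  finally show ?thesis .
 qed
 \<comment> \<open>The push-forward vanishes on points, since a point of \<open>D\<close> comes from
   at most one, null, member; the Ulam property then makes it zero.\<close>
 have "emeasure ?N D = 0"
  using D(2) at finite_measure.finite_measure_distr[OF fR gm] unfolding ulam_def by simp
 hence "emeasure ?R (?g -` D \<inter> space ?R) = 0" by (subst (asm) emeasure_distr[OF gm]) auto
 moreover have "ix y ~: A & d (ix y) : D" if "y : E x" "x ~: A" for x y
  using that ix[OF that(1)] d(1)[of x] by blast
 hence "?g -` D \<inter> space ?R = ?U" using fbmD(3)[OF M] by (auto simp: space_restrict_space)
 ultimately have "emeasure M ?U = 0" using emeasure_restrict_space[of ?U M ?U] Um by simp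
 thus ?thesis using that cA unions by blast
qed

text \<open>A well-ordering assigns each point to the first ball containing it. For fixed
  \<open>n\<close>, the points whose \<open>1 / (n + 1)\<close>-ball lies in their first ball form a
  family separated by \<open>1 / (n + 1)\<close>, so countably many centres carry its mass; every
  point belongs to the family of some \<open>n\<close>.\<close>

lemma ulam_countable_cover:
 fixes M :: "'a::metric_space measure"
 assumes M: "fbm M" and ul: "!!D :: 'a set. realizes_density_character D ==> ulam D" and r: "r > 0"
 obtains C where "countable C" "emeasure M (- (\<Union>x\<in>C. ball x r)) = 0"
proof -
 obtain D :: "'a set" where "realizes_density_character D" using ex_density_character by blast
 hence D: "closure D = UNIV" "ulam D" using ul by (auto simp: realizes_density_character_def)
 obtain R :: "('a \<times> 'a) set" where R: "well_order_on UNIV R" using well_order_on by blast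
 define lt where "lt = R - Id"
 have wf: "wf lt" using R by (simp add: lt_def well_order_on_def)
 have tot: "x ~= z ==> (x, z) : lt \<or> (z, x) : lt" for x z
  using R by (auto simp: lt_def well_order_on_def linear_order_on_def total_on_def)
 define E where "E n x = {y. ball y (1 / real (Suc n)) \<subseteq> ball x r} \<inter> (\<Inter>z\<in>{z. (z, x) : lt}. - ball z r)" for n x
 have "EX C. countable C & closed (\<Union>x\<in>-C. E n x) & emeasure M (\<Union>x\<in>-C. E n x) = 0" for n
 proof -
  let ?dl = "1 / real (Suc n)"
  \<comment> \<open>If \<open>y\<close> and \<open>y'\<close> were closer, \<open>y'\<close> would
    lie in the ball of the earlier centre \<open>x\<close>, which \<open>E n z\<close>
    avoids.\<close>
  have half: "?dl <= dist y y'" if "(x, z) : lt" "y : E n x" "y' : E n z" for x z y y'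
  proof (rule ccontr)
   assume "~ ?thesis"
   hence "y' : ball y ?dl" by simp
   hence "y' : ball x r" using that(2) unfolding E_def by blast
   thus False using that(1,3) unfolding E_def by blast
  qed
  have sep: "?dl <= dist y y'" if "x ~= z" "y : E n x" "y' : E n z" for x z y y'
   using tot[OF that(1)] half that by (metis dist_commute)
  have cl: "closed (E n x)" for x
  proof -
   have "closed {y. ball y ?dl \<subseteq> ball x r}"
   proof (unfold closed_sequential_limits, intro allI impI, elim conjE)
    fix y l assume y: "ALL n. y n : {y. ball y ?dl \<subseteq> ball x r}" and l: "y \<longlonglongrightarrow> l"
    have "w : ball x r" if "w : ball l ?dl" for w
    proof -
     have "(%n. dist (y n) w) \<longlonglongrightarrow> dist l w" using l by (intro tendsto_intros)
     hence "\<forall>\<^sub>F n in sequentially. dist (y n) w < ?dl" using that by (intro order_tendstoD(2)) auto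
     then obtain n where "dist (y n) w < ?dl" by (meson eventually_sequentially order_refl)
     hence "w : ball (y n) ?dl" by simp
     moreover have "ball (y n) ?dl \<subseteq> ball x r" using y by blast
     ultimately show ?thesis by blast
    qed
    thus "l : {y. ball y ?dl \<subseteq> ball x r}" by blast
   qed
   thus ?thesis unfolding E_def by (intro closed_Int closed_INT) auto
  qed
  show ?thesis
   by (rule ulam_separated_family[OF M D, of ?dl "E n"]) (use sep cl in auto)
 qed
 then obtain C where C: "!!n. countable (C n)" "!!n. closed (\<Union>x\<in>-C n. E n x)"
  "!!n. emeasure M (\<Union>x\<in>-C n. E n x) = 0" by metis
 have sub: "- (\<Union>x\<in>(\<Union>n. C n). ball x r) \<subseteq> (\<Union>n. \<Union>x\<in>-C n. E n x)"
 proof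
  fix y assume y: "y : - (\<Union>x\<in>(\<Union>n. C n). ball x r)"
  have "y : {x. y : ball x r}" using r by simp
  then obtain x where x: "y : ball x r" "!!z. (z, x) : lt ==> y ~: ball z r"
   using wf unfolding wf_eq_minimal by (metis mem_Collect_eq)
  obtain e where e: "e > 0" "ball y e \<subseteq> ball x r" using x(1) open_ball open_contains_ball by metis
  obtain n where n: "1 / real (Suc n) < e" using nat_approx_posE[OF e(1)] by blast
  have "ball y (1 / real (Suc n)) \<subseteq> ball x r" using e(2) n by (meson subset_ball less_imp_le order_trans)
  hence "y : E n x" using x(2) unfolding E_def by auto
  moreover have "x ~: C n" using y x(1) by blast
  ultimately show "y : (\<Union>n. \<Union>x\<in>-C n. E n x)" by blast
 qed
 have m: "- (\<Union>x\<in>(\<Union>n. C n). ball x r) : sets M"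
  unfolding fbmD(2)[OF M] by (intro borel_comp borel_open open_UN ballI) auto
 have "emeasure M (- (\<Union>x\<in>(\<Union>n. C n). ball x r)) = 0"
 proof -
  have Em: "(\<Union>x\<in>-C n. E n x) : sets M" for n unfolding fbmD(2)[OF M] by (rule borel_closed[OF C(2)])
  have "emeasure M (\<Union>n. \<Union>x\<in>-C n. E n x) = 0"
   by (rule emeasure_UN_eq_0) (use C Em in auto)
  thus ?thesis using emeasure_mono[OF sub] Em by (metis (no_types, lifting) le_zero_eq sets.countable_UN image_subset_iff)
 qed
 thus ?thesis using that[of "\<Union>n. C n"] C(1) by blast
qed

text \<open>At scale \<open>k\<close> finitely many closed balls miss mass at most
  \<open>e / 2^(k + 1)\<close>; the intersection over all scales is closed and totally bounded,
  hence compact by completeness.\<close>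

lemma tight_of_cover:
 fixes M :: "'a::complete_space measure"
 assumes M: "fbm M" and cov: "!!r. r > 0 ==> EX C. countable C & emeasure M (- (\<Union>x\<in>C. ball x r)) = 0" and e: "e > 0"
 obtains K where "compact K" "measure M (- K) <= e"
proof -
 interpret M: finite_measure M by (rule fbmD(1)[OF M])
 have sM: "sets M = sets borel" "space M = UNIV" using fbmD[OF M] by auto
 have "EX F. finite F & measure M (- (\<Union>x\<in>F. cball x (1 / real (Suc k)))) <= e / 2 ^ Suc k" for k
 proof -
  let ?r = "1 / real (Suc k)"
  obtain C where C: "countable C" "emeasure M (- (\<Union>x\<in>C. ball x ?r)) = 0" using cov[of ?r] by auto
  show ?thesis
  proof (cases "C = {}")
   case True
   hence "measure M (- {}) = 0" using C(2) by (simp add: measure_def)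
   thus ?thesis using e by (intro exI[of _ "{}"]) auto
  next
   case False
   define c where "c = from_nat_into C"
   have Cc: "C = range c" using False C(1) by (simp add: c_def range_from_nat_into)
   define A where "A n = - (\<Union>i<n. cball (c i) ?r)" for n
   have "(%n. measure M (A n)) \<longlonglongrightarrow> measure M (\<Inter>n. A n)"
   proof (rule M.finite_Lim_measure_decseq)
    have "A n : sets borel" for n unfolding A_def by (intro borel_comp borel_closed closed_UN) auto
    thus "range A \<subseteq> sets M" unfolding sM by blast
    show "decseq A" unfolding A_def decseq_def by auto
   qed
   moreover have "measure M (\<Inter>n. A n) = 0"
   proof -
    have s: "(\<Inter>n. A n) \<subseteq> - (\<Union>x\<in>C. ball x ?r)"
    proof
     fix y assume y: "y : (\<Inter>n. A n)"
     have "y ~: ball (c i) ?r" for i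
     proof -
      have "y : A (Suc i)" using y by blast
      thus ?thesis unfolding A_def by (auto simp: lessThan_Suc)
     qed
     thus "y : - (\<Union>x\<in>C. ball x ?r)" using Cc by auto
    qed
    have "emeasure M (\<Inter>n. A n) <= 0"
     unfolding C(2)[symmetric] by (rule emeasure_mono[OF s]) (unfold sM, intro borel_comp borel_open open_UN, auto)
    thus ?thesis by (simp add: measure_def)
   qed
   ultimately have "(%n. measure M (A n)) \<longlonglongrightarrow> 0" by simp
   hence "\<forall>\<^sub>F n in sequentially. measure M (A n) < e / 2 ^ Suc k" using e by (intro order_tendstoD(2)) auto
   then obtain n where "measure M (A n) < e / 2 ^ Suc k" by (meson eventually_sequentially order_refl)
   thus ?thesis by (intro exI[of _ "c ` {..<n}"]) (auto simp: A_def)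
  qed
 qed
 then obtain F where F: "!!k. finite (F k)" "!!k. measure M (- (\<Union>x\<in>F k. cball x (1 / real (Suc k)))) <= e / 2 ^ Suc k" by metis
 let ?B = "%k. \<Union>x\<in>F k. cball x (1 / real (Suc k))"
 define K where "K = (\<Inter>k. ?B k)"
 have clB: "closed (?B k)" for k using F(1) by (intro closed_UN) auto
 show ?thesis
 proof (rule that[of K])
  have "closed K" unfolding K_def using clB by (intro closed_INT) auto
  moreover have "EX k. finite k & K \<subseteq> (\<Union>x\<in>k. ball x eps)" if eps: "eps > 0" for eps
  proof -
   obtain k where k: "1 / real (Suc k) < eps" using nat_approx_posE[OF eps] by blast
   have "K \<subseteq> ?B k" unfolding K_def by blast
   also have "... \<subseteq> (\<Union>x\<in>F k. ball x eps)" using k by force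
   finally show ?thesis using F(1) by blast
  qed
  ultimately show "compact K" unfolding compact_eq_totally_bounded complete_eq_closed by blast
  have "summable (%k. e / 2 ^ Suc k)" "(\<Sum>k. e / 2 ^ Suc k) = e"
   using sums_mult[OF power_half_series, of e] by (auto simp: sums_iff power_divide field_simps)
  hence s: "summable (%k. e / 2 ^ Suc k)" "(\<Sum>k. e / 2 ^ Suc k) = e" by auto
  have s2: "summable (%k. measure M (- ?B k))"
   by (rule summable_comparison_test'[OF s(1), of 0]) (use F(2) in auto)
  have "measure M (- K) = measure M (\<Union>k. - ?B k)" unfolding K_def by (simp add: Compl_INT)
  also have "... <= (\<Sum>k. measure M (- ?B k))"
  proof (rule M.finite_measure_subadditive_countably[OF _ s2])
   have "- ?B k : sets borel" for k by (rule borel_comp[OF borel_closed[OF clB]])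
   thus "range (%k. - ?B k) \<subseteq> sets M" unfolding sM by blast
  qed
  also have "... <= (\<Sum>k. e / 2 ^ Suc k)" by (rule suminf_le[OF F(2) s2 s(1)])
  finally show "measure M (- K) <= e" using s(2) by simp
 qed
qed

section \<open>Mass measures and Jordan decompositions\<close>

lemma Lip_lipschitz:
 assumes "g : Lip_funs"
 shows "(Lip g)-lipschitz_on UNIV g"
proof -
 let ?S = "{L. L-lipschitz_on UNIV g}"
 have ne: "?S ~= {}" using assms by (auto simp: Lip_funs_def)
 have bb: "bdd_below ?S" by (rule bdd_belowI[of _ 0]) (auto intro: lipschitz_on_nonneg)
 show ?thesis
 proof (rule lipschitz_onI)
  show nn: "0 <= Lip g" unfolding Lip_def by (rule cInf_greatest[OF ne]) (auto intro: lipschitz_on_nonneg)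
  fix x y
  show "dist (g x) (g y) <= Lip g * dist x y"
  proof (cases "x = y")
   case False
   hence d: "dist x y > 0" by simp
   have "dist (g x) (g y) / dist x y <= Lip g" unfolding Lip_def
   proof (rule cInf_greatest[OF ne])
    fix L assume "L : ?S"
    hence "dist (g x) (g y) <= L * dist x y" by (auto dest: lipschitz_onD)
    thus "dist (g x) (g y) / dist x y <= L" using d by (simp add: divide_le_eq)
   qed
   thus ?thesis using d by (simp add: divide_le_eq)
  qed simp
 qed
qed

lemma Lip_nonneg: "g : Lip_funs ==> 0 <= Lip g"
 using Lip_lipschitz lipschitz_on_nonneg by blast

lemma Lip_bound: "g : Lip_funs ==> \<bar>g x - g y\<bar> <= Lip g * dist x y"
 using lipschitz_onD[OF Lip_lipschitz, of g x y] by (simp add: dist_real_def)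

lemma Lip_le: "L-lipschitz_on UNIV g ==> Lip g <= L"
 unfolding Lip_def by (rule cInf_lower) (auto intro!: bdd_belowI[of _ 0] intro: lipschitz_on_nonneg)

definition Lip_prod :: "('a::metric_space => real) list => real" where
 "Lip_prod pj = prod_list (map Lip pj)"

lemma Lip_prod_nonneg: "pj : Lip_tuples k ==> 0 <= Lip_prod pj"
proof -
 have "set pj \<subseteq> Lip_funs ==> 0 <= Lip_prod pj" for pj :: "('a => real) list"
  by (induct pj) (auto simp: Lip_prod_def Lip_nonneg)
 thus "pj : Lip_tuples k ==> 0 <= Lip_prod pj" by (simp add: Lip_tuples_def)
qed

lemma controls_iff:
 "controls k T mu \<longleftrightarrow> fbm mu & (ALL f:Lipb_funs. ALL pj:Lip_tuples k. \<bar>T f pj\<bar> <= Lip_prod pj * (LINT x|mu. \<bar>f x\<bar>))"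
 by (simp add: controls_def fbm_def Lip_prod_def conj_assoc)

definition linear_first :: "nat => 'a::metric_space functional => bool" where
 "linear_first k T \<longleftrightarrow> (ALL f:Lipb_funs. ALL g:Lipb_funs. ALL pj:Lip_tuples k. ALL a b.
   T (%x. a * f x + b * g x) pj = a * T f pj + b * T g pj)"

lemma currents_linear_first: "T : currents k ==> linear_first k T"
 by (simp add: currents_def multilinear_on_forms_def linear_first_def)

text \<open>Finite subfamilies are lists, so that concatenation enlarges them and their maxima
  increase.\<close>

fun max_abs :: "('b => 'a => real) => 'b list => 'a => real" where
 "max_abs r [] x = 0"
| "max_abs r (q # qs) x = max \<bar>r q x\<bar> (max_abs r qs x)"

lemma max_abs_append: "max_abs r (xs @ ys) x = max (max_abs r xs x) (max_abs r ys x)"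
proof (induct xs)
 case Nil
 have "0 <= max_abs r ys x" by (induct ys) auto
 thus ?case by simp
qed (auto simp: max.assoc)

lemma max_abs_bounds:
 assumes "!!q. \<bar>r q x\<bar> <= 1" shows "0 <= max_abs r qs x" "max_abs r qs x <= 1"
 using assms by (induct qs) (auto simp: max_def)

lemma max_abs_measurable:
 assumes "!!q. r q : borel_measurable borel"
 shows "max_abs r qs : borel_measurable (borel :: 'a::topological_space measure)"
proof (induct qs)
 case Nil thus ?case by simp
next
 case (Cons q qs)
 have "(%x. max \<bar>r q x\<bar> (max_abs r qs x)) : borel_measurable borel"
  using Cons assms[of q] by measurable
 thus ?case by simp
qed

text \<open>Riesz applied to \<open>T f pj / Lip_prod pj\<close>, which \<open>mu\<close> dominates
  with constant one. If \<open>pj\<close> is no tuple or \<open>Lip_prod pj\<close> is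
  \<open>0\<close>, the density is set to \<open>0\<close>; in the second case \<open>T\<close>
  vanishes by control, so the formula survives.\<close>

lemma density_family:
 fixes T :: "'a::metric_space functional"
 assumes lin: "linear_first k T" and c: "controls k T mu"
 obtains r where "!!pj. r pj : borel_measurable borel" "!!pj x. \<bar>r pj x\<bar> <= 1"
  "!!f pj. f : Lipb_funs ==> pj : Lip_tuples k ==> T f pj = Lip_prod pj * (LINT x|mu. f x * r pj x)"
  "!!pj x. ~ (pj : Lip_tuples k & Lip_prod pj > 0) ==> r pj x = 0"
proof -
 have M: "fbm mu" and bd: "!!f pj. f : Lipb_funs ==> pj : Lip_tuples k ==> \<bar>T f pj\<bar> <= Lip_prod pj * (LINT x|mu. \<bar>f x\<bar>)"
  using c by (auto simp: controls_iff)
 have "EX r. r : borel_measurable borel & (ALL x. \<bar>r x\<bar> <= 1) &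
   (ALL f:Lipb_funs. pj : Lip_tuples k --> T f pj = Lip_prod pj * (LINT x|mu. f x * r x)) &
   (~ (pj : Lip_tuples k & Lip_prod pj > 0) --> (ALL x. r x = 0))" for pj
 proof (cases "pj : Lip_tuples k & Lip_prod pj > 0")
  case False
  have "T f pj = 0" if "f : Lipb_funs" "pj : Lip_tuples k" for f
   using bd[OF that] False that Lip_prod_nonneg[of pj k] by (cases "Lip_prod pj = 0") auto
  thus ?thesis by (intro exI[of _ "%_. 0"]) auto
 next
  case True
  hence p: "pj : Lip_tuples k" "Lip_prod pj > 0" by auto
  obtain r where r: "r : borel_measurable borel" "!!x. \<bar>r x\<bar> <= 1"
   "!!f. f : Lipb_funs ==> T f pj / Lip_prod pj = (LINT x|mu. f x * r x)"
  proof (rule Riesz_dominated[OF M, of "%f. T f pj / Lip_prod pj"])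
   show "T (%x. a * f x + b * g x) pj / Lip_prod pj = a * (T f pj / Lip_prod pj) + b * (T g pj / Lip_prod pj)"
    if "f : Lipb_funs" "g : Lipb_funs" for f g a b
    using lin that p(1) unfolding linear_first_def by (simp add: add_divide_distrib)
   show "\<bar>T f pj / Lip_prod pj\<bar> <= (LINT x|mu. \<bar>f x\<bar>)" if "f : Lipb_funs" for f
    using bd[OF that p(1)] p(2) by (simp add: abs_divide divide_le_eq mult.commute)
  qed blast
  have "T f pj = Lip_prod pj * (LINT x|mu. f x * r x)" if "f : Lipb_funs" for f
   using r(3)[OF that] p(2) by (simp add: field_simps)
  thus ?thesis using r p by blast
 qed
 hence "EX r. ALL pj. r pj : borel_measurable borel & (ALL x. \<bar>r pj x\<bar> <= 1) &
   (ALL f:Lipb_funs. pj : Lip_tuples k --> T f pj = Lip_prod pj * (LINT x|mu. f x * r pj x)) &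
   (~ (pj : Lip_tuples k & Lip_prod pj > 0) --> (ALL x. r pj x = 0))" by (intro choice allI)
 thus ?thesis using that by blast
qed

text \<open>The mass measure is the essential supremum of the densities of \<open>T(\<cdot>, \<pi>) / Lip \<pi>\<close>; the supremum
  is reached along an increasing sequence of finite maxima.\<close>

lemma essential_supremum_sequence:
 fixes r :: "'b => 'a::metric_space => real"
 assumes M: "fbm mu" and rm: "!!q. r q : borel_measurable borel" and rb: "!!q x. \<bar>r q x\<bar> <= 1"
 obtains Q h where "h : borel_measurable borel" "!!x. 0 <= h x" "!!x. h x <= 1"
  "!!x. (%n. max_abs r (Q n) x) \<longlonglongrightarrow> h x" "!!q. AE x in mu. \<bar>r q x\<bar> <= h x"
proof -
 note m = max_abs_measurable[of r, OF rm] and b = max_abs_bounds[of r, OF rb]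
 have im: "integrable mu (max_abs r qs)" for qs
  by (rule fbm_integrable_bounded[OF M m, of _ 1]) (use b[of qs] in simp)
 let ?I = "%qs. \<integral>x. max_abs r qs x \<partial>mu"
 have one: "integrable mu (%_. 1::real)" using fbm_integrable_bounded[OF M, of "%_. 1" 1] by simp
 have bdd: "bdd_above (range ?I)"
  by (rule bdd_aboveI2[where M="\<integral>x. 1 \<partial>mu"]) (intro integral_mono im one b)
 define s where "s = (SUP qs. ?I qs)"
 have Is: "?I qs <= s" for qs unfolding s_def by (rule cSUP_upper[OF _ bdd]) simp
 have "EX qs. s - 1 / real (Suc n) < ?I qs" for n
 proof -
  have "s - 1 / real (Suc n) < (SUP qs. ?I qs)" by (simp add: s_def)
  thus ?thesis using less_cSUP_iff[OF _ bdd] by auto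
 qed
 then obtain qs where qs: "!!n. s - 1 / real (Suc n) < ?I (qs n)" by metis
 \<comment> \<open>Concatenation makes the maxima increase while keeping each list
   \<open>qs n\<close>, whose integral is within \<open>1 / (n + 1)\<close> of the supremum.\<close>
 define Q where "Q = rec_nat [] (%n l. qs n @ l)"
 have Q0: "Q 0 = []" and QS: "Q (Suc n) = qs n @ Q n" for n by (auto simp: Q_def)
 define h where "h x = (SUP n. max_abs r (Q n) x)" for x
 have bb: "bdd_above (range (%n. max_abs r (Q n) x))" for x by (rule bdd_aboveI2[where M=1]) (rule b)
 have inc: "incseq (%n. max_abs r (Q n) x)" for x by (rule incseq_SucI) (simp add: QS max_abs_append)
 have lim: "(%n. max_abs r (Q n) x) \<longlonglongrightarrow> h x" for x
  unfolding h_def by (rule LIMSEQ_incseq_SUP[OF bb inc])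
 have hm: "h : borel_measurable borel" by (rule borel_measurable_LIMSEQ_metric[OF m lim])
 have h0: "0 <= h x" and h1: "h x <= 1" for x
  using LIMSEQ_le_const[OF lim] LIMSEQ_le_const2[OF lim] b by blast+
 \<comment> \<open>Adding one more \<open>q\<close> to each list cannot push the limit above
   \<open>s\<close>, which \<open>h\<close> already reaches; hence the maximum of \<open>h\<close>
   with \<open>|r q|\<close> is \<open>h\<close> a.e.\<close>
 have dc: "(%n. \<integral>x. max \<bar>r q x\<bar> (max_abs r (Q n) x) \<partial>mu) \<longlonglongrightarrow> (LINT x|mu. max \<bar>r q x\<bar> (h x))" for q
 proof (rule integral_dominated_convergence[where w="%_. 1"])
  show "(%x. max \<bar>r q x\<bar> (h x)) : borel_measurable mu"
   unfolding fbmD(5)[OF M] using rm[of q] hm by measurable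
  show "(%x. max \<bar>r q x\<bar> (max_abs r (Q n) x)) : borel_measurable mu" for n
   unfolding fbmD(5)[OF M] using rm[of q] m[of "Q n"] by measurable
  show "AE x in mu. (%n. max \<bar>r q x\<bar> (max_abs r (Q n) x)) \<longlonglongrightarrow> max \<bar>r q x\<bar> (h x)"
   by (intro always_eventually allI tendsto_max tendsto_const lim)
  show "AE x in mu. norm (max \<bar>r q x\<bar> (max_abs r (Q n) x)) <= 1" for n
   using rb b by (auto simp: max_def)
 qed (rule one)
 have dch: "(%n. \<integral>x. max_abs r (Q n) x \<partial>mu) \<longlonglongrightarrow> (LINT x|mu. h x)"
 proof (rule integral_dominated_convergence[where w="%_. 1"])
  show "h : borel_measurable mu" "max_abs r (Q n) : borel_measurable mu" for n
   unfolding fbmD(5)[OF M] using hm m by auto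
  show "AE x in mu. norm (max_abs r (Q n) x) <= 1" for n using b by auto
 qed (use lim one in auto)
 have hs: "s <= (LINT x|mu. h x)"
 proof (rule field_le_epsilon)
  fix e :: real assume "e > 0"
  then obtain n where n: "1 / real (Suc n) < e" using nat_approx_posE by blast
  have "s - e < ?I (qs n)" using qs[of n] n by simp
  also have "... <= (LINT x|mu. h x)"
  proof (rule integral_mono[OF im])
   show "integrable mu h" by (rule fbm_integrable_bounded[OF M hm, of 1]) (use h0 h1 in simp)
   fix x
   have "max_abs r (qs n) x <= max_abs r (Q (Suc n)) x" by (simp add: QS max_abs_append)
   also have "... <= h x" unfolding h_def by (rule cSUP_upper[OF _ bb]) simp
   finally show "max_abs r (qs n) x <= h x" .
  qed
  finally show "s <= (LINT x|mu. h x) + e" by simp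
 qed
 have ih: "integrable mu h" by (rule fbm_integrable_bounded[OF M hm, of 1]) (use h0 h1 in simp)
 have AE: "AE x in mu. \<bar>r q x\<bar> <= h x" for q
 proof -
  have imx: "integrable mu (%x. max \<bar>r q x\<bar> (h x))"
  proof (rule fbm_integrable_bounded[OF M, of _ 1])
   show "(%x. max \<bar>r q x\<bar> (h x)) : borel_measurable borel" using rm[of q] hm by measurable
   show "\<bar>max \<bar>r q x\<bar> (h x)\<bar> <= 1" for x using rb[of q x] h0[of x] h1[of x] by (simp add: max_def)
  qed
  have "(LINT x|mu. max \<bar>r q x\<bar> (h x)) <= s"
   by (rule LIMSEQ_le_const2[OF dc]) (use Is[of "q # Q _"] in auto)
  hence "(LINT x|mu. max \<bar>r q x\<bar> (h x) - h x) <= 0"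
   using hs by (subst Bochner_Integration.integral_diff[OF imx ih]) simp
  hence "(LINT x|mu. max \<bar>r q x\<bar> (h x) - h x) = 0" by (intro antisym integral_nonneg_AE) auto
  hence "AE x in mu. max \<bar>r q x\<bar> (h x) - h x = 0"
   by (subst (asm) integral_nonneg_eq_0_iff_AE) (auto intro!: Bochner_Integration.integrable_diff imx ih)
  thus ?thesis by eventually_elim (auto simp: max_def split: if_splits)
 qed
 show ?thesis by (rule that[OF hm h0 h1 lim AE])
qed

text \<open>Splitting \<open>A\<close> by the sign of a density and by which density attains the
  maximum reduces the claim to one signed density, where it is the control inequality transferred
  from Lipschitz functions to Borel sets.\<close>

lemma max_abs_le_control:
 fixes T :: "'a::metric_space functional"
 assumes M: "fbm mu" and rm: "!!q. r q : borel_measurable borel" and rb: "!!q x. \<bar>r q x\<bar> <= 1"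
  and rT: "!!f pj. f : Lipb_funs ==> pj : Lip_tuples k ==> T f pj = Lip_prod pj * (LINT x|mu. f x * r pj x)"
  and r0: "!!pj x. ~ (pj : Lip_tuples k & Lip_prod pj > 0) ==> r pj x = 0"
  and c: "controls k T nu" and A: "A : sets borel"
 shows "(LINT x|mu. indicator A x * max_abs r qs x) <= measure nu A"
proof -
 have N: "fbm nu" using c by (simp add: controls_iff)
 interpret N: finite_measure nu by (rule fbmD(1)[OF N])
 have ir: "integrable mu (r q)" for q by (rule fbm_integrable_bounded[OF M rm rb])
 note m = max_abs_measurable[of r, OF rm] and b = max_abs_bounds[of r, OF rb]
 have im: "integrable mu (max_abs r qs)" for qs
  by (rule fbm_integrable_bounded[OF M m, of _ 1]) (use b[of qs] in simp)
 have i1: "integrable nu (%_. 1::real)" by simp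
 have sM: "sets nu = sets borel" "space nu = UNIV" "sets mu = sets borel" using fbmD[OF N] fbmD[OF M] by auto
 have signed: "(LINT x|mu. indicator B x * (sg * r q x)) <= measure nu B" if B: "B : sets borel" and sg: "\<bar>sg\<bar> = 1" for B q sg
 proof (cases "q : Lip_tuples k & Lip_prod q > 0")
  case True
  have "(LINT x|mu. indicator B x * (sg * r q x)) <= (LINT x|nu. indicator B x * 1)"
  proof (rule Lipb_integral_le_imp_set[OF M N _ i1 _ B])
   show "integrable mu (%x. sg * r q x)" using ir by simp
   fix f :: "'a => real" assume f: "f : Lipb_funs" "!!x. 0 <= f x"
   have "Lip_prod q * (LINT x|mu. f x * (sg * r q x)) = sg * T f q"
    using rT[OF f(1)] True by (simp add: mult.left_commute)
   also have "... <= \<bar>T f q\<bar>" using sg by (metis abs_ge_self abs_mult mult_1)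
   also have "... <= Lip_prod q * (LINT x|nu. \<bar>f x\<bar>)" using c f(1) True by (simp add: controls_iff)
   finally show "(LINT x|mu. f x * (sg * r q x)) <= (LINT x|nu. f x * 1)" using True f(2) by simp
  qed
  thus ?thesis by (simp add: sM)
 next
  case False thus ?thesis using r0[of q] by simp
 qed
 have single: "(LINT x|mu. indicator B x * \<bar>r q x\<bar>) <= measure nu B" if B: "B : sets borel" for B q
 proof -
  let ?P = "B \<inter> {x. 0 <= r q x}" and ?N = "B \<inter> {x. r q x < 0}"
  have P: "?P : sets borel" "?N : sets borel" using B rm[of q] by measurable
  have "(LINT x|mu. indicator B x * \<bar>r q x\<bar>) = (LINT x|mu. indicator ?P x * (1 * r q x) + indicator ?N x * (-1 * r q x))"
   by (rule Bochner_Integration.integral_cong) (auto simp: indicator_def)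
  also have "... = (LINT x|mu. indicator ?P x * (1 * r q x)) + (LINT x|mu. indicator ?N x * (-1 * r q x))"
   by (intro Bochner_Integration.integral_add fbm_integrable_indicator_mult M P) (use ir in auto)
  also have "... <= measure nu ?P + measure nu ?N" by (intro add_mono signed P) auto
  also have "... = measure nu (?P \<union> ?N)" by (rule N.finite_measure_Union[symmetric]) (use P sM in auto)
  also have "?P \<union> ?N = B" by auto
  finally show ?thesis .
 qed
 show ?thesis using A
 proof (induct qs arbitrary: A)
  case Nil thus ?case by simp
 next
  case (Cons q qs)
  let ?P = "A \<inter> {x. max_abs r qs x < \<bar>r q x\<bar>}" and ?N = "A \<inter> {x. \<bar>r q x\<bar> <= max_abs r qs x}"
  have P: "?P : sets borel" "?N : sets borel" using Cons(2) rm[of q] m[of qs] by measurable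
  have "(LINT x|mu. indicator A x * max_abs r (q # qs) x) = (LINT x|mu. indicator ?P x * \<bar>r q x\<bar> + indicator ?N x * max_abs r qs x)"
   by (rule Bochner_Integration.integral_cong) (auto simp: indicator_def max_def)
  also have "... = (LINT x|mu. indicator ?P x * \<bar>r q x\<bar>) + (LINT x|mu. indicator ?N x * max_abs r qs x)"
   by (intro Bochner_Integration.integral_add fbm_integrable_indicator_mult M P im) (use ir in auto)
  also have "... <= measure nu ?P + measure nu ?N" by (intro add_mono single Cons(1) P)
  also have "... = measure nu (?P \<union> ?N)" by (rule N.finite_measure_Union[symmetric]) (use P sM in auto)
  also have "?P \<union> ?N = A" by auto
  finally show ?case .
 qed
qed

text \<open>A Lipschitz substitute for taking, on the set where \<open>q\<close> attains the
  maximum, the density \<open>r q\<close> times its sign. The constraint that the \<open>|f|\<close>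
  add up to at most \<open>1\<close> is kept exactly: it is what later turns such sums into lower
  bounds for masses.\<close>

lemma max_abs_dual:
 fixes r :: "'b => 'a::metric_space => real"
 assumes M: "fbm mu" and rm: "!!q. r q : borel_measurable borel" and rb: "!!q x. \<bar>r q x\<bar> <= 1"
 shows "e > 0 ==> EX ps. (ALL (f, q):set ps. f : Lipb_funs & q : set qs) &
  (ALL x. (\<Sum>(f, q)\<leftarrow>ps. \<bar>f x\<bar>) <= 1) & (%x. \<Sum>(f, q)\<leftarrow>ps. f x * r q x) : borel_measurable borel &
  (LINT x|mu. \<bar>max_abs r qs x - (\<Sum>(f, q)\<leftarrow>ps. f x * r q x)\<bar>) <= e"
proof (induct qs arbitrary: e)
 case Nil
 thus ?case by (intro exI[of _ "[]"]) auto
next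
 case (Cons q qs)
 note m = max_abs_measurable[of r, OF rm] and b = max_abs_bounds[of r, OF rb]
 have "e / 6 > 0" using Cons(2) by simp
 from Cons(1)[OF this] obtain ps where ps: "!!f p. (f, p) : set ps ==> f : Lipb_funs & p : set qs"
  "!!x. (\<Sum>(f, q)\<leftarrow>ps. \<bar>f x\<bar>) <= 1" "(%x. \<Sum>(f, q)\<leftarrow>ps. f x * r q x) : borel_measurable borel"
  "(LINT x|mu. \<bar>max_abs r qs x - (\<Sum>(f, q)\<leftarrow>ps. f x * r q x)\<bar>) <= e / 6" by blast
 define \<Sigma> where "\<Sigma> x = (\<Sum>(f, q)\<leftarrow>ps. f x * r q x)" for x
 have \<Sigma>m: "\<Sigma> : borel_measurable borel" using ps(3) by (simp add: \<Sigma>_def[abs_def])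
 have \<Sigma>b: "\<bar>\<Sigma> x\<bar> <= 1" for x
 proof -
  have "\<bar>\<Sum>(f, q)\<leftarrow>ps. f x * r q x\<bar> <= (\<Sum>(f, q)\<leftarrow>ps. \<bar>f x\<bar>)"
  proof (induct ps)
   case (Cons p ps)
   obtain f q where p: "p = (f, q)" by (cases p)
   have "\<bar>f x * r q x\<bar> <= \<bar>f x\<bar> * 1" unfolding abs_mult by (intro mult_left_mono rb) auto
   thus ?case using Cons p by simp
  qed simp
  thus ?thesis using ps(2)[of x] by (simp add: \<Sigma>_def)
 qed
 define B where "B = {x. max_abs r qs x < \<bar>r q x\<bar>}"
 have Bm: "B : sets borel" unfolding B_def using rm[of q] m[of qs] by measurable
 have Pm: "{x. 0 < r q x} : sets borel" "{x. r q x < 0} : sets borel" using rm[of q] by measurable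
 obtain xi where xi: "xi : Lipb_funs" "ALL x. 0 <= xi x & xi x <= 1" "(LINT x|mu. \<bar>xi x - indicator B x\<bar>) < e / 6"
  using Lipb_approx_indicator[OF M M Bm \<open>e / 6 > 0\<close>] by blast
 obtain f1 where f1: "f1 : Lipb_funs" "ALL x. 0 <= f1 x & f1 x <= 1" "(LINT x|mu. \<bar>f1 x - indicator {x. 0 < r q x} x\<bar>) < e / 6"
  using Lipb_approx_indicator[OF M M Pm(1) \<open>e / 6 > 0\<close>] by blast
 obtain f2 where f2: "f2 : Lipb_funs" "ALL x. 0 <= f2 x & f2 x <= 1" "(LINT x|mu. \<bar>f2 x - indicator {x. r q x < 0} x\<bar>) < e / 6"
  using Lipb_approx_indicator[OF M M Pm(2) \<open>e / 6 > 0\<close>] by blast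
 \<comment> \<open>\<open>xi\<close> interpolates between the new density with approximate sign
   \<open>f1 - f2\<close> and the combination found for \<open>qs\<close>; convexity preserves the
   constraint.\<close>
 let ?ps = "(%x. xi x * (f1 x - f2 x), q) # map (%(f, q). (%x. (1 - xi x) * f x, q)) ps"
 have sum': "(\<Sum>(f, q)\<leftarrow>?ps. f x * r q x) = xi x * (f1 x - f2 x) * r q x + (1 - xi x) * \<Sigma> x" for x
  unfolding \<Sigma>_def by (simp add: comp_def case_prod_unfold sum_list_const_mult mult.assoc)
 have sumabs: "(\<Sum>(f, q)\<leftarrow>?ps. \<bar>f x\<bar>) <= 1" for x
 proof -
  have "(\<Sum>(f, q)\<leftarrow>?ps. \<bar>f x\<bar>) = xi x * \<bar>f1 x - f2 x\<bar> + (1 - xi x) * (\<Sum>(f, q)\<leftarrow>ps. \<bar>f x\<bar>)"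
   using xi(2)[rule_format, of x] by (simp add: comp_def case_prod_unfold sum_list_const_mult abs_mult)
  also have "... <= xi x * 1 + (1 - xi x) * 1"
   using xi(2)[rule_format, of x] f1(2)[rule_format, of x] f2(2)[rule_format, of x]
   by (intro add_mono mult_left_mono ps(2)) auto
  finally show ?thesis by simp
 qed
 have mS: "(%x. \<Sum>(f, q)\<leftarrow>?ps. f x * r q x) : borel_measurable borel"
  unfolding sum' using \<Sigma>m rm[of q] Lipb_measurable[OF xi(1)] Lipb_measurable[OF f1(1)] Lipb_measurable[OF f2(1)]
  by measurable
 define D where "D x = \<bar>max_abs r qs x - \<Sigma> x\<bar>" for x
 define a where "a x = \<bar>xi x - indicator B x\<bar>" for x
 define b1 where "b1 x = \<bar>f1 x - indicator {x. 0 < r q x} x\<bar>" for x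
 define b2 where "b2 x = \<bar>f2 x - indicator {x. r q x < 0} x\<bar>" for x
 \<comment> \<open>The switch error \<open>a\<close> enters on both branches, the signs contribute
   \<open>b1 + b2\<close>, the induction \<open>D\<close>; at \<open>e / 6\<close> each, the total
   stays below \<open>e\<close>.\<close>
 have pt: "\<bar>max_abs r (q # qs) x - (xi x * (f1 x - f2 x) * r q x + (1 - xi x) * \<Sigma> x)\<bar> <= 2 * a x + (b1 x + b2 x) + D x" for x
 proof -
  define i where "i = (indicator B x :: real)"
  define sg where "sg = (indicator {x. 0 < r q x} x - indicator {x. r q x < 0} x :: real)"
  have rsg: "\<bar>r q x\<bar> = sg * r q x" by (auto simp: sg_def indicator_def)
  have mx: "max_abs r (q # qs) x = i * \<bar>r q x\<bar> + (1 - i) * max_abs r qs x"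
   by (auto simp: i_def B_def indicator_def max_def)
  have gen: "e = t1 + t2 + t3 + t4 ==> \<bar>t1\<bar> <= a * 1 ==> \<bar>t3\<bar> <= a * 1 ==> \<bar>t4\<bar> <= 1 * d ==> \<bar>t2\<bar> <= 1 * (b * 1)
   ==> \<bar>e\<bar> <= 2 * a + b + d" for e t1 t2 t3 t4 a b d :: real by linarith
  have "max_abs r (q # qs) x - (xi x * (f1 x - f2 x) * r q x + (1 - xi x) * \<Sigma> x)
   = (i - xi x) * \<bar>r q x\<bar> + xi x * ((sg - (f1 x - f2 x)) * r q x) + (xi x - i) * max_abs r qs x + (1 - xi x) * (max_abs r qs x - \<Sigma> x)"
   unfolding mx using rsg by (simp add: algebra_simps)
  moreover have "\<bar>(i - xi x) * \<bar>r q x\<bar>\<bar> <= a x * 1"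
   unfolding abs_mult a_def i_def by (intro mult_mono) (use rb[of q x] in auto)
  moreover have "\<bar>(xi x - i) * max_abs r qs x\<bar> <= a x * 1"
   unfolding abs_mult a_def i_def by (intro mult_mono) (use b[of qs x] in auto)
  moreover have "\<bar>(1 - xi x) * (max_abs r qs x - \<Sigma> x)\<bar> <= 1 * D x"
   unfolding abs_mult D_def by (intro mult_mono) (use xi(2)[rule_format, of x] in auto)
  moreover have "\<bar>xi x * ((sg - (f1 x - f2 x)) * r q x)\<bar> <= 1 * ((b1 x + b2 x) * 1)"
  proof -
   have s1: "\<bar>sg - (f1 x - f2 x)\<bar> <= b1 x + b2 x" unfolding sg_def b1_def b2_def by linarith
   show ?thesis unfolding abs_mult
    by (intro mult_mono s1 rb mult_nonneg_nonneg abs_ge_zero) (use xi(2)[rule_format, of x] s1 in auto)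
  qed
  ultimately show ?thesis by (rule gen)
 qed
 have iB: "integrable mu (%x. \<bar>f x - indicator C x\<bar>)" if "f : Lipb_funs" "C : sets borel" for f and C :: "'a set"
 proof (intro integrable_abs Bochner_Integration.integrable_diff)
  show "integrable mu f" by (rule fbm_integrable_Lipb[OF M that(1)])
  show "integrable mu (indicator C :: _ => real)"
   by (rule fbm_integrable_bounded[OF M, of _ 1]) (use that(2) in \<open>auto simp: indicator_def\<close>)
 qed
 have ia: "integrable mu a" unfolding a_def[abs_def] by (rule iB[OF xi(1) Bm])
 have ib1: "integrable mu b1" unfolding b1_def[abs_def] by (rule iB[OF f1(1) Pm(1)])
 have ib2: "integrable mu b2" unfolding b2_def[abs_def] by (rule iB[OF f2(1) Pm(2)])
 have iD: "integrable mu D"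
 proof (rule fbm_integrable_bounded[OF M, of _ 2])
  show "D : borel_measurable borel" unfolding D_def[abs_def] using m[of qs] \<Sigma>m by measurable
  show "\<bar>D x\<bar> <= 2" for x unfolding D_def using b[of qs x] \<Sigma>b[of x] by linarith
 qed
 have "(LINT x|mu. \<bar>max_abs r (q # qs) x - (\<Sum>(f, q)\<leftarrow>?ps. f x * r q x)\<bar>) <= (LINT x|mu. 2 * a x + (b1 x + b2 x) + D x)"
  unfolding sum'
 proof (rule integral_mono_AE')
  show "integrable mu (%x. 2 * a x + (b1 x + b2 x) + D x)" using ia ib1 ib2 iD by simp
  show "AE x in mu. \<bar>max_abs r (q # qs) x - (xi x * (f1 x - f2 x) * r q x + (1 - xi x) * \<Sigma> x)\<bar> <= 2 * a x + (b1 x + b2 x) + D x"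
   by (rule always_eventually) (intro allI pt)
  show "AE x in mu. 0 <= 2 * a x + (b1 x + b2 x) + D x"
   by (rule always_eventually) (intro allI order_trans[OF abs_ge_zero pt])
 qed
 also have "... = 2 * (LINT x|mu. a x) + ((LINT x|mu. b1 x) + (LINT x|mu. b2 x)) + (LINT x|mu. D x)"
  using ia ib1 ib2 iD by simp
 also have "... <= 2 * (e / 6) + (e / 6 + e / 6) + e / 6"
  by (intro add_mono mult_left_mono) (use xi(3) f1(3) f2(3) ps(4) in \<open>auto simp: a_def b1_def b2_def D_def \<Sigma>_def\<close>)
 also have "... <= e" using Cons(2) by simp
 finally have "(LINT x|mu. \<bar>max_abs r (q # qs) x - (\<Sum>(f, q)\<leftarrow>?ps. f x * r q x)\<bar>) <= e" .
 moreover have "ALL (f, p):set ?ps. f : Lipb_funs & p : set (q # qs)"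
  using ps(1) xi(1) f1(1) f2(1) by (auto intro!: Lipb_mult Lipb_diff Lipb_const)
 ultimately show ?case using sumabs mS by blast
qed

text \<open>The candidate is \<open>h mu\<close> with \<open>h\<close> the essential supremum of the
  densities; a competitor dominates every finite maximum, hence \<open>h mu\<close>. The last claim,
  a dual formula by finite sums, is what passes to superpositions of curves.\<close>

lemma mass_measure_props:
 fixes T :: "'a::metric_space functional"
 assumes lin: "linear_first k T" and c: "controls k T mu"
 shows "controls k T (mass_measure k T)"
  and "!!nu. controls k T nu ==> emeasure (mass_measure k T) UNIV <= emeasure nu UNIV"
  and "e > 0 ==> EX ps. (ALL (f, pj):set ps. f : Lipb_funs & pj : Lip_tuples k) &
    (ALL x. (\<Sum>(f, pj)\<leftarrow>ps. \<bar>f x\<bar>) <= 1) &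
    measure (mass_measure k T) UNIV <= (\<Sum>(f, pj)\<leftarrow>ps. T f pj / Lip_prod pj) + e"
proof -
 have M: "fbm mu" using c by (simp add: controls_iff)
 obtain r where rm: "!!pj. r pj : borel_measurable borel" and rb: "!!pj x. \<bar>r pj x\<bar> <= 1"
  and rT: "!!f pj. f : Lipb_funs ==> pj : Lip_tuples k ==> T f pj = Lip_prod pj * (LINT x|mu. f x * r pj x)"
  and r0: "!!pj x. ~ (pj : Lip_tuples k & Lip_prod pj > 0) ==> r pj x = 0"
  by (rule density_family[OF lin c]) (rule that)
 obtain Q h where h: "h : borel_measurable borel" "!!x. 0 <= h x" "!!x. h x <= 1"
  "!!x. (%n. max_abs r (Q n) x) \<longlonglongrightarrow> h x" "!!q. AE x in mu. \<bar>r q x\<bar> <= h x"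
  by (rule essential_supremum_sequence[of mu r, OF M rm rb]) (rule that)
 note m = max_abs_measurable[of r, OF rm] and b = max_abs_bounds[of r, OF rb]
 have ih: "integrable mu h" by (rule fbm_integrable_bounded[OF M h(1), of 1]) (use h in simp)
 have ir: "integrable mu (r q)" for q by (rule fbm_integrable_bounded[OF M rm rb])
 have one: "integrable mu (%_. 1::real)" using fbm_integrable_bounded[OF M, of "%_. 1" 1] by simp
 define muT where "muT = density mu (%x. ennreal (h x))"
 have MT: "fbm muT" unfolding muT_def by (rule fbm_density[OF M ih h(2)])
 interpret MT: finite_measure muT by (rule fbmD(1)[OF MT])
 have intT: "(LINT x|muT. g x) = (LINT x|mu. g x * h x)" if "g : borel_measurable borel" for g :: "'a => real"
  unfolding muT_def using that h(1,2) by (subst integral_density) (auto simp: fbmD(5)[OF M] mult.commute)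
 have mT: "measure muT A = (LINT x|mu. indicator A x * h x)" if "A : sets borel" for A
  using intT[of "indicator A"] that fbmD(2,3)[OF MT] by simp
 have cT: "controls k T muT" unfolding controls_iff
 proof (intro conjI MT ballI)
  fix f :: "'a => real" and pj :: "('a => real) list" assume f: "f : Lipb_funs" "pj : Lip_tuples k"
  have "\<bar>\<integral>x. f x * r pj x \<partial>mu\<bar> <= (LINT x|mu. \<bar>f x * r pj x\<bar>)" by (rule integral_abs_bound)
  also have "... <= (LINT x|mu. \<bar>f x\<bar> * h x)"
  proof (rule integral_mono_AE)
   show "integrable mu (%x. \<bar>f x * r pj x\<bar>)" using fbm_integrable_mult[OF M ir f(1)] by simp
   show "integrable mu (%x. \<bar>f x\<bar> * h x)" by (rule fbm_integrable_mult[OF M ih Lipb_abs[OF f(1)]])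
   show "AE x in mu. \<bar>f x * r pj x\<bar> <= \<bar>f x\<bar> * h x" using h(5)[of pj]
    by eventually_elim (auto simp: abs_mult intro: mult_left_mono)
  qed
  also have "... = (LINT x|muT. \<bar>f x\<bar>)" using Lipb_measurable[OF Lipb_abs[OF f(1)]] by (rule intT[symmetric])
  finally show "\<bar>T f pj\<bar> <= Lip_prod pj * (LINT x|muT. \<bar>f x\<bar>)"
   unfolding rT[OF f] abs_mult using Lip_prod_nonneg[OF f(2)] by (simp add: mult_left_mono)
 qed
 have least: "muT <= nu" if c': "controls k T nu" for nu
 proof -
  have N: "fbm nu" using c' by (simp add: controls_iff)
  interpret N: finite_measure nu by (rule fbmD(1)[OF N])
  have "emeasure muT A <= emeasure nu A" if "A : sets muT" for A
  proof -
   have A: "A : sets borel" using that fbmD(2)[OF MT] by simp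
   have dc: "(%n. \<integral>x. indicator A x * max_abs r (Q n) x \<partial>mu) \<longlonglongrightarrow> (LINT x|mu. indicator A x * h x)"
   proof (rule integral_dominated_convergence[where w="%_. 1"])
    show "(%x. indicator A x * h x) : borel_measurable mu"
     "(%x. indicator A x * max_abs r (Q n) x) : borel_measurable mu" for n
     unfolding fbmD(5)[OF M] using h(1) m[of "Q n"] A by measurable
    show "AE x in mu. (%n. indicator A x * max_abs r (Q n) x) \<longlonglongrightarrow> indicator A x * h x"
     by (intro always_eventually allI tendsto_mult tendsto_const h(4))
    show "AE x in mu. norm (indicator A x * max_abs r (Q n) x) <= 1" for n
     using b by (auto simp: indicator_def)
   qed (rule one)
   have "(LINT x|mu. indicator A x * h x) <= measure nu A"
    by (rule LIMSEQ_le_const2[OF dc])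
      (use max_abs_le_control[OF M rm rb rT r0 c' A] in blast)
   thus ?thesis unfolding MT.emeasure_eq_measure N.emeasure_eq_measure mT[OF A] by (rule ennreal_leI)
  qed
  thus ?thesis using fbmD(2)[OF MT] fbmD(2)[OF N] by (simp add: le_measure)
 qed
 have eq: "mass_measure k T = muT" unfolding mass_measure_def
  by (rule Least_equality[of "controls k T" muT, OF cT least])
 show "controls k T (mass_measure k T)" using cT eq by simp
 show "emeasure (mass_measure k T) UNIV <= emeasure nu UNIV" if c': "controls k T nu" for nu
 proof -
  have "fbm nu" using c' by (simp add: controls_iff)
  thus ?thesis using least[OF c'] le_measureD3 fbmD[OF MT] fbmD eq by (metis le_measureD3)
 qed
 show "EX ps. (ALL (f, pj):set ps. f : Lipb_funs & pj : Lip_tuples k) &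
    (ALL x. (\<Sum>(f, pj)\<leftarrow>ps. \<bar>f x\<bar>) <= 1) &
    measure (mass_measure k T) UNIV <= (\<Sum>(f, pj)\<leftarrow>ps. T f pj / Lip_prod pj) + e" if e: "e > 0"
 proof -
  have dch: "(%n. \<integral>x. max_abs r (Q n) x \<partial>mu) \<longlonglongrightarrow> (LINT x|mu. h x)"
  proof (rule integral_dominated_convergence[where w="%_. 1"])
   show "h : borel_measurable mu" "max_abs r (Q n) : borel_measurable mu" for n
    unfolding fbmD(5)[OF M] using h m by auto
   show "AE x in mu. norm (max_abs r (Q n) x) <= 1" for n using b by auto
  qed (use h(4) one in auto)
  have "\<forall>\<^sub>F n in sequentially. (LINT x|mu. h x) - e / 2 < (LINT x|mu. max_abs r (Q n) x)"
   using e by (intro order_tendstoD(1)[OF dch]) auto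
  then obtain n where n: "(LINT x|mu. h x) - e / 2 < (LINT x|mu. max_abs r (Q n) x)"
   by (meson eventually_sequentially order_refl)
  obtain ps where ps: "ALL (f, q):set ps. f : Lipb_funs & q : set (Q n)"
   "!!x. (\<Sum>(f, q)\<leftarrow>ps. \<bar>f x\<bar>) <= 1" "(%x. \<Sum>(f, q)\<leftarrow>ps. f x * r q x) : borel_measurable borel"
   "(LINT x|mu. \<bar>max_abs r (Q n) x - (\<Sum>(f, q)\<leftarrow>ps. f x * r q x)\<bar>) <= e / 2"
   using max_abs_dual[of mu r "e / 2" "Q n", OF M rm rb] e by auto
  \<comment> \<open>The dropped pairs have density \<open>0\<close>, so they contribute nothing; the
    remaining ones have admissible \<open>pj\<close>.\<close>
  define ps' where "ps' = filter (%(f, q). q : Lip_tuples k & Lip_prod q > 0) ps"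
  have val: "(ALL (f, q):set ps. f : Lipb_funs) ==> integrable mu (%x. \<Sum>(f, q)\<leftarrow>ps. f x * r q x) &
   (LINT x|mu. (\<Sum>(f, q)\<leftarrow>ps. f x * r q x)) =
   (\<Sum>(f, q)\<leftarrow>filter (%(f, q). q : Lip_tuples k & Lip_prod q > 0) ps. T f q / Lip_prod q)" for ps
  proof (induct ps)
   case (Cons p ps)
   obtain f q where p: "p = (f, q)" by (cases p)
   have f: "f : Lipb_funs" using Cons(2) p by auto
   have i: "integrable mu (%x. f x * r q x)" by (rule fbm_integrable_mult[OF M ir f])
   show ?case using Cons p i f rT[OF f, of q] r0[of q] by (auto)
  qed simp
  have ps1: "ALL (f, q):set ps. f : Lipb_funs" using ps(1) by auto
  have imQ: "integrable mu (max_abs r (Q n))"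
   by (rule fbm_integrable_bounded[OF M m, of _ 1]) (use b[of "Q n"] in simp)
  have "(LINT x|mu. max_abs r (Q n) x) - (LINT x|mu. (\<Sum>(f, q)\<leftarrow>ps. f x * r q x))
    = (LINT x|mu. max_abs r (Q n) x - (\<Sum>(f, q)\<leftarrow>ps. f x * r q x))"
   using val[OF ps1] imQ by (intro Bochner_Integration.integral_diff[symmetric]) auto
  also have "... <= e / 2" using ps(4) integral_abs_bound[of mu "%x. max_abs r (Q n) x - (\<Sum>(f, q)\<leftarrow>ps. f x * r q x)"] by linarith
  finally have "(LINT x|mu. h x) <= (\<Sum>(f, q)\<leftarrow>ps'. T f q / Lip_prod q) + e"
   using n val[OF ps1] unfolding ps'_def by linarith
  moreover have "measure (mass_measure k T) UNIV = (LINT x|mu. h x)" unfolding eq using mT[of UNIV] by simp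
  moreover have "(\<Sum>(f, q)\<leftarrow>ps'. \<bar>f x\<bar>) <= 1" for x
  proof -
   have "(\<Sum>(f, q)\<leftarrow>filter P ps. \<bar>f x\<bar>) <= (\<Sum>(f, q)\<leftarrow>ps. \<bar>f x\<bar>)" for P by (induct ps) auto
   thus ?thesis unfolding ps'_def using ps(2)[of x] by (meson order_trans)
  qed
  moreover have "ALL (f, pj):set ps'. f : Lipb_funs & pj : Lip_tuples k" using ps1 by (auto simp: ps'_def)
  ultimately show ?thesis by (intro exI[of _ ps']) auto
 qed
qed

lemma mass_le_control:
 assumes "linear_first k T" "controls k T nu" shows "mass k T <= emeasure nu UNIV"
 using mass_measure_props(2)[OF assms assms(2)] assms(2) by (auto simp: mass_def)

lemma mass_eq:
 assumes "linear_first k T" "controls k T nu" shows "mass k T = ennreal (measure (mass_measure k T) UNIV)"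
proof -
 have "fbm (mass_measure k T)" using mass_measure_props(1)[OF assms] by (simp add: controls_iff)
 thus ?thesis using assms(2) finite_measure.emeasure_eq_measure[OF fbmD(1)] by (auto simp: mass_def)
qed

text \<open>The converse half of the dual formula. Forms with \<open>Lip_prod pj = 0\<close>
  contribute \<open>0\<close>, division by zero being \<open>0\<close>.\<close>

lemma dual_le_control:
 assumes c: "controls k T nu" and ps: "ALL (f, pj):set ps. f : Lipb_funs & pj : Lip_tuples k"
  and le1: "!!x. (\<Sum>(f, pj)\<leftarrow>ps. \<bar>f x\<bar>) <= 1"
 shows "(\<Sum>(f, pj)\<leftarrow>ps. T f pj / Lip_prod pj) <= measure nu UNIV"
proof -
 have N: "fbm nu" using c by (simp add: controls_iff)
 interpret N: finite_measure nu by (rule fbmD(1)[OF N])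
 have "(\<Sum>(f, pj)\<leftarrow>ps. T f pj / Lip_prod pj) <= (LINT x|nu. (\<Sum>(f, pj)\<leftarrow>ps. \<bar>f x\<bar>)) & integrable nu (%x. \<Sum>(f, pj)\<leftarrow>ps. \<bar>f x\<bar>)"
  using ps
 proof (induct ps)
  case (Cons p ps)
  obtain f pj where p: "p = (f, pj)" by (cases p)
  have f: "f : Lipb_funs" "pj : Lip_tuples k" using Cons(2) p by auto
  have i: "integrable nu (%x. \<bar>f x\<bar>)" by (rule fbm_integrable_Lipb[OF N Lipb_abs[OF f(1)]])
  have "\<bar>T f pj\<bar> <= Lip_prod pj * (LINT x|nu. \<bar>f x\<bar>)" using c f by (simp add: controls_iff)
  hence "T f pj <= Lip_prod pj * (LINT x|nu. \<bar>f x\<bar>)" by linarith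
  hence "T f pj / Lip_prod pj <= (LINT x|nu. \<bar>f x\<bar>)"
   using Lip_prod_nonneg[OF f(2)] by (cases "Lip_prod pj = 0") (auto simp: divide_le_eq mult.commute)
  thus ?case using Cons p i by auto
 qed simp
 moreover have "(LINT x|nu. (\<Sum>(f, pj)\<leftarrow>ps. \<bar>f x\<bar>)) <= (LINT x|nu. 1)"
  by (rule integral_mono_AE') (use le1 in auto)
 ultimately show ?thesis using fbmD(3)[OF N] by simp
qed

lemma jordan_exists:
 fixes S :: "'a::metric_space functional"
 assumes lin: "linear_first 0 S" and c: "controls 0 S mu"
 shows "EX P N. jordan_decomposition S P N"
proof -
 have M: "fbm mu" using c by (simp add: controls_iff)
 have e: "[] : Lip_tuples 0" by (simp add: Lip_tuples_def)
 obtain rh where rh: "rh : borel_measurable borel" "!!x. \<bar>rh x\<bar> <= 1" "!!f. f : Lipb_funs ==> S f [] = (LINT x|mu. f x * rh x)"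
 proof (rule Riesz_dominated[OF M, of "%f. S f []"])
  show "S (%x. a * f x + b * g x) [] = a * S f [] + b * S g []" if "f : Lipb_funs" "g : Lipb_funs" for f g a b
   using lin that e unfolding linear_first_def by blast
  show "\<bar>S f []\<bar> <= (LINT x|mu. \<bar>f x\<bar>)" if "f : Lipb_funs" for f
   using c that e unfolding controls_iff by (force simp: Lip_prod_def)
 qed blast
 have i: "integrable mu rh" by (rule fbm_integrable_bounded[OF M rh(1,2)])
 let ?P = "density mu (%x. ennreal (max 0 (rh x)))" and ?N = "density mu (%x. ennreal (max 0 (- rh x)))"
 have "fbm ?P" "fbm ?N" by (rule fbm_density[OF M]; use i in simp)+
 moreover have "{x. 0 < rh x} : sets borel" "- {x. 0 < rh x} : sets borel" using rh(1) by measurable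
 moreover have "emeasure ?P (- {x. 0 < rh x}) = 0"
  using rh(1) by (subst emeasure_density) (auto simp: fbmD(2,5)[OF M] nn_integral_0_iff_AE indicator_def max_def)
 moreover have "emeasure ?N {x. 0 < rh x} = 0"
  using rh(1) by (subst emeasure_density) (auto simp: fbmD(2,5)[OF M] nn_integral_0_iff_AE indicator_def max_def)
 moreover have "S f [] = (LINT x|?P. f x) - (LINT x|?N. f x)" if f: "f : Lipb_funs" for f
 proof -
  have "(LINT x|?P. f x) - (LINT x|?N. f x) = (LINT x|mu. f x * max 0 (rh x)) - (LINT x|mu. f x * max 0 (- rh x))"
   using rh(1) Lipb_measurable[OF f] by (subst (1 2) integral_density) (auto simp: fbmD(5)[OF M] mult.commute)
  also have "... = (LINT x|mu. f x * max 0 (rh x) - f x * max 0 (- rh x))"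
   by (intro Bochner_Integration.integral_diff[symmetric] fbm_integrable_mult M f) (use i in auto)
  also have "... = (LINT x|mu. f x * rh x)"
   by (rule Bochner_Integration.integral_cong) (auto simp: max_def)
  finally show ?thesis using rh(3)[OF f] by simp
 qed
 ultimately have "jordan_decomposition S ?P ?N" unfolding jordan_decomposition_def fbm_def by blast
 thus ?thesis by blast
qed

text \<open>Equal integrals give equal differences of measures on Borel sets. As \<open>P\<close>
  lives on \<open>A\<close> and \<open>N\<close> off it, \<open>P B\<close> is the difference on
  \<open>B \<inter> A\<close>, hence at most \<open>P' B\<close>; similarly for \<open>N\<close>,
  and exchanging the decompositions gives equality.\<close>

lemma jordan_unique:
 fixes S :: "'a::metric_space functional"
 assumes j: "jordan_decomposition S P N" "jordan_decomposition S P' N'"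
 shows "P = P' & N = N'"
proof -
 have *: "emeasure P B <= emeasure P' B & emeasure N B <= emeasure N' B"
  if j: "jordan_decomposition S P N" "jordan_decomposition S P' N'" and B: "B : sets borel" for P N P' N' B
 proof -
  have f: "fbm P" "fbm N" "fbm P'" "fbm N'" using j by (auto simp: jordan_decomposition_def fbm_def)
  interpret P: finite_measure P by (rule fbmD(1)[OF f(1)])
  interpret N: finite_measure N by (rule fbmD(1)[OF f(2)])
  interpret P': finite_measure P' by (rule fbmD(1)[OF f(3)])
  interpret N': finite_measure N' by (rule fbmD(1)[OF f(4)])
  obtain A where A: "A : sets borel" "emeasure P (- A) = 0" "emeasure N A = 0" using j(1) unfolding jordan_decomposition_def by blast
  have S: "(LINT x|P. f x) - (LINT x|N. f x) = (LINT x|P'. f x) - (LINT x|N'. f x)" if "f : Lipb_funs" for f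
   using j that unfolding jordan_decomposition_def by force
  have eq: "measure P C - measure N C = measure P' C - measure N' C" if C: "C : sets borel" for C
  proof -
   have "\<bar>(measure P C - measure N C) - (measure P' C - measure N' C)\<bar> <= e" if e: "e > 0" for e :: real
   proof -
    have e4: "e / 4 > 0" using e by simp
    have "EX f:Lipb_funs. (ALL x. 0 <= f x & f x <= 1) & (ALL K:{P, N, P', N'}. (LINT x|K. \<bar>f x - indicator C x\<bar>) < e / 4)"
     by (rule Lipb_approx_indicator_finite[OF _ _ C e4]) (use f in auto)
    then obtain g where g: "g : Lipb_funs" "ALL K:{P, N, P', N'}. (LINT x|K. \<bar>g x - indicator C x\<bar>) < e / 4" by blast
    have ap: "\<bar>(LINT x|K. g x) - measure K C\<bar> < e / 4" if K: "fbm K" "K : {P, N, P', N'}" for K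
    proof -
     interpret K: finite_measure K by (rule fbmD(1)[OF K(1)])
     have iC: "integrable K (indicator C :: _ => real)"
      by (rule fbm_integrable_bounded[OF K(1), of _ 1]) (use C in \<open>auto simp: indicator_def\<close>)
     have "(LINT x|K. g x - indicator C x) = (LINT x|K. g x) - measure K C"
      using C fbmD(2,3)[OF K(1)] by (subst Bochner_Integration.integral_diff[OF fbm_integrable_Lipb[OF K(1) g(1)] iC]) simp
     thus ?thesis using bspec[OF g(2) K(2)] integral_abs_bound[of K "%x. g x - indicator C x"] by linarith
    qed
    have "\<bar>(LINT x|P. g x) - measure P C\<bar> < e / 4" "\<bar>(LINT x|N. g x) - measure N C\<bar> < e / 4"
     "\<bar>(LINT x|P'. g x) - measure P' C\<bar> < e / 4" "\<bar>(LINT x|N'. g x) - measure N' C\<bar> < e / 4"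
     by (rule ap, rule f, simp)+
    thus ?thesis using S[OF g(1)] unfolding abs_less_iff abs_le_iff by linarith
   qed
   hence "\<bar>(measure P C - measure N C) - (measure P' C - measure N' C)\<bar> <= 0" by (rule field_le_epsilon) simp
   thus ?thesis by simp
  qed
  note sb = fbmD(2)[OF f(1)] fbmD(2)[OF f(2)] fbmD(2)[OF f(3)] fbmD(2)[OF f(4)]
  have BA: "B \<inter> A : sets borel" "B - A : sets borel" using A(1) B by auto
  have z: "measure P (B - A) = 0" "measure N (B \<inter> A) = 0"
  proof -
   have "emeasure P (B - A) <= emeasure P (- A)" by (rule emeasure_mono) (use A(1) sb in auto)
   thus "measure P (B - A) = 0" using A(2) by (simp add: measure_def)
   have "emeasure N (B \<inter> A) <= emeasure N A" by (rule emeasure_mono) (use A(1) sb in auto)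
   thus "measure N (B \<inter> A) = 0" using A(3) by (simp add: measure_def)
  qed
  have split: "measure K B = measure K (B \<inter> A) + measure K (B - A)" if "finite_measure K" "sets K = sets borel" for K
  proof -
   have "measure K ((B \<inter> A) \<union> (B - A)) = measure K (B \<inter> A) + measure K (B - A)"
    by (rule finite_measure.finite_measure_Union[OF that(1)]) (use BA that in auto)
   moreover have "(B \<inter> A) \<union> (B - A) = B" by auto
   ultimately show ?thesis by simp
  qed
  have "measure P B <= measure P' (B \<inter> A)"
   using split[OF fbmD(1,2)[OF f(1)]] z eq[OF BA(1)] measure_nonneg[of N' "B \<inter> A"] by linarith
  moreover have "measure P' (B \<inter> A) <= measure P' B" by (rule P'.finite_measure_mono) (use B sb in auto)
  moreover have "measure N B <= measure N' (B - A)"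
   using split[OF fbmD(1,2)[OF f(2)]] z eq[OF BA(2)] measure_nonneg[of P' "B - A"] by linarith
  moreover have "measure N' (B - A) <= measure N' B" by (rule N'.finite_measure_mono) (use B sb in auto)
  ultimately have "measure P B <= measure P' B" "measure N B <= measure N' B" by linarith+
  thus ?thesis
   unfolding P.emeasure_eq_measure N.emeasure_eq_measure P'.emeasure_eq_measure N'.emeasure_eq_measure
   by (intro conjI ennreal_leI)
 qed
 have s: "sets P = sets borel" "sets N = sets borel" "sets P' = sets borel" "sets N' = sets borel"
  using j by (auto simp: jordan_decomposition_def)
 have "P = P'" by (rule measure_eqI) (use *[OF j] *[OF j(2,1)] s in \<open>simp_all add: antisym\<close>)
 moreover have "N = N'" by (rule measure_eqI) (use *[OF j] *[OF j(2,1)] s in \<open>simp_all add: antisym\<close>)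
 ultimately show ?thesis by simp
qed

lemma jordan_parts:
 fixes S :: "'a::metric_space functional"
 assumes "linear_first 0 S" "controls 0 S mu"
 shows "jordan_decomposition S (pos_part S) (neg_part S)"
proof -
 obtain P N where j: "jordan_decomposition S P N" using jordan_exists[OF assms] by blast
 have "pos_part S = P" unfolding pos_part_def using j jordan_unique by (intro the_equality) blast+
 moreover have "neg_part S = N" unfolding neg_part_def using j jordan_unique by (intro the_equality) blast+
 ultimately show ?thesis using j by simp
qed

section \<open>Loeb measures of finite averages\<close>

definition ultra :: "'i filter => bool" where
 "ultra U \<longleftrightarrow> U ~= bot & (ALL P. eventually P U \<or> eventually (%x. ~ P x) U)"

text \<open>Zorn for systems of eventual properties: their inclusion is the reverse of the order on
  filters, so maximal systems belong to the finest proper filters below \<open>F\<close>.\<close>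

lemma ultra_exists:
 fixes F :: "'i filter"
 assumes "F ~= bot" obtains U where "ultra U" "U <= F"
proof -
 let ?E = "%G :: 'i filter. {P. eventually P G}"
 have sub: "?E G \<subseteq> ?E H \<longleftrightarrow> H <= G" for G H by (auto simp: le_filter_def)
 define A where "A = ?E ` {G. G ~= bot & G <= F}"
 have "EX M:A. ALL X:A. M \<subseteq> X --> X = M"
 proof (rule subset_Zorn_nonempty)
  show "A ~= {}" using assms by (auto simp: A_def)
  fix C assume C: "C ~= {}" "subset.chain A C"
  define B where "B = {G. G ~= bot & G <= F & ?E G : C}"
  have CB: "C = ?E ` B" using C(2) by (auto simp: B_def A_def subset_chain_def)
  have B0: "B ~= {}" using C(1) CB by auto
  have base: "EX x:B. x <= inf G H" if "G : B" "H : B" for G H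
  proof -
   have "?E G \<subseteq> ?E H \<or> ?E H \<subseteq> ?E G" using C(2) that by (auto simp: B_def subset_chain_def)
   thus ?thesis unfolding sub using that by (metis inf.order_iff inf_commute order_refl)
  qed
  have ev: "eventually P (Inf B) \<longleftrightarrow> (EX b:B. eventually P b)" for P by (rule eventually_Inf_base[OF B0 base])
  have "\<Union>C = ?E (Inf B)" using ev CB by auto
  moreover have "Inf B ~= bot" using ev[of "%_. False"] by (auto simp: B_def trivial_limit_def)
  moreover have "Inf B <= F" using B0 by (auto simp: B_def intro: Inf_lower2)
  ultimately show "\<Union>C : A" unfolding A_def by blast
 qed
 then obtain U where U: "U ~= bot" "U <= F" "!!G. G ~= bot ==> G <= F ==> ?E U \<subseteq> ?E G ==> ?E G = ?E U"
  unfolding A_def by auto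
 have "eventually P U \<or> eventually (%x. ~ P x) U" for P
 proof (rule ccontr)
  assume n: "~ ?thesis"
  let ?G = "inf U (principal {x. ~ P x})"
  have "?G ~= bot" using n by (auto simp: trivial_limit_def eventually_inf_principal)
  moreover have "?G <= F" using U(2) by (simp add: le_infI1)
  moreover have "?E U \<subseteq> ?E ?G" unfolding sub by simp
  ultimately have "?E ?G = ?E U" by (rule U(3))
  moreover have "(%x. ~ P x) : ?E ?G" by (simp add: eventually_inf_principal)
  ultimately show False using n by auto
 qed
 thus ?thesis using that U by (auto simp: ultra_def)
qed

lemma ultra_not: "ultra U ==> ~ eventually P U \<longleftrightarrow> eventually (%x. ~ P x) U"
 unfolding ultra_def using eventually_happens[OF eventually_conj] by fastforce

text \<open>The pigeonhole principle of ultrafilters; discretised functions and nearest net points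
  become constant through it.\<close>

lemma ultra_ex_finite:
 assumes U: "ultra U" and "finite V" "eventually (%i. g i : V) U"
 shows "EX v:V. eventually (%i. g i = v) U"
proof (rule ccontr)
 assume "~ ?thesis"
 hence "ALL v:V. eventually (%i. g i ~= v) U" using ultra_not[OF U] by blast
 hence "eventually (%i. ALL v:V. g i ~= v) U" by (rule eventually_ball_finite[OF assms(2)])
 hence "eventually (%i. False) U" using assms(3) by eventually_elim auto
 thus False using U by (simp add: ultra_def trivial_limit_def)
qed

text \<open>The limit is the supremum of the reals that stay below \<open>f\<close> eventually, an
  ultrafilter deciding every comparison.\<close>

lemma ultra_bounded_tendsto:
 fixes f :: "'i => real"
 assumes U: "ultra U" and b: "eventually (%i. \<bar>f i\<bar> <= B) U"
 shows "(f \<longlongrightarrow> Lim U f) U"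
proof -
 have nb: "U ~= bot" using U by (simp add: ultra_def)
 define S where "S = {a. eventually (%i. a <= f i) U}"
 have "-B : S" unfolding S_def using b by (auto elim!: eventually_mono)
 hence ne: "S ~= {}" by auto
 have ub: "a <= B" if "a : S" for a
 proof -
  have "eventually (%i. a <= f i & \<bar>f i\<bar> <= B) U" using that b by (auto simp: S_def eventually_conj_iff)
  thus ?thesis using eventually_happens'[OF nb] by fastforce
 qed
 hence bd: "bdd_above S" by (auto simp: bdd_above_def)
 have "(f \<longlongrightarrow> Sup S) U"
 proof (rule order_tendstoI)
  fix a assume "a < Sup S"
  then obtain a' where a': "a' : S" "a < a'" using less_cSup_iff[OF ne bd] by auto
  thus "eventually (%i. a < f i) U" unfolding S_def by (auto elim!: eventually_mono)
 next
  fix a assume a: "Sup S < a"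
  hence "a ~: S" using cSup_upper[OF _ bd] by force
  thus "eventually (%i. f i < a) U" unfolding S_def using ultra_not[OF U, of "%i. a <= f i"] by (simp add: not_le)
 qed
 thus ?thesis using tendsto_Lim[OF nb] by metis
qed

text \<open>Points of the ultraproduct are kept as functions of the index instead of classes modulo
  \<open>U\<close>; membership in an internal set is insensitive to changes on a
  \<open>U\<close>-negligible set of indices.\<close>

definition internal :: "'i filter => ('i => 'p set) => ('i => 'p) set" where
 "internal U S = {x. eventually (%i. x i : S i) U}"

lemma internal_Int: "internal U S \<inter> internal U T = internal U (%i. S i \<inter> T i)"
 by (auto simp: internal_def eventually_conj_iff)

lemma internal_Compl: assumes "ultra U" shows "- internal U S = internal U (%i. - S i)"
proof (rule set_eqI)
 fix x show "x : - internal U S \<longleftrightarrow> x : internal U (%i. - S i)"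
  using ultra_not[OF assms, of "%i. x i : S i"] by (simp add: internal_def)
qed

lemma ultra_disj:
 assumes "ultra U" shows "eventually (%i. P i \<or> Q i) U \<longleftrightarrow> eventually P U \<or> eventually Q U"
proof
 assume pq: "eventually (%i. P i \<or> Q i) U"
 show "eventually P U \<or> eventually Q U"
 proof (cases "eventually P U")
  case False
  hence "eventually (%i. ~ P i) U" using ultra_not[OF assms] by blast
  with pq have "eventually Q U" by eventually_elim blast
  thus ?thesis by simp
 qed simp
qed (auto elim: eventually_mono)

lemma internal_Un: "ultra U ==> internal U S \<union> internal U T = internal U (%i. S i \<union> T i)"
 by (auto simp: internal_def ultra_disj)

text \<open>Otherwise a selection from the symmetric differences would tell the two internal sets
  apart. This makes the limit content a function of the internal set.\<close>

lemma internal_eqD: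
 assumes U: "ultra U" and eq: "internal U S = internal U T" shows "eventually (%i. S i = T i) U"
proof (rule ccontr)
 assume "~ ?thesis"
 hence ne: "eventually (%i. S i ~= T i) U" using ultra_not[OF U] by blast
 define x where "x i = (SOME p. p : S i \<longleftrightarrow> p ~: T i)" for i
 have x: "eventually (%i. x i : S i \<longleftrightarrow> x i ~: T i) U"
  using ne
 proof eventually_elim
  case (elim i)
  hence "EX p. p : S i \<longleftrightarrow> p ~: T i" by auto
  thus ?case unfolding x_def by (rule someI_ex)
 qed
 show False
 proof (cases "eventually (%i. x i : S i) U")
  case True
  hence "x : internal U T" using eq by (auto simp: internal_def)
  hence "eventually (%i. x i : T i) U" by (simp add: internal_def)
  with x True have "eventually (%i. False) U" by eventually_elim auto
  thus False using U by (simp add: ultra_def trivial_limit_def)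
 next
  case False
  hence F: "eventually (%i. x i ~: S i) U" using ultra_not[OF U] by blast
  have "x ~: internal U T" using eq False by (auto simp: internal_def)
  hence "eventually (%i. x i ~: T i) U" using ultra_not[OF U] by (auto simp: internal_def)
  with x F have "eventually (%i. False) U" by eventually_elim auto
  thus False using U by (simp add: ultra_def trivial_limit_def)
 qed
qed

text \<open>Countable saturation of the ultraproduct; it makes the limit of the finite averages
  continuous at the empty set, hence countably additive.\<close>

lemma internal_saturated:
 fixes nf :: "'i => nat" and S :: "nat => 'i => 'p set"
 assumes U: "ultra U" and nf: "!!n. eventually (%i. n <= nf i) U"
  and ne: "!!n. internal U (S n) ~= {}" and dec: "!!n. internal U (S (Suc n)) \<subseteq> internal U (S n)"
 shows "(\<Inter>n. internal U (S n)) ~= {}"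
proof -
 define T where "T n i = (\<Inter>k\<le>n. S k i)" for n :: nat and i :: 'i
 have dec': "internal U (S m) \<subseteq> internal U (S n)" if "n <= m" for m n
  using lift_Suc_antimono_le[of "%n. internal U (S n)", OF dec that] .
 have T: "eventually (%i. T n i ~= {}) U" for n
 proof -
  obtain x where x: "x : internal U (S n)" using ne by blast
  have "ALL k:{..n}. eventually (%i. x i : S k i) U" using dec' x by (auto simp: internal_def)
  hence "eventually (%i. ALL k:{..n}. x i : S k i) U" by (intro eventually_ball_finite) auto
  thus ?thesis by eventually_elim (auto simp: T_def)
 qed
 \<comment> \<open>The bound \<open>nf i\<close> makes the set of admissible depths finite; as
   \<open>nf\<close> tends to infinity along \<open>U\<close>, every fixed depth is admissible
   eventually.\<close>
 define K where "K i = {k. k <= nf i & T k i ~= {}}" for i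
 have Kf: "finite (K i)" for i unfolding K_def by (rule finite_subset[of _ "{..nf i}"]) auto
 define x where "x i = (SOME p. p : T (Max (K i)) i)" for i
 have "x : internal U (S n)" for n
 proof -
  have "eventually (%i. n : K i) U" using nf[of n] T[of n] by eventually_elim (simp add: K_def)
  hence "eventually (%i. x i : S n i) U"
  proof eventually_elim
   case (elim i)
   have "Max (K i) : K i" using elim Kf by (intro Max_in) auto
   hence "x i : T (Max (K i)) i" unfolding x_def K_def by (auto simp: some_in_eq)
   moreover have "n <= Max (K i)" using elim Kf by (intro Max_ge)
   ultimately show ?case by (auto simp: T_def)
  qed
  thus ?thesis by (simp add: internal_def)
 qed
 thus ?thesis by blast
qed

text \<open>The weights are not normalised: their total is only bounded, and in the application it
  tends to the mass of the negative part of the boundary.\<close>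

definition avg :: "('i => 'p set) => ('i => 'p => real) => 'i => ('p => real) => real" where
 "avg A c i F = (\<Sum>p\<in>A i. c i p * F p)"

lemma avg_lin: "avg A c i (%p. a * F p + b * G p) = a * avg A c i F + b * avg A c i G"
 by (simp add: avg_def sum_distrib_left sum.distrib algebra_simps)

lemma avg_mono:
 "(!!p. 0 <= c i p) ==> (!!p. p : A i ==> F p <= G p) ==> avg A c i F <= avg A c i G"
 unfolding avg_def by (intro sum_mono mult_left_mono) auto

lemma avg_abs:
 assumes "!!p. 0 <= c i p" shows "\<bar>avg A c i F\<bar> <= avg A c i (%p. \<bar>F p\<bar>)"
 unfolding avg_def by (rule order_trans[OF sum_abs]) (auto simp: abs_mult assms intro!: sum_mono)

lemma avg_sum: "avg A c i (%p. \<Sum>v\<in>V. G v p) = (\<Sum>v\<in>V. avg A c i (G v))"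
 unfolding avg_def by (simp add: sum_distrib_left) (rule sum.swap)

text \<open>That \<open>nf\<close> tends to infinity along \<open>U\<close> provides the countable
  incompleteness behind saturation; the same \<open>nf\<close> later fixes the mesh of the
  chains.\<close>

locale loeb_data =
 fixes U :: "'i filter" and nf :: "'i => nat" and A :: "'i => 'p set" and c :: "'i => 'p => real" and B :: real
 assumes ultra: "ultra U" and nf: "!!n. eventually (%i. n <= nf i) U"
  and c0: "!!i p. 0 <= c i p" and mass: "!!i. avg A c i (%_. 1) <= B"
begin

abbreviation "av \<equiv> avg A c"

lemma nb: "U ~= bot" using ultra by (simp add: ultra_def)

lemma av_bound: assumes "!!p. \<bar>F p\<bar> <= K" "0 <= K" shows "\<bar>av i F\<bar> <= K * B"
proof -
 have "\<bar>av i F\<bar> <= av i (%p. \<bar>F p\<bar>)" by (rule avg_abs) (rule c0)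
 also have "... <= av i (%p. K * 1 + 0 * 0)" by (rule avg_mono) (use c0 assms in auto)
 also have "... = K * av i (%_. 1)" by (subst avg_lin) simp
 also have "... <= K * B" by (intro mult_left_mono mass assms)
 finally show ?thesis .
qed

lemma av_tendsto: assumes "!!i p. \<bar>F i p\<bar> <= K" shows "((%i. av i (F i)) \<longlongrightarrow> Lim U (%i. av i (F i))) U"
proof -
 have "0 <= K" using assms[of undefined undefined] by linarith
 thus ?thesis
  by (intro ultra_bounded_tendsto[OF ultra, where B="K * B"] always_eventually allI av_bound assms)
qed

definition \<Lambda> :: "('i => 'p set) => real" where "\<Lambda> S = Lim U (%i. av i (indicator (S i)))"

lemma \<Lambda>: "((%i. av i (indicator (S i))) \<longlongrightarrow> \<Lambda> S) U"
 unfolding \<Lambda>_def by (rule av_tendsto[where K=1]) (auto simp: indicator_def)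

lemma \<Lambda>_cong: assumes "internal U S = internal U T" shows "\<Lambda> S = \<Lambda> T"
proof (rule tendsto_unique[OF nb \<Lambda>])
 show "((%i. av i (indicator (S i))) \<longlongrightarrow> \<Lambda> T) U"
  by (rule Lim_transform_eventually[OF \<Lambda>]) (use internal_eqD[OF ultra assms] in \<open>eventually_elim, simp\<close>)
qed

lemma \<Lambda>_nonneg: "0 <= \<Lambda> S"
proof (rule tendsto_lowerbound[OF \<Lambda> always_eventually[OF allI] nb])
 show "0 <= av i (indicator (S i))" for i unfolding avg_def by (intro sum_nonneg mult_nonneg_nonneg c0) auto
qed

lemma \<Lambda>_add: assumes "internal U S \<inter> internal U T = {}" shows "\<Lambda> (%i. S i \<union> T i) = \<Lambda> S + \<Lambda> T"
proof (rule tendsto_unique[OF nb \<Lambda>])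
 have "internal U (%i. S i \<inter> T i) = internal U (%_. {})"
  using assms nb by (simp add: internal_Int) (simp add: internal_def trivial_limit_def)
 hence "eventually (%i. S i \<inter> T i = {}) U" by (rule internal_eqD[OF ultra])
 hence "eventually (%i. av i (indicator (S i)) + av i (indicator (T i)) = av i (indicator (S i \<union> T i))) U"
 proof eventually_elim
  case (elim i)
  have "indicator (S i \<union> T i) p = 1 * indicator (S i) p + 1 * (indicator (T i) p :: real)" for p
   using elim by (auto simp: indicator_def)
  thus ?case using avg_lin[of A c i 1 "indicator (S i)" 1 "indicator (T i)"] by (simp add: avg_def)
 qed
 thus "((%i. av i (indicator (S i \<union> T i))) \<longlongrightarrow> \<Lambda> S + \<Lambda> T) U"
  by (rule Lim_transform_eventually[OF tendsto_add[OF \<Lambda> \<Lambda>]])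
qed

text \<open>By saturation a decreasing sequence of internal sets with empty intersection is empty
  from some index on, so Caratheodory's continuity condition is met trivially.\<close>

lemma loeb_measure_exists:
 "EX M. space M = UNIV & sets M = sigma_sets UNIV (range (internal U)) & (ALL S. emeasure M (internal U S) = ennreal (\<Lambda> S))"
proof -
 define m where "m X = ennreal (\<Lambda> (SOME S. internal U S = X))" for X
 have m: "m (internal U S) = ennreal (\<Lambda> S)" for S
 proof -
  have "internal U (SOME T. internal U T = internal U S) = internal U S" by (rule someI[of _ S]) simp
  thus ?thesis unfolding m_def by (rule arg_cong[OF \<Lambda>_cong])
 qed
 have emp: "internal U (%_. {}) = {}" using nb by (simp add: internal_def trivial_limit_def)
 have \<Lambda>0: "\<Lambda> (%_. {}) = 0" using \<Lambda>_add[of "%_. {}" "%_. {}"] by (simp add: emp)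
 have alg: "algebra UNIV (range (internal U) :: ('i => 'p) set set)"
  unfolding algebra_iff_Un
 proof (intro conjI ballI)
  show "{} : range (internal U)" using emp by (metis rangeI)
  fix a :: "('i => 'p) set" assume "a : range (internal U)"
  thus "UNIV - a : range (internal U)" using internal_Compl[OF ultra] by (auto simp: Compl_eq_Diff_UNIV[symmetric])
 next
  fix a b :: "('i => 'p) set" assume "a : range (internal U)" "b : range (internal U)"
  thus "a \<union> b : range (internal U)" using internal_Un[OF ultra] by auto
 qed auto
 interpret algebra UNIV "range (internal U) :: ('i => 'p) set set" by (rule alg)
 have "EX mu :: ('i => 'p) set => ennreal. (ALL s:range (internal U). mu s = m s) & measure_space UNIV (sigma_sets UNIV (range (internal U))) mu"
 proof (rule caratheodory_empty_continuous)
  show "positive (range (internal U)) m" using m[of "%_. {}"] by (simp add: positive_def emp \<Lambda>0)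
  show "additive (range (internal U)) m" unfolding additive_def
  proof (intro ballI impI)
   fix a b :: "('i => 'p) set" assume "a : range (internal U)" "b : range (internal U)" and d: "a \<inter> b = {}"
   then obtain S T where ab: "a = internal U S" "b = internal U T" by blast
   show "m (a \<union> b) = m a + m b"
    using \<Lambda>_add[of S T] d unfolding ab internal_Un[OF ultra] m by (simp add: \<Lambda>_nonneg)
  qed
  show "m a ~= \<infinity>" if "a : range (internal U)" for a :: "('i => 'p) set" using m that by auto
  fix X :: "nat => ('i => 'p) set"
  assume X: "range X \<subseteq> range (internal U)" "decseq X" "(\<Inter>i. X i) = {}"
  have "ALL n. EX S. X n = internal U S" using X(1) by auto
  then obtain S where S: "!!n. X n = internal U (S n)" by metis
  obtain n where n: "X n = {}"
   using internal_saturated[OF ultra nf, of S] X(2,3) unfolding S decseq_Suc_iff by blast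
  have "X k = {}" if "k >= n" for k using n X(2) that by (auto simp: decseq_def)
  hence "m (X k) = 0" if "k >= n" for k using that m[of "%_. {}"] by (simp add: emp \<Lambda>0)
  thus "(%k. m (X k)) \<longlonglongrightarrow> 0"
   by (intro tendsto_eventually) (auto simp: eventually_sequentially)
 qed
 then obtain mu where mu: "!!S. mu (internal U S) = ennreal (\<Lambda> S)" "measure_space UNIV (sigma_sets UNIV (range (internal U))) mu"
  using m by auto
 let ?M = "measure_of UNIV (range (internal U)) mu"
 have sM: "sets ?M = sigma_sets UNIV (range (internal U))" by (rule sets_measure_of) simp
 have "emeasure ?M (internal U S) = mu (internal U S)" for S
 proof (rule emeasure_measure_of[OF refl])
  show "internal U S : sets ?M" unfolding sM by (rule sigma_sets.Basic) simp
 qed (use mu(2) in \<open>auto simp: measure_space_def sM\<close>)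
 thus ?thesis using mu(1) sM by (intro exI[of _ ?M]) (auto simp: space_measure_of)
qed

definition lam :: "('i => 'p) measure" where
 "lam = (SOME M. space M = UNIV & sets M = sigma_sets UNIV (range (internal U)) & (ALL S. emeasure M (internal U S) = ennreal (\<Lambda> S)))"

lemma lam: "space lam = UNIV" "sets lam = sigma_sets UNIV (range (internal U))" "emeasure lam (internal U S) = ennreal (\<Lambda> S)"
 using someI_ex[OF loeb_measure_exists] unfolding lam_def[symmetric] by auto

lemma internal_sets [measurable]: "internal U S : sets lam"
 unfolding lam(2) by (rule sigma_sets.Basic) simp

lemma internal_UNIV: "internal U (%_. UNIV) = UNIV"
 by (simp add: internal_def)

lemma finite_lam: "finite_measure lam"
 by (rule finite_measureI) (use lam(3)[of "%_. UNIV"] in \<open>simp add: internal_UNIV lam(1)\<close>)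

lemma measure_lam: "measure lam (internal U S) = \<Lambda> S"
 by (simp add: measure_def lam(3) \<Lambda>_nonneg)

text \<open>The standard part of the internal function represented by the family
  \<open>F\<close>.\<close>

definition st :: "('i => 'p => real) => ('i => 'p) => real" where
 "st F x = Lim U (%i. F i (x i))"

lemma st: assumes "eventually (%i. \<bar>F i (x i)\<bar> <= K) U" shows "((%i. F i (x i)) \<longlongrightarrow> st F x) U"
 unfolding st_def by (rule ultra_bounded_tendsto[OF ultra assms])

lemma st_measurable:
 assumes b: "!!i p. \<bar>F i p\<bar> <= K" shows "st F : borel_measurable lam"
 unfolding borel_measurable_iff_le
proof
 fix a
 have t: "((%i. F i (x i)) \<longlongrightarrow> st F x) U" for x by (rule st[where K=K]) (simp add: b)
 \<comment> \<open>A limit equal to \<open>a\<close> allows values slightly above \<open>a\<close>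
   at every index, hence the slack \<open>1 / (n + 1)\<close>.\<close>
 have "st F x <= a \<longleftrightarrow> (ALL n. x : internal U (%i. {p. F i p <= a + 1 / real (Suc n)}))" for x
 proof
  assume le: "st F x <= a"
  show "ALL n. x : internal U (%i. {p. F i p <= a + 1 / real (Suc n)})"
  proof
   fix n
   have "0 < 1 / real (Suc n)" by simp
   hence "st F x < a + 1 / real (Suc n)" using le by linarith
   hence "eventually (%i. F i (x i) < a + 1 / real (Suc n)) U" by (rule order_tendstoD(2)[OF t])
   thus "x : internal U (%i. {p. F i p <= a + 1 / real (Suc n)})"
    unfolding internal_def by (auto elim!: eventually_mono)
  qed
 next
  assume r: "ALL n. x : internal U (%i. {p. F i p <= a + 1 / real (Suc n)})"
  show "st F x <= a"
  proof (rule field_le_epsilon)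
   fix e :: real assume "e > 0"
   then obtain n where n: "1 / real (Suc n) < e" using nat_approx_posE by blast
   have "st F x <= a + 1 / real (Suc n)"
    by (rule tendsto_upperbound[OF t _ nb]) (use r in \<open>auto simp: internal_def\<close>)
   thus "st F x <= a + e" using n by simp
  qed
 qed
 hence "{x : space lam. st F x <= a} = (\<Inter>n. internal U (%i. {p. F i p <= a + 1 / real (Suc n)}))"
  by (auto simp: lam(1))
 thus "{x : space lam. st F x <= a} : sets lam" by simp
qed

text \<open>Approximate by the finitely many values of \<open>\<lfloor>N F\<rfloor> / N\<close>.\<close>

lemma st_integral:
 assumes b: "!!i p. \<bar>F i p\<bar> <= K"
 shows "integrable lam (st F)" "((%i. av i (F i)) \<longlongrightarrow> (LINT x|lam. st F x)) U"
proof -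
 interpret L: finite_measure lam by (rule finite_lam)
 have K: "0 <= K" using b[of undefined undefined] by linarith
 have t: "((%i. F i (x i)) \<longlongrightarrow> st F x) U" for x by (rule st[where K=K]) (simp add: b)
 have stb: "\<bar>st F x\<bar> <= K" for x
  by (rule tendsto_upperbound[OF tendsto_rabs[OF t] always_eventually nb]) (use b in auto)
 show int: "integrable lam (st F)"
  by (rule L.integrable_const_bound[of _ K]) (use stb st_measurable[OF b] in auto)
 have B0: "0 <= B" by (rule order_trans[OF _ mass[of undefined]]) (simp add: avg_def sum_nonneg c0)
 show "((%i. av i (F i)) \<longlongrightarrow> (LINT x|lam. st F x)) U"
 proof (rule tendstoI)
  fix e :: real assume e: "e > 0"
  define W where "W = measure lam UNIV + B + 1"
  have W: "0 < W" using B0 unfolding W_def by (simp add: add_nonneg_pos)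
  obtain N :: nat where N: "0 < N" "W / e * 2 < real N"
   using reals_Archimedean2[of "max 0 (W / e * 2)"] by (metis gr0I max_less_iff_conj of_nat_0 less_irrefl)
  define q where "q t = real_of_int \<lfloor>real N * t\<rfloor> / real N" for t
  have q: "q t <= t" "t - 1 / real N <= q t" for t
  proof -
   have "real_of_int \<lfloor>real N * t\<rfloor> <= real N * t" by simp
   thus "q t <= t" using N(1) by (simp add: q_def divide_le_eq mult.commute)
   have "real N * t - 1 <= real_of_int \<lfloor>real N * t\<rfloor>" by linarith
   hence "(real N * t - 1) / real N <= q t" unfolding q_def using N(1) by (intro divide_right_mono) auto
   thus "t - 1 / real N <= q t" using N(1) by (simp add: diff_divide_distrib)
  qed
  define V where "V = (%k. real_of_int k / real N) ` {\<lfloor>real N * (- K)\<rfloor>..\<lfloor>real N * K\<rfloor>}"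
  have Vf: "finite V" by (simp add: V_def)
  have qV: "q (F i p) : V" for i p
  proof -
   have "- K <= F i p" "F i p <= K" using b[of i p] by (auto simp: abs_le_iff)
   hence "real N * (- K) <= real N * F i p" "real N * F i p <= real N * K" by (intro mult_left_mono; simp)+
   thus ?thesis unfolding q_def V_def by (intro imageI) (simp add: floor_mono)
  qed
  define S where "S v i = {p. q (F i p) = v}" for v i
  define g where "g x = (\<Sum>v\<in>V. v * indicator (internal U (S v)) x)" for x
  have g: "\<bar>st F x - g x\<bar> <= 1 / real N" for x
  proof -
   obtain v where v: "v : V" "eventually (%i. q (F i (x i)) = v) U"
    using ultra_ex_finite[OF ultra Vf, of "%i. q (F i (x i))"] qV by auto
   have "x : internal U (S w) \<longleftrightarrow> w = v" for w
   proof
    assume "x : internal U (S w)"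
    hence "eventually (%i. q (F i (x i)) = w) U" by (simp add: internal_def S_def)
    with v(2) have "eventually (%i. w = v) U" by eventually_elim simp
    thus "w = v" using nb by (simp add: eventually_const_iff)
   qed (use v in \<open>simp add: internal_def S_def\<close>)
   hence "g x = (\<Sum>w\<in>V. if w = v then w else 0)" unfolding g_def by (intro sum.cong) (auto simp: indicator_def)
   hence gv: "g x = v" using v(1) Vf by (simp add: sum.delta)
   have "\<bar>st F x - v\<bar> <= 1 / real N"
   proof (rule tendsto_upperbound[OF tendsto_rabs[OF tendsto_diff[OF t tendsto_const]] _ nb])
    show "eventually (%i. \<bar>F i (x i) - v\<bar> <= 1 / real N) U" using v(2)
    proof eventually_elim
     case (elim i) thus ?case using q[of "F i (x i)"] by linarith
    qed
   qed
   thus ?thesis using gv by simp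
  qed
  have gi: "integrable lam g" unfolding g_def
   by (intro Bochner_Integration.integrable_sum integrable_mult_right) (simp add: L.emeasure_finite less_top[symmetric])
  have gint: "(LINT x|lam. g x) = (\<Sum>v\<in>V. v * \<Lambda> (S v))" unfolding g_def
   by (subst Bochner_Integration.integral_sum) (auto simp: lam(1) measure_lam L.emeasure_finite less_top[symmetric])
  have 1: "\<bar>(LINT x|lam. st F x) - (\<Sum>v\<in>V. v * \<Lambda> (S v))\<bar> <= measure lam UNIV / real N"
  proof -
   have "\<bar>(LINT x|lam. st F x) - (LINT x|lam. g x)\<bar> = \<bar>\<integral>x. st F x - g x \<partial>lam\<bar>"
    using int gi by simp
   also have "... <= (LINT x|lam. \<bar>st F x - g x\<bar>)" by (rule integral_abs_bound)
   also have "... <= (LINT x|lam. 1 / real N)"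
    by (intro integral_mono) (use int gi g in auto)
   finally show ?thesis using gint by (simp add: lam(1))
  qed
  have "((%i. \<Sum>v\<in>V. v * av i (indicator (S v i))) \<longlongrightarrow> (\<Sum>v\<in>V. v * \<Lambda> (S v))) U"
   by (intro tendsto_sum tendsto_mult tendsto_const \<Lambda>)
  from tendstoD[OF this half_gt_zero[OF e]]
  have "eventually (%i. \<bar>(\<Sum>v\<in>V. v * av i (indicator (S v i))) - (\<Sum>v\<in>V. v * \<Lambda> (S v))\<bar> < e / 2) U"
   unfolding dist_real_def .
  thus "eventually (%i. dist (av i (F i)) (LINT x|lam. st F x) < e) U"
  proof eventually_elim
   case (elim i)
   have "(\<Sum>v\<in>V. v * av i (indicator (S v i))) = av i (%p. q (F i p))"
   proof -
    have "q (F i p) = (\<Sum>v\<in>V. v * indicator (S v i) p)" for p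
    proof -
     have "(\<Sum>v\<in>V. v * indicator (S v i) p) = (\<Sum>v\<in>V. if v = q (F i p) then v else 0)"
      by (intro sum.cong) (auto simp: S_def indicator_def)
     thus ?thesis using qV Vf by (simp add: sum.delta)
    qed
    hence "av i (%p. q (F i p)) = av i (%p. \<Sum>v\<in>V. v * indicator (S v i) p)" by simp
    also have "... = (\<Sum>v\<in>V. av i (%p. v * indicator (S v i) p))" by (rule avg_sum)
    also have "... = (\<Sum>v\<in>V. v * av i (indicator (S v i)))"
     by (intro sum.cong) (auto simp: avg_def sum_distrib_left mult.left_commute)
    finally show ?thesis by simp
   qed
   moreover have "\<bar>av i (F i) - av i (%p. q (F i p))\<bar> <= 1 / real N * B"
   proof -
    have "av i (F i) - av i (%p. q (F i p)) = av i (%p. 1 * F i p + (-1) * q (F i p))"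
     unfolding avg_lin by simp
    also have "\<bar>...\<bar> <= 1 / real N * B"
    proof (rule av_bound)
     show "\<bar>1 * F i p + (-1) * q (F i p)\<bar> <= 1 / real N" for p using q[of "F i p"] by simp
    qed simp
    finally show ?thesis .
   qed
   moreover have "measure lam UNIV / real N + 1 / real N * B <= e / 2"
   proof -
    have "measure lam UNIV / real N + 1 / real N * B <= W / real N"
     unfolding W_def by (simp add: add_divide_distrib)
    also have "... <= e / 2" using N e W by (simp add: field_simps)
    finally show ?thesis .
   qed
   ultimately show ?case using elim 1 unfolding dist_real_def abs_less_iff abs_le_iff by linarith
  qed
 qed
qed

end

section \<open>Approximation of a current by weighted chains\<close>

text \<open>The functional is \<open>a = z - tau\<close> with \<open>z\<close> a nearest point to
  \<open>tau\<close> in the closure of the cone, obtained as an ultrafilter limit of a minimising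
  sequence since \<open>V\<close> need not be closed. Moving from \<open>z\<close> along an element
  of \<open>V\<close> gives nonnegativity on \<open>V\<close>; shrinking \<open>z\<close> towards
  \<open>0\<close> gives \<open>a . z <= 0\<close>, and then
  \<open>a . tau = a . z - |a|^2 < 0\<close>.\<close>

lemma cone_separation:
 fixes V :: "('i => real) set"
 assumes I: "finite I" and ne: "V ~= {}"
  and add: "!!v w. v : V ==> w : V ==> (%i. v i + w i) : V"
  and scale: "!!s v. 0 <= s ==> v : V ==> (%i. s * v i) : V"
  and far: "dl > 0" "!!v. v : V ==> EX i:I. dl < \<bar>v i - tau i\<bar>"
 obtains a where "!!v. v : V ==> 0 <= (\<Sum>i\<in>I. a i * v i)" "(\<Sum>i\<in>I. a i * tau i) < 0"
proof -
 define q where "q v = (\<Sum>i\<in>I. (v i - tau i)\<^sup>2)" for v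
 have qdl: "dl\<^sup>2 <= q v" if "v : V" for v
 proof -
  obtain i where i: "i : I" "dl < \<bar>v i - tau i\<bar>" using far(2)[OF \<open>v : V\<close>] by blast
  have "dl\<^sup>2 <= \<bar>v i - tau i\<bar>\<^sup>2" using i far(1) by (intro power_mono) auto
  also have "... = (v i - tau i)\<^sup>2" by simp
  also have "... <= q v" unfolding q_def by (rule member_le_sum[OF i(1) _ I]) simp
  finally show ?thesis .
 qed
 define d where "d = Inf (q ` V)"
 have bb: "bdd_below (q ` V)" using qdl by (auto intro!: bdd_belowI2)
 have dle: "d <= q v" if "v : V" for v unfolding d_def using that bb by (intro cInf_lower) auto
 have ddl: "dl\<^sup>2 <= d" unfolding d_def using ne qdl by (intro cInf_greatest) auto
 have "EX v:V. q v < d + 1 / real (Suc n)" for n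
 proof -
  have "Inf (q ` V) < d + 1 / real (Suc n)" by (simp add: d_def)
  thus ?thesis using cInf_less_iff[OF _ bb] ne by auto
 qed
 then obtain v where v: "!!n. v n : V" "!!n. q (v n) < d + 1 / real (Suc n)" by metis
 obtain W :: "nat filter" where W: "ultra W" "W <= sequentially" using ultra_exists[OF sequentially_bot] .
 have nb: "W ~= bot" using W(1) by (simp add: ultra_def)
 define z where "z i = Lim W (%n. v n i)" for i
 have z: "((%n. v n i) \<longlongrightarrow> z i) W" if i: "i : I" for i
  unfolding z_def
 proof (rule ultra_bounded_tendsto[OF W(1), where B="d + 2 + \<bar>tau i\<bar>"], intro always_eventually allI)
  fix n
  have "(v n i - tau i)\<^sup>2 <= q (v n)" unfolding q_def by (rule member_le_sum[OF i _ I]) simp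
  also have "... <= d + 1" using v(2)[of n] by (rule order_trans[OF less_imp_le]) simp
  finally have s: "(v n i - tau i)\<^sup>2 <= d + 1" .
  have sq: "y <= y\<^sup>2 + 1" for y :: real
  proof -
   have "2 * y <= y\<^sup>2 + 1" using zero_le_power2[of "y - 1"] by (simp add: power2_diff)
   moreover have "0 <= y\<^sup>2" by simp
   ultimately show ?thesis by linarith
  qed
  have "\<bar>v n i - tau i\<bar> <= (v n i - tau i)\<^sup>2 + 1" using sq[of "\<bar>v n i - tau i\<bar>"] by simp
  thus "\<bar>v n i\<bar> <= d + 2 + \<bar>tau i\<bar>" using s by linarith
 qed
 define a where "a i = z i - tau i" for i
 have at: "((%n. v n i - tau i) \<longlongrightarrow> a i) W" if "i : I" for i
  unfolding a_def by (intro tendsto_diff z that tendsto_const)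
 have qlim: "((%n. q (v n)) \<longlongrightarrow> (\<Sum>i\<in>I. (a i)\<^sup>2)) W" unfolding q_def
  by (intro tendsto_sum tendsto_power at)
 have qd: "(\<Sum>i\<in>I. (a i)\<^sup>2) <= d"
 proof (rule tendsto_le[OF nb _ qlim])
  have "(%n. d + 1 / real (Suc n)) \<longlonglongrightarrow> d + 0" by (intro tendsto_add tendsto_const LIMSEQ_Suc[OF lim_1_over_n])
  thus "((%n. d + 1 / real (Suc n)) \<longlongrightarrow> d) W" using tendsto_mono[OF W(2)] by simp
  show "\<forall>\<^sub>F n in W. q (v n) <= d + 1 / real (Suc n)" using v(2) by (intro always_eventually allI) (simp add: less_imp_le)
 qed
 have dq: "d <= (\<Sum>i\<in>I. (a i)\<^sup>2)"
  by (rule tendsto_lowerbound[OF qlim _ nb]) (intro always_eventually allI dle v)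
 have aeq: "(\<Sum>i\<in>I. (a i)\<^sup>2) = d" using qd dq by simp
 \<comment> \<open>First-order condition for one-sided variations: only positive \<open>s\<close>
   are available inside a cone.\<close>
 have lin0: "0 <= X" if "!!s. 0 < s ==> s <= 1 ==> 0 <= 2 * s * X + s\<^sup>2 * Y" "0 <= Y" for X Y :: real
 proof (rule ccontr)
  assume "~ 0 <= X"
  hence X: "X < 0" by simp
  define s where "s = min 1 (- X / (1 + Y))"
  have Y1: "0 < 1 + Y" using that(2) by simp
  have "s <= - X / (1 + Y)" unfolding s_def by simp
  hence "s * (1 + Y) <= - X" using Y1 by (simp only: pos_le_divide_eq)
  moreover have "0 < - X / (1 + Y)" using X Y1 by (intro divide_pos_pos) auto
  ultimately have s: "0 < s" "s <= 1" "s * (1 + Y) <= - X" unfolding s_def by auto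
  have "0 <= s * (2 * X + s * Y)" using that(1)[OF s(1,2)] by (simp add: power2_eq_square algebra_simps)
  hence "0 <= 2 * X + s * Y" using s(1) by (simp add: zero_le_mult_iff)
  moreover have "s * Y <= - X" using s by (simp add: algebra_simps)
  ultimately show False using X by linarith
 qed
 have nonneg: "0 <= (\<Sum>i\<in>I. a i * w i)" if w: "w : V" for w
 proof (rule lin0)
  fix s :: real assume s: "0 < s" "s <= 1"
  have ex: "q (%i. v n i + s * w i) = q (v n) + 2 * s * (\<Sum>i\<in>I. (v n i - tau i) * w i) + s\<^sup>2 * (\<Sum>i\<in>I. (w i)\<^sup>2)" for n
   unfolding q_def sum_distrib_left sum.distrib[symmetric]
   by (intro sum.cong refl) (simp add: power2_eq_square algebra_simps)
  have "((%n. q (v n) + 2 * s * (\<Sum>i\<in>I. (v n i - tau i) * w i) + s\<^sup>2 * (\<Sum>i\<in>I. (w i)\<^sup>2)) \<longlongrightarrow>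
   (\<Sum>i\<in>I. (a i)\<^sup>2) + 2 * s * (\<Sum>i\<in>I. a i * w i) + s\<^sup>2 * (\<Sum>i\<in>I. (w i)\<^sup>2)) W"
   by (intro tendsto_add qlim tendsto_mult tendsto_sum tendsto_const at)
  hence "d <= (\<Sum>i\<in>I. (a i)\<^sup>2) + 2 * s * (\<Sum>i\<in>I. a i * w i) + s\<^sup>2 * (\<Sum>i\<in>I. (w i)\<^sup>2)"
  proof (rule tendsto_lowerbound[OF _ _ nb], intro always_eventually allI)
   fix n
   have "(%i. v n i + s * w i) : V" using s by (intro add scale v w) auto
   thus "d <= q (v n) + 2 * s * (\<Sum>i\<in>I. (v n i - tau i) * w i) + s\<^sup>2 * (\<Sum>i\<in>I. (w i)\<^sup>2)"
    unfolding ex[symmetric] by (rule dle)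
  qed
  thus "0 <= 2 * s * (\<Sum>i\<in>I. a i * w i) + s\<^sup>2 * (\<Sum>i\<in>I. (w i)\<^sup>2)" using aeq by linarith
 qed (simp add: sum_nonneg)
 have az: "0 <= - (\<Sum>i\<in>I. a i * z i)"
 proof (rule lin0)
  fix s :: real assume s: "0 < s" "s <= 1"
  have ex: "q (%i. (1 - s) * v n i) = q (v n) + 2 * s * (- (\<Sum>i\<in>I. (v n i - tau i) * v n i)) + s\<^sup>2 * (\<Sum>i\<in>I. (v n i)\<^sup>2)" for n
   unfolding q_def sum_distrib_left sum_negf[symmetric] sum.distrib[symmetric]
   by (intro sum.cong refl) (simp add: power2_eq_square algebra_simps)
  have "((%n. q (v n) + 2 * s * (- (\<Sum>i\<in>I. (v n i - tau i) * v n i)) + s\<^sup>2 * (\<Sum>i\<in>I. (v n i)\<^sup>2)) \<longlongrightarrow>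
   (\<Sum>i\<in>I. (a i)\<^sup>2) + 2 * s * (- (\<Sum>i\<in>I. a i * z i)) + s\<^sup>2 * (\<Sum>i\<in>I. (z i)\<^sup>2)) W"
   by (intro tendsto_add qlim tendsto_mult tendsto_minus tendsto_sum tendsto_power tendsto_const at z)
  hence "d <= (\<Sum>i\<in>I. (a i)\<^sup>2) + 2 * s * (- (\<Sum>i\<in>I. a i * z i)) + s\<^sup>2 * (\<Sum>i\<in>I. (z i)\<^sup>2)"
  proof (rule tendsto_lowerbound[OF _ _ nb], intro always_eventually allI)
   fix n
   have "(%i. (1 - s) * v n i) : V" using s by (intro scale v) auto
   thus "d <= q (v n) + 2 * s * (- (\<Sum>i\<in>I. (v n i - tau i) * v n i)) + s\<^sup>2 * (\<Sum>i\<in>I. (v n i)\<^sup>2)"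
    unfolding ex[symmetric] by (rule dle)
  qed
  thus "0 <= 2 * s * (- (\<Sum>i\<in>I. a i * z i)) + s\<^sup>2 * (\<Sum>i\<in>I. (z i)\<^sup>2)" using aeq by linarith
 qed (simp add: sum_nonneg)
 have "(\<Sum>i\<in>I. a i * tau i) = (\<Sum>i\<in>I. a i * z i) - (\<Sum>i\<in>I. (a i)\<^sup>2)"
  unfolding sum_subtractf[symmetric] by (intro sum.cong) (auto simp: a_def power2_eq_square algebra_simps)
 moreover have "0 < dl\<^sup>2" using far(1) by simp
 ultimately have "(\<Sum>i\<in>I. a i * tau i) < 0" using az aeq ddl by linarith
 thus ?thesis using that nonneg by blast
qed

text \<open>A left-endpoint Riemann sum: appending a vertex adds a term that depends only on the old
  last vertex and the new one, as the least-cost function below requires.\<close>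

definition path_form :: "('a => real) => ('a => real) => 'a list => real" where
 "path_form f pj p = (\<Sum>j<length p - 1. f (p ! j) * (pj (p ! Suc j) - pj (p ! j)))"

definition path_cost :: "('a::metric_space => real) => 'a list => real" where
 "path_cost ph p = (\<Sum>j<length p - 1. ph (p ! j) * dist (p ! j) (p ! Suc j))"

definition chain :: "real => 'a::metric_space list => bool" where
 "chain eps p \<longleftrightarrow> p ~= [] & (ALL j<length p - 1. dist (p ! j) (p ! Suc j) < eps)"

lemma sum_snoc:
 assumes "p ~= []"
 shows "(\<Sum>j<length (p @ [y]) - 1. F ((p @ [y]) ! j) ((p @ [y]) ! Suc j)) = (\<Sum>j<length p - 1. F (p ! j) (p ! Suc j)) + (F (last p) y :: real)"
proof -
 have l: "length (p @ [y]) - 1 = Suc (length p - 1)" using assms by (cases p) auto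
 have "(\<Sum>j<length p - 1. F ((p @ [y]) ! j) ((p @ [y]) ! Suc j)) = (\<Sum>j<length p - 1. F (p ! j) (p ! Suc j))"
  by (intro sum.cong) (auto simp: nth_append)
 moreover have "(p @ [y]) ! (length p - 1) = last p" "(p @ [y]) ! Suc (length p - 1) = y"
  using assms by (auto simp: nth_append last_conv_nth)
 ultimately show ?thesis unfolding l by simp
qed

lemma path_form_snoc: "p ~= [] ==> path_form f pj (p @ [y]) = path_form f pj p + f (last p) * (pj y - pj (last p))"
 unfolding path_form_def using sum_snoc[of p "%a b. f a * (pj b - pj a)" y] by simp

lemma path_cost_snoc: "p ~= [] ==> path_cost ph (p @ [y]) = path_cost ph p + ph (last p) * dist (last p) y"
 unfolding path_cost_def using sum_snoc[of p "%a b. ph a * dist a b" y] by simp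

lemma chain_snoc: "chain eps p ==> dist (last p) y < eps ==> chain eps (p @ [y])"
 unfolding chain_def
proof (intro conjI allI impI)
 fix j assume p: "p ~= [] & (ALL j<length p - 1. dist (p ! j) (p ! Suc j) < eps)" "dist (last p) y < eps" and j: "j < length (p @ [y]) - 1"
 show "dist ((p @ [y]) ! j) ((p @ [y]) ! Suc j) < eps"
 proof (cases "j < length p - 1")
  case True thus ?thesis using p by (auto simp: nth_append)
 next
  case False
  hence "j = length p - 1" using j by auto
  thus ?thesis using p by (auto simp: nth_append last_conv_nth)
 qed
qed auto

lemma current1_lin:
 assumes T: "T : currents 1" and f: "f : Lipb_funs" and p: "p : Lip_funs" and q: "q : Lip_funs"
 shows "T f [%x. a * p x + b * q x] = a * T f [p] + b * T f [q]"
proof -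
 have "[p] : Lip_tuples 1" using p by (simp add: Lip_tuples_def)
 hence "T f ([p][0 := (%x. a * p x + b * q x)]) = a * T f ([p][0 := p]) + b * T f ([p][0 := q])"
  using T f p q unfolding currents_def multilinear_on_forms_def by blast
 thus ?thesis by simp
qed

lemma Lip_lin:
 assumes "p : Lip_funs" "q : Lip_funs" shows "(%x. a * p x + b * q x) : Lip_funs"
proof -
 obtain L M where "L-lipschitz_on UNIV p" "M-lipschitz_on UNIV q" using assms by (auto simp: Lip_funs_def)
 hence "(\<bar>a\<bar> * L + \<bar>b\<bar> * M)-lipschitz_on UNIV (%x. a * p x + b * q x)"
  by (intro lipschitz_on_add lipschitz_on_cmult_real)
 thus ?thesis by (auto simp: Lip_funs_def)
qed

lemma Lip_sum:
 assumes "finite I" "!!i. i : I ==> pj i : Lip_funs"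
 shows "(%x. \<Sum>i\<in>I. c i * pj i x) : Lip_funs"
 using assms
proof (induct rule: finite_induct)
 case empty thus ?case using Lipb_Lip[OF Lipb_const[of 0]] by simp
next
 case (insert j J)
 thus ?case using Lip_lin[of "pj j" "%x. \<Sum>i\<in>J. c i * pj i x" "c j" 1] by simp
qed

lemma current1_sum:
 assumes T: "T : currents 1" and f: "f : Lipb_funs" and "finite I" "!!i. i : I ==> pj i : Lip_funs"
 shows "T f [%x. \<Sum>i\<in>I. c i * pj i x] = (\<Sum>i\<in>I. c i * T f [pj i])"
 using assms(3,4)
proof (induct rule: finite_induct)
 case empty
 have "T f [%x. 0 * (0::real) + 0 * 0] = 0 * T f [%x. 0] + 0 * T f [%x. 0]"
  by (rule current1_lin[OF T f]) (auto intro: Lipb_Lip)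
 thus ?case by simp
next
 case (insert j J)
 thus ?case
  using current1_lin[OF T f, of "pj j" "%x. \<Sum>i\<in>J. c i * pj i x" "c j" 1] Lip_sum[of J pj c] by simp
qed

text \<open>Locality applied to \<open>p - q\<close>, which is constantly \<open>0\<close> near the
  support of \<open>f\<close>.\<close>

lemma current1_local:
 assumes T: "T : currents 1" and f: "f : Lipb_funs" and p: "p : Lip_funs" "q : Lip_funs"
  and U: "open U" "{x. f x ~= 0} \<subseteq> U" "!!x. x : U ==> p x = q x"
 shows "T f [p] = T f [q]"
proof -
 have "T f [%x. 1 * p x + (-1) * q x] = 0"
 proof -
  have "[%x. 1 * p x + (-1) * q x] : Lip_tuples 1" using Lip_lin[OF p, of 1 "-1"] by (simp add: Lip_tuples_def)
  moreover have "EX i<1. EX U c. open U & {x. f x ~= 0} \<subseteq> U & (ALL x:U. ([%x. 1 * p x + (-1) * q x] ! i) x = c)"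
   using U by (intro exI[of _ 0] conjI exI[of _ U] exI[of _ "0::real"]) auto
  ultimately show ?thesis using T f unfolding currents_def local_on_forms_def by blast
 qed
 thus ?thesis unfolding current1_lin[OF T f p] by simp
qed

text \<open>McShane's extension by the infimum of cones; the one-sided hypothesis covers both signs,
  because \<open>x\<close> and \<open>y\<close> range over all ordered pairs.\<close>

lemma McShane:
 fixes w :: "'a::metric_space => real"
 assumes "B ~= {}" "0 <= l" "!!x y. x : B ==> y : B ==> w y - w x <= l * dist x y"
 obtains w' where "l-lipschitz_on UNIV w'" "!!x. x : B ==> w' x = w x"
proof -
 define w' where "w' x = (INF b\<in>B. w b + l * dist b x)" for x
 obtain b0 where b0: "b0 : B" using assms(1) by blast
 have lb: "w b0 - l * dist x b0 <= w b + l * dist b x" if "b : B" for b x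
 proof -
  have "w b0 - w b <= l * dist b b0" using assms(3)[OF that b0] .
  also have "... <= l * (dist b x + dist x b0)" by (intro mult_left_mono dist_triangle assms)
  finally show ?thesis by (simp add: algebra_simps)
 qed
 have bdd: "bdd_below ((%b. w b + l * dist b x) ` B)" for x using lb by (intro bdd_belowI2)
 have le: "w' x <= w' y + l * dist x y" for x y
 proof -
  have "w' x - l * dist x y <= w' y" unfolding w'_def
  proof (rule cINF_greatest[OF assms(1)])
   fix b assume b: "b : B"
   have "w' x <= w b + l * dist b x" unfolding w'_def by (rule cINF_lower[OF bdd b])
   also have "l * dist b x <= l * (dist b y + dist x y)" using assms(2) by (intro mult_left_mono dist_triangle2) auto
   finally show "(INF b\<in>B. w b + l * dist b x) - l * dist x y <= w b + l * dist b y" unfolding w'_def by (simp add: algebra_simps)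
  qed
  thus ?thesis by simp
 qed
 show ?thesis
 proof (rule that[of w'])
  show "l-lipschitz_on UNIV w'"
  proof (rule lipschitz_onI[OF _ assms(2)])
   fix x y show "dist (w' x) (w' y) <= l * dist x y"
    using le[of x y] le[of y x] by (simp add: dist_real_def dist_commute abs_le_iff)
  qed
  fix x assume x: "x : B"
  have "w' x <= w x + l * dist x x" unfolding w'_def by (rule cINF_lower[OF bdd x])
  moreover have "w x <= w' x" unfolding w'_def
   by (rule cINF_greatest[OF assms(1)]) (use assms(3) x in \<open>simp add: algebra_simps\<close>)
  ultimately show "w' x = w x" by simp
 qed
qed

text \<open>Near a point \<open>z\<close> the function \<open>u - \<Sum> f\<^sub>i(z) pj\<^sub>i\<close> has Lipschitz constant close to \<open>ph(z)\<close>; by locality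
  this bounds the density of \<open>T\<close> against \<open>du - \<Sum> f\<^sub>i dpj\<^sub>i\<close>.\<close>

lemma local_form_estimate:
 fixes T :: "'a::metric_space functional"
 assumes T: "T : currents 1" and c: "controls 1 T mu"
  and cov: "!!r. r > 0 ==> EX C. countable C & emeasure mu (- (\<Union>x\<in>C. ball x r)) = 0"
  and ph: "ph : Lipb_funs" "!!x. 0 <= ph x" and u: "u : Lipb_funs"
  and I: "finite I" and f: "!!i. i : I ==> f i : Lipb_funs" and pj: "!!i. i : I ==> pj i : Lip_funs"
  and eps: "eps > 0"
  and ineq: "!!x y. dist x y < eps ==> u y - u x <= ph x * dist x y + (\<Sum>i\<in>I. f i x * (pj i y - pj i x))"
 shows "T (%_. 1) [u] <= (LINT x|mu. ph x) + (\<Sum>i\<in>I. T (f i) [pj i])"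
proof -
 have M: "fbm mu" using c by (simp add: controls_iff)
 have tup: "[p] : Lip_tuples 1" if "p : Lip_funs" for p :: "'a => real" using that by (simp add: Lip_tuples_def)
 have "EX rh. ALL pj:Lip_funs. rh pj : borel_measurable borel & (ALL x. \<bar>rh pj x\<bar> <= Lip pj) & (ALL f:Lipb_funs. T f [pj] = (LINT x|mu. f x * rh pj x))"
 proof -
  obtain r where r: "!!pj. r pj : borel_measurable borel" "!!pj x. \<bar>r pj x\<bar> <= 1"
   "!!f pj. f : Lipb_funs ==> pj : Lip_tuples 1 ==> T f pj = Lip_prod pj * (LINT x|mu. f x * r pj x)"
   by (rule density_family[OF currents_linear_first[OF T] c]) (rule that)
  have "(%x. Lip pj * r [pj] x) : borel_measurable borel & (ALL x. \<bar>Lip pj * r [pj] x\<bar> <= Lip pj) &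
   (ALL f:Lipb_funs. T f [pj] = (LINT x|mu. f x * (Lip pj * r [pj] x)))" if p: "pj : Lip_funs" for pj
  proof (intro conjI allI ballI)
   show "(%x. Lip pj * r [pj] x) : borel_measurable borel" using r(1)[of "[pj]"] by measurable
   show "\<bar>Lip pj * r [pj] x\<bar> <= Lip pj" for x
    using mult_left_mono[OF r(2)[of "[pj]" x] Lip_nonneg[OF p]] Lip_nonneg[OF p] by (simp add: abs_mult)
   show "T f [pj] = (LINT x|mu. f x * (Lip pj * r [pj] x))" if "f : Lipb_funs" for f
    using r(3)[OF that tup[OF p]] by (simp add: Lip_prod_def mult.left_commute)
  qed
  thus ?thesis by (intro exI[of _ "%pj x. Lip pj * r [pj] x"] ballI)
 qed
 then obtain rh where rh: "!!pj. pj : Lip_funs ==> rh pj : borel_measurable borel" "!!pj x. pj : Lip_funs ==> \<bar>rh pj x\<bar> <= Lip pj"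
   "!!f pj. pj : Lip_funs ==> f : Lipb_funs ==> T f [pj] = (LINT x|mu. f x * rh pj x)" by metis
 have irh: "integrable mu (rh pj)" if "pj : Lip_funs" for pj by (rule fbm_integrable_bounded[OF M rh(1)[OF that] rh(2)[OF that]])
 have uL: "u : Lip_funs" by (rule Lipb_Lip[OF u])
 \<comment> \<open>\<open>C s\<close> bounds the change over distance \<open>s\<close> of
   \<open>ph\<close> and of the coefficients \<open>f i\<close>, the latter weighted with
   \<open>Lip (pj i)\<close>.\<close>
 define C where "C = Lip ph + (\<Sum>i\<in>I. Lip (f i) * Lip (pj i))"
 note L0 = Lip_nonneg[OF Lipb_Lip[OF ph(1)]] Lip_nonneg[OF Lipb_Lip[OF f]] Lip_nonneg[OF pj]
 have C0: "0 <= C" unfolding C_def using L0 by (intro add_nonneg_nonneg sum_nonneg mult_nonneg_nonneg) auto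
 have AEball: "AE x in mu. x : ball z s --> rh u x <= ph x + (\<Sum>i\<in>I. f i x * rh (pj i) x) + 2 * C * s" if s: "0 < s" "s <= eps / 2" for z s
 proof -
  \<comment> \<open>The coefficients are frozen at the centre \<open>z\<close>; on the ball
    \<open>w\<close> is then Lipschitz with a constant \<open>l\<close> only slightly above
    \<open>ph z\<close>.\<close>
  define w where "w x = u x - (\<Sum>i\<in>I. f i z * pj i x)" for x
  define l where "l = ph z + C * s"
  have l0: "0 <= l" unfolding l_def using ph(2) C0 s by simp
  have wl: "w y - w x <= l * dist x y" if xy: "x : ball z s" "y : ball z s" for x y
  proof -
   have dxy: "dist x y < eps" using dist_triangle3[of x y z] xy s by auto
   have zx: "dist x z <= s" using xy by (simp add: dist_commute)
   have "w y - w x = u y - u x - (\<Sum>i\<in>I. f i z * (pj i y - pj i x))"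
    unfolding w_def by (simp add: sum_subtractf right_diff_distrib)
   also have "... <= ph x * dist x y + ((\<Sum>i\<in>I. f i x * (pj i y - pj i x)) - (\<Sum>i\<in>I. f i z * (pj i y - pj i x)))"
    using ineq[OF dxy] by simp
   also have "(\<Sum>i\<in>I. f i x * (pj i y - pj i x)) - (\<Sum>i\<in>I. f i z * (pj i y - pj i x)) = (\<Sum>i\<in>I. (f i x - f i z) * (pj i y - pj i x))"
    by (simp add: sum_subtractf left_diff_distrib)
   also have "... <= (\<Sum>i\<in>I. (Lip (f i) * s) * (Lip (pj i) * dist x y))"
   proof (intro sum_mono)
    fix i assume i: "i : I"
    have "(f i x - f i z) * (pj i y - pj i x) <= \<bar>f i x - f i z\<bar> * \<bar>pj i y - pj i x\<bar>" by (metis abs_ge_self abs_mult)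
    also have "... <= (Lip (f i) * s) * (Lip (pj i) * dist x y)"
    proof (intro mult_mono)
     show "\<bar>f i x - f i z\<bar> <= Lip (f i) * s"
      by (rule order_trans[OF Lip_bound[OF Lipb_Lip[OF f[OF i]]] mult_left_mono[OF zx L0(2)[OF i]]])
     show "\<bar>pj i y - pj i x\<bar> <= Lip (pj i) * dist x y"
      using Lip_bound[OF pj[OF i], of y x] by (simp add: dist_commute)
    qed (use L0(2)[OF i] s in auto)
    finally show "(f i x - f i z) * (pj i y - pj i x) <= (Lip (f i) * s) * (Lip (pj i) * dist x y)" .
   qed
   also have "... = (\<Sum>i\<in>I. Lip (f i) * Lip (pj i)) * s * dist x y"
    unfolding sum_distrib_right by (intro sum.cong refl) (simp add: mult_ac)
   also have "ph x * dist x y <= (ph z + Lip ph * s) * dist x y"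
   proof (intro mult_right_mono)
    have "ph x - ph z <= Lip ph * dist x z" using Lip_bound[OF Lipb_Lip[OF ph(1)], of x z] by (simp add: abs_le_iff)
    also have "... <= Lip ph * s" by (rule mult_left_mono[OF zx L0(1)])
    finally show "ph x <= ph z + Lip ph * s" by simp
   qed simp
   finally show ?thesis unfolding l_def C_def by (simp add: algebra_simps)
  qed
  \<comment> \<open>Outside the ball \<open>w\<close> may be steeper; locality will allow its
    replacement by a global \<open>l\<close>-Lipschitz extension.\<close>
  obtain w' where w': "l-lipschitz_on UNIV w'" "!!x. x : ball z s ==> w' x = w x"
   by (rule McShane[of "ball z s" l w]) (use s l0 wl in auto)
  have w'L: "w' : Lip_funs" using w'(1) by (auto simp: Lip_funs_def)
  have sL: "(%x. \<Sum>i\<in>I. f i z * pj i x) : Lip_funs" by (rule Lip_sum[OF I pj])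
  have wL: "w : Lip_funs" using Lip_lin[OF uL sL, of 1 "-1"] by (simp add: w_def[abs_def])
  \<comment> \<open>Positive exactly on \<open>ball z s\<close>, so an inequality tested against all
    \<open>g\<close> is localised by the factor \<open>b\<close>.\<close>
  define b where "b x = max 0 (s - dist x z)" for x
  have bL: "b : Lipb_funs" unfolding b_def by (rule Lip_dist_cut)
  have b0: "0 <= b x" for x by (simp add: b_def)
  define R where "R x = rh u x - (\<Sum>i\<in>I. f i z * rh (pj i) x)" for x
  have iR: "integrable mu R" unfolding R_def
   by (intro Bochner_Integration.integrable_diff Bochner_Integration.integrable_sum integrable_mult_right irh uL pj)
  have "AE x in mu. b x * R x <= b x * l"
  proof (rule AE_le_of_Lipb[OF M])
   show "integrable mu (%x. b x * R x)" by (rule fbm_integrable_mult[OF M iR bL])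
   show "integrable mu (%x. b x * l)" by (rule fbm_integrable_Lipb[OF M]) (use Lipb_cmult[OF bL, of l] in \<open>simp add: mult.commute\<close>)
   fix g :: "'a => real" assume g: "g : Lipb_funs" "!!x. 0 <= g x"
   have gb: "(%x. g x * b x) : Lipb_funs" by (rule Lipb_mult[OF g(1) bL])
   have int1: "integrable mu (%x. g x * b x * rh p x)" if "p : Lip_funs" for p by (rule fbm_integrable_mult[OF M irh[OF that] gb])
   have "(LINT x|mu. g x * (b x * R x)) = (LINT x|mu. g x * b x * rh u x - (\<Sum>i\<in>I. f i z * (g x * b x * rh (pj i) x)))"
    by (rule Bochner_Integration.integral_cong) (auto simp: R_def algebra_simps sum_distrib_left)
   also have "... = (LINT x|mu. g x * b x * rh u x) - (LINT x|mu. (\<Sum>i\<in>I. f i z * (g x * b x * rh (pj i) x)))"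
    by (intro Bochner_Integration.integral_diff Bochner_Integration.integrable_sum integrable_mult_right int1 uL pj)
   also have "(LINT x|mu. (\<Sum>i\<in>I. f i z * (g x * b x * rh (pj i) x))) = (\<Sum>i\<in>I. f i z * (LINT x|mu. g x * b x * rh (pj i) x))"
    using int1 pj by (subst Bochner_Integration.integral_sum) auto
   also have "(LINT x|mu. g x * b x * rh u x) - ... = T (%x. g x * b x) [u] - (\<Sum>i\<in>I. f i z * T (%x. g x * b x) [pj i])"
    using rh(3)[OF uL gb] rh(3)[OF pj gb] by simp
   also have "... = T (%x. g x * b x) [w]"
    using current1_lin[OF T gb uL sL, of 1 "-1"] current1_sum[OF T gb I pj] by (simp add: w_def[abs_def])
   also have "... = T (%x. g x * b x) [w']"
    by (rule current1_local[OF T gb wL w'L, of "ball z s"]) (use w'(2) in \<open>auto simp: b_def dist_commute\<close>)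
   also have "... <= Lip_prod [w'] * (LINT x|mu. \<bar>g x * b x\<bar>)"
    using c gb tup[OF w'L] abs_le_D1 unfolding controls_iff by blast
   also have "... <= l * (LINT x|mu. \<bar>g x * b x\<bar>)"
    by (intro mult_right_mono) (use Lip_le[OF w'(1)] in \<open>auto simp: Lip_prod_def\<close>)
   also have "... = (LINT x|mu. g x * (b x * l))" using g(2) b0 by (simp add: abs_mult mult_ac flip: integral_mult_right_zero)
   finally show "(LINT x|mu. g x * (b x * R x)) <= (LINT x|mu. g x * (b x * l))" .
  qed
  thus ?thesis
  proof eventually_elim
   case (elim x)
   show ?case
   proof
    assume x: "x : ball z s"
    hence "b x > 0" by (simp add: b_def dist_commute)
    hence "R x <= l" using elim by simp
    have zx: "dist x z <= s" using x by (simp add: dist_commute)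
    have "(\<Sum>i\<in>I. f i z * rh (pj i) x) <= (\<Sum>i\<in>I. f i x * rh (pj i) x + Lip (f i) * Lip (pj i) * s)"
    proof (intro sum_mono)
     fix i assume i: "i : I"
     have "(f i z - f i x) * rh (pj i) x <= \<bar>f i x - f i z\<bar> * \<bar>rh (pj i) x\<bar>" by (metis abs_ge_self abs_mult abs_minus_commute)
     also have "... <= (Lip (f i) * s) * Lip (pj i)"
     proof (intro mult_mono rh(2) pj i)
      show "\<bar>f i x - f i z\<bar> <= Lip (f i) * s"
       by (rule order_trans[OF Lip_bound[OF Lipb_Lip[OF f[OF i]]] mult_left_mono[OF zx L0(2)[OF i]]])
     qed (use L0(2)[OF i] s in auto)
     finally show "f i z * rh (pj i) x <= f i x * rh (pj i) x + Lip (f i) * Lip (pj i) * s" by (simp add: algebra_simps)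
    qed
    also have "... = (\<Sum>i\<in>I. f i x * rh (pj i) x) + (\<Sum>i\<in>I. Lip (f i) * Lip (pj i)) * s"
     by (simp add: sum.distrib sum_distrib_right)
    finally have 1: "(\<Sum>i\<in>I. f i z * rh (pj i) x) <= (\<Sum>i\<in>I. f i x * rh (pj i) x) + (\<Sum>i\<in>I. Lip (f i) * Lip (pj i)) * s" .
    have "ph z - ph x <= Lip ph * dist x z" using Lip_bound[OF Lipb_Lip[OF ph(1)], of x z] by (simp add: abs_le_iff)
    also have "... <= Lip ph * s" by (rule mult_left_mono[OF zx L0(1)])
    finally have 2: "ph z <= ph x + Lip ph * s" by simp
    have "C * s = Lip ph * s + (\<Sum>i\<in>I. Lip (f i) * Lip (pj i)) * s" by (simp add: C_def distrib_right)
    thus "rh u x <= ph x + (\<Sum>i\<in>I. f i x * rh (pj i) x) + 2 * C * s"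
     using \<open>R x <= l\<close> 1 2 unfolding R_def l_def by linarith
   qed
  qed
 qed
 \<comment> \<open>Countably many balls carry \<open>mu\<close>, so the exceptional sets of the
   single balls unite to a null set.\<close>
 have AEs: "AE x in mu. rh u x <= ph x + (\<Sum>i\<in>I. f i x * rh (pj i) x) + 2 * C * s" if s: "0 < s" "s <= eps / 2" for s
 proof -
  obtain D where D: "countable D" "emeasure mu (- (\<Union>x\<in>D. ball x s)) = 0" using cov[OF s(1)] by blast
  have "- (\<Union>x\<in>D. ball x s) : sets mu"
   unfolding fbmD(2)[OF M] by (intro borel_comp borel_open open_UN ballI) auto
  hence "- (\<Union>x\<in>D. ball x s) : null_sets mu" using D(2) by auto
  hence "AE x in mu. x ~: - (\<Union>x\<in>D. ball x s)" by (rule AE_not_in)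
  moreover have "AE x in mu. ALL z:D. x : ball z s --> rh u x <= ph x + (\<Sum>i\<in>I. f i x * rh (pj i) x) + 2 * C * s"
   unfolding AE_ball_countable[OF D(1)] using AEball[OF s] by blast
  ultimately show ?thesis by eventually_elim blast
 qed
 have "AE x in mu. ALL n::nat. rh u x <= ph x + (\<Sum>i\<in>I. f i x * rh (pj i) x) + 2 * C * (eps / 2 / real (Suc n))"
  unfolding AE_all_countable
 proof
  fix n :: nat
  have "eps / 2 / real (Suc n) <= eps / 2 / 1" using eps by (intro divide_left_mono) auto
  thus "AE x in mu. rh u x <= ph x + (\<Sum>i\<in>I. f i x * rh (pj i) x) + 2 * C * (eps / 2 / real (Suc n))"
   using eps by (intro AEs) auto
 qed
 hence AE: "AE x in mu. rh u x <= ph x + (\<Sum>i\<in>I. f i x * rh (pj i) x)"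
 proof eventually_elim
  case (elim x)
  have "(%n. ph x + (\<Sum>i\<in>I. f i x * rh (pj i) x) + 2 * C * (eps / 2 * (1 / real (Suc n)))) \<longlonglongrightarrow>
   ph x + (\<Sum>i\<in>I. f i x * rh (pj i) x) + 2 * C * (eps / 2 * 0)"
   by (intro tendsto_add tendsto_mult tendsto_const LIMSEQ_Suc[OF lim_1_over_n])
  thus ?case using LIMSEQ_le_const[of _ _ "rh u x"] elim by fastforce
 qed
 have iph: "integrable mu ph" by (rule fbm_integrable_Lipb[OF M ph(1)])
 have ifrh: "integrable mu (%x. f i x * rh (pj i) x)" if "i : I" for i
  by (rule fbm_integrable_mult[OF M irh[OF pj[OF that]] f[OF that]])
 have "T (%_. 1) [u] = (LINT x|mu. rh u x)" using rh(3)[OF uL Lipb_const[of 1]] by simp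
 also have "... <= (LINT x|mu. ph x + (\<Sum>i\<in>I. f i x * rh (pj i) x))"
  by (intro integral_mono_AE AE irh uL Bochner_Integration.integrable_add iph Bochner_Integration.integrable_sum ifrh)
 also have "... = (LINT x|mu. ph x) + (\<Sum>i\<in>I. (LINT x|mu. f i x * rh (pj i) x))"
  using iph ifrh by (subst Bochner_Integration.integral_add) auto
 also have "... = (LINT x|mu. ph x) + (\<Sum>i\<in>I. T (f i) [pj i])" using rh(3)[OF pj f] by simp
 finally show ?thesis .
qed


section \<open>Tests on chains and the approximation theorem\<close>

type_synonym 'a path_test = "('a => real) \<times> ('a => real) \<times> ('a => real) \<times> ('a => real) \<times> ('a => real)"

text \<open>All five slots are tested together, so that one separation yields form, cost, start and
  end at once. Only the cost density carries a sign: for it only an upper bound will be extracted,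
  whereas the other slots may be negated.\<close>

definition valid_tests :: "'a::metric_space path_test set" where
 "valid_tests = {(f, pj, ph, g, h). f : Lipb_funs & pj : Lip_funs & ph : Lipb_funs & (ALL x. 0 <= ph x) & g : Lipb_funs & h : Lipb_funs}"

definition test_value :: "'a::metric_space path_test => 'a list => real" where
 "test_value = (%(f, pj, ph, g, h) p. path_form f pj p + path_cost ph p + g (hd p) + h (last p))"

text \<open>Starts are matched with \<open>N\<close> and ends with \<open>P\<close>, in accordance
  with the boundary \<open>P - N\<close>.\<close>

definition test_target :: "'a::metric_space functional => 'a measure => 'a measure => 'a measure => 'a path_test => real" where
 "test_target T mu N P = (%(f, pj, ph, g, h). T f [pj] + (LINT x|mu. ph x) + (LINT x|N. g x) + (LINT x|P. h x))"

text \<open>The value function \<open>u(x)\<close>, the least cost of a chain ending at \<open>x\<close>, turns the inequality along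
  chains into the infinitesimal one of \<open>local_form_estimate\<close>.\<close>

lemma chain_inequality_transfer:
 fixes T :: "'a::metric_space functional"
 assumes T: "T : currents 1" and c: "controls 1 T mu"
  and cov: "!!r. r > 0 ==> EX C. countable C & emeasure mu (- (\<Union>x\<in>C. ball x r)) = 0"
  and j: "jordan_decomposition (boundary T) P N"
  and ph: "ph : Lipb_funs" "!!x. 0 <= ph x" and g: "g : Lipb_funs" and h: "h : Lipb_funs"
  and I: "finite I" and f: "!!i. i : I ==> f i : Lipb_funs" and pj: "!!i. i : I ==> pj i : Lip_funs"
  and eps: "eps > 0"
  and chains: "!!p. chain eps p ==> 0 <= (\<Sum>i\<in>I. path_form (f i) (pj i) p) + path_cost ph p + g (hd p) + h (last p)"
 shows "0 <= (\<Sum>i\<in>I. T (f i) [pj i]) + (LINT x|mu. ph x) + (LINT x|N. g x) + (LINT x|P. h x)"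
proof -
 have PN: "fbm P" "fbm N" using j by (auto simp: jordan_decomposition_def fbm_def)
 define F where "F p = (\<Sum>i\<in>I. path_form (f i) (pj i) p) + path_cost ph p + g (hd p)" for p
 define S where "S x = {p. chain eps p & last p = x}" for x :: 'a
 define u where "u x = (INF p\<in>S x. F p)" for x
 have single: "[x] : S x" for x by (simp add: S_def chain_def)
 have ne: "S x ~= {}" for x using single by blast
 have Fx: "F [x] = g x" for x by (simp add: F_def path_form_def path_cost_def)
 have low: "- h x <= F p" if "p : S x" for x p
  using chains[of p] that by (simp add: S_def F_def)
 have bdd: "bdd_below (F ` S x)" for x using low by (intro bdd_belowI2)
 have ug: "u x <= g x" for x unfolding u_def using cINF_lower[OF bdd single] Fx by metis
 have hu: "- h x <= u x" for x unfolding u_def by (rule cINF_greatest[OF ne low])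
 have step: "u y - u x <= ph x * dist x y + (\<Sum>i\<in>I. f i x * (pj i y - pj i x))" if d: "dist x y < eps" for x y
 proof -
  define e where "e = ph x * dist x y + (\<Sum>i\<in>I. f i x * (pj i y - pj i x))"
  have "u y - e <= F p" if p: "p : S x" for p
  proof -
   have pn: "p ~= []" "last p = x" using p by (auto simp: S_def chain_def)
   have "p @ [y] : S y" using p d chain_snoc[of eps p y] by (simp add: S_def)
   hence "u y <= F (p @ [y])" unfolding u_def by (rule cINF_lower[OF bdd])
   also have "F (p @ [y]) = F p + e"
    using pn by (simp add: F_def e_def path_form_snoc path_cost_snoc sum.distrib)
   finally show ?thesis by simp
  qed
  hence "u y - e <= u x" unfolding u_def[of x] by (intro cINF_greatest[OF ne])
  thus ?thesis by (simp add: e_def)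
 qed
 have uL: "u : Lipb_funs"
 proof -
  obtain Bg where Bg: "!!x. \<bar>g x\<bar> <= Bg" using LipbE[OF g] by metis
  obtain Bh where Bh: "!!x. \<bar>h x\<bar> <= Bh" using LipbE[OF h] by metis
  obtain Bph where Bph: "!!x. \<bar>ph x\<bar> <= Bph" using LipbE[OF ph(1)] by metis
  have "ALL i:I. EX B. ALL x. \<bar>f i x\<bar> <= B" using LipbE[OF f] by metis
  then obtain Bf where Bf: "!!i x. i : I ==> \<bar>f i x\<bar> <= Bf i" by metis
  define B where "B = Bg + Bh"
  have ub: "\<bar>u x\<bar> <= B" for x using ug[of x] hu[of x] Bg[of x] Bh[of x] unfolding B_def by linarith
  have B0: "0 <= B" using ub[of undefined] by linarith
  define K where "K = Bph + (\<Sum>i\<in>I. Bf i * Lip (pj i))"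
  have K: "ph x * dist x y + (\<Sum>i\<in>I. f i x * (pj i y - pj i x)) <= K * dist x y" for x y
  proof -
   have "(\<Sum>i\<in>I. f i x * (pj i y - pj i x)) <= (\<Sum>i\<in>I. Bf i * (Lip (pj i) * dist x y))"
   proof (rule sum_mono)
    fix i assume i: "i : I"
    have "f i x * (pj i y - pj i x) <= \<bar>f i x\<bar> * \<bar>pj i y - pj i x\<bar>" by (metis abs_ge_self abs_mult)
    also have "... <= Bf i * (Lip (pj i) * dist x y)"
    proof (intro mult_mono Bf i)
     show "\<bar>pj i y - pj i x\<bar> <= Lip (pj i) * dist x y" using Lip_bound[OF pj[OF i], of y x] by (simp add: dist_commute)
     show "0 <= Bf i" using Bf[OF i, of x] by linarith
    qed simp
    finally show "f i x * (pj i y - pj i x) <= Bf i * (Lip (pj i) * dist x y)" .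
   qed
   moreover have "ph x * dist x y <= Bph * dist x y" using Bph[of x] by (intro mult_right_mono) auto
   ultimately show ?thesis unfolding K_def by (simp add: distrib_right sum_distrib_right mult.assoc)
  qed
  \<comment> \<open>Points closer than \<open>eps\<close> are handled by \<open>step\<close>; for
    the others the oscillation \<open>2 B\<close> of \<open>u\<close> is spread over a distance at
    least \<open>eps\<close>.\<close>
  define L where "L = max \<bar>K\<bar> (2 * B / eps)"
  have le: "u y - u x <= L * dist x y" for x y
  proof (cases "dist x y < eps")
   case True
   have "u y - u x <= K * dist x y" using step[OF True] K[of x y] by linarith
   also have "... <= L * dist x y" unfolding L_def by (intro mult_right_mono) auto
   finally show ?thesis .
  next
   case False
   have "u y - u x <= 2 * B" using ub[of x] ub[of y] by linarith
   also have "2 * B = 2 * B / eps * eps" using eps by simp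
   also have "... <= L * dist x y" unfolding L_def using False B0 eps by (intro mult_mono) auto
   finally show ?thesis .
  qed
  show ?thesis
  proof (rule LipbI[OF _ ub])
   show "\<bar>u x - u y\<bar> <= L * dist x y" for x y using le[of x y] le[of y x] by (simp add: dist_commute abs_le_iff)
  qed
 qed
 have "T (%_. 1) [u] <= (LINT x|mu. ph x) + (\<Sum>i\<in>I. T (f i) [pj i])"
  by (rule local_form_estimate[OF T c cov ph uL I f pj eps step])
 moreover have "T (%_. 1) [u] = (LINT x|P. u x) - (LINT x|N. u x)"
  using j uL unfolding jordan_decomposition_def boundary_def by auto
 \<comment> \<open>\<open>- h <= u <= g\<close>, the upper bound from chains of one point;
   integration against \<open>P\<close> and \<open>N\<close> turns \<open>T(1, u)\<close> into the
   two boundary terms.\<close>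
 moreover have "(LINT x|P. - h x) <= (LINT x|P. u x)"
  by (intro integral_mono fbm_integrable_Lipb PN uL Lipb_uminus h hu)
 moreover have "(LINT x|N. u x) <= (LINT x|N. g x)"
  by (intro integral_mono fbm_integrable_Lipb PN uL g ug)
 ultimately show ?thesis by simp
qed

text \<open>If no weighted family works, the cone of vectors above some vector of weighted test sums
  stays away from the target. Being closed upwards, it forces nonnegative separating coefficients;
  these merge all tests into a single chain inequality with one nonnegative cost density, whose
  transfer to \<open>T\<close> contradicts the separation.\<close>

theorem chain_approximation:
 fixes T :: "'a::metric_space functional"
 assumes T: "T : currents 1" and c: "controls 1 T mu"
  and cov: "!!r. r > 0 ==> EX C. countable C & emeasure mu (- (\<Union>x\<in>C. ball x r)) = 0"
  and j: "jordan_decomposition (boundary T) P N"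
  and I: "finite I" "I \<subseteq> valid_tests" and eps: "eps > 0" and dl: "dl > 0"
 obtains A w where "finite A" "!!p. p : A ==> chain eps p" "!!p. 0 <= w p"
  "!!t. t : I ==> (\<Sum>p\<in>A. w p * test_value t p) <= test_target T mu N P t + dl"
proof (rule ccontr)
 assume contra: "~ thesis"
 note main = that
 let ?tau = "test_target T mu N P"
 define ok where "ok A w \<longleftrightarrow> finite A & (ALL p:A. chain eps p) & (ALL p. 0 <= w p)" for A :: "'a list set" and w :: "'a list => real"
 define V where "V = {v. EX A w. ok A w & (ALL t:I. (\<Sum>p\<in>A. w p * test_value t p) <= v t)}"
 obtain a where a: "!!v. v : V ==> 0 <= (\<Sum>i\<in>I. a i * v i)" "(\<Sum>i\<in>I. a i * ?tau i) < 0"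
 proof (rule cone_separation[OF I(1), of V dl ?tau])
  show "V ~= {}" unfolding V_def ok_def by (auto intro!: exI[of _ "%_. 0"] exI[of _ "{}"])
  show "(%i. v i + w i) : V" if vw: "v : V" "w : V" for v w
  proof -
   obtain A1 w1 where 1: "ok A1 w1" "ALL t:I. (\<Sum>p\<in>A1. w1 p * test_value t p) <= v t" using vw(1) unfolding V_def by blast
   obtain A2 w2 where 2: "ok A2 w2" "ALL t:I. (\<Sum>p\<in>A2. w2 p * test_value t p) <= w t" using vw(2) unfolding V_def by blast
   let ?w = "%p. (if p : A1 then w1 p else 0) + (if p : A2 then w2 p else 0)"
   have fin: "finite A1" "finite A2" using 1 2 by (auto simp: ok_def)
   have "(\<Sum>p\<in>A1 \<union> A2. ?w p * G p) = (\<Sum>p\<in>A1. w1 p * G p) + (\<Sum>p\<in>A2. w2 p * G p)" for G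
   proof -
    have "(\<Sum>p\<in>A1 \<union> A2. ?w p * G p) = (\<Sum>p\<in>A1 \<union> A2. if p : A1 then w1 p * G p else 0) + (\<Sum>p\<in>A1 \<union> A2. if p : A2 then w2 p * G p else 0)"
     unfolding sum.distrib[symmetric] by (intro sum.cong) (auto simp: distrib_right)
    also have "(\<Sum>p\<in>A1 \<union> A2. if p : A1 then w1 p * G p else 0) = (\<Sum>p\<in>A1. w1 p * G p)"
     using fin by (subst sum.inter_restrict[symmetric]) (auto intro: sum.cong)
    also have "(\<Sum>p\<in>A1 \<union> A2. if p : A2 then w2 p * G p else 0) = (\<Sum>p\<in>A2. w2 p * G p)"
     using fin by (subst sum.inter_restrict[symmetric]) (auto intro: sum.cong)
    finally show ?thesis .
   qed
   hence "ALL t:I. (\<Sum>p\<in>A1 \<union> A2. ?w p * test_value t p) <= v t + w t" using 1(2) 2(2) by (simp add: add_mono)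
   moreover have "ok (A1 \<union> A2) ?w" using 1(1) 2(1) by (auto simp: ok_def)
   ultimately show ?thesis unfolding V_def by blast
  qed
  show "(%i. s * v i) : V" if s: "0 <= s" "v : V" for s v
  proof -
   obtain A1 w1 where 1: "ok A1 w1" "ALL t:I. (\<Sum>p\<in>A1. w1 p * test_value t p) <= v t" using s(2) unfolding V_def by blast
   have "ALL t:I. (\<Sum>p\<in>A1. s * w1 p * test_value t p) <= s * v t"
    using 1(2) s(1) by (simp add: mult.assoc sum_distrib_left[symmetric] mult_left_mono)
   moreover have "ok A1 (%p. s * w1 p)" using 1(1) s(1) by (auto simp: ok_def)
   ultimately show ?thesis unfolding V_def by blast
  qed
  show "EX i:I. dl < \<bar>v i - ?tau i\<bar>" if v: "v : V" for v
  proof (rule ccontr)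
   assume n: "~ ?thesis"
   obtain A1 w1 where 1: "ok A1 w1" "ALL t:I. (\<Sum>p\<in>A1. w1 p * test_value t p) <= v t" using v unfolding V_def by blast
   have "(\<Sum>p\<in>A1. w1 p * test_value t p) <= ?tau t + dl" if "t : I" for t
   proof -
    have "\<bar>v t - ?tau t\<bar> <= dl" using n that by auto
    thus ?thesis using 1(2) that by fastforce
   qed
   thus False using contra 1(1) main[of A1 w1] unfolding ok_def by blast
  qed
 qed (use dl that in auto)
 have a0: "0 <= a t" if t: "t : I" for t
 proof -
  \<comment> \<open>The empty family has test sums \<open>0\<close>, so every nonnegative vector
    lies in \<open>V\<close>.\<close>
  have "(%i. if i = t then 1 else 0) : V"
   unfolding V_def ok_def by (auto intro!: exI[of _ "{}"] exI[of _ "%_. 0"])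
  hence "0 <= (\<Sum>i\<in>I. a i * (if i = t then 1 else 0))" by (rule a(1))
  also have "... = a t" using I(1) t by (simp add: sum.delta if_distrib[of "%x. _ * x"] cong: if_cong)
  finally show ?thesis .
 qed
 have path: "0 <= (\<Sum>t\<in>I. a t * test_value t p)" if p: "chain eps p" for p
 proof -
  have "(%t. test_value t p) : V" unfolding V_def ok_def using p
   by (auto intro!: exI[of _ "{p}"] exI[of _ "%_. 1"])
  thus ?thesis by (rule a(1))
 qed
 define ff where "ff t = fst t" for t :: "'a path_test"
 define pp where "pp t = fst (snd t)" for t :: "'a path_test"
 define cc where "cc t = fst (snd (snd t))" for t :: "'a path_test"
 define gg where "gg t = fst (snd (snd (snd t)))" for t :: "'a path_test"
 define hh where "hh t = snd (snd (snd (snd t)))" for t :: "'a path_test"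
 have val: "test_value t p = path_form (ff t) (pp t) p + path_cost (cc t) p + gg t (hd p) + hh t (last p)" for t p
  by (simp add: test_value_def ff_def pp_def cc_def gg_def hh_def case_prod_unfold)
 have tgt: "?tau t = T (ff t) [pp t] + (LINT x|mu. cc t x) + (LINT x|N. gg t x) + (LINT x|P. hh t x)" for t
  by (simp add: test_target_def ff_def pp_def cc_def gg_def hh_def case_prod_unfold)
 have ok: "ff t : Lipb_funs" "pp t : Lip_funs" "cc t : Lipb_funs" "0 <= cc t x" "gg t : Lipb_funs" "hh t : Lipb_funs" if "t : I" for t x
 proof -
  have "t : valid_tests" using that I(2) by blast
  thus "ff t : Lipb_funs" "pp t : Lip_funs" "cc t : Lipb_funs" "0 <= cc t x" "gg t : Lipb_funs" "hh t : Lipb_funs"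
   by (auto simp: valid_tests_def ff_def pp_def cc_def gg_def hh_def)
 qed
 have sumL: "(%x. \<Sum>t\<in>J. a t * k t x) : Lipb_funs" if "finite J" "!!t. t : J ==> k t : Lipb_funs" for J and k :: "'a path_test => 'a => real"
  using that
 proof (induct rule: finite_induct)
  case (insert t J)
  thus ?case using Lipb_lin[of "k t" "%x. \<Sum>t\<in>J. a t * k t x" "a t" 1] by simp
 qed simp
 have M: "fbm mu" using c by (simp add: controls_iff)
 have PN: "fbm P" "fbm N" using j by (auto simp: jordan_decomposition_def fbm_def)
 have sumI: "(LINT x|K. (\<Sum>t\<in>I. a t * k t x)) = (\<Sum>t\<in>I. a t * (LINT x|K. k t x))"
  if "fbm K" "!!t. t : I ==> k t : Lipb_funs" for K and k :: "'a path_test => 'a => real"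
  using that by (subst Bochner_Integration.integral_sum) (auto intro!: integrable_mult_right fbm_integrable_Lipb)
 have Tl: "T (%x. a t * ff t x) [pp t] = a t * T (ff t) [pp t]" if t: "t : I" for t
 proof -
  have "[pp t] : Lip_tuples 1" using ok(2)[OF t] by (simp add: Lip_tuples_def)
  hence "T (%x. a t * ff t x + 0 * ff t x) [pp t] = a t * T (ff t) [pp t] + 0 * T (ff t) [pp t]"
   using currents_linear_first[OF T] ok(1)[OF t] unfolding linear_first_def by blast
  thus ?thesis by simp
 qed
 have "0 <= (\<Sum>t\<in>I. T (%x. a t * ff t x) [pp t]) + (LINT x|mu. (\<Sum>t\<in>I. a t * cc t x))
   + (LINT x|N. (\<Sum>t\<in>I. a t * gg t x)) + (LINT x|P. (\<Sum>t\<in>I. a t * hh t x))"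
 proof (rule chain_inequality_transfer[OF T c cov j _ _ _ _ I(1) _ _ eps])
  show "(%x. a t * ff t x) : Lipb_funs" if "t : I" for t by (rule Lipb_cmult[OF ok(1)[OF that]])
  show "0 <= (\<Sum>t\<in>I. a t * cc t x)" for x using a0 ok(4) by (intro sum_nonneg mult_nonneg_nonneg)
  fix p :: "'a list" assume p: "chain eps p"
  have "path_form (%x. a t * ff t x) (pp t) p = a t * path_form (ff t) (pp t) p" for t
   by (simp add: path_form_def sum_distrib_left mult.assoc)
  moreover have "path_cost (%x. \<Sum>t\<in>I. a t * cc t x) p = (\<Sum>t\<in>I. a t * path_cost (cc t) p)"
   unfolding path_cost_def sum_distrib_right sum_distrib_left
   by (subst sum.swap) (simp add: mult.assoc)
  ultimately show "0 <= (\<Sum>t\<in>I. path_form (%x. a t * ff t x) (pp t) p) + path_cost (%x. \<Sum>t\<in>I. a t * cc t x) p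
    + (\<Sum>t\<in>I. a t * gg t (hd p)) + (\<Sum>t\<in>I. a t * hh t (last p))"
   using path[OF p] unfolding val by (simp add: distrib_left sum.distrib)
 qed (use ok sumL I in auto)
 also have "... = (\<Sum>t\<in>I. a t * ?tau t)"
  unfolding tgt using sumI[OF M ok(3)] sumI[OF PN(1) ok(6)] sumI[OF PN(2) ok(5)] Tl
  by (simp add: distrib_left sum.distrib)
 finally show False using a(2) by simp
qed

section \<open>Lipschitz curves and their classes\<close>

text \<open>Lebesgue's differentiation theorem in the one-sided form of the library, applied to \<open>f\<close> and to its
  reflection.\<close>

lemma AE_derivative_of_integral:
 fixes f F :: "real => real"
 assumes f: "!!a b. set_integrable lborel {a..b} f" and F: "!!a b. a <= b ==> F b - F a = (LINT t:{a..b}|lborel. f t)"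
 shows "AE t in lborel. (F has_real_derivative f t) (at t)"
proof -
 have io: "f integrable_on {a..b}" and FI: "a <= b ==> integral {a..b} f = F b - F a" for a b
  using set_borel_integral_eq_integral[OF f[of a b]] F[of a b] by auto
 obtain N1 where N1: "negligible N1" "!!x e. x ~: N1 ==> 0 < e ==> EX d>0. ALL h. 0 < h & h < d -->
   norm (integral (cbox x (x + h *\<^sub>R One)) f /\<^sub>R h ^ DIM(real) - f x) < e"
  using integrable_ccontinuous_explicit[of f] io by (metis box_real(2))
 obtain N2 where N2: "negligible N2" "!!x e. x ~: N2 ==> 0 < e ==> EX d>0. ALL h. 0 < h & h < d -->
   norm (integral (cbox x (x + h *\<^sub>R One)) (%t. f (- t)) /\<^sub>R h ^ DIM(real) - f (- x)) < e"
 proof -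
  have "(%t. f (- t)) integrable_on cbox a b" for a b
   using io[of "- b" "- a"] Henstock_Kurzweil_Integration.integrable_reflect_real[where f = f and a = "- b" and b = "- a"] by simp
  thus ?thesis using that by (rule integrable_ccontinuous_explicit)
 qed
 have "negligible (uminus ` N2)"
  by (rule negligible_locally_Lipschitz_image[OF _ N2(1)]) (auto intro!: exI[of _ "UNIV :: real set"] exI[of _ "1 :: real"] simp: dist_real_def)
 hence "negligible (N1 \<union> uminus ` N2)" using N1(1) by simp
 hence "AE t in lborel. t ~: N1 \<union> uminus ` N2"
  by (metis AE_completion_iff AE_not_in negligible_iff_null_sets)
 thus ?thesis
 proof eventually_elim
  case (elim t)
  have mt: "- t ~: N2" using elim by (metis UnI2 add.inverse_inverse image_eqI)
  have "EX d>0. ALL k. k ~= 0 & \<bar>k\<bar> < d --> \<bar>(F (t + k) - F t) / k - f t\<bar> < e" if e: "e > 0" for e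
  proof -
   obtain d1 where d1: "d1 > 0" "!!h. 0 < h ==> h < d1 ==> \<bar>integral {t..t + h} f / h - f t\<bar> < e"
    using N1(2)[of t, OF _ e] elim by (auto simp: divide_inverse mult.commute)
   obtain d2 where d2: "d2 > 0" "!!h. 0 < h ==> h < d2 ==> \<bar>integral {- t..- t + h} (%t. f (- t)) / h - f t\<bar> < e"
    using N2(2)[OF mt e] by (auto simp: divide_inverse mult.commute)
   have "\<bar>(F (t + k) - F t) / k - f t\<bar> < e" if k: "k ~= 0" "\<bar>k\<bar> < min d1 d2" for k
   proof (cases "k > 0")
    case True
    thus ?thesis using d1(2)[of k] FI[of t "t + k"] k by simp
   next
    case False
    have "integral {- t..- t + - k} (%t. f (- t)) = F t - F (t + k)"
     using Henstock_Kurzweil_Integration.integral_reflect_real[where f = f and a = "t + k" and b = t] FI[of "t + k" t] False by simp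
    moreover have "(F t - F (t + k)) / (- k) = (F (t + k) - F t) / k" by (simp add: divide_simps)
    ultimately show ?thesis using d2(2)[of "- k"] False k by simp
   qed
   thus ?thesis using d1(1) d2(1) by (intro exI[of _ "min d1 d2"]) auto
  qed
  thus ?case unfolding DERIV_def LIM_def by (auto simp: dist_real_def)
 qed
qed

text \<open>The Stieltjes measure of \<open>F\<close> is the image of Lebesgue measure under the
  inverse of \<open>F\<close>, which exists by the lower bound; by the upper bound \<open>F\<close>
  maps null sets to null sets, so Radon-Nikodym applies.\<close>

lemma bilipschitz_density:
 fixes F :: "real => real"
 assumes lo: "!!x y. x <= y ==> y - x <= F y - F x" and up: "!!x y. x <= y ==> F y - F x <= K * (y - x)"
 obtains f where "f : borel_measurable lborel" "!!a b. a <= b ==> emeasure (density lborel f) {a..b} = ennreal (F b - F a)"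
proof -
 have K: "0 <= K" using lo[of 0 1] up[of 0 1] by simp
 have absb: "\<bar>F y - F x\<bar> <= K * \<bar>y - x\<bar>" for x y
  using lo[of x y] up[of x y] lo[of y x] up[of y x] by (cases "x <= y") auto
 have cont: "continuous_on UNIV F"
 proof -
  have "K-lipschitz_on UNIV F" by (rule lipschitz_onI) (use absb K in \<open>auto simp: dist_real_def abs_minus_commute\<close>)
  thus ?thesis by (rule lipschitz_on_continuous_on)
 qed
 have mono: "F x <= F y \<longleftrightarrow> x <= y" for x y using lo[of x y] lo[of y x] by (cases "x <= y") auto
 have inj: "inj F" by (rule injI) (metis mono order_antisym order_refl)
 have surj: "surj F"
 proof -
  have "EX x. F x = c" for c
  proof -
   let ?s = "\<bar>c - F 0\<bar>"
   have "F (- ?s) <= c" using lo[of "- ?s" 0] by linarith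
   moreover have "c <= F ?s" using lo[of 0 ?s] by linarith
   ultimately show ?thesis
    using IVT'[of F "- ?s" c ?s] continuous_on_subset[OF cont] by auto
  qed
  thus ?thesis by (metis surjI)
 qed
 define G where "G = inv F"
 have FG: "F (G y) = y" and GF: "G (F x) = x" for x y
  using surj inj by (auto simp: G_def surj_f_inv_f)
 have Gm: "G : borel_measurable borel"
  by (rule borel_measurable_mono) (auto simp: mono_def intro: iffD1[OF mono] simp: FG)
 define N where "N = distr lborel borel G"
 have sN: "sets N = sets lborel" by (simp add: N_def)
 have eN: "emeasure N A = emeasure lborel (F ` A)" if "A : sets borel" for A
 proof -
  have "emeasure N A = emeasure lborel (G -` A \<inter> space lborel)" unfolding N_def using Gm that by (subst emeasure_distr) auto
  moreover have "G -` A \<inter> space lborel = F ` A" using FG GF by (auto simp: image_iff) metis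
  ultimately show ?thesis by simp
 qed
 have ac: "absolutely_continuous lborel N" unfolding absolutely_continuous_def
 proof
  fix A :: "real set" assume A: "A : null_sets lborel"
  have "negligible A" using A by (simp add: negligible_iff_null_sets null_sets_completionI)
  hence "negligible (F ` A)"
   by (rule negligible_locally_Lipschitz_image[rotated]) (auto intro!: exI[of _ UNIV] exI[of _ K] absb)
  moreover have "F ` A : sets lborel"
  proof -
   have "G -` A \<inter> space borel : sets borel" by (rule measurable_sets[OF Gm]) (use A in auto)
   moreover have "G -` A \<inter> space borel = F ` A" using FG GF by (auto simp: image_iff) metis
   ultimately show ?thesis by simp
  qed
  ultimately have "emeasure lborel (F ` A) = 0"
   using null_sets_completion_iff[of "F ` A" lborel] unfolding negligible_iff_null_sets by (simp add: null_setsD1)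
  thus "A : null_sets N" using A eN sN by (auto simp: null_sets_def)
 qed
 obtain f where f: "f : borel_measurable lborel" "density lborel f = N"
  using sigma_finite_measure.Radon_Nikodym[OF sigma_finite_lborel ac sN] by blast
 have "emeasure N {a..b} = ennreal (F b - F a)" if "a <= b" for a b
 proof -
  have "F ` {a..b} = {F a..F b}"
  proof (intro set_eqI iffI)
   fix y assume "y : {F a..F b}"
   hence "G y : {a..b}" using mono FG by (metis atLeastAtMost_iff)
   thus "y : F ` {a..b}" using FG by (metis imageI)
  qed (use mono in auto)
  thus ?thesis using eN[of "{a..b}"] that mono[of a b] by simp
 qed
 thus ?thesis using that f by simp
qed

lemma lipschitz_real_derivative:
 fixes g :: "real => real"
 assumes g: "L-lipschitz_on UNIV g"
 obtains h where "h : borel_measurable borel" "AE x in lborel. (g has_real_derivative h x) (at x)"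
  "!!a b. a <= b ==> set_integrable lborel {a..b} h & (LINT t:{a..b}|lborel. h t) = g b - g a"
proof -
 \<comment> \<open>The linear term raises the slope to at least \<open>1\<close>; its contribution
   \<open>L + 1\<close> is subtracted from the density afterwards.\<close>
 define F where "F x = g x + (L + 1) * x" for x
 have L: "0 <= L" by (rule lipschitz_on_nonneg[OF g])
 have b: "\<bar>g y - g x\<bar> <= L * (y - x)" if "x <= y" for x y
  using lipschitz_onD[OF g, of y x] that by (simp add: dist_real_def)
 have lo: "y - x <= F y - F x" if "x <= y" for x y
  using b[OF that] unfolding F_def by (simp add: algebra_simps abs_le_iff)
 have up: "F y - F x <= (2 * L + 1) * (y - x)" if "x <= y" for x y
  using b[OF that] unfolding F_def by (simp add: algebra_simps abs_le_iff)
 obtain f where f: "f : borel_measurable lborel" "!!a b. a <= b ==> emeasure (density lborel f) {a..b} = ennreal (F b - F a)"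
  by (rule bilipschitz_density[of F "2 * L + 1"]) (use lo up in blast)+
 have fin: "AE x in lborel. f x ~= \<infinity>"
 proof -
  have "AE x in lborel. ALL n::nat. f x * indicator {-real n..real n} x ~= \<infinity>"
   unfolding AE_all_countable
   by (intro allI nn_integral_PInf_AE) (use f(1) f(2)[of "- real _" "real _"] in \<open>auto simp: emeasure_density[symmetric]\<close>)
  thus ?thesis
  proof eventually_elim
   case (elim x)
   obtain n :: nat where "\<bar>x\<bar> <= real n" using real_arch_simple by blast
   thus ?case using elim[rule_format, of n] by (auto simp: abs_le_iff)
  qed
 qed
 define h where "h x = enn2real (f x) - (L + 1)" for x
 have hm: "h : borel_measurable borel" unfolding h_def using f(1) by simp
 have hi: "set_integrable lborel {a..b} h & (LINT t:{a..b}|lborel. h t) = g b - g a" if ab: "a <= b" for a b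
 proof -
  have fi: "(\<integral>\<^sup>+x. ennreal (enn2real (f x) * indicator {a..b} x) \<partial>lborel) = ennreal (F b - F a)"
  proof -
   have "(\<integral>\<^sup>+x. ennreal (enn2real (f x) * indicator {a..b} x) \<partial>lborel) = (\<integral>\<^sup>+x. f x * indicator {a..b} x \<partial>lborel)"
    by (rule nn_integral_cong_AE) (use fin in \<open>eventually_elim, auto simp: indicator_def less_top\<close>)
   also have "... = ennreal (F b - F a)" using f ab by (simp add: emeasure_density[symmetric])
   finally show ?thesis .
  qed
  have int: "integrable lborel (%x. enn2real (f x) * indicator {a..b} x)"
   by (rule integrableI_nonneg) (use f(1) fi in auto)
  have val: "(LINT x|lborel. enn2real (f x) * indicator {a..b} x) = F b - F a"
   using fi lo[OF ab] ab by (subst integral_eq_nn_integral) (use f(1) in auto)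
  have ic: "integrable lborel (%x. (L + 1) * indicator {a..b} x)" using ab by (intro integrable_mult_right) simp
  have vc: "(LINT x|lborel. (L + 1) * indicator {a..b} x) = (L + 1) * (b - a)" using ab by simp
  have eq: "indicator {a..b} x *\<^sub>R h x = enn2real (f x) * indicator {a..b} x - (L + 1) * indicator {a..b} x" for x
   by (simp add: h_def algebra_simps)
  show ?thesis
   unfolding set_integrable_def set_lebesgue_integral_def eq
   using int ic val vc by (simp add: F_def algebra_simps)
 qed
 have "set_integrable lborel {a..b} h" for a b using hi[of a b] by (cases "a <= b") (auto simp: set_integrable_def)
 hence "AE x in lborel. (g has_real_derivative h x) (at x)" by (rule AE_derivative_of_integral) (use hi in simp)
 thus ?thesis using that hm hi by blast
qed

text \<open>For a curve only the values on \<open>[0,1]\<close> matter, hence the restriction to interior points.\<close>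

lemma lipschitz_unit_interval_derivative:
 fixes g :: "real => real"
 assumes g: "L-lipschitz_on {0..1} g"
 obtains h where "h : borel_measurable borel" "!!t. \<bar>h t\<bar> <= L"
  "AE t in lebesgue. t : {0<..<1} --> (g has_real_derivative h t) (at t)"
  "AE t in lebesgue. t : {0<..<1} --> deriv g t = h t"
  "!!a b. 0 <= a ==> a <= b ==> b <= 1 ==> (LINT t:{a..b}|lborel. h t) = g b - g a"
proof -
 define k where "k t = g (max 0 (min 1 t))" for t
 have L: "0 <= L" by (rule lipschitz_on_nonneg[OF g])
 have k: "L-lipschitz_on UNIV k"
 proof (rule lipschitz_onI[OF _ L])
  fix x y :: real
  have "dist (k x) (k y) <= L * dist (max 0 (min 1 x)) (max 0 (min 1 y))"
   unfolding k_def by (rule lipschitz_onD[OF g]) auto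
  also have "... <= L * dist x y" by (intro mult_left_mono L) (auto simp: dist_real_def)
  finally show "dist (k x) (k y) <= L * dist x y" .
 qed
 obtain h where h: "h : borel_measurable borel" "AE x in lborel. (k has_real_derivative h x) (at x)"
  "!!a b. a <= b ==> set_integrable lborel {a..b} h & (LINT t:{a..b}|lborel. h t) = k b - k a"
  by (rule lipschitz_real_derivative[OF k]) (rule that)
 have bd: "\<bar>h x\<bar> <= L" if d: "(k has_real_derivative h x) (at x)" for x
 proof -
  have lim: "((%y. \<bar>(k y - k x) / (y - x)\<bar>) \<longlongrightarrow> \<bar>h x\<bar>) (at x)"
   using d unfolding has_field_derivative_iff by (rule tendsto_rabs)
  have "\<bar>(k y - k x) / (y - x)\<bar> <= L" if "y ~= x" for y
   using lipschitz_onD[OF k, of y x] that by (simp add: dist_real_def abs_divide divide_le_eq)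
  hence "\<forall>\<^sub>F y in at x. \<bar>(k y - k x) / (y - x)\<bar> <= L" unfolding eventually_at_filter by (simp add: always_eventually)
  thus ?thesis by (rule tendsto_upperbound[OF lim]) simp
 qed
 \<comment> \<open>Clipping makes the bound by \<open>L\<close> hold at every point; a.e. it changes
   nothing.\<close>
 define h' where "h' x = max (- L) (min L (h x))" for x
 have hh: "AE x in lborel. h' x = h x" using h(2) by eventually_elim (use bd in \<open>force simp: h'_def abs_le_iff\<close>)
 have gk: "(g has_real_derivative D) (at t)" if "t : {0<..<1}" "(k has_real_derivative D) (at t)" for t D
  by (rule has_field_derivative_transform_within_open[OF that(2), of "{0<..<1}"]) (use that(1) in \<open>auto simp: k_def\<close>)
 have AE1: "AE t in lebesgue. t : {0<..<1} --> (g has_real_derivative h' t) (at t)"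
  by (rule AE_completion) (use h(2) hh gk in \<open>eventually_elim, auto\<close>)
 show ?thesis
 proof (rule that[of h'])
  show hm: "h' : borel_measurable borel" unfolding h'_def using h(1) by measurable
  show "\<bar>h' t\<bar> <= L" for t unfolding h'_def using L by linarith
  show "AE t in lebesgue. t : {0<..<1} --> (g has_real_derivative h' t) (at t)" by (rule AE1)
  show "AE t in lebesgue. t : {0<..<1} --> deriv g t = h' t"
   using AE1 by eventually_elim (auto intro: DERIV_imp_deriv)
  fix a b :: real assume ab: "0 <= a" "a <= b" "b <= 1"
  have "(LINT t:{a..b}|lborel. h' t) = (LINT t:{a..b}|lborel. h t)"
   by (rule set_lebesgue_integral_cong_AE) (use hm h(1) hh in auto)
  also have "... = k b - k a" using h(3)[OF ab(2)] by simp
  also have "... = g b - g a" using ab by (simp add: k_def)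
  finally show "(LINT t:{a..b}|lborel. h' t) = g b - g a" .
 qed
qed

section \<open>Length and metric derivative of Lipschitz curves\<close>

definition part_points :: "real => real => nat => (nat => real) => bool" where
 "part_points a b n t \<longleftrightarrow> (ALL i<=n. a <= t i & t i <= b) & (ALL i<n. t i <= t (Suc i))"

definition part_sum :: "(real => 'a::metric_space) => nat => (nat => real) => real" where
 "part_sum r n t = (\<Sum>i<n. dist (r (t i)) (r (t (Suc i))))"

text \<open>Total variation. Subdivision points may coincide and need not contain the ends of the
  interval, so clamped equidistant grids are admissible.\<close>

definition vlen :: "(real => 'a::metric_space) => real => real => real" where
 "vlen r a b = Sup {part_sum r n t |n t. part_points a b n t}"

lemma vlen_bdd:
 assumes r: "M-lipschitz_on {0..1} r" and ab: "0 <= a" "a <= b" "b <= 1" and p: "part_points a b n t"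
 shows "part_sum r n t <= M * (b - a)"
proof -
 have M: "0 <= M" by (rule lipschitz_on_nonneg[OF r])
 have "part_sum r n t <= (\<Sum>i<n. M * (t (Suc i) - t i))" unfolding part_sum_def
 proof (rule sum_mono)
  fix i assume i: "i : {..<n}"
  hence "a <= t i" "t i <= b" "a <= t (Suc i)" "t (Suc i) <= b" "t i <= t (Suc i)" using p by (auto simp: part_points_def)
  thus "dist (r (t i)) (r (t (Suc i))) <= M * (t (Suc i) - t i)"
   using lipschitz_onD[OF r, of "t i" "t (Suc i)"] ab by (simp add: dist_real_def)
 qed
 also have "... = M * (t n - t 0)" by (simp add: sum_distrib_left[symmetric] sum_lessThan_telescope)
 also have "... <= M * (b - a)" using p M by (intro mult_left_mono) (auto simp: part_points_def intro: diff_mono)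
 finally show ?thesis .
qed

lemma vlen_upper:
 assumes r: "M-lipschitz_on {0..1} r" and ab: "0 <= a" "a <= b" "b <= 1" and p: "part_points a b n t"
 shows "part_sum r n t <= vlen r a b"
 unfolding vlen_def
proof (rule cSup_upper)
 show "bdd_above {part_sum r n t |n t. part_points a b n t}"
  using vlen_bdd[OF r ab] by (auto simp: bdd_above_def)
qed (use p in blast)

lemma vlen_least:
 assumes "a <= b" "!!n t. part_points a b n t ==> part_sum r n t <= B"
 shows "vlen r a b <= B"
 unfolding vlen_def
proof (rule cSup_least)
 have "part_points a b 0 (%_. a)" using assms(1) by (simp add: part_points_def)
 thus "{part_sum r n t |n t. part_points a b n t} ~= {}" by blast
qed (use assms(2) in blast)

lemma vlen_witness:
 assumes "a <= b" "x < vlen r a b" obtains n t where "part_points a b n t" "x < part_sum r n t"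
 using vlen_least[OF assms(1), of r x] assms(2) by (metis not_le)

lemma set_integrable_bounded_interval:
 fixes g :: "real => real"
 assumes g: "g : borel_measurable borel" "!!t. \<bar>g t\<bar> <= K"
 shows "set_integrable lborel {a..b} g"
 unfolding set_integrable_def
proof (rule Bochner_Integration.integrable_bound)
 show "integrable lborel (%t. K * indicator {a..b} t)"
  by (intro integrable_mult_right integrable_real_indicator) (auto simp: emeasure_lborel_Icc_eq)
 show "(%t. indicator {a..b} t *\<^sub>R g t) : borel_measurable lborel" using g(1) by simp
 have "norm (indicator {a..b} t *\<^sub>R g t) <= norm (K * indicator {a..b} t)" for t
  using g(2)[of t] by (simp add: indicator_def)
 thus "AE t in lborel. norm (indicator {a..b} t *\<^sub>R g t) <= norm (K * indicator {a..b} t)" by simp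
qed

lemma lborel_interval_diff:
 fixes g :: "real => real"
 assumes g: "g : borel_measurable borel" "!!t. \<bar>g t\<bar> <= K" and ab: "a <= b" "b <= c"
 shows "(LINT t:{a..c}|lborel. g t) = (LINT t:{a..b}|lborel. g t) + (LINT t:{b..c}|lborel. g t)"
proof -
 note i = set_integrable_bounded_interval[OF g]
 have "(LINT t:{a..b} \<union> {b..c}|lborel. g t) = (LINT t:{a..b}|lborel. g t) + (LINT t:{b..c}|lborel. g t)"
 proof (rule set_integral_Un_AE)
  have "AE t in lborel. t ~= b" by (rule AE_lborel_singleton)
  thus "AE t in lborel. ~ (t : {a..b} & t : {b..c})" by eventually_elim auto
 qed (use i in auto)
 moreover have "{a..b} \<union> {b..c} = {a..c}" using ab by auto
 ultimately show ?thesis by simp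
qed

lemma lborel_singleton_integral:
 fixes a :: real shows "(LINT s:{a..a}|lborel. g s) = (0::real)"
proof -
 have "AE x in lborel. indicator {a..a} x *\<^sub>R g x = 0"
  using AE_lborel_singleton[of a] by eventually_elim (auto simp: indicator_def)
 thus ?thesis unfolding set_lebesgue_integral_def by (rule integral_eq_zero_AE)
qed

lemma lborel_interval_sum:
 fixes g :: "real => real"
 assumes g: "g : borel_measurable borel" "!!t. \<bar>g t\<bar> <= K" and t: "!!i. i < n ==> t i <= t (Suc i)"
 shows "(\<Sum>i<n. LINT s:{t i..t (Suc i)}|lborel. g s) = (LINT s:{t 0..t n}|lborel. g s) & t 0 <= t n"
 using t
proof (induct n)
 case 0
 have "(LINT s:{t 0..t 0}|lborel. g s) = 0" by (rule lborel_singleton_integral)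
 thus ?case by simp
next
 case (Suc n)
 have "t 0 <= t n" using Suc by auto
 moreover have "t n <= t (Suc n)" by (rule Suc(2)) simp
 moreover from calculation have "t 0 <= t (Suc n)" by (rule order_trans)
 ultimately show ?case using Suc lborel_interval_diff[OF g, of "t 0" "t n" "t (Suc n)"] by auto
qed

text \<open>Folds an integral over \<open>N\<close> steps into an integral over shifts
  \<open>s\<close> of sums along one grid. For difference quotients each such sum is a variation sum
  divided by \<open>eta\<close>.\<close>

lemma interval_shift_sum:
 fixes D :: "real => real"
 assumes D: "D : borel_measurable borel" "!!t. \<bar>D t\<bar> <= K" and eta: "0 <= eta"
 shows "(LINT s:{a..a + real N * eta}|lborel. D s) = (LINT s:{0..eta}|lborel. (\<Sum>k<N. D (a + real k * eta + s)))"
proof -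
 have sh: "(LINT s:{c..c + eta}|lborel. D s) = (LINT s:{0..eta}|lborel. D (c + s))" for c
 proof -
  have "(LINT x|lborel. indicator {c..c + eta} x *\<^sub>R D x) = (LINT x|lborel. indicator {c..c + eta} (c + x) *\<^sub>R D (c + x))"
   using lborel_integral_real_affine[of 1 "%x. indicator {c..c + eta} x *\<^sub>R D x" c] by simp
  also have "... = (LINT x|lborel. indicator {0..eta} x *\<^sub>R D (c + x))"
   by (rule Bochner_Integration.integral_cong) (auto simp: indicator_def)
  finally show ?thesis unfolding set_lebesgue_integral_def .
 qed
 have "(LINT s:{a..a + real N * eta}|lborel. D s) = (\<Sum>k<N. LINT s:{a + real k * eta..a + real (Suc k) * eta}|lborel. D s)"
  using lborel_interval_sum[OF D, of N "%k. a + real k * eta"] eta by (simp add: distrib_right)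
 also have "... = (\<Sum>k<N. LINT s:{0..eta}|lborel. D (a + real k * eta + s))"
 proof (intro sum.cong refl)
  fix k
  have "a + real (Suc k) * eta = (a + real k * eta) + eta" by (simp add: distrib_right)
  thus "(LINT s:{a + real k * eta..a + real (Suc k) * eta}|lborel. D s) = (LINT s:{0..eta}|lborel. D (a + real k * eta + s))"
   using sh[of "a + real k * eta"] by (simp only:)
 qed
 also have "... = (LINT s:{0..eta}|lborel. (\<Sum>k<N. D (a + real k * eta + s)))"
 proof -
  have i: "set_integrable lborel {0..eta} (%s. D (a + real k * eta + s))" for k
   by (rule set_integrable_bounded_interval) (use D in measurable)
  show ?thesis unfolding set_lebesgue_integral_def scaleR_sum_right
   by (rule Bochner_Integration.integral_sum[symmetric]) (rule i[unfolded set_integrable_def])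
 qed
 finally show ?thesis .
qed

text \<open>The metric derivative is \<open>sup\<^sub>q \<bar>(d(r, r(q)))'\<bar>\<close> over rational \<open>q\<close>.\<close>

lemma metric_derivative_exists:
 fixes r :: "real => 'a::metric_space"
 assumes r: "M-lipschitz_on {0..1} r"
 obtains m where "m : borel_measurable borel" "!!t. 0 <= m t" "!!t. m t <= M"
  "AE t in lborel. t : {0<..<1} --> ((%h. dist (r (t + h)) (r t) / \<bar>h\<bar>) \<longlongrightarrow> m t) (at 0)"
  "!!a b. 0 <= a ==> a <= b ==> b <= 1 ==> vlen r a b = (LINT t:{a..b}|lborel. m t)"
proof -
 have M: "0 <= M" by (rule lipschitz_on_nonneg[OF r])
 \<comment> \<open>Countably many reference points leave one null set, and their density suffices to
   recover distances. The point \<open>0\<close> keeps the index set of the supremum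
   nonempty.\<close>
 define X where "X = \<rat> \<inter> {0..1::real}"
 have cX: "countable X" unfolding X_def by (intro countable_Int1 countable_rat)
 have X0: "0 : X" by (simp add: X_def)
 have gl: "M-lipschitz_on {0..1} (%t. dist (r t) (r q))" for q
 proof (rule lipschitz_onI[OF _ M])
  fix x y :: real assume "x : {0..1}" "y : {0..1}"
  hence "dist (r x) (r y) <= M * dist x y" by (rule lipschitz_onD[OF r])
  moreover have "\<bar>dist (r x) (r q) - dist (r y) (r q)\<bar> <= dist (r x) (r y)"
   using dist_triangle[of "r x" "r q" "r y"] dist_triangle3[of "r y" "r q" "r x"] by (simp add: abs_le_iff)
  ultimately show "dist (dist (r x) (r q)) (dist (r y) (r q)) <= M * dist x y" by (simp add: dist_real_def)
 qed
 define P where "P q h \<longleftrightarrow> h : borel_measurable borel & (ALL t. \<bar>h t\<bar> <= M) &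
  (AE t in lborel. t : {0<..<1} --> ((%t. dist (r t) (r q)) has_real_derivative h t) (at t)) &
  (ALL a b. 0 <= a & a <= b & b <= 1 --> (LINT t:{a..b}|lborel. h t) = dist (r b) (r q) - dist (r a) (r q))" for q h
 have "EX h. P q h" for q
  by (rule lipschitz_unit_interval_derivative[OF gl[of q]]) (auto simp: P_def AE_completion_iff)
 then obtain h where "!!q. P q (h q)" by metis
 hence h: "!!q. h q : borel_measurable borel" "!!q t. \<bar>h q t\<bar> <= M"
  "!!q. AE t in lborel. t : {0<..<1} --> ((%t. dist (r t) (r q)) has_real_derivative h q t) (at t)"
  "!!q a b. 0 <= a ==> a <= b ==> b <= 1 ==> (LINT t:{a..b}|lborel. h q t) = dist (r b) (r q) - dist (r a) (r q)"
  by (auto simp: P_def)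
 define m where "m t = (SUP q\<in>X. \<bar>h q t\<bar>)" for t
 have bdd: "bdd_above ((%q. \<bar>h q t\<bar>) ` X)" for t using h(2) by (intro bdd_aboveI2)
 have mm: "m : borel_measurable borel" unfolding m_def
  by (rule borel_measurable_cSUP[OF cX]) (use h(1) bdd in \<open>auto intro: borel_measurable_abs\<close>)
 have hm: "\<bar>h q t\<bar> <= m t" if "q : X" for q t unfolding m_def by (rule cSUP_upper[OF that bdd])
 have m0: "0 <= m t" for t using hm[OF X0, of t] by linarith
 have mM: "m t <= M" for t unfolding m_def by (rule cSUP_least) (use X0 h(2) in auto)
 have mb: "\<bar>m t\<bar> <= M" for t using m0 mM by simp
 have im: "set_integrable lborel {a..b} m" for a b by (rule set_integrable_bounded_interval[OF mm mb])
 have dle: "dist (r s) (r t) <= (LINT u:{s..t}|lborel. m u)" if st: "0 <= s" "s <= t" "t <= 1" for s t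
 proof (rule field_le_epsilon)
  fix e :: real assume e: "e > 0"
  define dl where "dl = e / 2 / (M + 1)"
  have dl: "dl > 0" using e M by (simp add: dl_def)
  have "EX q:X. \<bar>s - q\<bar> < dl"
  proof (cases "s = 1")
   case True thus ?thesis using dl by (intro bexI[of _ 1]) (auto simp: X_def)
  next
   case False
   hence "s < min 1 (s + dl)" using st dl by auto
   then obtain q where "q : \<rat>" "s < q" "q < min 1 (s + dl)" using Rats_dense_in_real by blast
   thus ?thesis using st by (intro bexI[of _ q]) (auto simp: X_def)
  qed
  then obtain q where q: "q : X" "\<bar>s - q\<bar> < dl" by blast
  have "dist (r s) (r q) <= M * dist s q" by (rule lipschitz_onD[OF r]) (use st q in \<open>auto simp: X_def\<close>)
  also have "... <= (M + 1) * dl" using q(2) M by (intro mult_mono) (auto simp: dist_real_def)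
  also have "... = e / 2"
  proof -
   have "M + 1 ~= 0" using M by linarith
   moreover have "x * (y / x) = y" if "x ~= 0" for x y :: real using that by simp
   ultimately show ?thesis unfolding dl_def by blast
  qed
  finally have sq: "dist (r s) (r q) <= e / 2" .
  have "dist (r s) (r t) <= dist (r t) (r q) - dist (r s) (r q) + 2 * dist (r s) (r q)"
   using dist_triangle2[of "r s" "r t" "r q"] by simp
  also have "dist (r t) (r q) - dist (r s) (r q) = (LINT u:{s..t}|lborel. h q u)" using h(4)[OF st] by simp
  also have "... <= (LINT u:{s..t}|lborel. m u)"
   by (rule set_integral_mono[OF set_integrable_bounded_interval[OF h(1,2)] im])
     (use hm[OF q(1)] in \<open>auto simp: abs_le_iff\<close>)
  finally show "dist (r s) (r t) <= (LINT u:{s..t}|lborel. m u) + e" using sq by linarith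
 qed
 \<comment> \<open>Extension by \<open>0\<close> gives an integrable function on the whole line, so
   the differentiation theorem applies to its primitive \<open>F\<close>.\<close>
 define m1 where "m1 t = (if t : {0..1} then m t else 0)" for t
 have m1m: "m1 : borel_measurable borel" unfolding m1_def using mm by measurable
 have m1b: "0 <= m1 t" "\<bar>m1 t\<bar> <= M" for t using m0 mM M by (auto simp: m1_def)
 have im1: "integrable lborel m1"
 proof -
  have "integrable lborel (%t. indicator {0..1} t *\<^sub>R m t)" using im[of 0 1] unfolding set_integrable_def .
  moreover have "indicator {0..1} t *\<^sub>R m t = m1 t" for t by (auto simp: m1_def)
  ultimately show ?thesis by simp
 qed
 define F where "F t = (LINT u:{..t}|lborel. m1 u)" for t
 have sI: "set_integrable lborel A m1" if "A : sets borel" for A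
  unfolding set_integrable_def by (rule integrable_mult_indicator[OF _ im1]) (use that in simp)
 have Fd: "F b - F a = (LINT u:{a..b}|lborel. m1 u)" if "a <= b" for a b
 proof -
  have "(LINT u:{..a} \<union> {a..b}|lborel. m1 u) = (LINT u:{..a}|lborel. m1 u) + (LINT u:{a..b}|lborel. m1 u)"
  proof (rule set_integral_Un_AE)
   have "AE t in lborel. t ~= a" by (rule AE_lborel_singleton)
   thus "AE t in lborel. ~ (t : {..a} & t : {a..b})" by eventually_elim auto
  qed (use sI in auto)
  moreover have "{..a} \<union> {a..b} = {..b}" using that by auto
  ultimately show ?thesis by (simp add: F_def)
 qed
 have AEF: "AE t in lborel. (F has_real_derivative m1 t) (at t)"
  by (rule AE_derivative_of_integral) (use sI Fd in auto)
 have dF: "dist (r s) (r t) <= F t - F s" if st: "0 <= s" "s <= t" "t <= 1" for s t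
 proof -
  have "(LINT u:{s..t}|lborel. m u) = (LINT u:{s..t}|lborel. m1 u)"
   by (rule set_lebesgue_integral_cong) (use st in \<open>auto simp: m1_def\<close>)
  thus ?thesis using dle[OF st] Fd[OF st(2)] by simp
 qed
 have AEh: "AE t in lborel. ALL q:X. t : {0<..<1} --> ((%t. dist (r t) (r q)) has_real_derivative h q t) (at t)"
  unfolding AE_ball_countable[OF cX] using h(3) by blast
 have md: "AE t in lborel. t : {0<..<1} --> ((%h. dist (r (t + h)) (r t) / \<bar>h\<bar>) \<longlongrightarrow> m t) (at 0)"
  using AEF AEh
 proof eventually_elim
  case (elim t)
  show ?case
  proof
   assume t: "t : {0<..<1}"
   have mt: "m1 t = m t" using t by (simp add: m1_def)
   have near: "eventually (%k. t + k : {0..1} & k ~= 0) (at 0)"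
   proof -
    have "eventually (%k. k : {- t<..<1 - t}) (at 0)"
     by (rule eventually_at_in_open') (use t in auto)
    moreover have "eventually (%k. k ~= (0::real)) (at 0)" by (simp add: eventually_at_filter)
    ultimately show ?thesis by eventually_elim auto
   qed
   show "((%h. dist (r (t + h)) (r t) / \<bar>h\<bar>) \<longlongrightarrow> m t) (at 0)"
   proof (rule order_tendstoI)
    \<comment> \<open>Lower limit: the distance to \<open>r q\<close> is 1-Lipschitz, so its slope
      along \<open>r\<close> bounds the metric slope from below.\<close>
    fix a assume "a < m t"
    then obtain q where q: "q : X" "a < \<bar>h q t\<bar>"
     unfolding m_def using less_cSUP_iff[OF _ bdd] X0 by blast
    have "((%t. dist (r t) (r q)) has_real_derivative h q t) (at t)" using elim(2) q(1) t by blast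
    hence "((%k. (dist (r (t + k)) (r q) - dist (r t) (r q)) / k) \<longlongrightarrow> h q t) (at 0)" by (simp add: DERIV_def)
    hence "((%k. \<bar>(dist (r (t + k)) (r q) - dist (r t) (r q)) / k\<bar>) \<longlongrightarrow> \<bar>h q t\<bar>) (at 0)" by (rule tendsto_rabs)
    hence "eventually (%k. a < \<bar>(dist (r (t + k)) (r q) - dist (r t) (r q)) / k\<bar>) (at 0)"
     using q(2) by (rule order_tendstoD(1))
    thus "eventually (%k. a < dist (r (t + k)) (r t) / \<bar>k\<bar>) (at 0)"
    proof eventually_elim
     case (elim k)
     have "\<bar>dist (r (t + k)) (r q) - dist (r t) (r q)\<bar> <= dist (r (t + k)) (r t)"
      using dist_triangle[of "r (t + k)" "r q" "r t"] dist_triangle3[of "r t" "r q" "r (t + k)"] by (simp add: abs_le_iff)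
     hence "\<bar>(dist (r (t + k)) (r q) - dist (r t) (r q)) / k\<bar> <= dist (r (t + k)) (r t) / \<bar>k\<bar>"
      unfolding abs_divide by (rule divide_right_mono) simp
     thus ?case using elim by linarith
    qed
   next
    \<comment> \<open>Upper limit: increments of \<open>r\<close> are bounded by increments of
      \<open>F\<close>, which has derivative \<open>m t\<close> here.\<close>
    fix a assume a: "m t < a"
    have "((%k. (F (t + k) - F t) / k) \<longlongrightarrow> m t) (at 0)" using elim(1) mt by (simp add: DERIV_def)
    hence "eventually (%k. (F (t + k) - F t) / k < a) (at 0)" using a by (rule order_tendstoD(2))
    thus "eventually (%k. dist (r (t + k)) (r t) / \<bar>k\<bar> < a) (at 0)" using near
    proof eventually_elim
     case (elim k)
     have "dist (r (t + k)) (r t) / \<bar>k\<bar> <= (F (t + k) - F t) / k"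
     proof (cases "k > 0")
      case True
      hence "dist (r t) (r (t + k)) <= F (t + k) - F t" using elim t by (intro dF) auto
      thus ?thesis using True by (simp add: dist_commute divide_right_mono)
     next
      case False
      hence k: "k < 0" using elim by auto
      hence "dist (r (t + k)) (r t) <= F t - F (t + k)" using elim t by (intro dF) auto
      hence "dist (r (t + k)) (r t) / (- k) <= (F t - F (t + k)) / (- k)" using k by (intro divide_right_mono) auto
      also have "... = (F (t + k) - F t) / k" by (simp add: divide_simps)
      finally show ?thesis using k by simp
     qed
     thus ?case using elim by linarith
    qed
   qed
  qed
 qed
 have vl: "vlen r a b = (LINT t:{a..b}|lborel. m t)" if ab: "0 <= a" "a <= b" "b <= 1" for a b
 proof (rule antisym)
  show "vlen r a b <= (LINT t:{a..b}|lborel. m t)"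
  proof (rule vlen_least[OF ab(2)])
   fix n t assume p: "part_points a b n t"
   have "part_sum r n t <= (\<Sum>i<n. LINT u:{t i..t (Suc i)}|lborel. m u)" unfolding part_sum_def
   proof (rule sum_mono)
    fix i assume "i : {..<n}"
    hence "a <= t i" "t (Suc i) <= b" "t i <= t (Suc i)" using p by (auto simp: part_points_def)
    thus "dist (r (t i)) (r (t (Suc i))) <= (LINT u:{t i..t (Suc i)}|lborel. m u)"
     using ab by (intro dle) auto
   qed
   also have "... = (LINT u:{t 0..t n}|lborel. m u)"
    using lborel_interval_sum[OF mm mb, of n t] p by (auto simp: part_points_def)
   also have "... <= (LINT u:{a..b}|lborel. m u)"
    unfolding set_lebesgue_integral_def
   proof (rule integral_mono)
    show "integrable lborel (%u. indicator {x..y} u *\<^sub>R m u)" for x y using im unfolding set_integrable_def .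
    have "a <= t 0" "t n <= b" using p by (auto simp: part_points_def)
    thus "indicator {t 0..t n} u *\<^sub>R m u <= indicator {a..b} u *\<^sub>R m u" for u
     using m0[of u] by (auto simp: indicator_def)
   qed (use im in \<open>simp add: set_integrable_def\<close>)
   finally show "part_sum r n t <= (LINT t:{a..b}|lborel. m t)" .
  qed
 next
  \<comment> \<open>For the reverse inequality the difference quotients \<open>D N\<close> converge
    boundedly to \<open>m\<close>, and folding their integral over the grid bounds it by the
    variation. The clamp keeps shifted grid points in the interval.\<close>
  define k where "k t = r (max a (min b t))" for t
  define eta where "eta N = (b - a) / real (Suc N)" for N
  define D where "D N t = dist (k (t + eta N)) (k t) / eta N" for N t
  show "(LINT t:{a..b}|lborel. m t) <= vlen r a b"
  proof (cases "a = b")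
   case True
   have "(LINT t:{a..b}|lborel. m t) = 0" unfolding True by (rule lborel_singleton_integral)
   moreover have "0 <= vlen r a b" using vlen_upper[OF r ab, of 0 "%_. a"] ab by (simp add: part_points_def part_sum_def)
   ultimately show ?thesis by simp
  next
   case False
   hence lt: "a < b" using ab by simp
   have eta: "eta N > 0" for N using lt by (simp add: eta_def)
   have kl: "dist (k x) (k y) <= M * \<bar>x - y\<bar>" for x y
   proof -
    have "dist (k x) (k y) <= M * dist (max a (min b x)) (max a (min b y))"
     unfolding k_def by (rule lipschitz_onD[OF r]) (use ab in auto)
    also have "... <= M * \<bar>x - y\<bar>" by (intro mult_left_mono M) (auto simp: dist_real_def)
    finally show ?thesis .
   qed
   have kc: "continuous_on UNIV k"
   proof -
    have "M-lipschitz_on UNIV k" by (rule lipschitz_onI) (use kl M in \<open>auto simp: dist_real_def\<close>)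
    thus ?thesis by (rule lipschitz_on_continuous_on)
   qed
   have Dm: "D N : borel_measurable borel" for N
   proof -
    have "continuous_on UNIV (D N)" unfolding D_def
     by (intro continuous_intros continuous_on_compose2[OF kc]) (use eta[of N] in auto)
    thus ?thesis by (rule borel_measurable_continuous_onI)
   qed
   have Db: "\<bar>D N t\<bar> <= M" for N t
    using kl[of "t + eta N" t] eta[of N] by (simp add: D_def abs_divide divide_le_eq)
   have up: "(LINT t:{a..b}|lborel. D N t) <= vlen r a b" for N
   proof -
    have ba: "a + real (Suc N) * eta N = b" by (simp add: eta_def)
    have "(LINT t:{a..b}|lborel. D N t) = (LINT s:{0..eta N}|lborel. (\<Sum>i<Suc N. D N (a + real i * eta N + s)))"
     using interval_shift_sum[OF Dm Db, of "eta N" a "Suc N"] eta[of N] unfolding ba by simp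
    also have "... <= (LINT s:{0..eta N}|lborel. vlen r a b / eta N)"
    proof (rule set_integral_mono)
     have sm: "(%s. \<Sum>i<Suc N. D N (a + real i * eta N + s)) : borel_measurable borel" using Dm[of N] by measurable
     have "\<bar>\<Sum>i<Suc N. D N (a + real i * eta N + s)\<bar> <= real (Suc N) * M" for s
      using order_trans[OF sum_abs sum_bounded_above[of "{..<Suc N}" "%i. \<bar>D N (a + real i * eta N + s)\<bar>" M]] Db by simp
     thus "set_integrable lborel {0..eta N} (%s. \<Sum>i<Suc N. D N (a + real i * eta N + s))"
      by (rule set_integrable_bounded_interval[OF sm])
     show "set_integrable lborel {0..eta N} (%s. vlen r a b / eta N)"
      by (rule set_integrable_bounded_interval[of _ "\<bar>vlen r a b / eta N\<bar>"]) auto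
     fix s assume s: "s : {0..eta N}"
     define t where "t i = max a (min b (a + real i * eta N + s))" for i
     have "part_points a b (Suc N) t" unfolding part_points_def t_def
      using lt eta[of N] by (auto intro!: max.mono min.mono mult_right_mono simp: distrib_right)
     hence "part_sum r (Suc N) t <= vlen r a b" by (rule vlen_upper[OF r ab])
     moreover have "(\<Sum>i<Suc N. D N (a + real i * eta N + s)) = part_sum r (Suc N) t / eta N"
      unfolding part_sum_def sum_divide_distrib
      by (intro sum.cong refl) (simp add: D_def k_def t_def dist_commute algebra_simps)
     ultimately show "(\<Sum>i<Suc N. D N (a + real i * eta N + s)) <= vlen r a b / eta N"
      using eta[of N] by (simp add: divide_right_mono)
    qed
    also have "... = vlen r a b" using eta[of N] by (simp add: set_lebesgue_integral_def)
    finally show ?thesis .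
   qed
   have eta0: "eta \<longlonglongrightarrow> 0"
    using tendsto_mult_right_zero[OF LIMSEQ_Suc[OF lim_1_over_n], of "b - a"] by (simp add: eta_def[abs_def])
   have "(%N. LINT t:{a..b}|lborel. D N t) \<longlonglongrightarrow> (LINT t:{a..b}|lborel. m t)"
    unfolding set_lebesgue_integral_def
   proof (rule integral_dominated_convergence[where w="%t. M * indicator {a..b} t"])
    show "(%t. indicator {a..b} t *\<^sub>R m t) : borel_measurable lborel" using mm by measurable
    show "(%t. indicator {a..b} t *\<^sub>R D N t) : borel_measurable lborel" for N using Dm[of N] by measurable
    show "integrable lborel (%t. M * indicator {a..b} t)" using lt by (intro integrable_mult_right) simp
    show "AE t in lborel. norm (indicator {a..b} t *\<^sub>R D N t) <= M * indicator {a..b} t" for N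
     using Db by (intro always_eventually allI) (auto simp: indicator_def)
    have ne: "AE t in lborel. t ~= a" "AE t in lborel. t ~= b" by (rule AE_lborel_singleton)+
    show "AE t in lborel. (%N. indicator {a..b} t *\<^sub>R D N t) \<longlonglongrightarrow> indicator {a..b} t *\<^sub>R m t"
     using md ne
    proof eventually_elim
     case (elim t)
     show ?case
     proof (cases "t : {a..b}")
      case True
      hence t: "a < t" "t < b" using elim by auto
      have f0: "filterlim eta (at 0) sequentially"
       using eta0 eta by (simp add: filterlim_at order_less_imp_not_eq2)
      have "((%h. dist (r (t + h)) (r t) / \<bar>h\<bar>) \<longlongrightarrow> m t) (at 0)" using elim(1) t ab by auto
      from filterlim_compose[OF this f0]
      have "(%N. dist (r (t + eta N)) (r t) / \<bar>eta N\<bar>) \<longlonglongrightarrow> m t" .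
      moreover have "eventually (%N. dist (r (t + eta N)) (r t) / \<bar>eta N\<bar> = D N t) sequentially"
      proof -
       have "eventually (%N. eta N < b - t) sequentially" using eta0 t by (intro order_tendstoD(2)) auto
       thus ?thesis
       proof eventually_elim
        case (elim N)
        hence "max a (min b (t + eta N)) = t + eta N" "max a (min b t) = t" using t eta[of N] by auto
        thus ?case using eta[of N] by (simp add: D_def k_def)
       qed
      qed
      ultimately have "(%N. D N t) \<longlonglongrightarrow> m t" by (rule Lim_transform_eventually)
      thus ?thesis using True by simp
     qed simp
    qed
   qed
   thus ?thesis by (rule LIMSEQ_le_const2) (use up in auto)
  qed
 qed
 show ?thesis by (rule that[OF mm m0 mM md vl])
qed

section \<open>Integrals of forms along curves\<close>

definition curve_integral :: "(real => 'a::metric_space) => ('a => real) => ('a => real) => real" where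
 "curve_integral r f pj = (LINT t:{0..1}|lebesgue. f (r t) * deriv (%s. pj (r s)) t)"

lemma lip_comp_curve:
 assumes "M-lipschitz_on {0..1} r" "pj : Lip_funs"
 shows "(Lip pj * M)-lipschitz_on {0..1} (%t. pj (r t))"
 using lipschitz_on_compose2[of M "{0..1}" r "Lip pj" pj] assms Lip_lipschitz[of pj]
 by (meson lipschitz_on_subset subset_UNIV)

lemma clamp_lipschitz:
 fixes r :: "real => 'a::metric_space"
 assumes r: "M-lipschitz_on {0..1} r" shows "M-lipschitz_on UNIV (%t. r (max 0 (min 1 t)))"
proof (rule lipschitz_onI[OF _ lipschitz_on_nonneg[OF r]])
 fix x y :: real
 have "dist (r (max 0 (min 1 x))) (r (max 0 (min 1 y))) <= M * dist (max 0 (min 1 x)) (max 0 (min 1 y))"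
  by (rule lipschitz_onD[OF r]) auto
 also have "... <= M * dist x y" by (intro mult_left_mono lipschitz_on_nonneg[OF r]) (auto simp: dist_real_def)
 finally show "dist (r (max 0 (min 1 x))) (r (max 0 (min 1 y))) <= M * dist x y" .
qed

text \<open>All analytic facts about a Lipschitz curve are read off a Borel metric derivative \<open>m\<close> and, for
  each \<open>pj\<close>, a Borel version of \<open>(pj \<circ> r)'\<close> dominated by \<open>Lip pj m\<close>.\<close>

definition curve_slope :: "(real => 'a::metric_space) => (real => real) => ('a => real) => (real => real) => bool" where
 "curve_slope r m pj h \<longleftrightarrow> h : borel_measurable borel & (ALL t. \<bar>h t\<bar> <= Lip pj * m t) &
    (ALL a b. 0 <= a & a <= b & b <= 1 --> (LINT t:{a..b}|lborel. h t) = pj (r b) - pj (r a)) &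
    (ALL f:Lip_funs. curve_integral r f pj = (LINT t:{0..1}|lborel. f (r (max 0 (min 1 t))) * h t))"

lemma curve_derivatives:
 fixes r :: "real => 'a::metric_space"
 assumes r: "M-lipschitz_on {0..1} r"
 obtains m where "m : borel_measurable borel" "!!t. 0 <= m t" "!!t. m t <= M"
  "!!a b. 0 <= a ==> a <= b ==> b <= 1 ==> vlen r a b = (LINT t:{a..b}|lborel. m t)"
  "(LINT t:{0..1}|lebesgue. metric_derivative r t) = vlen r 0 1"
  "!!pj. pj : Lip_funs ==> EX h. curve_slope r m pj h"
proof -
 obtain m where m: "m : borel_measurable borel" "!!t. 0 <= m t" "!!t. m t <= M"
  "AE t in lborel. t : {0<..<1} --> ((%h. dist (r (t + h)) (r t) / \<bar>h\<bar>) \<longlongrightarrow> m t) (at 0)"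
  "!!a b. 0 <= a ==> a <= b ==> b <= 1 ==> vlen r a b = (LINT t:{a..b}|lborel. m t)"
  by (rule metric_derivative_exists[OF r]) (rule that)
 have ends: "AE t in lborel. t ~= (0::real)" "AE t in lborel. t ~= (1::real)" by (rule AE_lborel_singleton)+
 have cong: "(LINT t:{0..1}|lebesgue. F t) = (LINT t:{0..1}|lborel. G t)"
  if ae: "AE t in lborel. t : {0<..<1} --> F t = G t" and G: "G : borel_measurable borel" for F G :: "real => real"
 proof -
  have ae': "AE t in lborel. indicator {0..1} t *\<^sub>R G t = indicator {0..1} t *\<^sub>R F t"
   using ae ends by eventually_elim (auto simp: indicator_def)
  have Gm: "(%t. indicator {0..1} t *\<^sub>R G t) : borel_measurable lebesgue"
   using G by (intro measurable_completion) simp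
  \<comment> \<open>\<open>F\<close> may involve \<open>deriv\<close> at points without derivative;
    it is measurable for the completion only because it agrees a.e. with the Borel function
    \<open>G\<close>.\<close>
  have Fm: "(%t. indicator {0..1} t *\<^sub>R F t) : borel_measurable lebesgue"
  proof (rule measurableI)
   let ?G = "%t. indicator {0..1} t *\<^sub>R G t" and ?F = "%t. indicator {0..1} t *\<^sub>R F t"
   fix S :: "real set" assume S: "S : sets borel"
   have N: "{t. ?G t ~= ?F t} : null_sets lebesgue"
    using AE_completion[OF ae'] by (simp add: completion.AE_iff_null_sets)
   have "{t. ?G t ~= ?F t} \<inter> ?F -` S : null_sets lebesgue" by (rule completion.complete2[OF _ N]) auto
   moreover have "?G -` S - {t. ?G t ~= ?F t} : sets lebesgue"
    using measurable_sets[OF Gm S] N by auto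
   moreover have "?F -` S \<inter> space lebesgue = (?G -` S - {t. ?G t ~= ?F t}) \<union> ({t. ?G t ~= ?F t} \<inter> ?F -` S)" by auto
   ultimately show "?F -` S \<inter> space lebesgue : sets lebesgue" by (simp only: sets.Un null_setsD2)
  qed simp
  have "(LINT t:{0..1}|lebesgue. F t) = (LINT t|lebesgue. indicator {0..1} t *\<^sub>R G t)"
   unfolding set_lebesgue_integral_def
   by (rule integral_cong_AE[OF Fm Gm]) (use AE_completion[OF ae'] in \<open>eventually_elim, auto\<close>)
  also have "... = (LINT t:{0..1}|lborel. G t)"
   unfolding set_lebesgue_integral_def by (rule integral_completion) (use G in simp)
  finally show ?thesis .
 qed
 have md: "(LINT t:{0..1}|lebesgue. metric_derivative r t) = vlen r 0 1"
 proof -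
  have "AE t in lborel. t : {0<..<1} --> metric_derivative r t = m t"
   using m(4) unfolding metric_derivative_def by eventually_elim (auto intro!: tendsto_Lim)
  thus ?thesis using cong[OF _ m(1)] m(5)[of 0 1] by simp
 qed
 have piece: "EX h. curve_slope r m pj h" if pj: "pj : Lip_funs" for pj
 proof -
  note Lp = Lip_nonneg[OF pj]
  obtain h where h: "h : borel_measurable borel" "!!t. \<bar>h t\<bar> <= Lip pj * M"
   "AE t in lebesgue. t : {0<..<1} --> ((%t. pj (r t)) has_real_derivative h t) (at t)"
   "AE t in lebesgue. t : {0<..<1} --> deriv (%t. pj (r t)) t = h t"
   "!!a b. 0 <= a ==> a <= b ==> b <= 1 ==> (LINT t:{a..b}|lborel. h t) = pj (r b) - pj (r a)"
   by (rule lipschitz_unit_interval_derivative[OF lip_comp_curve[OF r pj]]) (rule that)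
  \<comment> \<open>Clipped at the bound that the metric derivative imposes a.e., so that the
    estimate holds at every \<open>t\<close>.\<close>
  define h' where "h' t = max (- (Lip pj * m t)) (min (Lip pj * m t) (h t))" for t
  have h'm: "h' : borel_measurable borel" unfolding h'_def using h(1) m(1) by measurable
  have h'b: "\<bar>h' t\<bar> <= Lip pj * m t" for t
   using mult_nonneg_nonneg[OF Lp m(2)[of t]] unfolding h'_def by linarith
  have ae: "AE t in lborel. t : {0<..<1} --> h' t = h t & deriv (%t. pj (r t)) t = h t"
   using m(4) h(3)[unfolded AE_completion_iff] h(4)[unfolded AE_completion_iff]
  proof eventually_elim
   case (elim t)
   show ?case
   proof
    assume t: "t : {0<..<1}"
    have "((%k. (pj (r (t + k)) - pj (r t)) / k) \<longlongrightarrow> h t) (at 0)" using elim t by (simp add: DERIV_def)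
    hence l: "((%k. \<bar>(pj (r (t + k)) - pj (r t)) / k\<bar>) \<longlongrightarrow> \<bar>h t\<bar>) (at 0)" by (rule tendsto_rabs)
    have u: "((%k. Lip pj * (dist (r (t + k)) (r t) / \<bar>k\<bar>)) \<longlongrightarrow> Lip pj * m t) (at 0)"
     by (intro tendsto_mult_left) (use elim t in blast)
    have "\<bar>h t\<bar> <= Lip pj * m t"
    proof (rule tendsto_le[OF _ u l])
     have "\<bar>(pj (r (t + k)) - pj (r t)) / k\<bar> <= Lip pj * (dist (r (t + k)) (r t) / \<bar>k\<bar>)" for k
      unfolding abs_divide times_divide_eq_right by (rule divide_right_mono[OF Lip_bound[OF pj]]) simp
     thus "\<forall>\<^sub>F k in at 0. \<bar>(pj (r (t + k)) - pj (r t)) / k\<bar> <= Lip pj * (dist (r (t + k)) (r t) / \<bar>k\<bar>)"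
      by (intro always_eventually allI)
    qed simp
    thus "h' t = h t & deriv (%t. pj (r t)) t = h t" using elim t unfolding h'_def by (auto simp: abs_le_iff)
   qed
  qed
  have int: "(LINT t:{a..b}|lborel. h' t) = pj (r b) - pj (r a)" if ab: "0 <= a" "a <= b" "b <= 1" for a b
  proof -
   have "AE t\<in>{a..b} in lborel. h' t = h t" using ae ends by eventually_elim (use ab in force)
   hence "(LINT t:{a..b}|lborel. h' t) = (LINT t:{a..b}|lborel. h t)"
    by (intro set_lebesgue_integral_cong_AE) (use h(1) h'm in auto)
   thus ?thesis using h(5)[OF ab] by simp
  qed
  have ci: "curve_integral r f pj = (LINT t:{0..1}|lborel. f (r (max 0 (min 1 t))) * h' t)" if f: "f : Lip_funs" for f
   unfolding curve_integral_def
  proof (rule cong)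
   have "continuous_on UNIV (%t. f (r (max 0 (min 1 t))))"
    using continuous_on_compose2[OF Lipb_continuous[OF f] lipschitz_on_continuous_on[OF clamp_lipschitz[OF r]]] by simp
   hence "(%t. f (r (max 0 (min 1 t)))) : borel_measurable borel" by (rule borel_measurable_continuous_onI)
   thus "(%t. f (r (max 0 (min 1 t))) * h' t) : borel_measurable borel" using h'm by measurable
   show "AE t in lborel. t : {0<..<1} --> f (r t) * deriv (%s. pj (r s)) t = f (r (max 0 (min 1 t))) * h' t"
    using ae by eventually_elim auto
  qed
  show ?thesis unfolding curve_slope_def using h'm h'b int ci by blast
 qed
 show ?thesis by (rule that[OF m(1,2,3,5) md piece])
qed

lemma vlen_props:
 assumes r: "M-lipschitz_on {0..1} r"
 shows "!!a b. 0 <= a ==> a <= b ==> b <= 1 ==> 0 <= vlen r a b"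
  and "!!a b. 0 <= a ==> a <= b ==> b <= 1 ==> vlen r a b <= M * (b - a)"
  and "!!a b c. 0 <= a ==> a <= b ==> b <= c ==> c <= 1 ==> vlen r a c = vlen r a b + vlen r b c"
  and "!!a b. 0 <= a ==> a <= b ==> b <= 1 ==> dist (r a) (r b) <= vlen r a b"
  and "(LINT t:{0..1}|lebesgue. metric_derivative r t) = vlen r 0 1"
proof -
 obtain m where m: "m : borel_measurable borel" "!!t. 0 <= m t" "!!t. m t <= M"
  "!!a b. 0 <= a ==> a <= b ==> b <= 1 ==> vlen r a b = (LINT t:{a..b}|lborel. m t)"
  "(LINT t:{0..1}|lebesgue. metric_derivative r t) = vlen r 0 1"
  by (rule curve_derivatives[OF r]) (rule that)
 show "(LINT t:{0..1}|lebesgue. metric_derivative r t) = vlen r 0 1" by (rule m(5))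
 show "vlen r a b <= M * (b - a)" if ab: "0 <= a" "a <= b" "b <= 1" for a b
  by (rule vlen_least[OF ab(2) vlen_bdd[OF r ab]])
 show dist: "dist (r a) (r b) <= vlen r a b" if ab: "0 <= a" "a <= b" "b <= 1" for a b
  using vlen_upper[OF r ab, of 1 "%i. if i = 0 then a else b"] ab by (simp add: part_points_def part_sum_def)
 show "0 <= vlen r a b" if ab: "0 <= a" "a <= b" "b <= 1" for a b
  using dist[OF ab] zero_le_dist order_trans by blast
 show "vlen r a c = vlen r a b + vlen r b c" if "0 <= a" "a <= b" "b <= c" "c <= 1" for a b c
  using lborel_interval_diff[OF m(1), of M a b c] m(2,3) m(4)[of a c] m(4)[of a b] m(4)[of b c] that by simp
qed

text \<open>On each piece \<open>f\<close> is frozen at the left end. The slope of \<open>pj\<close>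
  integrates exactly to the increment of \<open>pj\<close>, so only the oscillation of
  \<open>f\<close>, weighted with length, remains.\<close>

lemma curve_integral_riemann:
 assumes r: "M-lipschitz_on {0..1} r" and f: "f : Lip_funs" and pj: "pj : Lip_funs"
  and t: "t 0 = 0" "t n = 1" "!!i. i < n ==> t i <= t (Suc i)" "!!i. i <= n ==> 0 <= t i & t i <= 1"
  and osc: "!!i s. i < n ==> t i <= s ==> s <= t (Suc i) ==> dist (r s) (r (t i)) <= om"
 shows "\<bar>curve_integral r f pj - (\<Sum>i<n. f (r (t i)) * (pj (r (t (Suc i))) - pj (r (t i))))\<bar> <= Lip f * om * Lip pj * vlen r 0 1"
proof -
 obtain m where m: "m : borel_measurable borel" "!!t. 0 <= m t" "!!t. m t <= M"
  "!!a b. 0 <= a ==> a <= b ==> b <= 1 ==> vlen r a b = (LINT t:{a..b}|lborel. m t)"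
  "!!pj. pj : Lip_funs ==> EX h. curve_slope r m pj h"
  by (rule curve_derivatives[OF r]) (rule that)
 obtain h where h: "h : borel_measurable borel" "!!t. \<bar>h t\<bar> <= Lip pj * m t"
  "!!a b. 0 <= a ==> a <= b ==> b <= 1 ==> (LINT t:{a..b}|lborel. h t) = pj (r b) - pj (r a)"
  "!!f. f : Lip_funs ==> curve_integral r f pj = (LINT t:{0..1}|lborel. f (r (max 0 (min 1 t))) * h t)"
  using m(5)[OF pj] unfolding curve_slope_def by blast
 note Lp = Lip_nonneg[OF pj] and Lf = Lip_nonneg[OF f]
 have M0: "0 <= M" by (rule lipschitz_on_nonneg[OF r])
 let ?c = "%t. max 0 (min 1 (t::real))"
 have fc: "(%t. f (r (?c t))) : borel_measurable borel"
  using continuous_on_compose2[OF Lipb_continuous[OF f] lipschitz_on_continuous_on[OF clamp_lipschitz[OF r]]]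
  by (intro borel_measurable_continuous_onI) simp
 obtain K where K: "!!t. \<bar>f (r (?c t))\<bar> <= K"
 proof -
  have "\<bar>f (r (?c t))\<bar> <= \<bar>f (r 0)\<bar> + Lip f * M" for t
  proof -
   have "\<bar>f (r (?c t)) - f (r 0)\<bar> <= Lip f * dist (r (?c t)) (r 0)" by (rule Lip_bound[OF f])
   also have "... <= Lip f * (M * 1)"
   proof (rule mult_left_mono[OF _ Lf])
    have "dist (r (?c t)) (r 0) <= M * dist (?c t) 0" by (rule lipschitz_onD[OF r]) auto
    also have "... <= M * 1" by (rule mult_left_mono[OF _ M0]) auto
    finally show "dist (r (?c t)) (r 0) <= M * 1" .
   qed
   finally show ?thesis by simp
  qed
  thus ?thesis using that by blast
 qed
 define g where "g t = f (r (?c t)) * h t" for t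
 have gm: "g : borel_measurable borel" unfolding g_def using fc h(1) by measurable
 have hb: "\<bar>h t\<bar> <= Lip pj * M" for t using h(2)[of t] mult_left_mono[OF m(3) Lp, of t] by linarith
 have gb: "\<bar>g t\<bar> <= K * (Lip pj * M)" for t unfolding g_def abs_mult
  by (intro mult_mono K hb) (use K[of t] in linarith, simp)
 have pieces: "\<bar>(LINT s:{t i..t (Suc i)}|lborel. g s) - f (r (t i)) * (pj (r (t (Suc i))) - pj (r (t i)))\<bar> <=
   (LINT s:{t i..t (Suc i)}|lborel. Lip f * om * Lip pj * m s)" if i: "i < n" for i
 proof -
  have ti: "0 <= t i" "t i <= t (Suc i)" "t (Suc i) <= 1" using t(3)[OF i] t(4)[of i] t(4)[of "Suc i"] i by auto
  have i1: "set_integrable lborel {t i..t (Suc i)} g" by (rule set_integrable_bounded_interval[OF gm gb])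
  have i2: "set_integrable lborel {t i..t (Suc i)} (%s. f (r (t i)) * h s)"
   using set_integrable_bounded_interval[OF h(1) hb] by simp
  have i3: "set_integrable lborel {t i..t (Suc i)} (%s. Lip f * om * Lip pj * m s)"
   using set_integrable_bounded_interval[OF m(1), of M] m(2,3) by simp
  have e: "(LINT s:{t i..t (Suc i)}|lborel. f (r (t i)) * h s) = f (r (t i)) * (pj (r (t (Suc i))) - pj (r (t i)))"
   using h(3)[OF ti] by simp
  have "\<bar>(LINT s:{t i..t (Suc i)}|lborel. g s) - f (r (t i)) * (pj (r (t (Suc i))) - pj (r (t i)))\<bar> =
    \<bar>LINT s:{t i..t (Suc i)}|lborel. g s - f (r (t i)) * h s\<bar>" unfolding set_integral_diff(2)[OF i1 i2] e ..
  also have "... <= (LINT s:{t i..t (Suc i)}|lborel. \<bar>g s - f (r (t i)) * h s\<bar>)"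
   unfolding set_lebesgue_integral_def
   by (rule order_trans[OF integral_abs_bound]) (auto intro!: eq_refl Bochner_Integration.integral_cong simp: abs_mult)
  also have "... <= (LINT s:{t i..t (Suc i)}|lborel. Lip f * om * Lip pj * m s)"
  proof (rule set_integral_mono[OF _ i3])
   show "set_integrable lborel {t i..t (Suc i)} (%s. \<bar>g s - f (r (t i)) * h s\<bar>)"
    by (rule set_integrable_abs[OF set_integral_diff(1)[OF i1 i2]])
   fix s assume s: "s : {t i..t (Suc i)}"
   hence cs: "?c s = s" using ti by auto
   have "\<bar>g s - f (r (t i)) * h s\<bar> = \<bar>f (r s) - f (r (t i))\<bar> * \<bar>h s\<bar>"
    unfolding g_def cs abs_mult[symmetric] by (simp add: left_diff_distrib)
   also have "... <= (Lip f * om) * (Lip pj * m s)"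
   proof (rule mult_mono[OF _ h(2)])
    show "\<bar>f (r s) - f (r (t i))\<bar> <= Lip f * om"
     by (rule order_trans[OF Lip_bound[OF f] mult_left_mono[OF osc[OF i] Lf]]) (use s in auto)
    thus "0 <= Lip f * om" by linarith
   qed simp
   finally show "\<bar>g s - f (r (t i)) * h s\<bar> <= Lip f * om * Lip pj * m s" by (simp add: mult.assoc)
  qed
  finally show ?thesis .
 qed
 have "curve_integral r f pj = (\<Sum>i<n. LINT s:{t i..t (Suc i)}|lborel. g s)"
  using lborel_interval_sum[OF gm gb, of n t] t h(4)[OF f] by (simp add: g_def)
 hence "\<bar>curve_integral r f pj - (\<Sum>i<n. f (r (t i)) * (pj (r (t (Suc i))) - pj (r (t i))))\<bar> =
   \<bar>\<Sum>i<n. (LINT s:{t i..t (Suc i)}|lborel. g s) - f (r (t i)) * (pj (r (t (Suc i))) - pj (r (t i)))\<bar>"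
  by (simp add: sum_subtractf)
 also have "... <= (\<Sum>i<n. LINT s:{t i..t (Suc i)}|lborel. Lip f * om * Lip pj * m s)"
  by (rule order_trans[OF sum_abs]) (intro sum_mono pieces, simp)
 also have "... = Lip f * om * Lip pj * (\<Sum>i<n. LINT s:{t i..t (Suc i)}|lborel. m s)"
  by (simp add: sum_distrib_left)
 also have "(\<Sum>i<n. LINT s:{t i..t (Suc i)}|lborel. m s) = vlen r 0 1"
  using lborel_interval_sum[OF m(1), of M n t] m(2,3) m(4)[of 0 1] t by simp
 finally show ?thesis .
qed

lemma incbij_ends:
 assumes "ph : increasing_bijections" shows "ph 0 = 0" "ph 1 = 1"
  and "!!s t. 0 <= s ==> s <= t ==> t <= 1 ==> ph s <= ph t"
  and "!!y. 0 <= y ==> y <= 1 ==> EX x. 0 <= x & x <= 1 & ph x = y"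
proof -
 have m: "strict_mono_on {0..1} ph" and b: "bij_betw ph {0..1} {0..1}" using assms by (auto simp: increasing_bijections_def)
 show mono: "ph s <= ph t" if "0 <= s" "s <= t" "t <= 1" for s t
  using m that by (intro strict_mono_on_leD[OF m]) auto
 show sur: "EX x. 0 <= x & x <= 1 & ph x = y" if "0 <= y" "y <= 1" for y
 proof -
  have "y : ph ` {0..1}" using b that by (simp add: bij_betw_def)
  thus ?thesis by auto
 qed
 obtain x where x: "0 <= x" "x <= 1" "ph x = 0" using sur[of 0] by auto
 have "ph 0 <= 0" using mono[of 0 x] x by simp
 thus "ph 0 = 0" using increasing_bijections_mem[OF assms, of 0] by simp
 obtain x where x: "0 <= x" "x <= 1" "ph x = 1" using sur[of 1] by auto
 have "1 <= ph 1" using mono[of x 1] x by simp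
 thus "ph 1 = 1" using increasing_bijections_mem[OF assms, of 1] by simp
qed

text \<open>Both integrals are compared with Riemann sums over corresponding points, so the bound on
  \<open>c\<close> is uniform in its length rather than its Lipschitz constant. The number
  \<open>N\<close> of pieces is fixed before \<open>dl\<close>, because moving the grid values costs
  a multiple of \<open>dl\<close> for each piece.\<close>

lemma curve_integral_continuous:
 assumes r: "M-lipschitz_on {0..1} r" and f: "f : Lipb_funs" and pj: "pj : Lip_funs" and rR: "vlen r 0 1 <= R" and e: "e > 0"
 obtains dl where "dl > 0" "!!c ph. lip_curve c ==> ph : increasing_bijections ==> vlen c 0 1 <= R ==>
   (!!t. t : {0..1} ==> dist (r t) (c (ph t)) <= dl) ==> \<bar>curve_integral r f pj - curve_integral c f pj\<bar> < e"
proof -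
 have fL: "f : Lip_funs" by (rule Lipb_Lip[OF f])
 obtain B where B: "0 <= B" "!!x. \<bar>f x\<bar> <= B" using LipbE[OF f] by metis
 note Lf = Lip_nonneg[OF fL] and Lp = Lip_nonneg[OF pj]
 have M0: "0 <= M" by (rule lipschitz_on_nonneg[OF r])
 have R0: "0 <= R" using vlen_props(1)[OF r, of 0 1] rR by simp
 define A where "A = Lip f * Lip pj * R"
 have A0: "0 <= A" unfolding A_def using Lf Lp R0 by simp
 obtain N :: nat where N: "4 * (A * M) / e < real N" using reals_Archimedean2 by blast
 have N0: "real N > 0" using N A0 M0 e by (smt (verit) divide_nonneg_pos mult_nonneg_nonneg)
 define C where "C = 3 * A + 2 * B * Lip pj * real N + 1"
 have C0: "C > 0" unfolding C_def using A0 B(1) Lp by (intro add_nonneg_pos add_nonneg_nonneg mult_nonneg_nonneg) auto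
 define dl where "dl = e / (2 * C)"
 have dl: "dl > 0" using e C0 by (simp add: dl_def)
 show ?thesis
 proof (rule that[OF dl])
  fix c ph assume c: "lip_curve c" and ph: "ph : increasing_bijections" and cR: "vlen c 0 1 <= R"
   and cl: "!!t. t : {0..1} ==> dist (r t) (c (ph t)) <= dl"
  obtain L where L: "L-lipschitz_on {0..1} c" using c by (auto simp: lip_curve_def)
  define t where "t i = real i / real N" for i
  have N1: "N ~= 0" using N0 by auto
  have t: "t 0 = 0" "t N = 1" "!!i. t i <= t (Suc i)" "!!i. i <= N ==> 0 <= t i & t i <= 1"
   using N0 by (auto simp: t_def divide_right_mono)
  have oscr: "dist (r s) (r (t i)) <= M / real N" if "i < N" "t i <= s" "s <= t (Suc i)" for i s
  proof -
   have "dist (r s) (r (t i)) <= M * dist s (t i)"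
    by (rule lipschitz_onD[OF r]) (use that t(4)[of i] t(4)[of "Suc i"] in auto)
   also have "... <= M * (1 / real N)"
   proof (rule mult_left_mono[OF _ M0])
    have "s - t i <= t (Suc i) - t i" using that by simp
    also have "... = 1 / real N" by (simp add: t_def diff_divide_distrib[symmetric])
    finally show "dist s (t i) <= 1 / real N" using that by (simp add: dist_real_def)
   qed
   finally show ?thesis by simp
  qed
  note ph0 = incbij_ends[OF ph]
  have 1: "\<bar>curve_integral r f pj - (\<Sum>i<N. f (r (t i)) * (pj (r (t (Suc i))) - pj (r (t i))))\<bar> <= Lip f * (M / real N) * Lip pj * vlen r 0 1"
   by (rule curve_integral_riemann[OF r fL pj t(1,2) t(3) t(4) oscr])
  define u where "u i = ph (t i)" for i
  have u: "u 0 = 0" "u N = 1" "!!i. i < N ==> u i <= u (Suc i)" "!!i. i <= N ==> 0 <= u i & u i <= 1"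
  proof -
   show "u 0 = 0" "u N = 1" using t ph0 by (auto simp: u_def)
   show "u i <= u (Suc i)" if "i < N" for i unfolding u_def using t(3)[of i] t(4)[of i] t(4)[of "Suc i"] that by (intro ph0(3)) auto
   show "0 <= u i & u i <= 1" if "i <= N" for i unfolding u_def using increasing_bijections_mem[OF ph, of "t i"] t(4)[OF that] by auto
  qed
  have cl': "dist (r (t i)) (c (u i)) <= dl" if "i <= N" for i unfolding u_def using cl t(4)[OF that] by auto
  have oscc: "dist (c s) (c (u i)) <= M / real N + 2 * dl" if i: "i < N" "u i <= s" "s <= u (Suc i)" for i s
  proof -
   have s01: "0 <= s" "s <= 1" using i u(4)[of i] u(4)[of "Suc i"] by auto
   obtain x where x: "0 <= x" "x <= 1" "ph x = s" using ph0(4)[OF s01] by blast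
   \<comment> \<open>A parameter in the \<open>i\<close>-th piece that \<open>ph\<close> sends to
     \<open>s\<close>; the clamp is there because the preimage \<open>x\<close> is not yet known to
     lie in that piece.\<close>
   define y where "y = max (t i) (min (t (Suc i)) x)"
   have ti: "0 <= t i" "t i <= t (Suc i)" "t (Suc i) <= 1" using t(3)[of i] t(4)[of i] t(4)[of "Suc i"] i(1) by auto
   have y: "t i <= y" "y <= t (Suc i)" unfolding y_def using ti by auto
   have "ph y = s"
   proof (cases "x < t i")
    case True
    hence "s <= u i" using ph0(3)[of x "t i"] x ti unfolding u_def by auto
    hence "s = u i" using i by simp
    moreover have "y = t i" using True ti unfolding y_def by auto
    ultimately show ?thesis by (simp add: u_def)
   next
    case False
    show ?thesis
    proof (cases "x > t (Suc i)")
     case True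
     hence "u (Suc i) <= s" using ph0(3)[of "t (Suc i)" x] x ti unfolding u_def by auto
     hence "s = u (Suc i)" using i by simp
     moreover have "y = t (Suc i)" using True ti unfolding y_def by auto
     ultimately show ?thesis by (simp add: u_def)
    next
     case False
     hence "y = x" using \<open>~ x < t i\<close> unfolding y_def by auto
     thus ?thesis using x by simp
    qed
   qed
   hence "dist (c s) (c (u i)) <= dist (c s) (r y) + dist (r y) (r (t i)) + dist (r (t i)) (c (u i))"
    using dist_triangle[of "c s" "c (u i)" "r y"] dist_triangle[of "r y" "c (u i)" "r (t i)"] by linarith
   also have "dist (c s) (r y) <= dl" using cl[of y] y ti \<open>ph y = s\<close> by (simp add: dist_commute)
   also have "dist (r y) (r (t i)) <= M / real N" by (rule oscr[OF i(1) y])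
   also have "dist (r (t i)) (c (u i)) <= dl" using cl' i(1) by simp
   finally show ?thesis by simp
  qed
  have 2: "\<bar>curve_integral c f pj - (\<Sum>i<N. f (c (u i)) * (pj (c (u (Suc i))) - pj (c (u i))))\<bar> <= Lip f * (M / real N + 2 * dl) * Lip pj * vlen c 0 1"
   by (rule curve_integral_riemann[OF L fL pj u oscc])
  have 3: "\<bar>(\<Sum>i<N. f (r (t i)) * (pj (r (t (Suc i))) - pj (r (t i)))) - (\<Sum>i<N. f (c (u i)) * (pj (c (u (Suc i))) - pj (c (u i))))\<bar>
    <= Lip f * dl * Lip pj * vlen r 0 1 + 2 * B * Lip pj * dl * real N"
  proof -
   have "\<bar>f (r (t i)) * (pj (r (t (Suc i))) - pj (r (t i))) - f (c (u i)) * (pj (c (u (Suc i))) - pj (c (u i)))\<bar>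
     <= Lip f * dl * Lip pj * vlen r (t i) (t (Suc i)) + 2 * B * Lip pj * dl" if i: "i < N" for i
   proof -
    have ti: "0 <= t i" "t i <= t (Suc i)" "t (Suc i) <= 1" using t(3)[of i] t(4)[of i] t(4)[of "Suc i"] i(1) by auto
    have "f (r (t i)) * (pj (r (t (Suc i))) - pj (r (t i))) - f (c (u i)) * (pj (c (u (Suc i))) - pj (c (u i)))
     = (f (r (t i)) - f (c (u i))) * (pj (r (t (Suc i))) - pj (r (t i)))
     + f (c (u i)) * ((pj (r (t (Suc i))) - pj (c (u (Suc i)))) + (pj (c (u i)) - pj (r (t i))))"
     by (simp add: algebra_simps)
    moreover have "\<bar>(f (r (t i)) - f (c (u i))) * (pj (r (t (Suc i))) - pj (r (t i)))\<bar> <= (Lip f * dl) * (Lip pj * vlen r (t i) (t (Suc i)))"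
     unfolding abs_mult
    proof (intro mult_mono)
     show "\<bar>f (r (t i)) - f (c (u i))\<bar> <= Lip f * dl"
      by (rule order_trans[OF Lip_bound[OF fL] mult_left_mono[OF cl' Lf]]) (use i in simp)
     show "\<bar>pj (r (t (Suc i))) - pj (r (t i))\<bar> <= Lip pj * vlen r (t i) (t (Suc i))"
      by (rule order_trans[OF Lip_bound[OF pj] mult_left_mono[OF _ Lp]]) (use vlen_props(4)[OF r ti] in \<open>simp add: dist_commute\<close>)
    qed (use Lf dl in auto)
    moreover have "\<bar>f (c (u i)) * ((pj (r (t (Suc i))) - pj (c (u (Suc i)))) + (pj (c (u i)) - pj (r (t i))))\<bar> <= B * (Lip pj * dl + Lip pj * dl)"
     unfolding abs_mult
    proof (intro mult_mono B order_trans[OF abs_triangle_ineq] add_mono)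
     show "\<bar>pj (r (t (Suc i))) - pj (c (u (Suc i)))\<bar> <= Lip pj * dl"
      by (rule order_trans[OF Lip_bound[OF pj] mult_left_mono[OF cl' Lp]]) (use i in simp)
     show "\<bar>pj (c (u i)) - pj (r (t i))\<bar> <= Lip pj * dl"
      by (rule order_trans[OF Lip_bound[OF pj] mult_left_mono[OF _ Lp]]) (use cl'[of i] i in \<open>simp add: dist_commute\<close>)
    qed simp
    ultimately show ?thesis by (simp add: algebra_simps)
   qed
   hence "(\<Sum>i<N. \<bar>f (r (t i)) * (pj (r (t (Suc i))) - pj (r (t i))) - f (c (u i)) * (pj (c (u (Suc i))) - pj (c (u i)))\<bar>)
     <= (\<Sum>i<N. Lip f * dl * Lip pj * vlen r (t i) (t (Suc i)) + 2 * B * Lip pj * dl)" by (intro sum_mono) simp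
   also have "... = Lip f * dl * Lip pj * (\<Sum>i<N. vlen r (t i) (t (Suc i))) + 2 * B * Lip pj * dl * real N"
    by (simp add: sum.distrib sum_distrib_left)
   also have "(\<Sum>i<N. vlen r (t i) (t (Suc i))) = vlen r 0 1"
   proof -
    have "n <= N ==> (\<Sum>i<n. vlen r (t i) (t (Suc i))) = vlen r 0 (t n)" for n
    proof (induct n)
     case 0
     have "vlen r 0 0 = 0" using vlen_props(1,2)[OF r, of 0 0] by simp
     thus ?case using t(1) by simp
    next
     case (Suc n)
     thus ?case using vlen_props(3)[OF r, of 0 "t n" "t (Suc n)"] t(3)[of n] t(4)[of n] t(4)[of "Suc n"] by simp
    qed
    thus ?thesis using t(2) by simp
   qed
   finally show ?thesis unfolding sum_subtractf[symmetric] by (rule order_trans[OF sum_abs])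
  qed
  have 4: "Lip f * X * Lip pj * v <= A * X" if "0 <= X" "v <= R" for X v
  proof -
   have "Lip f * X * Lip pj * v <= Lip f * X * Lip pj * R" using that Lf Lp by (intro mult_left_mono) auto
   thus ?thesis by (simp add: A_def mult_ac)
  qed
  have "\<bar>curve_integral r f pj - curve_integral c f pj\<bar> <= A * (M / real N) + A * (M / real N + 2 * dl) + (A * dl + 2 * B * Lip pj * dl * real N)"
  proof -
   have "Lip f * (M / real N) * Lip pj * vlen r 0 1 <= A * (M / real N)" by (rule 4[OF _ rR]) (use M0 in simp)
   moreover have "Lip f * (M / real N + 2 * dl) * Lip pj * vlen c 0 1 <= A * (M / real N + 2 * dl)"
    by (rule 4[OF _ cR]) (use M0 dl in simp)
   moreover have "Lip f * dl * Lip pj * vlen r 0 1 <= A * dl" by (rule 4[OF _ rR]) (use dl in simp)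
   ultimately show ?thesis using 1 2 3 by linarith
  qed
  also have "... = 2 * (A * M) / real N + (C - 1) * dl" by (simp add: C_def algebra_simps)
  also have "... < e / 2 + e / 2"
  proof (rule add_less_le_mono)
   show "2 * (A * M) / real N < e / 2" using N N0 e by (simp add: field_simps)
   have "(C - 1) * dl <= C * dl" using dl by simp
   also have "... = e / 2" using C0 by (simp add: dl_def)
   finally show "(C - 1) * dl <= e / 2" .
  qed
  finally show "\<bar>curve_integral r f pj - curve_integral c f pj\<bar> < e" by simp
 qed
qed

section \<open>Classes of curves and their Borel structure\<close>

lemma lip_rep_curve: "lip_curve (rep_curve th)"
 using Quotient3_rep_reflp[OF Quotient3_curve, of th] by (simp add: curve_equiv_def)

lemma rep_abs_curve: "lip_curve c ==> curve_equiv (rep_curve (abs_curve c)) c"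
 by (rule Quotient3_rep_abs[OF Quotient3_curve]) (simp add: curve_equiv_def curve_dist_refl)

lemma dist_curve_rep: "dist th th' = curve_dist (rep_curve th) (rep_curve th')"
 by (rule dist_curve.rep_eq)

definition near :: "(real => 'a::metric_space) => (real => 'a) => (real => real) => real => bool" where
 "near r c ph d \<longleftrightarrow> lip_curve c & ph : increasing_bijections & (ALL t:{0..1}. dist (r t) (c (ph t)) <= d)"

lemma near_of_dist:
 assumes "lip_curve r" "lip_curve c" "curve_dist r c < d" shows "EX ph. near r c ph d"
 using curve_dist_witness[OF assms] assms(2) unfolding near_def by metis

text \<open>Stable properties of curves define open, parameterization independent conditions on classes.\<close>

definition stable :: "((real => 'a::metric_space) => bool) => bool" where
 "stable P \<longleftrightarrow> (ALL r. lip_curve r & P r --> (EX d>0. ALL c ph. near r c ph d --> P c))"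

text \<open>Equivalent curves are within every positive tolerance of each other after
  reparameterization, in both directions.\<close>

lemma stable_equiv:
 assumes "stable P" "curve_equiv r c" shows "P r \<longleftrightarrow> P c"
proof -
 have *: "P c" if rc: "P r" "lip_curve r" "lip_curve c" "curve_dist r c = 0" for r c
 proof -
  obtain d where d: "d > 0" "!!c ph. near r c ph d ==> P c" using assms(1) rc unfolding stable_def by blast
  thus ?thesis using near_of_dist[of r c d] rc by force
 qed
 show ?thesis using * assms(2) curve_dist_sym unfolding curve_equiv_def by metis
qed

lemma stable_open:
 assumes "stable P" shows "open {th. P (rep_curve th)}"
 unfolding open_dist
proof (intro ballI)
 fix th assume "th : {th. P (rep_curve th)}"
 then obtain d where d: "d > 0" "!!c ph. near (rep_curve th) c ph d ==> P c"
  using assms lip_rep_curve unfolding stable_def by blast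
 have "P (rep_curve th')" if "dist th' th < d" for th'
  using near_of_dist[OF lip_rep_curve[of th] lip_rep_curve[of th'], of d] that d(2)
  by (auto simp: dist_curve_rep[symmetric] dist_commute)
 thus "EX e>0. ALL y. dist y th < e --> y : {th. P (rep_curve th)}" using d(1) by auto
qed

text \<open>Lower semicontinuity of length on a subinterval: a subdivision with variation above
  \<open>a\<close> is carried over by \<open>ph\<close>, each of its \<open>n\<close> terms losing
  at most \<open>2 d\<close>.\<close>

lemma vlen_lower_near:
 assumes r: "lip_curve r" and st: "0 <= s" "s <= t" "t <= 1" and a: "a < vlen r s t"
 obtains d where "d > 0" "!!c ph. near r c ph d ==> a < vlen c (ph s) (ph t)"
proof -
 obtain n u where u: "part_points s t n u" "a < part_sum r n u" using vlen_witness[OF st(2) a] by blast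
 define d where "d = (part_sum r n u - a) / 2 / (2 * real n + 1)"
 have d0: "d > 0" using u(2) by (simp add: d_def)
 have dn: "2 * real n * d < part_sum r n u - a"
 proof -
  have "2 * real n * d <= (2 * real n + 1) * d" using d0 by (intro mult_right_mono) auto
  also have "... = (part_sum r n u - a) / 2"
   unfolding d_def using of_nat_0_le_iff[of n, where ?'a = real] by (subst times_divide_eq_right, subst nonzero_mult_div_cancel_left) auto
  finally show ?thesis using u(2) by (simp add: field_simps)
 qed
 show ?thesis
 proof (rule that[OF d0])
  fix c ph assume "near r c ph d"
  hence c: "lip_curve c" and ph: "ph : increasing_bijections" and cl: "!!t. t : {0..1} ==> dist (r t) (c (ph t)) <= d"
   by (auto simp: near_def)
  note php = incbij_ends[OF ph] increasing_bijections_mem[OF ph]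
  obtain L where L: "L-lipschitz_on {0..1} c" using c by (auto simp: lip_curve_def)
  have ui: "0 <= u i & s <= u i & u i <= t & u i <= 1" if "i <= n" for i
   using u(1) st that unfolding part_points_def by force
  have pp: "part_points (ph s) (ph t) n (%i. ph (u i))"
   unfolding part_points_def
  proof (intro conjI allI impI)
   fix i assume "i <= n"
   thus "ph s <= ph (u i)" "ph (u i) <= ph t" using ui st by (auto intro!: php(3))
  next
   fix i assume "i < n"
   thus "ph (u i) <= ph (u (Suc i))" using ui[of i] ui[of "Suc i"] u(1) by (auto intro!: php(3) simp: part_points_def)
  qed
  have "part_sum r n u <= part_sum c n (%i. ph (u i)) + (\<Sum>i<n. 2 * d)"
   unfolding part_sum_def sum.distrib[symmetric]
  proof (rule sum_mono)
   fix i assume "i : {..<n}"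
   hence "dist (r (u i)) (c (ph (u i))) <= d" "dist (r (u (Suc i))) (c (ph (u (Suc i)))) <= d"
    using ui[of i] ui[of "Suc i"] by (auto intro!: cl)
   thus "dist (r (u i)) (r (u (Suc i))) <= dist (c (ph (u i))) (c (ph (u (Suc i)))) + 2 * d"
    using dist_triangle[of "r (u i)" "r (u (Suc i))" "c (ph (u i))"]
     dist_triangle2[of "c (ph (u i))" "r (u (Suc i))" "c (ph (u (Suc i)))"] by linarith
  qed
  hence "a < part_sum c n (%i. ph (u i))" using dn by simp
  also have "... <= vlen c (ph s) (ph t)"
  proof (rule vlen_upper[OF L _ _ _ pp])
   show "ph s <= ph t" by (rule php(3)[OF st])
   show "0 <= ph s" "ph t <= 1" using php(5)[of s] php(5)[of t] st by auto
  qed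
  finally show "a < vlen c (ph s) (ph t)" .
 qed
qed

lemma stable_vlen: "stable (%r. a < vlen r 0 1)"
 unfolding stable_def
proof (intro allI impI)
 fix r :: "real => 'a" assume "lip_curve r & a < vlen r 0 1"
 then obtain d where d: "d > 0" "!!c ph. near r c ph d ==> a < vlen c (ph 0) (ph 1)"
  using vlen_lower_near[of r 0 1 a] by auto
 hence "a < vlen c 0 1" if "near r c ph d" for c ph
  using d(2)[OF that] incbij_ends(1,2)[of ph] that by (simp add: near_def)
 thus "EX d>0. ALL c ph. near r c ph d --> a < vlen c 0 1" using d(1) by blast
qed

text \<open>A quantitative failure of injectivity up to constancy: a long piece with close ends.
  Both inequalities are strict, which makes the condition stable.\<close>

definition self_approach :: "real => real => (real => 'a::metric_space) => bool" where
 "self_approach kap dl r \<longleftrightarrow> (EX s t. 0 <= s & s <= t & t <= 1 & kap < vlen r s t & dist (r s) (r t) < dl)"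

lemma stable_self_approach: "stable (self_approach kap dl)"
 unfolding stable_def
proof (intro allI impI)
 fix r :: "real => 'a" assume "lip_curve r & self_approach kap dl r"
 then obtain s t where r: "lip_curve r" and st: "0 <= s" "s <= t" "t <= 1" "kap < vlen r s t" "dist (r s) (r t) < dl"
  by (auto simp: self_approach_def)
 obtain d where d: "d > 0" "!!c ph. near r c ph d ==> kap < vlen c (ph s) (ph t)"
  using vlen_lower_near[OF r st(1-4)] by blast
 define e where "e = min d ((dl - dist (r s) (r t)) / 3)"
 have e: "e > 0" "e <= d" "3 * e <= dl - dist (r s) (r t)" using d(1) st(5) by (auto simp: e_def min_def)
 have "self_approach kap dl c" if n: "near r c ph e" for c ph
 proof -
  have ph: "ph : increasing_bijections" using n by (simp add: near_def)
  have "near r c ph d" using n e(2) by (force simp: near_def)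
  hence "kap < vlen c (ph s) (ph t)" by (rule d(2))
  moreover have "dist (r s) (c (ph s)) <= e" "dist (r t) (c (ph t)) <= e" using n st by (auto simp: near_def)
  hence "dist (c (ph s)) (c (ph t)) < dl"
   using dist_triangle3[of "c (ph s)" "c (ph t)" "r s"] dist_triangle[of "r s" "c (ph t)" "r t"] e by linarith
  moreover have "0 <= ph s" "ph s <= ph t" "ph t <= 1"
   using incbij_ends(3)[OF ph st(1-3)] increasing_bijections_mem[OF ph, of s] increasing_bijections_mem[OF ph, of t] st by auto
  ultimately show ?thesis unfolding self_approach_def by blast
 qed
 thus "EX d>0. ALL c ph. near r c ph d --> self_approach kap dl c" using e(1) by blast
qed

lemma curve_length_vlen: "curve_length th = vlen (rep_curve th) 0 1"
proof -
 obtain M where "M-lipschitz_on {0..1} (rep_curve th)" using lip_rep_curve[of th] by (auto simp: lip_curve_def)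
 from vlen_props(5)[OF this] show ?thesis by (simp add: curve_length_def)
qed

lemma curve_length_abs: assumes "lip_curve c" shows "curve_length (abs_curve c) = vlen c 0 1"
proof -
 have "a < vlen (rep_curve (abs_curve c)) 0 1 \<longleftrightarrow> a < vlen c 0 1" for a
  by (rule stable_equiv[OF stable_vlen rep_abs_curve[OF assms]])
 thus ?thesis unfolding curve_length_vlen by (meson linorder_neqE_linordered_idom order_less_irrefl)
qed

lemma curve_length_open: "open {th. a < curve_length th}"
 unfolding curve_length_vlen by (rule stable_open[OF stable_vlen])

lemma curve_length_measurable: "curve_length : borel_measurable borel"
 by (rule borel_measurableI_greater) (use borel_open[OF curve_length_open] in simp)

lemma curve_integral_equiv:
 assumes e: "curve_equiv r c" and f: "f : Lipb_funs" and pj: "pj : Lip_funs"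
 shows "curve_integral r f pj = curve_integral c f pj"
proof (rule ccontr)
 assume "curve_integral r f pj ~= curve_integral c f pj"
 hence g: "\<bar>curve_integral r f pj - curve_integral c f pj\<bar> > 0" by simp
 have l: "lip_curve r" "lip_curve c" "curve_dist r c = 0" using e by (auto simp: curve_equiv_def)
 obtain M where M: "M-lipschitz_on {0..1} r" using l by (auto simp: lip_curve_def)
 obtain dl where dl: "dl > 0" "!!c' ph. lip_curve c' ==> ph : increasing_bijections ==> vlen c' 0 1 <= max (vlen r 0 1) (vlen c 0 1) ==>
   (!!t. t : {0..1} ==> dist (r t) (c' (ph t)) <= dl) ==> \<bar>curve_integral r f pj - curve_integral c' f pj\<bar> < \<bar>curve_integral r f pj - curve_integral c f pj\<bar>"
  by (rule curve_integral_continuous[OF M f pj max.cobounded1[of _ "vlen c 0 1"] g]) (rule that, assumption, blast)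
 obtain ph where "near r c ph dl" using near_of_dist[OF l(1,2), of dl] l(3) dl(1) by auto
 thus False using dl(2)[of c ph] by (auto simp: near_def)
qed

lemma Lip_tuples_1: "pj : Lip_tuples 1 \<longleftrightarrow> (EX p:Lip_funs. pj = [p])"
 by (auto simp: Lip_tuples_def length_Suc_conv)

lemma curve_current_single:
 "f : Lipb_funs ==> p : Lip_funs ==> curve_current th f [p] = curve_integral (rep_curve th) f p"
 unfolding curve_current_def curve_integral_def using Lip_tuples_1[of "[p]"] by simp

lemma curve_current_abs:
 "lip_curve c ==> f : Lipb_funs ==> p : Lip_funs ==> curve_current (abs_curve c) f [p] = curve_integral c f p"
 by (simp add: curve_current_single curve_integral_equiv[OF rep_abs_curve])

text \<open>Continuous on each closed set of curves of length at most \<open>n\<close>, though in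
  general not on the whole space; the truncations to these sets converge pointwise.\<close>

lemma curve_current_measurable:
 assumes f: "f : Lipb_funs" and p: "p : Lip_funs"
 shows "(%th. curve_current th f [p]) : borel_measurable borel"
proof -
 let ?F = "%th :: 'a curve. curve_integral (rep_curve th) f p"
 let ?C = "%n. {th :: 'a curve. curve_length th <= real n}"
 have cl: "closed (?C n)" for n
  using curve_length_open[of "real n"] by (simp add: closed_def Collect_neg_eq[symmetric] not_le)
 have cont: "continuous_on (?C n) ?F" for n
  unfolding continuous_on_iff
 proof (intro ballI allI impI)
  fix th :: "'a curve" and e assume th: "th : ?C n" and e: "0 < (e::real)"
  obtain M where M: "M-lipschitz_on {0..1} (rep_curve th)" using lip_rep_curve[of th] by (auto simp: lip_curve_def)
  have v: "vlen (rep_curve th) 0 1 <= real n" using th by (simp add: curve_length_vlen)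
  obtain dl where dl: "dl > 0" "!!c ph. lip_curve c ==> ph : increasing_bijections ==> vlen c 0 1 <= real n ==>
    (!!t. t : {0..1} ==> dist (rep_curve th t) (c (ph t)) <= dl) ==> \<bar>?F th - curve_integral c f p\<bar> < e"
   by (rule curve_integral_continuous[OF M f p v e]) (rule that, assumption, blast)
  have "dist (?F th') (?F th) < e" if th': "th' : ?C n" "dist th' th < dl" for th'
  proof -
   obtain ph where "near (rep_curve th) (rep_curve th') ph dl"
    using near_of_dist[OF lip_rep_curve[of th] lip_rep_curve[of th'], of dl] th'(2)
    by (auto simp: dist_curve_rep[symmetric] dist_commute)
   hence "\<bar>?F th - ?F th'\<bar> < e" using dl(2)[of "rep_curve th'" ph] th'(1) by (auto simp: near_def curve_length_vlen)
   thus ?thesis by (simp add: dist_real_def abs_minus_commute)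
  qed
  thus "EX d>0. ALL x':?C n. dist x' th < d --> dist (?F x') (?F th) < e" using dl(1) by blast
 qed
 have "?F : borel_measurable borel"
 proof (rule borel_measurable_LIMSEQ_metric)
  show "(%th. indicator (?C n) th *\<^sub>R ?F th) : borel_measurable borel" for n
   by (rule borel_measurable_continuous_on_indicator[OF _ cont]) (use cl in simp)
  fix th :: "'a curve"
  obtain N :: nat where N: "curve_length th <= real N" using real_arch_simple by blast
  have "indicator (?C n) th *\<^sub>R ?F th = ?F th" if "N <= n" for n using N that by (auto simp: indicator_def)
  thus "(%n. indicator (?C n) th *\<^sub>R ?F th) \<longlonglongrightarrow> ?F th"
   by (intro tendsto_eventually) (auto simp: eventually_sequentially)
 qed
 thus ?thesis using f p by (simp add: curve_current_single)
qed

text \<open>Increasing bijections fix \<open>0\<close> and \<open>1\<close>, so the endpoint maps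
  are 1-Lipschitz.\<close>

lemma endpoint_continuous:
 assumes "i = 0 \<or> i = 1" shows "continuous_on UNIV (endpoint i :: 'a::metric_space curve => 'a)"
proof -
 have *: "dist (r i) (c i) <= curve_dist r c" if lip: "lip_curve r" "lip_curve c" for r c :: "real => 'a"
 proof (rule field_le_epsilon)
  fix e :: real assume "0 < e"
  then obtain ph where n: "near r c ph (curve_dist r c + e)" using near_of_dist[OF lip, of "curve_dist r c + e"] by auto
  have "ph i = i" using assms incbij_ends(1,2)[of ph] n by (auto simp: near_def)
  thus "dist (r i) (c i) <= curve_dist r c + e" using assms n unfolding near_def by (metis atLeastAtMost_iff order_refl zero_le_one)
 qed
 have "1-lipschitz_on UNIV (endpoint i :: 'a curve => 'a)"
  by (rule lipschitz_onI) (use * lip_rep_curve in \<open>auto simp: endpoint_def dist_curve_rep\<close>)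
 thus ?thesis by (rule lipschitz_on_continuous_on)
qed

lemma endpoint_abs:
 assumes "i = 0 \<or> i = 1" "lip_curve c" shows "endpoint i (abs_curve c) = c i"
proof -
 let ?r = "rep_curve (abs_curve c)"
 have e: "lip_curve ?r" "curve_dist ?r c = 0" using rep_abs_curve[OF assms(2)] by (auto simp: curve_equiv_def)
 have "dist (?r i) (c i) <= e" if "e > 0" for e
 proof -
  obtain ph where n: "near ?r c ph e" using near_of_dist[OF e(1) assms(2), of e] e(2) \<open>e > 0\<close> by auto
  have "ph i = i" using assms incbij_ends(1,2)[of ph] n by (auto simp: near_def)
  thus ?thesis using assms n unfolding near_def by (metis atLeastAtMost_iff order_refl zero_le_one)
 qed
 hence "dist (?r i) (c i) <= 0" by (rule dense_ge)
 thus ?thesis by (simp add: endpoint_def)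
qed

text \<open>The image under the curve of the metric derivative times Lebesgue measure controls the
  current, and its total mass is the length. The mass itself may be smaller, as a curve can cancel
  itself.\<close>

lemma curve_current_control:
 fixes th :: "'a::metric_space curve"
 obtains nu where "controls 1 (curve_current th) nu" "emeasure nu UNIV = ennreal (curve_length th)"
  and "linear_first 1 (curve_current th)"
proof -
 define r where "r = rep_curve th"
 obtain M where r: "M-lipschitz_on {0..1} r" using lip_rep_curve[of th] by (auto simp: lip_curve_def r_def)
 have M0: "0 <= M" by (rule lipschitz_on_nonneg[OF r])
 obtain m where m: "m : borel_measurable borel" "!!t. 0 <= m t" "!!t. m t <= M"
  "!!a b. 0 <= a ==> a <= b ==> b <= 1 ==> vlen r a b = (LINT t:{a..b}|lborel. m t)"
  "!!pj. pj : Lip_funs ==> EX h. curve_slope r m pj h"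
  by (rule curve_derivatives[OF r]) (rule that)
 define c where "c t = r (max 0 (min 1 t))" for t
 have cm: "c : borel_measurable borel"
  unfolding c_def by (rule borel_measurable_continuous_onI[OF lipschitz_on_continuous_on[OF clamp_lipschitz[OF r]]])
 let ?w = "%t. indicator {0..1} t * m t"
 have wm: "?w : borel_measurable borel" using m(1) by simp
 have mi: "set_integrable lborel {0..1} m" by (rule set_integrable_bounded_interval[OF m(1), of M]) (use m in auto)
 define nu where "nu = distr (density lborel (%t. ennreal (?w t))) borel c"
 have cm': "c : measurable (density lborel (%t. ennreal (?w t))) borel" using cm by simp
 have tot: "emeasure nu UNIV = ennreal (curve_length th)"
 proof -
  have "emeasure nu UNIV = (\<integral>\<^sup>+t. ennreal (?w t) \<partial>lborel)"
   unfolding nu_def using wm by (subst emeasure_distr[OF cm']) (auto simp: emeasure_density)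
  also have "... = ennreal (LINT t|lborel. ?w t)"
   by (rule nn_integral_eq_integral) (use mi m(2) in \<open>auto simp: set_integrable_def\<close>)
  also have "(LINT t|lborel. ?w t) = curve_length th"
   using m(4)[of 0 1] by (simp add: set_lebesgue_integral_def curve_length_vlen r_def)
  finally show ?thesis .
 qed
 have nu: "fbm nu" unfolding fbm_def
  by (intro conjI finite_measureI) (use tot in \<open>auto simp: nu_def\<close>)
 have nui: "(LINT x|nu. g x) = (LINT t:{0..1}|lborel. g (c t) * m t)" if g: "g : borel_measurable borel" for g :: "'a => real"
 proof -
  have "(LINT x|nu. g x) = (LINT t|(density lborel (%t. ennreal (?w t))). g (c t))"
   unfolding nu_def by (rule integral_distr[OF cm' g])
  also have "... = (LINT t|lborel. ?w t *\<^sub>R g (c t))"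
   by (rule integral_density) (use g cm wm m(2) in auto)
  also have "... = (LINT t:{0..1}|lborel. g (c t) * m t)" unfolding set_lebesgue_integral_def
   by (rule Bochner_Integration.integral_cong) (auto simp: mult_ac)
  finally show ?thesis .
 qed
 have key: "EX h. (ALL f:Lipb_funs. set_integrable lborel {0..1} (%t. f (c t) * h t) & curve_current th f [p] = (LINT t:{0..1}|lborel. f (c t) * h t))
   & (ALL t. \<bar>h t\<bar> <= Lip p * m t)" if p: "p : Lip_funs" for p
 proof -
  obtain h where h: "h : borel_measurable borel" "!!t. \<bar>h t\<bar> <= Lip p * m t"
   "!!f. f : Lip_funs ==> curve_integral r f p = (LINT t:{0..1}|lborel. f (r (max 0 (min 1 t))) * h t)"
   using m(5)[OF p] unfolding curve_slope_def by blast
  have "set_integrable lborel {0..1} (%t. f (c t) * h t) & curve_current th f [p] = (LINT t:{0..1}|lborel. f (c t) * h t)"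
   if f: "f : Lipb_funs" for f
  proof
   obtain B where B: "0 <= B" "!!x. \<bar>f x\<bar> <= B" using LipbE[OF f] by metis
   show "set_integrable lborel {0..1} (%t. f (c t) * h t)"
   proof (rule set_integrable_bounded_interval)
    show "(%t. f (c t) * h t) : borel_measurable borel" using Lipb_measurable[OF f] cm h(1) by measurable
    show "\<bar>f (c t) * h t\<bar> <= B * (Lip p * M)" for t unfolding abs_mult
     by (intro mult_mono B order_trans[OF h(2)] mult_left_mono m(3) Lip_nonneg[OF p]) simp
   qed
   show "curve_current th f [p] = (LINT t:{0..1}|lborel. f (c t) * h t)"
    using h(3)[OF Lipb_Lip[OF f]] f p by (simp add: curve_current_single r_def c_def)
  qed
  thus ?thesis using h(2) by blast
 qed
 have "controls 1 (curve_current th) nu"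
  unfolding controls_iff
 proof (intro conjI ballI nu)
  fix f :: "'a => real" and pj :: "('a => real) list" assume f: "f : Lipb_funs" and "pj : Lip_tuples 1"
  then obtain p where p: "p : Lip_funs" "pj = [p]" using Lip_tuples_1 by blast
  obtain h where h: "set_integrable lborel {0..1} (%t. f (c t) * h t)" "curve_current th f [p] = (LINT t:{0..1}|lborel. f (c t) * h t)"
   "!!t. \<bar>h t\<bar> <= Lip p * m t" using key[OF p(1)] f by blast
  have "\<bar>curve_current th f [p]\<bar> <= (LINT t:{0..1}|lborel. \<bar>f (c t) * h t\<bar>)"
   unfolding h(2) set_lebesgue_integral_def
   by (rule order_trans[OF integral_abs_bound]) (auto intro!: eq_refl Bochner_Integration.integral_cong simp: abs_mult)
  also have "... <= (LINT t:{0..1}|lborel. Lip p * (\<bar>f (c t)\<bar> * m t))"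
  proof (rule set_integral_mono)
   show "set_integrable lborel {0..1} (%t. \<bar>f (c t) * h t\<bar>)" by (rule set_integrable_abs[OF h(1)])
   obtain B where B: "0 <= B" "!!x. \<bar>f x\<bar> <= B" using LipbE[OF f] by metis
   show "set_integrable lborel {0..1} (%t. Lip p * (\<bar>f (c t)\<bar> * m t))"
   proof (rule set_integrable_bounded_interval)
    show "(%t. Lip p * (\<bar>f (c t)\<bar> * m t)) : borel_measurable borel" using Lipb_measurable[OF f] cm m(1) by measurable
    show "\<bar>Lip p * (\<bar>f (c t)\<bar> * m t)\<bar> <= Lip p * (B * M)" for t
     using Lip_nonneg[OF p(1)] m(2)[of t] m(3)[of t] B by (simp add: abs_mult mult_mono mult_left_mono)
   qed
   fix t show "\<bar>f (c t) * h t\<bar> <= Lip p * (\<bar>f (c t)\<bar> * m t)"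
    using mult_left_mono[OF h(3)[of t], of "\<bar>f (c t)\<bar>"] by (simp add: abs_mult mult_ac)
  qed
  also have "... = Lip_prod pj * (LINT x|nu. \<bar>f x\<bar>)"
   using nui[of "%x. \<bar>f x\<bar>"] Lipb_measurable[OF f] by (simp add: p(2) Lip_prod_def)
  finally show "\<bar>curve_current th f pj\<bar> <= Lip_prod pj * (LINT x|nu. \<bar>f x\<bar>)" using p(2) by simp
 qed
 moreover have "linear_first 1 (curve_current th)"
  unfolding linear_first_def
 proof (intro ballI allI)
  fix f g :: "'a => real" and pj :: "('a => real) list" and a b :: real
  assume f: "f : Lipb_funs" and g: "g : Lipb_funs" and "pj : Lip_tuples 1"
  then obtain p where p: "p : Lip_funs" "pj = [p]" using Lip_tuples_1 by blast
  obtain h where h: "!!f. f : Lipb_funs ==> set_integrable lborel {0..1} (%t. f (c t) * h t)"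
   "!!f. f : Lipb_funs ==> curve_current th f [p] = (LINT t:{0..1}|lborel. f (c t) * h t)" using key[OF p(1)] by blast
  have "curve_current th (%x. a * f x + b * g x) [p] = (LINT t:{0..1}|lborel. a * (f (c t) * h t) + b * (g (c t) * h t))"
   using h(2)[OF Lipb_lin[OF f g]] by (simp add: algebra_simps)
  also have "... = a * curve_current th f [p] + b * curve_current th g [p]"
   using h(1)[OF f] h(1)[OF g] by (subst set_integral_add(2)) (auto simp: h(2)[OF f] h(2)[OF g])
  finally show "curve_current th (%x. a * f x + b * g x) pj = a * curve_current th f pj + b * curve_current th g pj" using p(2) by simp
 qed
 ultimately show ?thesis using that tot by blast
qed

lemma mass_curve_current_le: "mass 1 (curve_current th) <= ennreal (curve_length th)"
 by (rule curve_current_control[of th]) (metis mass_le_control)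

lemma dual_le_mass_curve_current:
 assumes "ALL (f, pj):set ps. f : Lipb_funs & pj : Lip_tuples 1" "!!x. (\<Sum>(f, pj)\<leftarrow>ps. \<bar>f x\<bar>) <= 1"
 shows "ennreal (\<Sum>(f, pj)\<leftarrow>ps. curve_current th f pj / Lip_prod pj) <= mass 1 (curve_current th)"
proof -
 obtain nu where nu: "controls 1 (curve_current th) nu" "linear_first 1 (curve_current th)"
  by (rule curve_current_control[of th])
 show ?thesis unfolding mass_eq[OF nu(2,1)]
  by (intro ennreal_leI dual_le_control[OF mass_measure_props(1)[OF nu(2,1)] assms])
qed

text \<open>The arclength reparameterization of an injective-up-to-constancy curve is only a uniform limit of
  reparameterizations by bijections, which is what \<open>d\<^sub>\<Theta> = 0\<close> asks for.\<close>

lemma is_arcI: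
 assumes len: "curve_length th > 0"
  and sep: "!!k::nat. EX m::nat. ~ self_approach (1 / Suc k) (1 / Suc m) (rep_curve th)"
 shows "is_arc th"
proof -
 define r where "r = rep_curve th"
 obtain M where r: "M-lipschitz_on {0..1} r" using lip_rep_curve[of th] by (auto simp: lip_curve_def r_def)
 note vp = vlen_props[OF r]
 define V where "V = vlen r 0 1"
 have V: "V > 0" using len by (simp add: V_def curve_length_vlen r_def)
 define v where "v t = vlen r 0 t" for t
 have v0: "v 0 = 0" using vp(1,2)[of 0 0] by (simp add: v_def)
 have v1: "v 1 = V" by (simp add: v_def V_def)
 have vd: "vlen r s t = v t - v s" if "0 <= s" "s <= t" "t <= 1" for s t using vp(3)[of 0 s t] that by (simp add: v_def)
 have vmono: "v s <= v t" if "0 <= s" "s <= t" "t <= 1" for s t using vd[OF that] vp(1)[OF that] by simp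
 have vl: "M-lipschitz_on {0..1} v"
 proof (rule lipschitz_onI[OF _ lipschitz_on_nonneg[OF r]])
  have *: "dist (v x) (v y) <= M * dist x y" if "0 <= x" "x <= y" "y <= 1" for x y
   using vd[OF that] vp(2)[OF that] vmono[OF that] that by (simp add: dist_real_def)
  fix x y :: real assume "x : {0..1}" "y : {0..1}"
  thus "dist (v x) (v y) <= M * dist x y" using *[of x y] *[of y x] by (cases "x <= y") (auto simp: dist_commute)
 qed
 have vc: "continuous_on {0..1} v" by (rule lipschitz_on_continuous_on[OF vl])
 have "EX t. 0 <= t & t <= 1 & v t = V * s" if "s : {0..1}" for s
  using IVT'[of v 0 "V * s" 1] that V vc v0 v1 by auto
 \<comment> \<open>A right inverse of the length function, chosen pointwise. Where \<open>v\<close>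
   is constant so is \<open>r\<close>, hence the choice does not affect \<open>c\<close>.\<close>
 then obtain tau where tau: "!!s. s : {0..1} ==> 0 <= tau s & tau s <= 1 & v (tau s) = V * s" by metis
 have rd: "dist (r s) (r t) <= \<bar>v s - v t\<bar>" if "0 <= s" "s <= 1" "0 <= t" "t <= 1" for s t
  using vp(4)[of s t] vp(4)[of t s] vd[of s t] vd[of t s] that by (cases "s <= t") (auto simp: dist_commute)
 define c where "c s = r (tau s)" for s
 have cl: "V-lipschitz_on {0..1} c"
 proof (rule lipschitz_onI)
  fix x y :: real assume xy: "x : {0..1}" "y : {0..1}"
  have "dist (c x) (c y) <= \<bar>V * x - V * y\<bar>" unfolding c_def using rd[of "tau x" "tau y"] tau[OF xy(1)] tau[OF xy(2)] by simp
  also have "... = V * dist x y" using V by (simp add: dist_real_def right_diff_distrib[symmetric] abs_mult)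
  finally show "dist (c x) (c y) <= V * dist x y" .
 qed (use V in simp)
 have lc: "lip_curve c" "lip_curve r" using cl r by (auto simp: lip_curve_def)
 have v01: "v t / V : {0..1}" if "t : {0..1}" for t using vmono[of 0 t] vmono[of t 1] that V v0 v1 by auto
 have rc: "r t = c (v t / V)" if "t : {0..1}" for t
  using rd[of t "tau (v t / V)"] tau[OF v01[OF that]] that V by (simp add: c_def)
 have "inj_on c {0..1}"
 proof -
  have *: "c x ~= c y" if xy: "0 <= x" "x < y" "y <= 1" for x y
  proof -
   have tau': "0 <= tau x" "v (tau x) = V * x" "tau y <= 1" "v (tau y) = V * y" "0 <= tau y" "tau x <= 1" using tau[of x] tau[of y] xy by auto
   have le: "tau x <= tau y"
   proof (rule ccontr)
    assume "~ tau x <= tau y"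
    hence "V * y <= V * x" using vmono[of "tau y" "tau x"] tau' by auto
    thus False using V xy by simp
   qed
   have "0 < V * y - V * x" using V xy by simp
   then obtain k where k: "1 / real (Suc k) < V * y - V * x" using nat_approx_posE by blast
   obtain m :: nat where m: "~ self_approach (1 / Suc k) (1 / Suc m) r" using sep unfolding r_def by blast
   have "1 / real (Suc k) < vlen r (tau x) (tau y)" using k vd[of "tau x" "tau y"] tau' le by simp
   hence "~ dist (r (tau x)) (r (tau y)) < 1 / real (Suc m)" using m le tau' unfolding self_approach_def by blast
   thus ?thesis by (auto simp: c_def)
  qed
  show ?thesis
  proof (rule inj_onI)
   fix x y :: real assume xy: "x : {0..1}" "y : {0..1}" "c x = c y"
   thus "x = y" using *[of x y] *[of y x] by (cases x y rule: linorder_cases) auto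
  qed
 qed
 moreover have "curve_dist r c <= e" if e: "e > 0" for e
 proof -
  obtain n where n: "1 / real (Suc n) < e / V" using nat_approx_posE[of "e / V"] e V by auto
  \<comment> \<open>\<open>v / V\<close> need not be injective, so a fraction \<open>q\<close> of
    the identity is mixed in. This moves parameters by at most \<open>q\<close>, and
    \<open>c\<close> is \<open>V\<close>-Lipschitz.\<close>
  define q where "q = 1 / real (Suc n)"
  have q: "0 < q" "q <= 1" "V * q < e" using n V by (auto simp: q_def field_simps)
  define ph where "ph t = (1 - q) * (v t / V) + q * t" for t
  have sm: "strict_mono_on {0..1} ph"
  proof (rule strict_mono_onI)
   fix x y :: real assume xy: "x : {0..1}" "y : {0..1}" "x < y"
   have "(1 - q) * (v x / V) <= (1 - q) * (v y / V)" using vmono[of x y] xy q V by (intro mult_left_mono divide_right_mono) auto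
   moreover have "q * x < q * y" using q xy by simp
   ultimately show "ph x < ph y" by (simp add: ph_def)
  qed
  have ph01: "ph 0 = 0" "ph 1 = 1" using v0 v1 V by (auto simp: ph_def)
  have "ph ` {0..1} = {0..1}"
  proof
   show "ph ` {0..1} \<subseteq> {0..1}"
    using strict_mono_on_leD[OF sm, of 0] strict_mono_on_leD[OF sm, of _ 1] ph01 by force
   have cph: "continuous_on {0..1} ph" unfolding ph_def using vc V by (intro continuous_intros) auto
   show "{0..1} \<subseteq> ph ` {0..1}"
   proof
    fix y :: real assume "y : {0..1}"
    then obtain x where "0 <= x" "x <= 1" "ph x = y" using IVT'[of ph 0 y 1] cph ph01 by auto
    thus "y : ph ` {0..1}" by auto
   qed
  qed
  hence ib: "ph : increasing_bijections"
   using sm strict_mono_on_imp_inj_on[OF sm] by (simp add: increasing_bijections_def bij_betw_def)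
  show ?thesis
  proof (rule curve_dist_upper[OF lc(2,1) ib])
   fix t :: real assume t: "t : {0..1}"
   have "dist (r t) (c (ph t)) <= V * dist (v t / V) (ph t)"
    unfolding rc[OF t] by (rule lipschitz_onD[OF cl v01[OF t] increasing_bijections_mem[OF ib t]])
   also have "dist (v t / V) (ph t) = q * \<bar>v t / V - t\<bar>"
   proof -
    have "w - ((1 - q) * w + q * t) = q * (w - t)" for w by (simp add: algebra_simps)
    thus ?thesis using q by (simp only: dist_real_def ph_def abs_mult abs_of_pos)
   qed
   also have "... <= q * 1" using v01[OF t] t q by (intro mult_left_mono) auto
   finally show "dist (r t) (c (ph t)) <= e" using q V by (smt (verit) mult_left_mono mult.right_neutral)
  qed
 qed
 hence "curve_dist r c <= 0" by (rule dense_ge)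
 hence "curve_equiv r c" using curve_dist_nonneg[OF lc(2,1)] lc by (simp add: curve_equiv_def)
 ultimately show ?thesis unfolding is_arc_def r_def by blast
qed

lemma self_approach_abs: "lip_curve c ==> self_approach kap dl (rep_curve (abs_curve c)) \<longleftrightarrow> self_approach kap dl c"
 by (rule stable_equiv[OF stable_self_approach rep_abs_curve])

section \<open>Arclength parameterization of paths\<close>

definition psum :: "'a::metric_space list => nat => real" where
 "psum p j = (\<Sum>i<j. dist (p ! i) (p ! Suc i))"

abbreviation plen :: "'a::metric_space list => real" where
 "plen p \<equiv> psum p (length p - 1)"

lemma psum_simps [simp]: "psum p 0 = 0" "psum p (Suc j) = psum p j + dist (p ! j) (p ! Suc j)"
 by (simp_all add: psum_def)

lemma psum_mono: "i <= j ==> psum p i <= psum p j"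
 unfolding psum_def by (rule sum_mono2) auto

lemma psum_nonneg: "0 <= psum p j"
 by (simp add: psum_def sum_nonneg)

lemma sum_block: "a <= b ==> (\<Sum>j\<in>{a..<b}. (F (Suc j) - F j :: real)) = F b - F a"
 by (induct b rule: dec_induct) auto

lemma psum_block: "a <= b ==> (\<Sum>j\<in>{a..<b}. dist (p ! j) (p ! Suc j)) = psum p b - psum p a"
 using sum_block[of a b "psum p"] by simp

lemma dist_psum: "a <= b ==> dist (p ! a) (p ! b) <= psum p b - psum p a"
proof (induct b rule: dec_induct)
 case (step n)
 thus ?case using dist_triangle[of "p ! a" "p ! Suc n" "p ! n"] by simp
qed simp

lemma path_cost_1: "path_cost (%_. 1) p = plen p"
 by (simp add: path_cost_def psum_def)

text \<open>The last vertex reached within the fraction \<open>t\<close> of the length. The clause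
  for \<open>t <= 0\<close> forces index \<open>0\<close> even when initial edges have length
  zero.\<close>

definition idx :: "'a::metric_space list => real => nat" where
 "idx p t = (if t <= 0 then 0 else Max {j. j <= length p - 1 & psum p j <= t * plen p})"

definition pt :: "'a::metric_space list => real => 'a" where
 "pt p t = p ! idx p t"

lemma idx_props:
 assumes p: "chain eps p" and eps: "eps > 0"
 shows "idx p 0 = 0" "idx p 1 = length p - 1"
  and "0 <= t ==> idx p t <= length p - 1"
  and "0 <= s ==> s <= t ==> idx p s <= idx p t"
  and "0 <= t ==> t <= 1 ==> \<bar>psum p (idx p t) - t * plen p\<bar> <= eps"
proof -
 let ?J = "%t. {j. j <= length p - 1 & psum p j <= t * plen p}"
 have fin: "finite (?J t)" for t by (rule finite_subset[of _ "{..length p - 1}"]) auto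
 have ne: "0 : ?J t" if "0 <= t" for t using psum_nonneg[of p] that by simp
 have mx: "idx p t : ?J t" "!!j. j : ?J t ==> j <= idx p t" if "0 < t" for t
 proof -
  have e: "idx p t = Max (?J t)" using that by (simp add: idx_def)
  have n: "?J t ~= {}" using ne[of t] that by (metis empty_iff less_imp_le)
  show "idx p t : ?J t" unfolding e by (rule Max_in[OF fin n])
  show "j <= idx p t" if "j : ?J t" for j unfolding e by (rule Max_ge[OF fin that])
 qed
 show 0: "idx p 0 = 0" by (simp add: idx_def)
 show le: "idx p t <= length p - 1" if "0 <= t" for t
  using mx(1)[of t] 0 that by (cases "t = 0") auto
 show "idx p 1 = length p - 1" using mx(2)[of 1 "length p - 1"] mx(1)[of 1] by simp
 show "idx p s <= idx p t" if st: "0 <= s" "s <= t"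
 proof (cases "s = 0")
  case True thus ?thesis using 0 by simp
 next
  case False
  have "psum p (idx p s) <= t * plen p"
   using mx(1)[of s] False st mult_right_mono[of s t "plen p"] psum_nonneg[of p "length p - 1"] by auto
  thus ?thesis using mx(2)[of t "idx p s"] le[of s] False st by simp
 qed
 show "\<bar>psum p (idx p t) - t * plen p\<bar> <= eps" if t: "0 <= t" "t <= 1"
 proof (cases "t = 0")
  case True thus ?thesis using 0 eps by simp
 next
  case False
  hence m: "idx p t : ?J t" using mx(1)[of t] t by simp
  have "t * plen p <= psum p (idx p t) + eps"
  proof (cases "idx p t = length p - 1")
   case True
   thus ?thesis using mult_right_mono[OF t(2) psum_nonneg[of p "length p - 1"]] eps by simp
  next
   case F: False
   hence lt: "idx p t < length p - 1" using m by simp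
   hence "~ Suc (idx p t) <= idx p t & Suc (idx p t) <= length p - 1" by simp
   hence "t * plen p < psum p (Suc (idx p t))" using mx(2)[of t "Suc (idx p t)"] False t lt by fastforce
   moreover have "dist (p ! idx p t) (p ! Suc (idx p t)) < eps" using p lt by (simp add: chain_def)
   ultimately show ?thesis by simp
  qed
  thus ?thesis using m eps by simp
 qed
qed

lemma idx_psum_diff:
 assumes "chain eps p" "eps > 0" "0 <= s" "s <= t" "t <= 1"
 shows "\<bar>psum p (idx p t) - psum p (idx p s) - (t - s) * plen p\<bar> <= 2 * eps"
 using idx_props(5)[OF assms(1,2), of s] idx_props(5)[OF assms(1,2), of t] assms(3-5) by (simp add: left_diff_distrib)

lemma pt_dist:
 assumes "chain eps p" "eps > 0" "0 <= s" "s <= t" "t <= 1"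
 shows "dist (pt p s) (pt p t) <= (t - s) * plen p + 2 * eps"
 using dist_psum[OF idx_props(4)[OF assms(1-4)], of p] idx_psum_diff[OF assms] by (simp add: pt_def)

lemma pt_ends:
 assumes "chain eps p" "eps > 0" shows "pt p 0 = hd p" "pt p 1 = last p"
 using idx_props(1,2)[OF assms] assms by (auto simp: pt_def chain_def hd_conv_nth last_conv_nth)

lemma pt_in:
 assumes "chain eps p" "eps > 0" "0 <= t" shows "pt p t : set p"
proof -
 have "idx p t < length p" using idx_props(3)[OF assms] assms(1) by (cases p) (auto simp: chain_def)
 thus ?thesis by (simp add: pt_def)
qed

text \<open>Edges are grouped into \<open>m\<close> blocks of nearly equal length, with defect
  \<open>2 eps\<close> from the mesh, and \<open>f\<close> is frozen at the start of each block. The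
  result is a finite sum in the points \<open>pt\<close>, whose number no longer grows with the
  chain, so it passes to limits.\<close>

lemma path_form_blocks:
 assumes p: "chain eps p" and eps: "eps > 0" and f: "f : Lip_funs" and pj: "pj : Lip_funs" and m: "m > (0::nat)"
 shows "\<bar>path_form f pj p - (\<Sum>k<m. f (pt p (real k / real m)) * (pj (pt p (real (Suc k) / real m)) - pj (pt p (real k / real m))))\<bar>
  <= Lip f * (plen p / real m + 2 * eps) * Lip pj * plen p"
proof -
 define a where "a k = idx p (real k / real m)" for k
 have a: "a 0 = 0" "a m = length p - 1" "!!k. a k <= a (Suc k)"
  using idx_props[OF p eps] m by (auto simp: a_def divide_right_mono)
 have a0: "k <= n ==> a k <= a n" for k n by (rule lift_Suc_mono_le[of a, OF a(3)])
 note Lf = Lip_nonneg[OF f] and Lp = Lip_nonneg[OF pj]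
 have split: "(\<Sum>j<a n. G j) = (\<Sum>k<n. \<Sum>j\<in>{a k..<a (Suc k)}. (G j :: real))" for n G
 proof (induct n)
  case (Suc n)
  have "(\<Sum>j<a (Suc n). G j) = (\<Sum>j<a n. G j) + (\<Sum>j\<in>{a n..<a (Suc n)}. G j)"
   using sum.atLeastLessThan_concat[of 0 "a n" "a (Suc n)" G] a(3)[of n] by (simp add: atLeast0LessThan)
  thus ?case using Suc by simp
 qed (simp add: a(1))
 let ?d = "%j. dist (p ! j) (p ! Suc j)" and ?\<Delta> = "%j. pj (p ! Suc j) - pj (p ! j)"
 let ?w = "plen p / real m + 2 * eps"
 have blk: "\<bar>(\<Sum>j\<in>{a k..<a (Suc k)}. f (p ! j) * ?\<Delta> j) - f (p ! a k) * (pj (p ! a (Suc k)) - pj (p ! a k))\<bar>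
   <= Lip f * ?w * Lip pj * (psum p (a (Suc k)) - psum p (a k))" if k: "k < m" for k
 proof -
  have w: "psum p (a (Suc k)) - psum p (a k) <= ?w"
  proof -
   have e: "real (Suc k) / real m - real k / real m = 1 / real m" using m by (simp add: field_simps)
   have "real (Suc k) / real m <= 1" "real k / real m <= real (Suc k) / real m" using k m by (auto simp: divide_le_eq divide_right_mono)
   thus ?thesis using idx_psum_diff[OF p eps, of "real k / real m" "real (Suc k) / real m"] unfolding e a_def
    by (simp add: abs_le_iff)
  qed
  have "f (p ! a k) * (pj (p ! a (Suc k)) - pj (p ! a k)) = (\<Sum>j\<in>{a k..<a (Suc k)}. f (p ! a k) * ?\<Delta> j)"
   unfolding sum_distrib_left[symmetric] sum_block[OF a(3)[of k], of "%j. pj (p ! j)"] ..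
  hence "\<bar>(\<Sum>j\<in>{a k..<a (Suc k)}. f (p ! j) * ?\<Delta> j) - f (p ! a k) * (pj (p ! a (Suc k)) - pj (p ! a k))\<bar>
    = \<bar>\<Sum>j\<in>{a k..<a (Suc k)}. (f (p ! j) - f (p ! a k)) * ?\<Delta> j\<bar>" by (simp add: sum_subtractf left_diff_distrib)
  also have "... <= (\<Sum>j\<in>{a k..<a (Suc k)}. (Lip f * ?w) * (Lip pj * ?d j))"
  proof (rule order_trans[OF sum_abs sum_mono])
   fix j assume j: "j : {a k..<a (Suc k)}"
   have "dist (p ! j) (p ! a k) <= psum p j - psum p (a k)" using dist_psum[of "a k" j p] j by (simp add: dist_commute)
   also have "... <= ?w" using w psum_mono[of j "a (Suc k)" p] j by simp
   finally have "\<bar>f (p ! j) - f (p ! a k)\<bar> <= Lip f * ?w"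
    by (intro order_trans[OF Lip_bound[OF f] mult_left_mono[OF _ Lf]])
   moreover have "\<bar>?\<Delta> j\<bar> <= Lip pj * ?d j" using Lip_bound[OF pj, of "p ! Suc j" "p ! j"] by (simp add: dist_commute)
   ultimately show "\<bar>(f (p ! j) - f (p ! a k)) * ?\<Delta> j\<bar> <= (Lip f * ?w) * (Lip pj * ?d j)"
    unfolding abs_mult by (intro mult_mono) auto
  qed
  also have "... = Lip f * ?w * Lip pj * (psum p (a (Suc k)) - psum p (a k))"
   unfolding psum_block[OF a(3)[of k], symmetric] by (simp add: sum_distrib_left mult.assoc)
  finally show ?thesis .
 qed
 have "path_form f pj p = (\<Sum>k<m. \<Sum>j\<in>{a k..<a (Suc k)}. f (p ! j) * ?\<Delta> j)"
  unfolding path_form_def a(2)[symmetric] by (rule split)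
 hence "\<bar>path_form f pj p - (\<Sum>k<m. f (pt p (real k / real m)) * (pj (pt p (real (Suc k) / real m)) - pj (pt p (real k / real m))))\<bar>
   = \<bar>\<Sum>k<m. (\<Sum>j\<in>{a k..<a (Suc k)}. f (p ! j) * ?\<Delta> j) - f (p ! a k) * (pj (p ! a (Suc k)) - pj (p ! a k))\<bar>"
  by (simp add: sum_subtractf pt_def a_def)
 also have "... <= (\<Sum>k<m. Lip f * ?w * Lip pj * (psum p (a (Suc k)) - psum p (a k)))"
  by (rule order_trans[OF sum_abs sum_mono]) (use blk in auto)
 also have "... = Lip f * ?w * Lip pj * plen p"
  unfolding sum_distrib_left[symmetric] using sum_lessThan_telescope[of "%k. psum p (a k)" m] a(1,2) by simp
 finally show ?thesis .
qed

text \<open>While a chain is at distance at least \<open>1 / k\<close> from \<open>K\<close>, every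
  edge costs its full length; so the distance never exceeds \<open>1 / k\<close> plus one edge plus
  the total cost.\<close>

lemma path_near_set:
 assumes p: "chain eps p" and eps: "eps > 0" and k: "k > 0" and h: "infdist (hd p) K <= 1 / k" and y: "y : set p"
 shows "infdist y K <= 1 / k + eps + path_cost (%x. min 1 (k * infdist x K)) p"
proof -
 let ?g = "%x. min 1 (k * infdist x K)"
 have g0: "0 <= ?g x" for x using k infdist_nonneg[of x K] by simp
 have *: "j <= length p - 1 ==> infdist (p ! j) K <= 1 / k + eps + (\<Sum>i<j. ?g (p ! i) * dist (p ! i) (p ! Suc i))" for j
 proof (induct j)
  case 0 thus ?case using h p eps by (simp add: chain_def hd_conv_nth)
 next
  case (Suc j)
  have t: "infdist (p ! Suc j) K <= infdist (p ! j) K + dist (p ! j) (p ! Suc j)"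
   using infdist_triangle[of "p ! Suc j" K "p ! j"] by (simp add: dist_commute)
  have s0: "0 <= (\<Sum>i<j. ?g (p ! i) * dist (p ! i) (p ! Suc i))" by (intro sum_nonneg mult_nonneg_nonneg g0) auto
  show ?case
  proof (cases "1 / k <= infdist (p ! j) K")
   case True
   hence "?g (p ! j) = 1" using k by (simp add: field_simps)
   thus ?thesis using Suc t by simp
  next
   case False
   have "dist (p ! j) (p ! Suc j) < eps" using p Suc.prems by (simp add: chain_def)
   moreover have "0 <= ?g (p ! j) * dist (p ! j) (p ! Suc j)" using g0 by simp
   ultimately show ?thesis using False t s0 by simp
  qed
 qed
 obtain j where j: "j < length p" "y = p ! j" using y by (auto simp: in_set_conv_nth)
 have "(\<Sum>i<j. ?g (p ! i) * dist (p ! i) (p ! Suc i)) <= path_cost ?g p"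
  unfolding path_cost_def by (rule sum_mono2) (use j g0 in auto)
 thus ?thesis using *[of j] j by fastforce
qed

section \<open>Closed selections of edges\<close>

text \<open>The discrete counterpart of \<open>self_approach\<close>. The length condition is not
  strict, so that removing the piece saves at least \<open>kap\<close>.\<close>

definition near_loop :: "real => real => 'a::metric_space list => bool" where
 "near_loop kap dl p \<longleftrightarrow> (EX a b. a <= b & b <= length p - 1 & kap <= psum p b - psum p a & dist (p ! a) (p ! b) < dl)"

lemma Lipb_clip:
 assumes "f : Lip_funs" "0 <= K" shows "(%x. max (- K) (min K (f x))) : Lipb_funs"
proof (rule LipbI[of _ "Lip f" K])
 show "\<bar>max (- K) (min K (f x)) - max (- K) (min K (f y))\<bar> <= Lip f * dist x y" for x y
  using Lip_bound[OF assms(1), of x y] by linarith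
 show "\<bar>max (- K) (min K (f x))\<bar> <= K" for x using assms(2) by linarith
qed

text \<open>Costs are bounded above by integrals against \<open>mu\<close>, and
  \<open>mass_T\<close> gives \<open>mu\<close> exactly the mass of \<open>T\<close>; together they
  leave no room for discarded edges. Tightness serves the existence of limit curves, the mutual
  singularity of \<open>P\<close> and \<open>N\<close> serves their nonconstancy.\<close>

locale transport_limit = loeb_data U nf A c B
 for U :: "'i filter" and nf :: "'i => nat" and A :: "'i => 'a::complete_space list set" and c :: "'i => 'a list => real" and B :: real +
 fixes T :: "'a functional" and mu P N :: "'a measure"
 assumes T: "T : currents 1" and ctrl: "controls 1 T mu" and mass_T: "mass 1 T = emeasure mu UNIV"
  and acyc: "acyclic_current 1 T"
  and chains: "!!i p. p : A i ==> chain (1 / real (Suc (nf i))) p"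
  and lim_form: "!!f pj. f : Lipb_funs ==> pj : Lip_funs ==> ((%i. avg A c i (path_form f pj)) \<longlongrightarrow> T f [pj]) U"
  and lim_cost: "!!ph e. ph : Lipb_funs ==> (!!x. 0 <= ph x) ==> e > 0 ==>
   eventually (%i. avg A c i (path_cost ph) <= (LINT x|mu. ph x) + e) U"
  and lim_start: "!!g. g : Lipb_funs ==> ((%i. avg A c i (%p. g (hd p))) \<longlongrightarrow> (LINT x|N. g x)) U"
  and lim_end: "!!g. g : Lipb_funs ==> ((%i. avg A c i (%p. g (last p))) \<longlongrightarrow> (LINT x|P. g x)) U"
  and PN: "fbm P" "fbm N" "EX S:sets borel. emeasure P (- S) = 0 & emeasure N S = 0"
  and tight: "!!e. e > 0 ==> EX K. compact K & K ~= {} & measure mu (- K) <= e & measure N (- K) <= e"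
begin

text \<open>Selections act on edges and not on whole chains, because a loop has to be cut out of a
  chain whose remainder is kept.\<close>

definition scost :: "('i => 'a list => nat set) => ('a => real) => 'i => 'a list => real" where
 "scost J ph i p = (\<Sum>j\<in>J i p. ph (p ! j) * dist (p ! j) (p ! Suc j))"

definition sform :: "('i => 'a list => nat set) => ('a => real) => ('a => real) => 'i => 'a list => real" where
 "sform J f pj i p = (\<Sum>j\<in>J i p. f (p ! j) * (pj (p ! Suc j) - pj (p ! j)))"

definition LC :: "('i => 'a list => nat set) => ('a => real) => real" where
 "LC J ph = Lim U (%i. av i (scost J ph i))"

definition LF :: "('i => 'a list => nat set) => ('a => real) => ('a => real) => real" where
 "LF J f pj = Lim U (%i. av i (sform J f pj i))"

definition sel :: "('i => 'a list => nat set) => bool" where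
 "sel J \<longleftrightarrow> (ALL i p. J i p \<subseteq> {..<length p - 1})"

definition unsel :: "('i => 'a list => nat set) => 'i => 'a list => nat set" where
 "unsel J i p = {..<length p - 1} - J i p"

lemma sel_unsel: "sel (unsel J)" by (auto simp: sel_def unsel_def)

lemma mu: "fbm mu" using ctrl by (simp add: controls_iff)

lemma scost_nonneg: "(!!x. 0 <= ph x) ==> 0 <= scost J ph i p"
 unfolding scost_def by (intro sum_nonneg mult_nonneg_nonneg) auto

lemma scost_le_path_cost:
 assumes "sel J" "!!x. 0 <= ph x" shows "scost J ph i p <= path_cost ph p"
 unfolding scost_def path_cost_def by (rule sum_mono2) (use assms in \<open>auto simp: sel_def\<close>)

lemma sform_le:
 assumes "pj : Lip_funs" shows "\<bar>sform J f pj i p\<bar> <= Lip pj * scost J (%x. \<bar>f x\<bar>) i p"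
proof -
 have "\<bar>sform J f pj i p\<bar> <= (\<Sum>j\<in>J i p. Lip pj * (\<bar>f (p ! j)\<bar> * dist (p ! j) (p ! Suc j)))"
  unfolding sform_def
 proof (rule order_trans[OF sum_abs sum_mono])
  fix j
  show "\<bar>f (p ! j) * (pj (p ! Suc j) - pj (p ! j))\<bar> <= Lip pj * (\<bar>f (p ! j)\<bar> * dist (p ! j) (p ! Suc j))"
   using mult_left_mono[OF Lip_bound[OF assms, of "p ! Suc j" "p ! j"], of "\<bar>f (p ! j)\<bar>"]
   by (simp add: abs_mult dist_commute mult_ac)
 qed
 thus ?thesis by (simp add: scost_def sum_distrib_left)
qed

lemma av_mono: "(!!p. p : A i ==> F p <= G p) ==> av i F <= av i G"
 by (rule avg_mono) (rule c0)

lemma av_cmult: "av i (%p. k * F p) = k * av i F"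
 using avg_lin[of A c i k F 0 F] by simp

lemma path_cost_bound:
 assumes "ph : Lipb_funs" shows "EX K. eventually (%i. av i (path_cost (%x. \<bar>ph x\<bar>)) <= K) U"
 using lim_cost[OF Lipb_abs[OF assms], of 1] by auto

lemma LC:
 assumes J: "sel J" and ph: "ph : Lipb_funs"
 shows "((%i. av i (scost J ph i)) \<longlongrightarrow> LC J ph) U"
proof -
 obtain K where K: "eventually (%i. av i (path_cost (%x. \<bar>ph x\<bar>)) <= K) U" using path_cost_bound[OF ph] by blast
 have "eventually (%i. \<bar>av i (scost J ph i)\<bar> <= K) U" using K
 proof eventually_elim
  case (elim i)
  have "\<bar>av i (scost J ph i)\<bar> <= av i (%p. \<bar>scost J ph i p\<bar>)" by (rule avg_abs) (rule c0)
  also have "... <= av i (path_cost (%x. \<bar>ph x\<bar>))"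
  proof (rule av_mono)
   fix p
   have "\<bar>scost J ph i p\<bar> <= scost J (%x. \<bar>ph x\<bar>) i p"
    unfolding scost_def by (rule order_trans[OF sum_abs]) (simp add: abs_mult)
   also have "... <= path_cost (%x. \<bar>ph x\<bar>) p" by (rule scost_le_path_cost[OF J]) simp
   finally show "\<bar>scost J ph i p\<bar> <= path_cost (%x. \<bar>ph x\<bar>) p" .
  qed
  finally show ?case using elim by simp
 qed
 thus ?thesis unfolding LC_def by (rule ultra_bounded_tendsto[OF ultra])
qed

lemma LF:
 assumes J: "sel J" and f: "f : Lipb_funs" and pj: "pj : Lip_funs"
 shows "((%i. av i (sform J f pj i)) \<longlongrightarrow> LF J f pj) U"
proof -
 obtain K where K: "eventually (%i. av i (path_cost (%x. \<bar>f x\<bar>)) <= K) U" using path_cost_bound[OF f] by blast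
 have "eventually (%i. \<bar>av i (sform J f pj i)\<bar> <= Lip pj * K) U" using K
 proof eventually_elim
  case (elim i)
  have "\<bar>av i (sform J f pj i)\<bar> <= av i (%p. \<bar>sform J f pj i p\<bar>)" by (rule avg_abs) (rule c0)
  also have "... <= av i (%p. Lip pj * path_cost (%x. \<bar>f x\<bar>) p)"
   by (intro av_mono order_trans[OF sform_le[OF pj]] mult_left_mono scost_le_path_cost J Lip_nonneg[OF pj]) simp
  also have "... <= Lip pj * K" unfolding av_cmult by (rule mult_left_mono[OF elim Lip_nonneg[OF pj]])
  finally show ?case .
 qed
 thus ?thesis unfolding LF_def by (rule ultra_bounded_tendsto[OF ultra])
qed

lemma LC_lin:
 assumes J: "sel J" and "f : Lipb_funs" "g : Lipb_funs"
 shows "LC J (%x. a * f x + b * g x) = a * LC J f + b * LC J g"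
proof (rule tendsto_unique[OF nb LC[OF J Lipb_lin[OF assms(2,3)]]])
 have "scost J (%x. a * f x + b * g x) i = (%p. a * scost J f i p + b * scost J g i p)" for i
  by (rule ext) (simp add: scost_def sum_distrib_left sum.distrib algebra_simps)
 thus "((%i. av i (scost J (%x. a * f x + b * g x) i)) \<longlongrightarrow> a * LC J f + b * LC J g) U"
  unfolding avg_lin by (simp add: avg_lin) (intro tendsto_intros LC assms)
qed

lemma LF_lin:
 assumes J: "sel J" and "f : Lipb_funs" "g : Lipb_funs" "pj : Lip_funs"
 shows "LF J (%x. a * f x + b * g x) pj = a * LF J f pj + b * LF J g pj"
proof (rule tendsto_unique[OF nb LF[OF J Lipb_lin[OF assms(2,3)] assms(4)]])
 have "sform J (%x. a * f x + b * g x) pj i = (%p. a * sform J f pj i p + b * sform J g pj i p)" for i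
  unfolding sform_def sum_distrib_left sum.distrib[symmetric] by (intro ext sum.cong refl) (simp add: algebra_simps)
 thus "((%i. av i (sform J (%x. a * f x + b * g x) pj i)) \<longlongrightarrow> a * LF J f pj + b * LF J g pj) U"
  by (simp add: avg_lin) (intro tendsto_intros LF assms)
qed

lemma LF_lin2:
 assumes J: "sel J" and "f : Lipb_funs" "pj : Lip_funs" "sg : Lip_funs"
 shows "LF J f (%x. a * pj x + b * sg x) = a * LF J f pj + b * LF J f sg"
proof (rule tendsto_unique[OF nb LF[OF J assms(2) Lip_lin[OF assms(3,4)]]])
 have "sform J f (%x. a * pj x + b * sg x) i = (%p. a * sform J f pj i p + b * sform J f sg i p)" for i
  unfolding sform_def sum_distrib_left sum.distrib[symmetric] by (intro ext sum.cong refl) (simp add: algebra_simps)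
 thus "((%i. av i (sform J f (%x. a * pj x + b * sg x) i)) \<longlongrightarrow> a * LF J f pj + b * LF J f sg) U"
  by (simp add: avg_lin) (intro tendsto_intros LF assms)
qed

lemma LC_nonneg:
 assumes "sel J" "ph : Lipb_funs" "!!x. 0 <= ph x" shows "0 <= LC J ph"
proof (rule tendsto_lowerbound[OF LC[OF assms(1,2)] always_eventually nb], rule allI)
 show "0 <= av i (scost J ph i)" for i
  unfolding avg_def by (intro sum_nonneg mult_nonneg_nonneg c0 scost_nonneg assms)
qed

lemma LF_le:
 assumes J: "sel J" and f: "f : Lipb_funs" and pj: "pj : Lip_funs"
 shows "\<bar>LF J f pj\<bar> <= Lip pj * LC J (%x. \<bar>f x\<bar>)"
proof (rule tendsto_le[OF nb tendsto_mult_left[OF LC[OF J Lipb_abs[OF f]]] tendsto_rabs[OF LF[OF J f pj]] always_eventually], rule allI)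
 fix i
 have "\<bar>av i (sform J f pj i)\<bar> <= av i (%p. \<bar>sform J f pj i p\<bar>)" by (rule avg_abs) (rule c0)
 also have "... <= Lip pj * av i (scost J (%x. \<bar>f x\<bar>) i)"
  unfolding av_cmult[symmetric] by (rule av_mono) (rule sform_le[OF pj])
 finally show "\<bar>av i (sform J f pj i)\<bar> <= Lip pj * av i (scost J (%x. \<bar>f x\<bar>) i)" .
qed

text \<open>Selected and remaining edges split the cost, which \<open>mu\<close> bounds in the
  limit; for constant \<open>ph = 1\<close> this becomes the subcurrent inequality.\<close>

lemma LC_unsel:
 assumes J: "sel J" and ph: "ph : Lipb_funs" "!!x. 0 <= ph x"
 shows "LC J ph + LC (unsel J) ph <= (LINT x|mu. ph x)"
proof (rule field_le_epsilon)
 fix e :: real assume e: "e > 0"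
 have "path_cost ph p = 1 * scost J ph i p + 1 * scost (unsel J) ph i p" for i p
  unfolding path_cost_def scost_def unsel_def
  using sum.subset_diff[of "J i p" "{..<length p - 1}"] J by (simp add: sel_def add.commute)
 hence eq: "av i (path_cost ph) = av i (scost J ph i) + av i (scost (unsel J) ph i)" for i
  using avg_lin[of A c i 1 "scost J ph i" 1 "scost (unsel J) ph i"] by (simp add: avg_def)
 show "LC J ph + LC (unsel J) ph <= (LINT x|mu. ph x) + e"
  by (rule tendsto_upperbound[OF tendsto_add[OF LC[OF J ph(1)] LC[OF sel_unsel ph(1)]] _ nb])
   (use lim_cost[OF ph e] in \<open>simp add: eq\<close>)
qed

lemma LC_le:
 assumes "sel J" "ph : Lipb_funs" "!!x. 0 <= ph x" shows "LC J ph <= (LINT x|mu. ph x)"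
 using LC_unsel[OF assms] LC_nonneg[OF sel_unsel assms(2,3), of J] by simp

lemma LF_bound:
 assumes "sel J" "f : Lipb_funs" "pj : Lip_funs" shows "\<bar>LF J f pj\<bar> <= Lip pj * (LINT x|mu. \<bar>f x\<bar>)"
 by (rule order_trans[OF LF_le[OF assms] mult_left_mono[OF LC_le[OF assms(1) Lipb_abs[OF assms(2)]] Lip_nonneg[OF assms(3)]]]) simp

lemma LF_unsel:
 assumes J: "sel J" and f: "f : Lipb_funs" and pj: "pj : Lip_funs"
 shows "LF (unsel J) f pj = T f [pj] - LF J f pj"
proof -
 have "path_form f pj p = 1 * sform J f pj i p + 1 * sform (unsel J) f pj i p" for i p
  unfolding path_form_def sform_def unsel_def
  using sum.subset_diff[of "J i p" "{..<length p - 1}"] J by (simp add: sel_def add.commute)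
 hence eq: "av i (path_form f pj) = av i (sform J f pj i) + av i (sform (unsel J) f pj i)" for i
  using avg_lin[of A c i 1 "sform J f pj i" 1 "sform (unsel J) f pj i"] by (simp add: avg_def)
 have "LF J f pj + LF (unsel J) f pj = T f [pj]"
  by (rule tendsto_unique[OF nb tendsto_add[OF LF[OF J f pj] LF[OF sel_unsel f pj]]])
   (use lim_form[OF f pj] in \<open>simp add: eq\<close>)
 thus ?thesis by simp
qed

lemma mesh: assumes "e > 0" shows "eventually (%i. 1 / real (Suc (nf i)) < e) U"
proof -
 obtain n where n: "1 / real (Suc n) < e" using nat_approx_posE[OF assms] by blast
 show ?thesis using nf[of n]
 proof eventually_elim
  case (elim i)
  hence "1 / real (Suc (nf i)) <= 1 / real (Suc n)" by (intro divide_left_mono) auto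
  thus ?case using n by simp
 qed
qed

text \<open>Leibniz along the selected edges: \<open>\<Delta>(f sg) = f(x) \<Delta>sg + sg(y) \<Delta>f\<close>.\<close>

lemma LF_leibniz_bound:
 assumes J: "sel J" and bd: "!!g. g : Lipb_funs ==> LF J (%_. 1) g = 0"
  and f: "f : Lipb_funs" "!!x. f x ~= 0 ==> dist x z < R" and sg: "sg : Lip_funs"
  and K: "0 <= K" "!!x. dist x z < R + 1 ==> \<bar>sg x\<bar> <= K"
 shows "\<bar>LF J f sg\<bar> <= Lip f * (LINT x|mu. min K \<bar>sg x\<bar>)"
proof -
 note fL = Lipb_Lip[OF f(1)]
 note Lf = Lip_nonneg[OF fL] and Ls = Lip_nonneg[OF sg]
 interpret mu: finite_measure mu by (rule fbmD(1)[OF mu])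
 define \<psi> where "\<psi> x = \<bar>max (- K) (min K (sg x))\<bar>" for x
 have \<psi>: "\<psi> : Lipb_funs" "!!x. 0 <= \<psi> x" "!!x. \<psi> x = min K \<bar>sg x\<bar>"
  unfolding \<psi>_def using K(1) by (auto intro!: Lipb_abs Lipb_clip sg)
 \<comment> \<open>The product \<open>f sg\<close>, written with clipped \<open>sg\<close> so as to
   be bounded Lipschitz; the clip is inactive where \<open>f\<close> is nonzero.\<close>
 define u where "u x = f x * max (- K) (min K (sg x))" for x
 have u: "u : Lipb_funs" unfolding u_def by (intro Lipb_mult f Lipb_clip sg K)
 have u': "u x = f x * sg x" for x
 proof (cases "f x = 0")
  case False
  hence "\<bar>sg x\<bar> <= K" using f(2)[of x] K(2)[of x] by simp
  thus ?thesis by (simp add: u_def abs_le_iff max_def min_def)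
 qed (simp add: u_def)
 have key: "\<bar>LF J f sg\<bar> <= Lip f * ((LINT x|mu. \<psi> x) + e * measure mu UNIV)" if e: "e > 0" for e
 proof -
  have ei: "(%x. 1 * \<psi> x + e * 1) : Lipb_funs" by (intro Lipb_lin \<psi> Lipb_const)
  have es: "eventually (%i. 1 / real (Suc (nf i)) < min 1 (e / (Lip sg + 1))) U"
   by (rule mesh) (use e Ls in \<open>simp add: add_nonneg_pos\<close>)
  \<comment> \<open>As the selection is closed, the increments of \<open>u\<close> sum to
    \<open>0\<close> in the limit, and only the term in which \<open>sg\<close> is not
    differentiated survives.\<close>
  have lim1: "((%i. \<bar>av i (sform J f sg i)\<bar> - \<bar>av i (sform J (%_. 1) u i)\<bar>) \<longlongrightarrow> \<bar>LF J f sg\<bar> - \<bar>0\<bar>) U"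
   using LF[OF J Lipb_const[of 1] Lipb_Lip[OF u]] bd[OF u] by (intro tendsto_diff tendsto_rabs LF[OF J f(1) sg]) simp
  have lim2: "((%i. Lip f * av i (scost J (%x. 1 * \<psi> x + e * 1) i)) \<longlongrightarrow> Lip f * LC J (%x. 1 * \<psi> x + e * 1)) U"
   by (intro tendsto_mult_left LC J ei)
  have "\<bar>LF J f sg\<bar> - \<bar>0\<bar> <= Lip f * LC J (%x. 1 * \<psi> x + e * 1)"
  proof (rule tendsto_le[OF nb lim2 lim1], use es in eventually_elim)
   case (elim i)
   let ?eps = "1 / real (Suc (nf i))"
   have eps: "?eps <= 1" "Lip sg * ?eps <= e"
   proof -
    have "?eps * (Lip sg + 1) < e" using elim Ls by (simp only: less_divide_eq min_less_iff_conj split: if_splits)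
    thus "Lip sg * ?eps <= e" by (simp add: field_simps)
   qed (use elim in simp)
   have "av i (%p. 1 * sform J f sg i p + (-1) * sform J (%_. 1) u i p) : {- (Lip f * av i (scost J (%x. 1 * \<psi> x + e * 1) i)) .. Lip f * av i (scost J (%x. 1 * \<psi> x + e * 1) i)}"
   proof -
    have "\<bar>av i (%p. 1 * sform J f sg i p + (-1) * sform J (%_. 1) u i p)\<bar> <= av i (%p. \<bar>1 * sform J f sg i p + (-1) * sform J (%_. 1) u i p\<bar>)"
     by (rule avg_abs) (rule c0)
    also have "... <= av i (%p. Lip f * scost J (%x. 1 * \<psi> x + e * 1) i p)"
    proof (rule av_mono)
     fix p assume p: "p : A i"
     have "\<bar>1 * sform J f sg i p + (-1) * sform J (%_. 1) u i p\<bar> =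
       \<bar>\<Sum>j\<in>J i p. f (p ! j) * (sg (p ! Suc j) - sg (p ! j)) - (u (p ! Suc j) - u (p ! j))\<bar>"
      by (simp add: sform_def sum_subtractf)
     also have "... <= (\<Sum>j\<in>J i p. Lip f * ((1 * \<psi> (p ! j) + e * 1) * dist (p ! j) (p ! Suc j)))"
     proof (rule order_trans[OF sum_abs sum_mono])
      fix j assume "j : J i p"
      hence "j < length p - 1" using J by (auto simp: sel_def)
      hence d: "dist (p ! j) (p ! Suc j) < ?eps" using chains[OF p] by (simp add: chain_def)
      let ?x = "p ! j" and ?y = "p ! Suc j"
      have eq: "f ?x * (sg ?y - sg ?x) - (u ?y - u ?x) = - (sg ?y * (f ?y - f ?x))"
       unfolding u' by (simp add: algebra_simps)
      show "\<bar>f ?x * (sg ?y - sg ?x) - (u ?y - u ?x)\<bar> <= Lip f * ((1 * \<psi> ?x + e * 1) * dist ?x ?y)"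
      proof (cases "f ?y = f ?x")
       case True
       thus ?thesis unfolding eq using Lf \<psi>(2)[of ?x] e by simp
      next
       case False
       \<comment> \<open>\<open>f\<close> changes along the edge, so one of its ends lies where
         \<open>f\<close> is nonzero, and the other within one mesh width, at most
         \<open>1\<close>.\<close>
       have "dist ?x z < R + 1"
       proof (cases "f ?x = 0")
        case True
        hence "dist ?y z < R" using False f(2)[of ?y] by auto
        thus ?thesis using dist_triangle[of ?x z ?y] d eps(1) by linarith
       next
        case False
        thus ?thesis using f(2)[of ?x] by simp
       qed
       hence "\<psi> ?x = \<bar>sg ?x\<bar>" using K(2) \<psi>(3)[of ?x] by (simp add: min_absorb2)
       moreover have "\<bar>sg ?y - sg ?x\<bar> <= e"
       proof -
        have "\<bar>sg ?y - sg ?x\<bar> <= Lip sg * dist ?y ?x" by (rule Lip_bound[OF sg])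
        also have "... <= Lip sg * ?eps" using d by (intro mult_left_mono Ls) (simp add: dist_commute)
        finally show ?thesis using eps(2) by simp
       qed
       ultimately have "\<bar>sg ?y\<bar> <= 1 * \<psi> ?x + e * 1" by linarith
       hence "\<bar>sg ?y * (f ?y - f ?x)\<bar> <= (1 * \<psi> ?x + e * 1) * (Lip f * dist ?y ?x)"
        unfolding abs_mult by (intro mult_mono Lip_bound[OF fL]) auto
       thus ?thesis unfolding eq abs_minus_cancel by (simp add: dist_commute mult_ac)
      qed
     qed
     also have "... = Lip f * scost J (%x. 1 * \<psi> x + e * 1) i p" by (simp add: scost_def sum_distrib_left)
     finally show "\<bar>1 * sform J f sg i p + (-1) * sform J (%_. 1) u i p\<bar> <= Lip f * scost J (%x. 1 * \<psi> x + e * 1) i p" .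
    qed
    finally show ?thesis unfolding av_cmult abs_le_iff by auto
   qed
   thus ?case unfolding avg_lin by (auto simp: abs_if)
  qed
  also have "LC J (%x. 1 * \<psi> x + e * 1) <= (LINT x|mu. 1 * \<psi> x + e * 1)"
   by (rule LC_le[OF J ei]) (use \<psi>(2) e in \<open>simp add: add_nonneg_nonneg\<close>)
  also have "... = (LINT x|mu. \<psi> x) + e * measure mu UNIV"
   using fbm_integrable_Lipb[OF mu \<psi>(1)] by (simp add: fbmD(3)[OF mu])
  finally show ?thesis using Lf by (simp add: mult_left_mono)
 qed
 have "((%e. Lip f * ((LINT x|mu. \<psi> x) + e * measure mu UNIV)) \<longlongrightarrow> Lip f * ((LINT x|mu. \<psi> x) + 0 * measure mu UNIV)) (at_right 0)"
  by (intro tendsto_intros)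
 hence "\<bar>LF J f sg\<bar> <= Lip f * ((LINT x|mu. \<psi> x) + 0 * measure mu UNIV)"
  by (rule tendsto_lowerbound) (auto intro!: eventually_at_right_less[THEN eventually_mono] key)
 thus ?thesis by (simp add: \<psi>(3))
qed

text \<open>First \<open>f\<close> is cut off to a ball, where the \<open>sg n\<close> are uniformly
  bounded; there the Leibniz bound, in which \<open>sg n\<close> is not differentiated, tends to
  \<open>0\<close> by dominated convergence. The tail of \<open>f\<close> is small in
  \<open>L^1(mu)\<close>.\<close>

lemma LF_tendsto_0:
 assumes J: "sel J" and bd: "!!g. g : Lipb_funs ==> LF J (%_. 1) g = 0" and f: "f : Lipb_funs"
  and lip: "!!n. K-lipschitz_on UNIV (sg n)" and lim: "!!x. (%n. sg n x) \<longlonglongrightarrow> 0"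
 shows "(%n::nat. LF J f (sg n)) \<longlonglongrightarrow> 0"
proof -
 interpret mu: finite_measure mu by (rule fbmD(1)[OF mu])
 have sg: "sg n : Lip_funs" for n using lip by (auto simp: Lip_funs_def)
 have K0: "0 <= K" by (rule lipschitz_on_nonneg[OF lip])
 fix z :: 'a
 define xi where "xi R x = min 1 (max 0 (real R + 1 - dist x z))" for R :: nat and x
 have xi: "xi R : Lipb_funs" for R unfolding xi_def by (intro Lipb_min Lipb_const Lip_dist_cut)
 have fxi: "(%x. f x * xi R x) : Lipb_funs" for R by (intro Lipb_mult f xi)
 obtain b where b: "!!n. \<bar>sg n z\<bar> <= b"
  using convergent_imp_Bseq[OF convergentI[OF lim[of z]]] by (auto simp: Bseq_def)
 have c1: "(%n. LF J (%x. f x * xi R x) (sg n)) \<longlonglongrightarrow> 0" for R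
 proof -
  define K' where "K' = b + K * (real R + 2)"
  have K': "0 <= K'" unfolding K'_def using b[of 0] K0 by (intro add_nonneg_nonneg mult_nonneg_nonneg) auto
  have "\<bar>LF J (%x. f x * xi R x) (sg n)\<bar> <= Lip (%x. f x * xi R x) * (LINT x|mu. min K' \<bar>sg n x\<bar>)" for n
  proof (rule LF_leibniz_bound[where z = z and R = "real R + 1", OF J bd fxi _ sg K'])
   show "dist x z < real R + 1" if "f x * xi R x ~= 0" for x using that by (auto simp: xi_def min_def max_def split: if_splits)
   fix x assume x: "dist x z < real R + 1 + 1"
   have "\<bar>sg n x - sg n z\<bar> <= K * dist x z" using lipschitz_onD[OF lip, of x z] by (simp add: dist_real_def)
   also have "... <= K * (real R + 2)" using x by (intro mult_left_mono K0) simp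
   finally show "\<bar>sg n x\<bar> <= K'" using b[of n] unfolding K'_def by linarith
  qed auto
  moreover have "(%n. Lip (%x. f x * xi R x) * (LINT x|mu. min K' \<bar>sg n x\<bar>)) \<longlonglongrightarrow> Lip (%x. f x * xi R x) * (LINT x|mu. 0)"
  proof (rule tendsto_mult_left, rule integral_dominated_convergence[where w = "%_. K'"])
   show "(%x. min K' \<bar>sg n x\<bar>) : borel_measurable mu" for n
    unfolding fbmD(5)[OF mu] using Lip_measurable[OF sg[of n]] by measurable
   have "(%n. min K' \<bar>sg n x\<bar>) \<longlonglongrightarrow> min K' \<bar>0\<bar>" for x by (intro tendsto_intros lim)
   thus "AE x in mu. (%n. min K' \<bar>sg n x\<bar>) \<longlonglongrightarrow> 0" using K' by (simp add: min_absorb2)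
  qed (use K' in auto)
  ultimately show ?thesis
   by (intro Lim_null_comparison[of "%n. LF J (%x. f x * xi R x) (sg n)" "%n. Lip (%x. f x * xi R x) * (LINT x|mu. min K' \<bar>sg n x\<bar>)"]) simp_all
 qed
 have c2: "(%R. \<integral>x. \<bar>1 * f x + (-1) * (f x * xi R x)\<bar> \<partial>mu) \<longlonglongrightarrow> (LINT x|mu. 0)"
 proof (rule integral_dominated_convergence[where w = "%x. \<bar>f x\<bar>"])
  show "(%x. \<bar>1 * f x + (-1) * (f x * xi R x)\<bar>) : borel_measurable mu" for R
   unfolding fbmD(5)[OF mu] by (rule Lipb_measurable) (intro Lipb_abs Lipb_lin f fxi)
  show "integrable mu (%x. \<bar>f x\<bar>)" by (rule fbm_integrable_Lipb[OF mu Lipb_abs[OF f]])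
  have "(%R. \<bar>1 * f x + (-1) * (f x * xi R x)\<bar>) \<longlonglongrightarrow> 0" for x
  proof (rule tendsto_eventually)
   obtain R0 :: nat where R0: "dist x z <= real R0" using real_arch_simple by blast
   have "xi R x = 1" if "R0 <= R" for R using R0 that by (simp add: xi_def)
   thus "\<forall>\<^sub>F R in sequentially. \<bar>1 * f x + (-1) * (f x * xi R x)\<bar> = 0"
    by (auto simp: eventually_sequentially)
  qed
  thus "AE x in mu. (%R. \<bar>1 * f x + (-1) * (f x * xi R x)\<bar>) \<longlonglongrightarrow> 0" by simp
  have "\<bar>1 * f x + (-1) * (f x * xi R x)\<bar> = \<bar>f x\<bar> * (1 - xi R x)" for R x
  proof -
   have "1 * f x + (-1) * (f x * xi R x) = f x * (1 - xi R x)" by (simp add: algebra_simps)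
   thus ?thesis by (simp add: abs_mult xi_def)
  qed
  moreover have "\<bar>f x\<bar> * (1 - xi R x) <= \<bar>f x\<bar>" for R x by (rule mult_left_le) (auto simp: xi_def)
  ultimately have "\<bar>1 * f x + (-1) * (f x * xi R x)\<bar> <= \<bar>f x\<bar>" for R x by metis
  thus "AE x in mu. norm \<bar>1 * f x + (-1) * (f x * xi R x)\<bar> <= \<bar>f x\<bar>" for R
   by (intro AE_I2) (simp only: real_norm_def abs_idempotent)
 qed simp
 show ?thesis
 proof (rule tendstoI)
  fix e :: real assume e: "e > 0"
  have "e / 2 / (K + 1) > 0" using e K0 by simp
  then obtain R where R: "(LINT x|mu. \<bar>1 * f x + (-1) * (f x * xi R x)\<bar>) < e / 2 / (K + 1)"
   using order_tendstoD(2)[OF c2, of "e / 2 / (K + 1)"] by (auto simp: eventually_sequentially)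
  have "\<forall>\<^sub>F n in sequentially. \<bar>LF J (%x. f x * xi R x) (sg n)\<bar> < e / 2"
   using tendstoD[OF c1[of R], of "e / 2"] e by simp
  thus "\<forall>\<^sub>F n in sequentially. dist (LF J f (sg n)) 0 < e"
  proof eventually_elim
   case (elim n)
   let ?d = "\<integral>x. \<bar>1 * f x + (-1) * (f x * xi R x)\<bar> \<partial>mu"
   have d0: "0 <= ?d" by (rule Bochner_Integration.integral_nonneg) simp
   have "\<bar>LF J (%x. 1 * f x + (-1) * (f x * xi R x)) (sg n)\<bar> <= Lip (sg n) * ?d"
    by (rule LF_bound[OF J Lipb_lin[OF f fxi] sg])
   also have "... <= (K + 1) * ?d" using Lip_le[OF lip[of n]] by (intro mult_right_mono d0) simp
   also have "... < (K + 1) * (e / 2 / (K + 1))" using R K0 by (intro mult_strict_left_mono) auto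
   also have "... = e / 2" using K0 by (subst times_divide_eq_right, subst nonzero_mult_div_cancel_left) auto
   finally have "\<bar>LF J (%x. 1 * f x + (-1) * (f x * xi R x)) (sg n)\<bar> < e / 2" .
   thus ?case using elim unfolding LF_lin[OF J f fxi sg] dist_real_def by linarith
  qed
 qed
qed

text \<open>Chains jump, so an edge may leave the set \<open>f ~= 0\<close>. Subtracting from
  \<open>f\<close> its truncation to \<open>[-d, d]\<close> leaves only edges that start where
  \<open>|f| > d\<close>; for small mesh these also end where \<open>f\<close> is nonzero, so
  \<open>pj\<close> has no increment. The truncation contributes a multiple of
  \<open>d\<close>.\<close>

lemma LF_local:
 assumes J: "sel J" and f: "f : Lipb_funs" and pj: "pj : Lip_funs" and const: "!!x. f x ~= 0 ==> pj x = k"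
 shows "LF J f pj = 0"
proof -
 note fL = Lipb_Lip[OF f]
 have "\<bar>LF J f pj\<bar> <= Lip pj * (d * measure mu UNIV)" if d: "d > 0" for d
 proof -
  define h where "h x = max (- d) (min d (f x))" for x
  have h: "h : Lipb_funs" unfolding h_def using d by (intro Lipb_clip fL) simp
  have fh: "(%x. 1 * f x + (-1) * h x) : Lipb_funs" by (intro Lipb_lin f h)
  have Lf: "0 <= Lip f" by (rule Lip_nonneg[OF fL])
  have "LF J (%x. 1 * f x + (-1) * h x) pj = 0"
  proof (rule tendsto_unique[OF nb LF[OF J fh pj] tendsto_eventually])
   have "eventually (%i. 1 / real (Suc (nf i)) < d / (Lip f + 1)) U" by (rule mesh) (use d Lf in simp)
   thus "\<forall>\<^sub>F i in U. av i (sform J (%x. 1 * f x + (-1) * h x) pj i) = 0"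
   proof eventually_elim
    case (elim i)
    have "sform J (%x. 1 * f x + (-1) * h x) pj i p = 0" if p: "p : A i" for p
     unfolding sform_def
    proof (intro sum.neutral ballI)
     fix j assume "j : J i p"
     hence "j < length p - 1" using J by (auto simp: sel_def)
     hence dj: "dist (p ! j) (p ! Suc j) < 1 / real (Suc (nf i))" using chains[OF p] by (simp add: chain_def)
     show "(1 * f (p ! j) + (-1) * h (p ! j)) * (pj (p ! Suc j) - pj (p ! j)) = 0"
     proof (cases "\<bar>f (p ! j)\<bar> <= d")
      case True
      hence "h (p ! j) = f (p ! j)" unfolding h_def by linarith
      thus ?thesis by simp
     next
      case False
      have "\<bar>f (p ! Suc j) - f (p ! j)\<bar> <= Lip f * dist (p ! Suc j) (p ! j)" by (rule Lip_bound[OF fL])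
      also have "... <= (Lip f + 1) * dist (p ! j) (p ! Suc j)" by (simp add: dist_commute mult_right_mono)
      also have "... <= (Lip f + 1) * (d / (Lip f + 1))" using dj elim Lf by (intro mult_left_mono) auto
      also have "... = d" using Lf by simp
      finally have "f (p ! Suc j) ~= 0" using False by linarith
      moreover have "f (p ! j) ~= 0" using False d by auto
      ultimately show ?thesis using const by simp
     qed
    qed
    thus ?case by (simp add: avg_def)
   qed
  qed
  hence "LF J f pj = LF J h pj" unfolding LF_lin[OF J f h pj] by simp
  also have "\<bar>...\<bar> <= Lip pj * (LINT x|mu. \<bar>h x\<bar>)" by (rule LF_bound[OF J h pj])
  also have "... <= Lip pj * (LINT x|mu. d)"
  proof (intro mult_left_mono Lip_nonneg pj integral_mono)
   show "integrable mu (%x. \<bar>h x\<bar>)" by (rule fbm_integrable_Lipb[OF mu Lipb_abs[OF h]])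
   show "integrable mu (%x. d)" by (rule fbm_integrable_Lipb[OF mu Lipb_const])
   show "\<bar>h x\<bar> <= d" for x unfolding h_def using d by linarith
  qed
  finally show ?thesis by (simp add: fbmD(3)[OF mu] mult_ac)
 qed
 note key = this
 have "((%d. Lip pj * (d * measure mu UNIV)) \<longlongrightarrow> Lip pj * (0 * measure mu UNIV)) (at_right 0)"
  by (intro tendsto_intros)
 hence "\<bar>LF J f pj\<bar> <= Lip pj * (0 * measure mu UNIV)"
  by (rule tendsto_lowerbound) (auto intro!: eventually_at_right_less[THEN eventually_mono] key)
 thus ?thesis by simp
qed

definition sel_current :: "('i => 'a list => nat set) => 'a functional" where
 "sel_current J f pjs = (if f : Lipb_funs & pjs : Lip_tuples 1 then LF J f (pjs ! 0) else 0)"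

lemma Lip_tuples_1_nth: "pjs : Lip_tuples 1 ==> pjs ! 0 : Lip_funs & pjs = [pjs ! 0]"
 by (auto simp: Lip_tuples_1 simp del: One_nat_def)

text \<open>\<open>LC J\<close> is a positive functional dominated by \<open>mu\<close>, hence
  integration against some \<open>nu\<close>. The functional \<open>T'\<close> is left free, because
  the bound serves both \<open>sel_current J\<close> and its complement in \<open>T\<close>.\<close>

lemma sel_controls:
 assumes J: "sel J"
 obtains nu where "emeasure nu UNIV = ennreal (LC J (%_. 1))"
  "!!T'. (!!f pj. f : Lipb_funs ==> pj : Lip_funs ==> T' f [pj] = LF J f pj) ==> controls 1 T' nu"
proof -
 obtain nu where nu: "fbm nu" "!!f. f : Lipb_funs ==> LC J f = (LINT x|nu. f x)"
 proof (rule Riesz_positive[OF mu, of "LC J"])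
  show "LC J (%x. a * f x + b * g x) = a * LC J f + b * LC J g" if "f : Lipb_funs" "g : Lipb_funs" for f g a b
   using LC_lin[OF J that] .
  show "0 <= LC J f" "LC J f <= (LINT x|mu. f x)" if "f : Lipb_funs" "!!x. 0 <= f x" for f
   using LC_nonneg[OF J that] LC_le[OF J that] .
 qed (rule that)
 interpret nu: finite_measure nu by (rule fbmD(1)[OF nu(1)])
 have "controls 1 T' nu" if T': "!!f pj. f : Lipb_funs ==> pj : Lip_funs ==> T' f [pj] = LF J f pj" for T'
  unfolding controls_iff
 proof (intro conjI ballI nu)
  fix f :: "'a => real" and pjs :: "('a => real) list" assume f: "f : Lipb_funs" and "pjs : Lip_tuples 1"
  then obtain p where p: "p : Lip_funs" "pjs = [p]" using Lip_tuples_1 by blast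
  show "\<bar>T' f pjs\<bar> <= Lip_prod pjs * (LINT x|nu. \<bar>f x\<bar>)"
   using LF_le[OF J f p(1)] nu(2)[OF Lipb_abs[OF f]] T'[OF f p(1)] by (simp add: p Lip_prod_def)
 qed
 moreover have "emeasure nu UNIV = ennreal (LC J (%_. 1))"
  using nu(2)[OF Lipb_const[of 1]] by (simp add: fbmD(3)[OF nu(1)] nu.emeasure_eq_measure)
 ultimately show ?thesis using that by blast
qed

text \<open>The vanishing boundary enters through the continuity axiom, by way of the Leibniz rule;
  the other axioms are inherited from the discrete integrals.\<close>

lemma sel_current_currents:
 assumes J: "sel J" and bd: "!!g. g : Lipb_funs ==> LF J (%_. 1) g = 0"
 shows "sel_current J : currents 1"
 unfolding currents_def
proof (intro CollectI conjI)
 have single: "[p] : Lip_tuples 1" if "p : Lip_funs" for p :: "'a => real" using that Lip_tuples_1 by blast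
 show "ALL f pj. ~ (f : Lipb_funs & pj : Lip_tuples 1) --> sel_current J f pj = 0" by (simp add: sel_current_def)
 show "EX mu. controls 1 (sel_current J) mu"
 proof -
  obtain nu where nu: "!!T'. (!!f pj. f : Lipb_funs ==> pj : Lip_funs ==> T' f [pj] = LF J f pj) ==> controls 1 T' nu"
   by (rule sel_controls[OF J]) (rule that, blast)
  have "controls 1 (sel_current J) nu" by (rule nu) (simp add: sel_current_def single del: One_nat_def)
  thus ?thesis by blast
 qed
 have upd: "pjs[0 := p] = [p]" if "pjs : Lip_tuples 1" for pjs and p :: "'a => real"
  using that unfolding Lip_tuples_1 by auto
 show "multilinear_on_forms 1 (sel_current J)"
  unfolding multilinear_on_forms_def
 proof (intro conjI ballI allI impI)
  fix f g :: "'a => real" and pjs :: "('a => real) list" and a b assume "f : Lipb_funs" "g : Lipb_funs" "pjs : Lip_tuples 1"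
  thus "sel_current J (%x. a * f x + b * g x) pjs = a * sel_current J f pjs + b * sel_current J g pjs"
   using Lip_tuples_1_nth[of pjs] LF_lin[OF J] by (simp add: sel_current_def Lipb_lin)
 next
  fix f :: "'a => real" and pjs :: "('a => real) list" and i :: nat and p q :: "'a => real" and a b
  assume a: "f : Lipb_funs" "pjs : Lip_tuples 1" "i < 1" "p : Lip_funs" "q : Lip_funs"
  thus "sel_current J f (pjs[i := %x. a * p x + b * q x]) = a * sel_current J f (pjs[i := p]) + b * sel_current J f (pjs[i := q])"
   using LF_lin2[OF J a(1,4,5)] by (simp add: sel_current_def upd single Lip_lin del: One_nat_def)
 qed
 show "continuous_on_forms 1 (sel_current J)"
  unfolding continuous_on_forms_def
 proof (intro ballI allI impI)
  fix f :: "'a => real" and pj :: "('a => real) list" and pjs :: "nat => ('a => real) list"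
  assume f: "f : Lipb_funs" and pj: "pj : Lip_tuples 1"
   and "(ALL n. pjs n : Lip_tuples 1) & (EX L. ALL n. ALL i<1. L-lipschitz_on UNIV (pjs n ! i)) &
    (ALL i<1. ALL x. (%n. (pjs n ! i) x) \<longlonglongrightarrow> (pj ! i) x)"
  then obtain L where pjs: "!!n. pjs n : Lip_tuples 1" "!!n. L-lipschitz_on UNIV (pjs n ! 0)"
   "!!x. (%n. (pjs n ! 0) x) \<longlonglongrightarrow> (pj ! 0) x" by auto
  note l = Lip_tuples_1_nth[OF pj] Lip_tuples_1_nth[OF pjs(1)]
  have "(%n. LF J f (%x. 1 * (pjs n ! 0) x + (-1) * (pj ! 0) x)) \<longlonglongrightarrow> 0"
  proof (rule LF_tendsto_0[OF J bd f])
   show "(\<bar>1\<bar> * L + \<bar>-1\<bar> * Lip (pj ! 0))-lipschitz_on UNIV (%x. 1 * (pjs n ! 0) x + (-1) * (pj ! 0) x)" for n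
    by (intro lipschitz_on_add lipschitz_on_cmult_real pjs Lip_lipschitz) (use l in blast)
   show "(%n. 1 * (pjs n ! 0) x + (-1) * (pj ! 0) x) \<longlonglongrightarrow> 0" for x
    using tendsto_diff[OF pjs(3)[of x] tendsto_const[of "(pj ! 0) x"]] by simp
  qed
  hence "(%n. LF J f (pjs n ! 0) - LF J f (pj ! 0)) \<longlonglongrightarrow> 0"
   by (subst (asm) LF_lin2[OF J f]) (use l in auto)
  hence "(%n. LF J f (pjs n ! 0)) \<longlonglongrightarrow> LF J f (pj ! 0)" by (simp add: LIM_zero_iff)
  thus "(%n. sel_current J f (pjs n)) \<longlonglongrightarrow> sel_current J f pj" using f pj pjs(1) by (simp add: sel_current_def)
 qed
 show "local_on_forms 1 (sel_current J)"
  unfolding local_on_forms_def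
 proof (intro ballI impI)
  fix f :: "'a => real" and pj :: "('a => real) list" assume f: "f : Lipb_funs" and pj: "pj : Lip_tuples 1"
   and "EX i<1. EX U c. open U & {x. f x ~= 0} \<subseteq> U & (ALL x:U. (pj ! i) x = c)"
  then obtain k where "!!x. f x ~= 0 ==> (pj ! 0) x = k" by (auto simp: subset_iff)
  hence "LF J f (pj ! 0) = 0" using Lip_tuples_1_nth[OF pj] by (intro LF_local[OF J f]) auto
  thus "sel_current J f pj = 0" by (simp add: sel_current_def)
 qed
qed

text \<open>Edges whose removal leaves no boundary behind carry a cycle of \<open>T\<close>, hence no mass.\<close>

theorem closed_selection_negligible:
 assumes J: "sel J" and bd: "!!g. g : Lipb_funs ==> LF J (%_. 1) g = 0"
 shows "measure mu UNIV <= LC (unsel J) (%_. 1)"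
proof -
 interpret mu: finite_measure mu by (rule fbmD(1)[OF mu])
 let ?C = "sel_current J" and ?D = "%f pj. T f pj - sel_current J f pj"
 obtain nu where nu: "emeasure nu UNIV = ennreal (LC J (%_. 1))"
  "!!T'. (!!f pj. f : Lipb_funs ==> pj : Lip_funs ==> T' f [pj] = LF J f pj) ==> controls 1 T' nu"
  by (rule sel_controls[OF J]) (rule that, assumption, blast)
 obtain nu' where nu': "emeasure nu' UNIV = ennreal (LC (unsel J) (%_. 1))"
  "!!T'. (!!f pj. f : Lipb_funs ==> pj : Lip_funs ==> T' f [pj] = LF (unsel J) f pj) ==> controls 1 T' nu'"
  by (rule sel_controls[OF sel_unsel]) (rule that, assumption, blast)
 have single: "[p] : Lip_tuples 1" if "p : Lip_funs" for p :: "'a => real" using that Lip_tuples_1 by blast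
 have C: "controls 1 ?C nu" by (rule nu(2)) (simp add: sel_current_def single del: One_nat_def)
 have D: "controls 1 ?D nu'" by (rule nu'(2)) (simp add: sel_current_def single LF_unsel[OF J] del: One_nat_def)
 have Cc: "?C : currents 1" by (rule sel_current_currents[OF J bd])
 note lT = currents_linear_first[OF T] and lC = currents_linear_first[OF Cc]
 have lD: "linear_first 1 ?D" using lT lC unfolding linear_first_def by (simp add: algebra_simps)
 have "mass 1 ?D + mass 1 ?C <= ennreal (LC (unsel J) (%_. 1)) + ennreal (LC J (%_. 1))"
  using mass_le_control[OF lD D] mass_le_control[OF lC C] nu nu' by (intro add_mono) auto
 also have "... = ennreal (LC J (%_. 1) + LC (unsel J) (%_. 1))"
  using LC_nonneg[OF J Lipb_const[of 1]] LC_nonneg[OF sel_unsel Lipb_const[of 1], of J] by (simp add: ennreal_plus add.commute)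
 also have "... <= ennreal (measure mu UNIV)"
  using LC_unsel[OF J Lipb_const[of 1]] by (intro ennreal_leI) (simp add: fbmD(3)[OF mu])
 finally have "subcurrent 1 ?C T" unfolding subcurrent_def using T Cc mass_T by (simp add: mu.emeasure_eq_measure)
 moreover have "boundary ?C = (%f pj. 0)"
 proof (intro ext)
  fix f :: "'a => real" and pj :: "('a => real) list"
  show "boundary ?C f pj = 0"
   using bd[of f] by (auto simp: boundary_def sel_current_def Lip_tuples_1)
 qed
 \<comment> \<open>With \<open>?C = 0\<close> all of \<open>T\<close> is controlled by the measure
   of the remaining edges, which therefore bounds its mass.\<close>
 ultimately have "?C = (%f pj. 0)" using acyc unfolding acyclic_current_def cycle_of_def by blast
 hence "?D = T" by (simp add: fun_eq_iff)
 hence "emeasure mu UNIV <= ennreal (LC (unsel J) (%_. 1))" using mass_le_control[OF lT] D nu'(1) mass_T by metis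
 thus ?thesis
  using LC_nonneg[OF sel_unsel Lipb_const[of 1], of J] by (simp add: mu.emeasure_eq_measure)
qed

end

section \<open>Long paths and almost closed loops\<close>

text \<open>Overspill: properties valid for each fixed \<open>n\<close> persist up to some
  \<open>h\<close> tending to infinity along \<open>U\<close>. Taking the greatest \<open>n\<close>
  below \<open>nf i\<close> makes this work for \<open>Q\<close> that is not monotone in
  \<open>n\<close>.\<close>

lemma (in loeb_data) slow_choice:
 assumes Q: "!!n::nat. eventually (Q n) U"
 obtains h where "!!n. eventually (%i. n <= h i) U" "eventually (%i. Q (h i) i) U"
proof -
 define h where "h i = (GREATEST n. n <= nf i & Q n i)" for i
 have b: "n <= nf i & Q n i --> n <= nf i" for n i by simp
 have "eventually (%i. n <= h i) U" for n
  using nf[of n] Q[of n] by eventually_elim (auto simp: h_def intro!: Greatest_le_nat[where b = "nf _"])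
 moreover have "eventually (%i. Q (h i) i) U"
  using Q[of 0]
 proof eventually_elim
  case (elim i)
  have "h i <= nf i & Q (h i) i" unfolding h_def by (rule GreatestI_nat[of _ 0 "nf i"]) (use elim in auto)
  thus ?case by simp
 qed
 ultimately show ?thesis using that by blast
qed

text \<open>The intersection of the internal sets is null, and by the ultrafilter property a point
  outside \<open>internal U (S n)\<close> has \<open>x i\<close> outside \<open>S n i\<close>
  eventually.\<close>

lemma (in loeb_data) AE_not_internal:
 assumes small: "!!e. e > 0 ==> EX n::nat. \<Lambda> (S n) <= e"
 shows "AE x in lam. EX n. eventually (%i. x i ~: S n i) U"
proof (rule AE_I')
 let ?N = "\<Inter>n. internal U (S n)"
 interpret L: finite_measure lam by (rule finite_lam)
 have m: "?N : sets lam" by (rule sets.countable_INT'') (use sets.top[of lam] in \<open>auto simp: lam(1) internal_sets\<close>)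
 have "measure lam ?N <= e" if e: "e > 0" for e
 proof -
  obtain n where n: "\<Lambda> (S n) <= e" using small[OF e] by blast
  have "measure lam ?N <= measure lam (internal U (S n))" by (rule L.finite_measure_mono) (auto simp: internal_sets)
  thus ?thesis using n by (simp add: measure_lam)
 qed
 hence "measure lam ?N <= 0" by (rule dense_ge)
 thus "?N : null_sets lam" using m by (intro null_setsI) (auto simp: L.emeasure_eq_measure intro!: antisym[OF _ measure_nonneg])
 show "{x : space lam. ~ (EX n. eventually (%i. x i ~: S n i) U)} \<subseteq> ?N"
  using ultra_not[OF ultra] by (auto simp: internal_def)
qed

context transport_limit
begin

abbreviation "ml \<equiv> measure mu UNIV"

text \<open>Truncated lengths are bounded, so their limits are integrals over the Loeb measure; the
  limit of the full lengths could contain length that has escaped to infinity.\<close>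

definition mR :: "real => real" where
 "mR R = Lim U (%i. av i (%p. min R (plen p)))"

lemma plen_nonneg: "0 <= plen (p :: 'a list)" by (rule psum_nonneg)

lemma mR: "0 <= R ==> ((%i. av i (%p. min R (plen p))) \<longlongrightarrow> mR R) U"
 unfolding mR_def by (rule av_tendsto[where K = R]) (use plen_nonneg in \<open>simp add: min_def\<close>)

lemma av_plen: "e > 0 ==> eventually (%i. av i plen <= ml + e) U"
proof -
 have "path_cost (%_. 1) = (plen :: 'a list => real)" by (rule ext) (rule path_cost_1)
 thus "e > 0 ==> eventually (%i. av i plen <= ml + e) U"
  using lim_cost[OF Lipb_const[of 1], of e] by (simp add: fbmD(3)[OF mu])
qed

lemma mR_le: assumes "0 <= R" shows "mR R <= ml"
proof (rule field_le_epsilon)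
 fix e :: real assume e: "e > 0"
 show "mR R <= ml + e"
 proof (rule tendsto_upperbound[OF mR[OF assms] _ nb], use av_plen[OF e] in eventually_elim)
  case (elim i)
  have "av i (%p. min R (plen p)) <= av i plen" by (rule av_mono) simp
  thus ?case using elim by simp
 qed
qed

text \<open>Markov's inequality: the weight of chains longer than \<open>n\<close> tends to
  \<open>0\<close>, and with it the boundary of all long chains together.\<close>

lemma av_long:
 assumes n: "n > 0" shows "eventually (%i. av i (indicator {p. real n < plen p}) <= (ml + 1) / real n) U"
 using av_plen[of 1, OF zero_less_one]
proof eventually_elim
 case (elim i)
 have "av i (indicator {p. real n < plen p}) <= av i (%p. (1 / real n) * plen p)"
  by (rule av_mono) (use n plen_nonneg in \<open>auto simp: indicator_def field_simps\<close>)
 also have "... <= (1 / real n) * (ml + 1)" unfolding av_cmult using elim by (intro mult_left_mono) auto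
 finally show ?case by simp
qed

lemma B_nonneg: "0 <= B"
 by (rule order_trans[OF _ mass[of undefined]]) (simp add: avg_def sum_nonneg c0)

text \<open>The discarded edges are whole paths that are too long, or the almost closed loops of the others:
  neither contributes to the boundary in the limit.\<close>

lemma discard_long_and_loops:
 obtains h where "!!n. eventually (%i. n <= h i) U"
  "!!kap dl s e. 0 <= kap ==> (!!i. 0 <= dl i) ==> (dl \<longlongrightarrow> 0) U ==> (!!n::nat. mR (real n) <= s) ==> e > 0 ==>
   eventually (%i. kap * av i (indicator {p. plen p <= real (h i) & near_loop kap (dl i) p}) <= s - ml + e) U"
proof -
 \<comment> \<open>The threshold \<open>h i\<close> for long chains grows so slowly that the mean of
   lengths truncated at \<open>h i\<close> is still governed by the values
   \<open>mR n\<close>.\<close>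
 obtain h where h: "!!n. eventually (%i. n <= h i) U"
  "eventually (%i. av i (%p. min (real (h i)) (plen p)) <= mR (real (h i)) + 1 / real (Suc (h i))) U"
 proof (rule slow_choice[of "%n i. av i (%p. min (real n) (plen p)) <= mR (real n) + 1 / real (Suc n)"])
  fix n :: nat
  have "mR (real n) < mR (real n) + 1 / real (Suc n)" by simp
  hence "eventually (%i. av i (%p. min (real n) (plen p)) < mR (real n) + 1 / real (Suc n)) U"
   by (rule order_tendstoD(2)[OF mR[OF of_nat_0_le_iff]])
  thus "eventually (%i. av i (%p. min (real n) (plen p)) <= mR (real n) + 1 / real (Suc n)) U"
   by (rule eventually_mono) simp
 qed (rule that)
 show ?thesis
 proof (rule that[OF h(1)])
  fix kap s e :: real and dl :: "'i => real"
  assume kap: "0 <= kap" and dl: "!!i. 0 <= dl i" "(dl \<longlongrightarrow> 0) U" and s: "!!n::nat. mR (real n) <= s" and e: "e > 0"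
  define loop where "loop i p a b \<longleftrightarrow> a <= b & b <= length p - 1 & kap <= psum p b - psum p a & dist (p ! a) (p ! b) < dl i"
   for i and p :: "'a list" and a b
  have "EX ab. ALL i p. near_loop kap (dl i) p --> loop i p (fst (ab i p)) (snd (ab i p))"
  proof -
   have "ALL i p. EX z. near_loop kap (dl i) p --> loop i p (fst z) (snd z)" by (auto simp: near_loop_def loop_def)
   thus ?thesis by metis
  qed
  then obtain ab where ab: "!!i p. near_loop kap (dl i) p ==> loop i p (fst (ab i p)) (snd (ab i p))" by blast
  define J where "J i p = (if real (h i) < plen p then {..<length p - 1}
    else if near_loop kap (dl i) p then {fst (ab i p)..<snd (ab i p)} else {})" for i and p :: "'a list"
  have J: "sel J" unfolding sel_def
  proof (intro allI)
   fix i p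
   show "J i p \<subseteq> {..<length p - 1}" using ab[of i p] by (auto simp: J_def loop_def)
  qed
  have bd: "LF J (%_. 1) g = 0" if g: "g : Lipb_funs" for g
  proof (rule tendsto_unique[OF nb LF[OF J Lipb_const Lipb_Lip[OF g]]])
   obtain G where G: "0 <= G" "!!x. \<bar>g x\<bar> <= G" using LipbE[OF g] by metis
   note gL = Lipb_Lip[OF g]
   \<comment> \<open>Boundary per chain: two endpoint values for a discarded long chain, whose
     weight tends to \<open>0\<close>, and a term of the size of the gap \<open>dl i\<close> for a
     discarded loop.\<close>
   have sb: "\<bar>sform J (%_. 1) g i p\<bar> <= 2 * G * indicator {p. real (h i) < plen p} p + Lip g * dl i * 1" for i p
   proof -
    have bl: "\<bar>\<Sum>j\<in>{a..<b}. 1 * (g (p ! Suc j) - g (p ! j))\<bar> = \<bar>g (p ! b) - g (p ! a)\<bar>" if "a <= b" for a b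
     using sum_block[OF that, of "%j. g (p ! j)"] by simp
    have Ld: "0 <= Lip g * dl i" using Lip_nonneg[OF gL] dl(1)[of i] by simp
    consider "real (h i) < plen p" | "~ real (h i) < plen p" "near_loop kap (dl i) p" | "~ real (h i) < plen p" "~ near_loop kap (dl i) p" by blast
    thus ?thesis
    proof cases
     case 1
     have "\<bar>sform J (%_. 1) g i p\<bar> = \<bar>g (p ! (length p - 1)) - g (p ! 0)\<bar>"
      using bl[of 0 "length p - 1"] 1 by (simp add: sform_def J_def atLeast0LessThan)
     thus ?thesis using G(2)[of "p ! (length p - 1)"] G(2)[of "p ! 0"] 1 Ld by simp
    next
     case 2
     hence l: "loop i p (fst (ab i p)) (snd (ab i p))" using ab by blast
     hence "\<bar>sform J (%_. 1) g i p\<bar> = \<bar>g (p ! snd (ab i p)) - g (p ! fst (ab i p))\<bar>"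
      using bl[of "fst (ab i p)" "snd (ab i p)"] 2 by (simp add: sform_def J_def loop_def)
     also have "... <= Lip g * dist (p ! snd (ab i p)) (p ! fst (ab i p))" by (rule Lip_bound[OF gL])
     also have "... <= Lip g * dl i" using l by (intro mult_left_mono Lip_nonneg gL) (simp add: loop_def dist_commute)
     finally show ?thesis using 2 by simp
    next
     case 3
     thus ?thesis using Ld by (simp add: sform_def J_def)
    qed
   qed
   show "((%i. av i (sform J (%_. 1) g i)) \<longlongrightarrow> 0) U"
   proof (rule tendstoI)
    fix r :: real assume r: "r > 0"
    have ml1: "0 <= 2 * G * (ml + 1)" using G(1) by simp
    obtain n :: nat where n: "2 * G * (ml + 1) / (r / 2) < real n" using reals_Archimedean2 by blast
    have n0: "n > 0" using n ml1 r by (metis divide_nonneg_pos gr0I half_gt_zero of_nat_0 not_le)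
    have n': "2 * G * ((ml + 1) / real n) < r / 2" using n n0 r by (simp add: field_simps)
    have LB: "0 < Lip g * B + 1" using B_nonneg Lip_nonneg[OF gL] by (simp add: add_nonneg_pos)
    have "eventually (%i. dl i < r / 2 / (Lip g * B + 1)) U" by (rule order_tendstoD(2)[OF dl(2)]) (use r LB in simp)
    thus "eventually (%i. dist (av i (sform J (%_. 1) g i)) 0 < r) U"
     using h(1)[of n] av_long[OF n0]
    proof eventually_elim
     case (elim i)
     have "\<bar>av i (sform J (%_. 1) g i)\<bar> <= av i (%p. \<bar>sform J (%_. 1) g i p\<bar>)" by (rule avg_abs) (rule c0)
     also have "... <= av i (%p. 2 * G * indicator {p. real n < plen p} p + Lip g * dl i * 1)"
     proof (rule av_mono)
      fix p :: "'a list"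
      have "(indicator {p. real (h i) < plen p} p :: real) <= indicator {p. real n < plen p} p" using elim by (auto simp: indicator_def)
      hence "2 * G * indicator {p. real (h i) < plen p} p <= 2 * G * indicator {p. real n < plen p} p" using G(1) by (intro mult_left_mono) auto
      thus "\<bar>sform J (%_. 1) g i p\<bar> <= 2 * G * indicator {p. real n < plen p} p + Lip g * dl i * 1" using sb[of i p] by linarith
     qed
     also have "... = 2 * G * av i (indicator {p. real n < plen p}) + Lip g * dl i * av i (%_. 1)" by (rule avg_lin)
     also have "... <= 2 * G * ((ml + 1) / real n) + Lip g * dl i * B"
      using elim G(1) Lip_nonneg[OF gL] dl(1)[of i] mass[of i] by (intro add_mono mult_left_mono) auto
     also have "Lip g * dl i * B <= (Lip g * B + 1) * dl i" using dl(1)[of i] by (simp add: algebra_simps)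
     also have "... < r / 2" using elim LB by (simp add: field_simps)
     finally show ?case using n' by (simp add: dist_real_def)
    qed
   qed
  qed
  \<comment> \<open>The remaining edges must carry all of the mass, yet on a chain with a loop they
    fall short of the truncated length by \<open>kap\<close>.\<close>
  have Z: "ml <= LC (unsel J) (%_. 1)" by (rule closed_selection_negligible[OF J bd])
  have sc: "scost (unsel J) (%_. 1) i p <= 1 * min (real (h i)) (plen p) + (- kap) * indicator {p. plen p <= real (h i) & near_loop kap (dl i) p} p" for i p
  proof -
   have tot: "scost (unsel J) (%_. 1) i p + (\<Sum>j\<in>J i p. dist (p ! j) (p ! Suc j)) = plen p"
    unfolding scost_def unsel_def psum_def
    using sum.subset_diff[of "J i p" "{..<length p - 1}" "%j. dist (p ! j) (p ! Suc j)"] J by (simp add: sel_def)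
   consider "real (h i) < plen p" | "~ real (h i) < plen p" "near_loop kap (dl i) p" | "~ real (h i) < plen p" "~ near_loop kap (dl i) p" by blast
   thus ?thesis
   proof cases
    case 1
    hence "(\<Sum>j\<in>J i p. dist (p ! j) (p ! Suc j)) = plen p" by (simp add: J_def psum_def)
    thus ?thesis using tot 1 by simp
   next
    case 2
    hence l: "loop i p (fst (ab i p)) (snd (ab i p))" using ab by blast
    hence "kap <= (\<Sum>j\<in>J i p. dist (p ! j) (p ! Suc j))" using 2 by (simp add: J_def psum_block loop_def)
    thus ?thesis using tot 2 by simp
   next
    case 3
    hence "(\<Sum>j\<in>J i p. dist (p ! j) (p ! Suc j)) = 0" by (simp add: J_def)
    thus ?thesis using tot 3 by simp
   qed
  qed
  have "ml - e / 2 < LC (unsel J) (%_. 1)" using Z e by simp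
  hence e1: "eventually (%i. ml - e / 2 < av i (scost (unsel J) (%_. 1) i)) U"
   by (rule order_tendstoD(1)[OF LC[OF sel_unsel Lipb_const]])
  obtain n where n: "1 / real (Suc n) < e / 2" using nat_approx_posE[of "e / 2"] e by auto
  show "eventually (%i. kap * av i (indicator {p. plen p <= real (h i) & near_loop kap (dl i) p}) <= s - ml + e) U"
   using e1 h(1)[of n] h(2)
  proof eventually_elim
   case (elim i)
   have "av i (scost (unsel J) (%_. 1) i) <= av i (%p. 1 * min (real (h i)) (plen p) + (- kap) * indicator {p. plen p <= real (h i) & near_loop kap (dl i) p} p)"
    by (rule av_mono) (rule sc)
   also have "... = 1 * av i (%p. min (real (h i)) (plen p)) + (- kap) * av i (indicator {p. plen p <= real (h i) & near_loop kap (dl i) p})"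
    by (rule avg_lin)
   finally have "kap * av i (indicator {p. plen p <= real (h i) & near_loop kap (dl i) p}) < mR (real (h i)) + 1 / real (Suc (h i)) - (ml - e / 2)"
    using elim(1,3) by linarith
   moreover have "1 / real (Suc (h i)) <= 1 / real (Suc n)" using elim(2) by (intro divide_left_mono) auto
   ultimately show ?case using s[of "h i"] n by linarith
  qed
 qed
qed

text \<open>The case of \<open>kap\<close> and \<open>dl\<close> equal to \<open>0\<close>: no two
  points are closer than \<open>0\<close>, so only long chains are discarded. If truncated lengths
  stayed below \<open>ml - e\<close>, the estimate would read \<open>0 <= - e / 2\<close>.\<close>

lemma no_escape: assumes e: "e > 0" shows "EX n::nat. ml - e < mR (real n)"
proof (rule ccontr)
 assume "~ ?thesis"
 hence s: "mR (real n) <= ml - e" for n :: nat by (auto simp: not_less)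
 obtain h where h: "!!n. eventually (%i. n <= h i) U" "!!kap dl s e. 0 <= kap ==> (!!i. 0 <= dl i) ==> (dl \<longlongrightarrow> 0) U ==> (!!n::nat. mR (real n) <= s) ==> e > 0 ==>
   eventually (%i. kap * av i (indicator {p. plen p <= real (h i) & near_loop kap (dl i) p}) <= s - ml + e) U"
  by (rule discard_long_and_loops) (rule that, assumption, blast)
 have "eventually (%i. 0 * av i (indicator {p. plen p <= real (h i) & near_loop 0 0 p}) <= (ml - e) - ml + e / 2) U"
  by (rule h(2)) (use s e in auto)
 thus False using e nb by (auto simp: eventually_const_iff)
qed

text \<open>If the measure stayed above \<open>e\<close>, overspill would give gaps tending to
  \<open>0\<close> at weight still above \<open>e\<close>; discarding these loops would cost more
  than \<open>kap e\<close> of length, although truncated lengths are at most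
  \<open>ml\<close>.\<close>

lemma no_loops:
 assumes kap: "kap > 0" and e: "e > 0"
 shows "EX m::nat. \<Lambda> (%i. {p. plen p <= R & near_loop kap (1 / real (Suc m)) p}) <= e"
proof (rule ccontr)
 let ?S = "%m. {p. plen p <= R & near_loop kap (1 / real (Suc m)) (p :: 'a list)}"
 assume "~ ?thesis"
 hence *: "e < \<Lambda> (%i. ?S m)" for m by (auto simp: not_le)
 obtain k where k: "!!n. eventually (%i. n <= k i) U" "eventually (%i. e < av i (indicator (?S (k i)))) U"
  using slow_choice[of "%m i. e < av i (indicator (?S m))"] order_tendstoD(1)[OF \<Lambda> *] by blast
 obtain h where h: "!!n. eventually (%i. n <= h i) U" "!!kap dl s e. 0 <= kap ==> (!!i. 0 <= dl i) ==> (dl \<longlongrightarrow> 0) U ==> (!!n::nat. mR (real n) <= s) ==> e > 0 ==>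
   eventually (%i. kap * av i (indicator {p. plen p <= real (h i) & near_loop kap (dl i) p}) <= s - ml + e) U"
  by (rule discard_long_and_loops) (rule that, assumption, blast)
 obtain n :: nat where n: "R <= real n" using real_arch_simple by blast
 have "eventually (%i. kap * av i (indicator {p. plen p <= real (h i) & near_loop kap (1 / real (Suc (k i))) p}) <= ml - ml + kap * e) U"
 proof (rule h(2))
  show "((%i. 1 / real (Suc (k i))) \<longlongrightarrow> 0) U"
  proof (rule tendstoI)
   fix r :: real assume "r > 0"
   then obtain n where n: "1 / real (Suc n) < r" using nat_approx_posE by blast
   show "eventually (%i. dist (1 / real (Suc (k i))) 0 < r) U" using k(1)[of n]
   proof eventually_elim
    case (elim i)
    hence "1 / real (Suc (k i)) <= 1 / real (Suc n)" by (intro divide_left_mono) auto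
    thus ?case using n by (simp add: dist_real_def)
   qed
  qed
  show "mR (real n) <= ml" for n by (rule mR_le) simp
 qed (use kap e in auto)
 hence "eventually (%i. False) U" using k(2) h(1)[of n]
 proof eventually_elim
  case (elim i)
  have "av i (indicator (?S (k i))) <= av i (indicator {p. plen p <= real (h i) & near_loop kap (1 / real (Suc (k i))) p})"
   by (rule av_mono) (use elim(3) n in \<open>auto simp: indicator_def\<close>)
  hence "kap * e < kap * av i (indicator {p. plen p <= real (h i) & near_loop kap (1 / real (Suc (k i))) p})"
   using elim(2) kap by (intro mult_strict_left_mono) auto
  thus ?case using elim(1) by simp
 qed
 thus False using nb by (simp add: trivial_limit_def)
qed

lemma AE_in_A: "AE x in lam. eventually (%i. x i : A i) U"
proof -
 have "\<Lambda> (%i. - A i) = 0"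
  by (rule tendsto_unique[OF nb \<Lambda>]) (simp add: avg_def indicator_def)
 hence "AE x in lam. EX n::nat. eventually (%i. x i ~: - A i) U" by (intro AE_not_internal) simp
 thus ?thesis by simp
qed

lemma AE_finite_length: "AE x in lam. EX n::nat. eventually (%i. plen (x i) <= real n) U"
proof -
 have "AE x in lam. EX n. eventually (%i. x i ~: {p. real n < plen p}) U"
 proof (rule AE_not_internal)
  fix e :: real assume e: "e > 0"
  obtain n :: nat where n: "(ml + 1) / e < real n" using reals_Archimedean2 by blast
  have n0: "n > 0" using n e by (metis add_nonneg_pos divide_pos_pos gr0I less_asym measure_nonneg of_nat_0 zero_less_one)
  have "\<Lambda> (%i. {p. real n < plen p}) <= (ml + 1) / real n" by (rule tendsto_upperbound[OF \<Lambda> av_long[OF n0] nb])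
  also have "... <= e" using n n0 e by (simp add: field_simps)
  finally show "EX n. \<Lambda> (%i. {p. real n < plen p}) <= e" by blast
 qed
 thus ?thesis by (simp add: not_less)
qed

lemma AE_no_loops: "AE x in lam. ALL k::nat. EX m::nat. eventually (%i. ~ near_loop (1 / real (Suc k)) (1 / real (Suc m)) (x i)) U"
proof -
 have "AE x in lam. ALL k n::nat. EX m. eventually (%i. x i ~: {p. plen p <= real n & near_loop (1 / real (Suc k)) (1 / real (Suc m)) p}) U"
  unfolding AE_all_countable by (intro allI AE_not_internal no_loops) simp_all
 thus ?thesis using AE_finite_length
 proof eventually_elim
  case (elim x)
  obtain n :: nat where n: "eventually (%i. plen (x i) <= real n) U" using elim(2) by blast
  show ?case
  proof
   fix k :: nat
   obtain m where "eventually (%i. x i ~: {p. plen p <= real n & near_loop (1 / real (Suc k)) (1 / real (Suc m)) p}) U" using elim(1) by blast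
   hence "eventually (%i. ~ near_loop (1 / real (Suc k)) (1 / real (Suc m)) (x i)) U" using n by eventually_elim simp
   thus "EX m::nat. eventually (%i. ~ near_loop (1 / real (Suc k)) (1 / real (Suc m)) (x i)) U" by blast
  qed
 qed
qed

text \<open>The truncated distance to \<open>K n\<close>, as a cost and at the start, has mean of
  order \<open>1 / (n + 1)\<close>. Along a subsequence both tend to \<open>0\<close> at almost
  every chain, and \<open>path_near_set\<close> keeps the chain near some \<open>K n\<close>. The
  nets are collected in one countable \<open>D\<close>, which later yields measurability although
  the space may be nonseparable.\<close>

lemma AE_totally_bounded:
 obtains D where "countable D"
  "AE x in lam. ALL e>0. EX F. finite F & F \<subseteq> D & eventually (%i. ALL y:set (x i). EX z:F. dist y z < e) U"
proof -
 have "EX K. compact K & K ~= {} & measure mu (- K) <= 1 / real (Suc n) & measure N (- K) <= 1 / real (Suc n)" for n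
  by (rule tight) simp
 then obtain K where K: "!!n. compact (K n)" "!!n. K n ~= {}" "!!n. measure mu (- K n) <= 1 / real (Suc n)" "!!n. measure N (- K n) <= 1 / real (Suc n)"
  by metis
 have "EX C. finite C & K n \<subseteq> (\<Union>c\<in>C. ball c (1 / real (Suc m)))" for n m
  using K(1)[of n] unfolding compact_eq_totally_bounded by (meson divide_pos_pos of_nat_0_less_iff zero_less_Suc zero_less_one)
 then obtain C where C: "!!n m. finite (C n m)" "!!n m. K n \<subseteq> (\<Union>c\<in>C n m. ball c (1 / real (Suc m)))" by metis
 define D where "D = (\<Union>n m. C n m)"
 have D: "countable D" unfolding D_def by (intro countable_UN countableI_type countable_finite C)
 define g where "g n x = min 1 (real (Suc n) * infdist x (K n))" for n x
 have g: "g n : Lipb_funs" "0 <= g n x" "g n x <= 1" for n x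
  unfolding g_def by (rule Lipb_infdist_cut) (simp_all add: infdist_nonneg)
 have gi: "(LINT x|M. g n x) <= 1 / real (Suc n)" if M: "fbm M" "measure M (- K n) <= 1 / real (Suc n)" for n M
 proof -
  have Kb: "- K n : sets borel" using compact_imp_closed[OF K(1)[of n]] by auto
  have "(LINT x|M. g n x) <= (LINT x|M. indicator (- K n) x)"
  proof (rule integral_mono)
   show "integrable M (g n)" by (rule fbm_integrable_Lipb[OF M(1) g(1)])
   show "integrable M (indicator (- K n) :: 'a => real)"
    by (rule fbm_integrable_bounded[OF M(1), where B = 1]) (use Kb in \<open>auto simp: indicator_def\<close>)
   show "g n x <= indicator (- K n) x" for x using g(3)[of n x] by (auto simp: g_def indicator_def)
  qed
  also have "... = measure M (- K n)" using Kb by (simp add: fbmD[OF M(1)])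
  finally show ?thesis using M(2) by simp
 qed
 \<comment> \<open>Truncated at \<open>1\<close> to be bounded, as integrals of standard parts
   require; values below \<open>1 / 2\<close> still reveal the true cost.\<close>
 define F1 where "F1 n i p = min 1 (path_cost (g n) p)" for n and i :: 'i and p
 define F2 where "F2 n i p = g n (hd p)" for n and i :: 'i and p
 have pc0: "0 <= path_cost (g n) p" for n p unfolding path_cost_def by (intro sum_nonneg mult_nonneg_nonneg g) auto
 have b: "\<bar>F1 n i p\<bar> <= 1" "\<bar>F2 n i p\<bar> <= 1" for n i p using pc0[of n p] g(2,3)[of n "hd p"] by (auto simp: F1_def F2_def)
 have t: "((%i. F1 n i (x i)) \<longlongrightarrow> st (F1 n) x) U" "((%i. F2 n i (x i)) \<longlongrightarrow> st (F2 n) x) U" for n x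
  by (rule st[where K = 1], simp add: b)+
 define u where "u n x = st (F1 n) x + st (F2 n) x" for n x
 have s0: "0 <= st (F1 n) x" "0 <= st (F2 n) x" for n x
  by (rule tendsto_lowerbound[OF t(1) always_eventually nb], simp add: F1_def pc0)
   (rule tendsto_lowerbound[OF t(2) always_eventually nb], simp add: F2_def g)
 have i1: "(LINT x|lam. st (F1 n) x) <= 1 / real (Suc n)" for n
 proof (rule field_le_epsilon)
  fix e :: real assume e: "e > 0"
  have "(LINT x|lam. st (F1 n) x) <= (LINT x|mu. g n x) + e"
  proof (rule tendsto_upperbound[OF st_integral(2) _ nb])
   show "eventually (%i. av i (F1 n i) <= (LINT x|mu. g n x) + e) U" using lim_cost[OF g(1)[of n] g(2)[of n] e]
   proof eventually_elim
    case (elim i)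
    have "av i (F1 n i) <= av i (path_cost (g n))" by (rule av_mono) (simp add: F1_def)
    thus ?case using elim by simp
   qed
  qed (rule b(1))
  thus "(LINT x|lam. st (F1 n) x) <= 1 / real (Suc n) + e" using gi[OF mu K(3)[of n]] by simp
 qed
 have i2: "(LINT x|lam. st (F2 n) x) <= 1 / real (Suc n)" for n
 proof -
  have "(LINT x|lam. st (F2 n) x) = (LINT x|N. g n x)"
  proof (rule tendsto_unique[OF nb st_integral(2)[where K = 1]])
   have "F2 n i = (%p. g n (hd p))" for i by (rule ext) (simp add: F2_def)
   thus "((%i. av i (F2 n i)) \<longlongrightarrow> (LINT x|N. g n x)) U" using lim_start[OF g(1)[of n]] by simp
  qed (rule b(2))
  thus ?thesis using gi[OF PN(2) K(4)[of n]] by simp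
 qed
 have int: "integrable lam (u n)" for n
  unfolding u_def by (intro Bochner_Integration.integrable_add st_integral(1)[where K = 1] b)
 have "(%n. \<integral>x. norm (u n x) \<partial>lam) \<longlonglongrightarrow> 0"
 proof (rule Lim_null_comparison)
  have "(LINT x|lam. norm (u n x)) = (LINT x|lam. st (F1 n) x) + (LINT x|lam. st (F2 n) x)" for n
  proof -
   have "(LINT x|lam. norm (u n x)) = (LINT x|lam. u n x)"
    by (rule Bochner_Integration.integral_cong) (use s0 in \<open>auto simp: u_def\<close>)
   also have "... = (LINT x|lam. st (F1 n) x) + (LINT x|lam. st (F2 n) x)"
    unfolding u_def by (intro Bochner_Integration.integral_add st_integral(1)[where K = 1] b)
   finally show ?thesis .
  qed
  moreover have "0 <= (LINT x|lam. norm (u n x))" for n by simp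
  ultimately have "norm (LINT x|lam. norm (u n x)) <= 2 * (1 / real (Suc n))" for n
   using i1[of n] i2[of n] by (simp only: real_norm_def abs_of_nonneg)
  thus "\<forall>\<^sub>F n in sequentially. norm (LINT x|lam. norm (u n x)) <= 2 * (1 / real (Suc n))"
   by (intro always_eventually allI)
  show "(%n. 2 * (1 / real (Suc n))) \<longlonglongrightarrow> 0"
   using tendsto_mult_right_zero[OF LIMSEQ_Suc[OF lim_1_over_n], of 2] by simp
 qed
 then obtain r :: "nat => nat" where r: "strict_mono r" "AE x in lam. (%n. u (r n) x) \<longlonglongrightarrow> 0"
  using tendsto_L1_AE_subseq[of lam u, OF int] by blast
 have "AE x in lam. ALL e>0. EX F. finite F & F \<subseteq> D & eventually (%i. ALL y:set (x i). EX z:F. dist y z < e) U"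
  using r(2) AE_in_A
 proof eventually_elim
  case (elim x)
  show ?case
  proof (intro allI impI)
   fix e :: real assume e: "e > 0"
   have ev: "eventually (%n. u (r n) x < min (e / 8) (1 / 2)) sequentially" by (rule order_tendstoD(2)[OF elim(1)]) (use e in simp)
   obtain m where m: "1 / real (Suc m) < e / 8" using nat_approx_posE[of "e / 8"] e by auto
   obtain n where n: "u (r n) x < min (e / 8) (1 / 2)" "m <= n"
    using ev unfolding eventually_sequentially by (metis nat_le_linear)
   define k where "k = r n"
   have "m <= k" unfolding k_def using n(2) seq_suble[OF r(1), of n] by simp
   hence k: "1 / real (Suc k) < e / 8" using m by (meson divide_left_mono le_less_trans of_nat_0_less_iff of_nat_mono Suc_le_mono zero_less_Suc zero_le_one mult_pos_pos)
   have "st (F1 k) x < min (e / 8) (1 / 2)" "st (F2 k) x < 1 / 2" using n(1) s0[of k x] unfolding u_def k_def by auto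
   hence e12: "eventually (%i. F1 k i (x i) < min (e / 8) (1 / 2)) U" "eventually (%i. F2 k i (x i) < 1 / 2) U"
    using order_tendstoD(2)[OF t(1)] order_tendstoD(2)[OF t(2)] by blast+
   have e3: "eventually (%i. 1 / real (Suc (nf i)) < e / 8) U" by (rule mesh) (use e in simp)
   have "eventually (%i. ALL y:set (x i). EX z:C k m. dist y z < e) U"
    using e12 e3 elim(2)
   proof eventually_elim
    case (elim i)
    have ch: "chain (1 / real (Suc (nf i))) (x i)" using chains elim(4) .
    have pc: "path_cost (g k) (x i) < e / 8" using elim(1) by (auto simp: F1_def min_def split: if_splits)
    have "real (Suc k) * infdist (hd (x i)) (K k) <= 1" using elim(2) by (auto simp: F2_def g_def min_def split: if_splits)
    hence hd: "infdist (hd (x i)) (K k) <= 1 / real (Suc k)" by (simp add: field_simps)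
    show ?case
    proof
     fix y assume y: "y : set (x i)"
     have "infdist y (K k) <= 1 / real (Suc k) + 1 / real (Suc (nf i)) + path_cost (%x. min 1 (real (Suc k) * infdist x (K k))) (x i)"
      by (rule path_near_set[OF ch _ _ hd y]) auto
     hence "infdist y (K k) < e / 2" using k elim(3) pc e unfolding g_def by linarith
     then obtain z where z: "z : K k" "dist y z < e / 2" using K(2)[of k] unfolding infdist_notempty[OF K(2)] by (subst (asm) cINF_less_iff) auto
     then obtain z' where z': "z' : C k m" "dist z' z < 1 / real (Suc m)" using C(2)[of k m] by auto
     have "dist y z' < e" using dist_triangle2[of y z' z] z(2) z'(2) m e by linarith
     thus "EX z:C k m. dist y z < e" using z'(1) by blast
    qed
   qed
   thus "EX F. finite F & F \<subseteq> D & eventually (%i. ALL y:set (x i). EX z:F. dist y z < e) U"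
    using C(1)[of k m] unfolding D_def by blast
  qed
 qed
 thus ?thesis by (rule that[OF D])
qed

end

section \<open>Standard parts of paths\<close>

text \<open>By pigeonhole each finite net contains a centre within \<open>e\<close> of
  \<open>U\<close>-almost all \<open>y i\<close>; the centres for \<open>e = 1 / (n + 1)\<close>
  form a Cauchy sequence, and completeness gives the limit.\<close>

lemma ultra_metric_limit:
 fixes y :: "'i => 'a::complete_space"
 assumes U: "ultra U" and tb: "!!e. e > 0 ==> EX F. finite F & eventually (%i. EX z:F. dist (y i) z < e) U"
 shows "EX l. (y \<longlongrightarrow> l) U"
proof -
 have nb: "U ~= bot" using U by (simp add: ultra_def)
 have "EX z. eventually (%i. dist (y i) z < e) U" if e: "e > 0" for e
 proof -
  obtain F where F: "finite F" "eventually (%i. EX z:F. dist (y i) z < e) U" using tb[OF e] by blast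
  have "eventually (%i. (SOME z. z : F & dist (y i) z < e) : F) U" using F(2)
   by eventually_elim (rule someI2_ex, auto)
  then obtain z where z: "eventually (%i. (SOME z. z : F & dist (y i) z < e) = z) U"
   using ultra_ex_finite[OF U F(1), of "%i. SOME z. z : F & dist (y i) z < e"] by blast
  have "eventually (%i. dist (y i) z < e) U" using F(2) z
  proof eventually_elim
   case (elim i)
   hence "(SOME z. z : F & dist (y i) z < e) : F & dist (y i) (SOME z. z : F & dist (y i) z < e) < e"
    by (intro someI_ex[of "%z. z : F & dist (y i) z < e"]) blast
   thus ?case using elim(2) by simp
  qed
  thus ?thesis by blast
 qed
 hence "EX z. eventually (%i. dist (y i) z < 1 / real (Suc n)) U" for n by simp
 then obtain z where z: "!!n. eventually (%i. dist (y i) (z n) < 1 / real (Suc n)) U" by metis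
 have zz: "dist (z m) (z n) < 1 / real (Suc m) + 1 / real (Suc n)" for m n
 proof -
  obtain i where "dist (y i) (z m) < 1 / real (Suc m)" "dist (y i) (z n) < 1 / real (Suc n)"
   using eventually_happens'[OF nb eventually_conj[OF z[of m] z[of n]]] by blast
  thus ?thesis using dist_triangle3[of "z m" "z n" "y i"] by linarith
 qed
 have "Cauchy z"
 proof (rule metric_CauchyI)
  fix e :: real assume "e > 0"
  then obtain M where M: "1 / real (Suc M) < e / 2" using nat_approx_posE[of "e / 2"] by auto
  have "dist (z m) (z n) < e" if "M <= m" "M <= n" for m n
  proof -
   have "1 / real (Suc m) <= 1 / real (Suc M)" "1 / real (Suc n) <= 1 / real (Suc M)" using that by (auto intro!: divide_left_mono)
   thus ?thesis using zz[of m n] M by linarith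
  qed
  thus "EX M. ALL m>=M. ALL n>=M. dist (z m) (z n) < e" by blast
 qed
 then obtain l where l: "z \<longlonglongrightarrow> l" using Cauchy_convergent convergent_def by blast
 have "(y \<longlongrightarrow> l) U"
 proof (rule tendstoI)
  fix e :: real assume e: "e > 0"
  obtain M where M: "1 / real (Suc M) < e / 2" using nat_approx_posE[of "e / 2"] e by auto
  obtain n where n: "M <= n" "dist (z n) l < e / 2"
   using tendstoD[OF l, of "e / 2"] e unfolding eventually_sequentially by (metis half_gt_zero nat_le_linear)
  have "1 / real (Suc n) <= 1 / real (Suc M)" using n(1) by (auto intro!: divide_left_mono)
  hence n': "1 / real (Suc n) < e / 2" using M by linarith
  show "eventually (%i. dist (y i) l < e) U" using z[of n]
   by eventually_elim (use dist_triangle[of _ l "z n"] n(2) n' in \<open>smt (verit) field_sum_of_halves\<close>)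
 qed
 thus ?thesis by blast
qed

context transport_limit
begin

text \<open>The chains with a usable standard part: finite length, no piece of noninfinitesimal
  length with infinitely close ends, and vertices near finite nets from \<open>D\<close> at every
  scale.\<close>

definition good :: "'a set => ('i => 'a list) => bool" where
 "good D x \<longleftrightarrow> eventually (%i. x i : A i) U & (EX n::nat. eventually (%i. plen (x i) <= real n) U) &
   (ALL k::nat. EX m::nat. eventually (%i. ~ near_loop (1 / real (Suc k)) (1 / real (Suc m)) (x i)) U) &
   (ALL e>0. EX F. finite F & F \<subseteq> D & eventually (%i. ALL y:set (x i). EX z:F. dist y z < e) U)"

text \<open>The limit of the lengths of the chains, which may exceed the length of the limit curve;
  only the comparison of masses shows that nothing is lost in total.\<close>

definition slen :: "('i => 'a list) => real" where
 "slen x = Lim U (%i. plen (x i))"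

definition scurve :: "('i => 'a list) => real => 'a" where
 "scurve x t = Lim U (%i. pt (x i) t)"

abbreviation "mesh_size i \<equiv> 1 / real (Suc (nf i))"

lemma mesh_tendsto: "((%i. mesh_size i) \<longlongrightarrow> 0) U"
proof (rule tendstoI)
 fix e :: real assume "e > 0"
 from mesh[OF this] show "eventually (%i. dist (mesh_size i) 0 < e) U"
  by eventually_elim (simp add: dist_real_def)
qed

context
 fixes D x assumes g: "good D x"
begin

lemma good_chain: "eventually (%i. chain (mesh_size i) (x i)) U"
proof -
 have "eventually (%i. x i : A i) U" using g by (simp add: good_def)
 thus ?thesis by (rule eventually_mono) (rule chains)
qed

lemma slen: "((%i. plen (x i)) \<longlongrightarrow> slen x) U"
proof -
 obtain n :: nat where "eventually (%i. plen (x i) <= real n) U" using g by (auto simp: good_def)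
 hence "eventually (%i. \<bar>plen (x i)\<bar> <= real n) U" by eventually_elim (use plen_nonneg in simp)
 thus ?thesis unfolding slen_def by (rule ultra_bounded_tendsto[OF ultra])
qed

lemma slen_nonneg: "0 <= slen x"
 by (rule tendsto_lowerbound[OF slen always_eventually nb]) (intro allI plen_nonneg)

lemma scurve_tendsto:
 assumes t: "0 <= t" shows "((%i. pt (x i) t) \<longlongrightarrow> scurve x t) U"
proof -
 have "EX l. ((%i. pt (x i) t) \<longlongrightarrow> l) U"
 proof (rule ultra_metric_limit[OF ultra])
  fix e :: real assume "e > 0"
  then obtain F where F: "finite F" "eventually (%i. ALL y:set (x i). EX z:F. dist y z < e) U" using g unfolding good_def by blast
  have "eventually (%i. EX z:F. dist (pt (x i) t) z < e) U" using F(2) good_chain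
   by eventually_elim (use pt_in[OF _ _ t] in force)
  thus "EX F. finite F & eventually (%i. EX z:F. dist (pt (x i) t) z < e) U" using F(1) by blast
 qed
 thus ?thesis unfolding scurve_def using tendsto_Lim[OF nb] by blast
qed

lemma scurve_near_D:
 assumes t: "0 <= t" and e: "e > 0" shows "EX d:D. dist (scurve x t) d < e"
proof -
 have e2: "e / 2 > 0" using e by simp
 obtain F where F: "F \<subseteq> D" "eventually (%i. ALL y:set (x i). EX z:F. dist y z < e / 2) U"
  using g e2 unfolding good_def by blast
 have "eventually (%i. EX d:D. dist (scurve x t) d < e) U"
  using F(2) good_chain tendstoD[OF scurve_tendsto[OF t] e2]
 proof eventually_elim
  case (elim i)
  obtain z where z: "z : F" "dist (pt (x i) t) z < e / 2" using elim(1) pt_in[OF elim(2) _ t] by auto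
  hence "dist (scurve x t) z < e" using dist_triangle3[of "scurve x t" z "pt (x i) t"] elim(3) by linarith
  thus ?case using z(1) F(1) by blast
 qed
 thus ?thesis using nb by (simp add: eventually_const_iff)
qed

lemma scurve_lipschitz: "(slen x)-lipschitz_on {0..1} (scurve x)"
proof (rule lipschitz_onI[OF _ slen_nonneg])
 have *: "dist (scurve x s) (scurve x t) <= slen x * dist s t" if st: "0 <= s" "s <= t" "t <= 1" for s t
 proof (rule tendsto_le[OF nb])
  show "((%i. dist (pt (x i) s) (pt (x i) t)) \<longlongrightarrow> dist (scurve x s) (scurve x t)) U"
   by (intro tendsto_dist scurve_tendsto) (use st in auto)
  have "((%i. (t - s) * plen (x i) + 2 * mesh_size i) \<longlongrightarrow> (t - s) * slen x + 2 * 0) U"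
   by (intro tendsto_intros slen mesh_tendsto)
  thus "((%i. (t - s) * plen (x i) + 2 * mesh_size i) \<longlongrightarrow> slen x * dist s t) U"
   using st by (simp add: dist_real_def mult.commute)
  show "eventually (%i. dist (pt (x i) s) (pt (x i) t) <= (t - s) * plen (x i) + 2 * mesh_size i) U"
   using good_chain by eventually_elim (rule pt_dist, use st in auto)
 qed
 fix s t :: real assume "s : {0..1}" "t : {0..1}"
 thus "dist (scurve x s) (scurve x t) <= slen x * dist s t"
  using *[of s t] *[of t s] by (cases "s <= t") (auto simp: dist_commute)
qed

lemma scurve_vlen_le: "0 <= s ==> s <= t ==> t <= 1 ==> vlen (scurve x) s t <= slen x * (t - s)"
 by (rule vlen_props(2)[OF scurve_lipschitz])

lemma scurve_ends:
 assumes h: "h : Lipb_funs"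
 shows "((%i. h (hd (x i))) \<longlongrightarrow> h (scurve x 0)) U" "((%i. h (last (x i))) \<longlongrightarrow> h (scurve x 1)) U"
proof -
 have cont: "isCont h y" for y using Lipb_continuous[OF Lipb_Lip[OF h]] by (simp add: continuous_on_eq_continuous_at)
 have t: "((%i. h (pt (x i) t)) \<longlongrightarrow> h (scurve x t)) U" if "0 <= t" for t
  by (rule isCont_tendsto_compose[OF cont scurve_tendsto[OF that]])
 show "((%i. h (hd (x i))) \<longlongrightarrow> h (scurve x 0)) U"
  by (rule Lim_transform_eventually[OF t[of 0]]) (simp, use good_chain in \<open>eventually_elim, simp add: pt_ends\<close>)
 show "((%i. h (last (x i))) \<longlongrightarrow> h (scurve x 1)) U"
  by (rule Lim_transform_eventually[OF t[of 1]]) (simp, use good_chain in \<open>eventually_elim, simp add: pt_ends\<close>)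
qed

text \<open>Chain and curve are both compared with Riemann sums over \<open>m\<close> equal pieces;
  for fixed \<open>m\<close> the sums of the chains converge to that of the curve, being continuous
  in finitely many points \<open>pt\<close>. So \<open>m\<close> is fixed first and the mesh
  afterwards.\<close>

lemma scurve_form:
 assumes f: "f : Lipb_funs" and pj: "pj : Lip_funs"
 shows "((%i. path_form f pj (x i)) \<longlongrightarrow> curve_integral (scurve x) f pj) U"
proof (rule tendstoI)
 fix e :: real assume e: "e > 0"
 note fL = Lipb_Lip[OF f]
 note Lf = Lip_nonneg[OF fL] and Lp = Lip_nonneg[OF pj]
 define C where "C = Lip f * Lip pj"
 define l where "l = slen x + 1"
 have C: "0 <= C" unfolding C_def using Lf Lp by simp
 have l: "0 < l" "slen x <= l" using slen_nonneg by (auto simp: l_def)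
 obtain m :: nat where m: "C * l * l / (e / 4) < real m" using reals_Archimedean2 by blast
 have "0 <= C * l * l / (e / 4)" using C l e by simp
 hence m0: "m > 0" using m by (metis gr0I of_nat_0 not_le)
 have m1: "C * (l / real m) * l < e / 4" using m m0 e by (simp add: field_simps)
 define s where "s k = real k / real m" for k
 have s: "s 0 = 0" "s m = 1" "!!k. s k <= s (Suc k)" "!!k. k <= m ==> 0 <= s k & s k <= 1"
  using m0 by (auto simp: s_def divide_right_mono)
 have "\<bar>curve_integral (scurve x) f pj - (\<Sum>k<m. f (scurve x (s k)) * (pj (scurve x (s (Suc k))) - pj (scurve x (s k))))\<bar>
   <= Lip f * (l / real m) * Lip pj * vlen (scurve x) 0 1"
 proof (rule curve_integral_riemann[OF scurve_lipschitz fL pj s])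
  fix k r assume k: "k < m" "s k <= r" "r <= s (Suc k)"
  have "dist (scurve x r) (scurve x (s k)) <= slen x * dist r (s k)"
   by (rule lipschitz_onD[OF scurve_lipschitz]) (use k s(4)[of k] s(4)[of "Suc k"] in auto)
  also have "... <= l * (1 / real m)"
  proof (rule mult_mono)
   have "s (Suc k) - s k = 1 / real m" by (simp add: s_def diff_divide_distrib[symmetric])
   thus "dist r (s k) <= 1 / real m" using k by (simp add: dist_real_def)
  qed (use l in auto)
  finally show "dist (scurve x r) (scurve x (s k)) <= l / real m" by simp
 qed
 also have "... <= Lip f * (l / real m) * Lip pj * l"
  using scurve_vlen_le[of 0 1] l Lf Lp by (intro mult_left_mono) auto
 also have "... < e / 4" using m1 by (simp add: C_def mult_ac)
 finally have e1: "\<bar>curve_integral (scurve x) f pj - (\<Sum>k<m. f (scurve x (s k)) * (pj (scurve x (s (Suc k))) - pj (scurve x (s k))))\<bar> < e / 4" .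
 have cont: "isCont h y" if "h : Lip_funs" for h :: "'a => real" and y
  using Lipb_continuous[OF that] by (simp add: continuous_on_eq_continuous_at)
 have "((%i. \<Sum>k<m. f (pt (x i) (s k)) * (pj (pt (x i) (s (Suc k))) - pj (pt (x i) (s k)))) \<longlongrightarrow>
   (\<Sum>k<m. f (scurve x (s k)) * (pj (scurve x (s (Suc k))) - pj (scurve x (s k))))) U"
  by (intro tendsto_sum tendsto_mult tendsto_diff isCont_tendsto_compose[OF cont] scurve_tendsto fL pj) (auto simp: s_def)
 hence e2: "eventually (%i. \<bar>(\<Sum>k<m. f (pt (x i) (s k)) * (pj (pt (x i) (s (Suc k))) - pj (pt (x i) (s k)))) -
   (\<Sum>k<m. f (scurve x (s k)) * (pj (scurve x (s (Suc k))) - pj (scurve x (s k))))\<bar> < e / 4) U"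
  unfolding tendsto_iff dist_real_def using e by (elim allE[of _ "e / 4"]) simp
 have "eventually (%i. plen (x i) < l) U" by (rule order_tendstoD(2)[OF slen]) (simp add: l_def)
 moreover have "eventually (%i. mesh_size i < e / 4 / (2 * C * l + 1)) U"
  by (rule mesh) (use e C l in \<open>simp add: add_nonneg_pos\<close>)
 ultimately show "eventually (%i. dist (path_form f pj (x i)) (curve_integral (scurve x) f pj) < e) U"
  using e2 good_chain
 proof eventually_elim
  case (elim i)
  have "\<bar>path_form f pj (x i) - (\<Sum>k<m. f (pt (x i) (s k)) * (pj (pt (x i) (s (Suc k))) - pj (pt (x i) (s k))))\<bar>
    <= Lip f * (plen (x i) / real m + 2 * mesh_size i) * Lip pj * plen (x i)"
   unfolding s_def by (rule path_form_blocks[OF elim(4) _ fL pj m0]) simp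
  also have "... = C * ((plen (x i) / real m + 2 * mesh_size i) * plen (x i))" by (simp add: C_def mult_ac)
  also have "... <= C * ((l / real m + 2 * mesh_size i) * l)"
   using elim(1) plen_nonneg[of "x i"] l m0 by (intro mult_left_mono C mult_mono add_mono divide_right_mono) auto
  also have "... = C * (l / real m) * l + 2 * C * l * mesh_size i" by (simp add: algebra_simps)
  also have "2 * C * l * mesh_size i <= (2 * C * l + 1) * mesh_size i" by (intro mult_right_mono) auto
  also have "... <= (2 * C * l + 1) * (e / 4 / (2 * C * l + 1))"
   using elim(2) C l by (intro mult_left_mono) (auto intro: add_nonneg_nonneg)
  also have "... = e / 4"
  proof -
   have "2 * C * l + 1 ~= 0" using mult_nonneg_nonneg[OF C less_imp_le[OF l(1)]] by linarith
   thus ?thesis by (subst times_divide_eq_right, subst nonzero_mult_div_cancel_left) auto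
  qed
  finally have "\<bar>path_form f pj (x i) - (\<Sum>k<m. f (pt (x i) (s k)) * (pj (pt (x i) (s (Suc k))) - pj (pt (x i) (s k))))\<bar> < e / 4 + e / 4"
   using m1 by linarith
  thus ?case using e1 elim(3) unfolding dist_real_def by linarith
 qed
qed

text \<open>A piece of the limit curve is at most as long as the limit of the matching pieces of the
  chains, so a self-approach of the curve is already a near loop of the chains.\<close>

lemma scurve_no_self_approach: "EX m::nat. ~ self_approach (1 / real (Suc k)) (1 / real (Suc m)) (scurve x)"
proof -
 obtain m :: nat where m: "eventually (%i. ~ near_loop (1 / real (Suc k)) (1 / real (Suc m)) (x i)) U" using g unfolding good_def by blast
 have "~ self_approach (1 / real (Suc k)) (1 / real (Suc m)) (scurve x)"
 proof
  let ?kap = "1 / real (Suc k)" and ?dl = "1 / real (Suc m)"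
  assume "self_approach ?kap ?dl (scurve x)"
  then obtain s t where st: "0 <= s" "s <= t" "t <= 1" "?kap < vlen (scurve x) s t" "dist (scurve x s) (scurve x t) < ?dl"
   by (auto simp: self_approach_def)
  have "((%i. (t - s) * plen (x i) - 2 * mesh_size i) \<longlongrightarrow> (t - s) * slen x - 2 * 0) U"
   by (intro tendsto_intros slen mesh_tendsto)
  moreover have "?kap < (t - s) * slen x - 2 * 0" using st(4) scurve_vlen_le[OF st(1-3)] by (simp add: mult.commute)
  ultimately have 1: "eventually (%i. ?kap < (t - s) * plen (x i) - 2 * mesh_size i) U" by (rule order_tendstoD(1))
  have 2: "eventually (%i. dist (pt (x i) s) (pt (x i) t) < ?dl) U"
   by (rule order_tendstoD(2)[OF tendsto_dist[OF scurve_tendsto scurve_tendsto] st(5)]) (use st in auto)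
  have "eventually (%i. False) U" using 1 2 m good_chain
  proof eventually_elim
   case (elim i)
   have p: "0 < mesh_size i" by simp
   have "near_loop ?kap ?dl (x i)"
    unfolding near_loop_def
   proof (intro exI conjI)
    show "idx (x i) s <= idx (x i) t" by (rule idx_props(4)[OF elim(4) p st(1,2)])
    show "idx (x i) t <= length (x i) - 1" by (rule idx_props(3)[OF elim(4) p]) (use st in simp)
    show "?kap <= psum (x i) (idx (x i) t) - psum (x i) (idx (x i) s)"
     using idx_psum_diff[OF elim(4) p st(1-3)] elim(1) by (simp only: abs_le_iff) linarith
    show "dist (x i ! idx (x i) s) (x i ! idx (x i) t) < ?dl" using elim(2) by (simp add: pt_def)
   qed
   thus ?case using elim(3) by blast
  qed
  thus False using nb by (simp add: trivial_limit_def)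
 qed
 thus ?thesis by blast
qed

end

end

section \<open>The Borel map to classes of curves and the transport\<close>

lemma dist_abs_curve: "lip_curve a ==> lip_curve b ==> dist (abs_curve a) (abs_curve b) = curve_dist a b"
 by (rule dist_curve.abs_eq) (simp_all add: curve_equiv_def curve_dist_refl)

context transport_limit
begin

text \<open>A set of full measure on which everything is good; outside it curves are constant.\<close>

context
 fixes D G assumes D: "countable D" and good: "G : sets lam" "ALL x:G. good D x" and full: "AE x in lam. x : G"
begin

lemmas G = good(1) good(2)[rule_format]

definition gcurve :: "('i => 'a list) => real => 'a" where
 "gcurve x = (if x : G then scurve x else (%_. undefined))"

definition class_of :: "('i => 'a list) => 'a curve" where
 "class_of x = abs_curve (gcurve x)"

lemma gcurve_lip: "lip_curve (gcurve x)"
proof (cases "x : G")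
 case True
 thus ?thesis using scurve_lipschitz[OF G(2)[OF True]] by (auto simp: gcurve_def lip_curve_def)
next
 case False
 thus ?thesis by (auto simp: gcurve_def lip_curve_def lipschitz_on_def intro!: exI[of _ "0::real"])
qed

lemma scurve_dist_measurable:
 assumes t: "0 <= t" and r: "0 <= r" shows "{x : G. dist (scurve x t) y <= r} : sets lam"
proof -
 \<comment> \<open>Truncation at \<open>r + 1\<close> makes the function bounded without changing
   the set where it is at most \<open>r\<close>.\<close>
 define F where "F i p = min (r + 1) (dist (pt p t) y)" for i :: 'i and p
 have F: "\<bar>F i p\<bar> <= r + 1" for i p using r by (simp add: F_def min_def)
 have "st F x = min (r + 1) (dist (scurve x t) y)" if "x : G" for x
 proof -
  have "((%i. F i (x i)) \<longlongrightarrow> min (r + 1) (dist (scurve x t) y)) U"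
   unfolding F_def by (intro tendsto_intros scurve_tendsto[OF G(2)[OF that] t])
  thus ?thesis unfolding st_def by (rule tendsto_Lim[OF nb])
 qed
 hence "{x : G. dist (scurve x t) y <= r} = G \<inter> {x : space lam. st F x <= r}" by (auto simp: lam(1) min_def split: if_splits)
 also have "... : sets lam" using G(1) st_measurable[OF F] by (intro sets.Int) (auto simp: borel_measurable_iff_le)
 finally show ?thesis .
qed

text \<open>Measurability is checked in the sup metric, where the curves are separable: they are approximated
  by step functions with values in \<open>D\<close>.\<close>

lemma class_measurable: "class_of : measurable lam borel"
proof (rule borel_measurableI)
 fix S :: "'a curve set" assume S: "open S"
 \<comment> \<open>\<open>ds\<close> encodes a step function with \<open>length ds - 1\<close> equal
   steps. Closeness is imposed at rational times only, which keeps the condition countable;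
   Lipschitz bounds extend the comparison of two curves to all times.\<close>
 define Q where "Q ds m = {x : G. ALL N j. 0 < N & j <= N -->
   dist (scurve x (real j / real N)) (ds ! nat \<lfloor>real (length ds - 1) * (real j / real N)\<rfloor>) <= 1 / real (Suc m)}" for ds :: "'a list" and m :: nat
 \<comment> \<open>There are countably many pairs with \<open>ds\<close> from \<open>D\<close>;
   those whose set \<open>Q ds m\<close> lies in the preimage of \<open>S\<close> exhaust it, since
   every open ball around a class contains the image of such a set.\<close>
 define W where "W = {(ds, m). ds : lists D & (ALL x:Q ds m. class_of x : S)}"
 have UN: "UNIV : sets lam" using sets.top[of lam] by (simp add: lam(1))
 have Qm: "Q ds m : sets lam" for ds m
 proof -
  have "Q ds m = G \<inter> (\<Inter>N. \<Inter>j. if 0 < N & j <= N then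
    {x : G. dist (scurve x (real j / real N)) (ds ! nat \<lfloor>real (length ds - 1) * (real j / real N)\<rfloor>) <= 1 / real (Suc m)} else UNIV)"
   unfolding Q_def by (auto split: if_splits)
  also have "... : sets lam"
  proof (intro sets.Int G sets.countable_INT'')
   show "(if 0 < N & j <= N then
    {x : G. dist (scurve x (real j / real N)) (ds ! nat \<lfloor>real (length ds - 1) * (real j / real N)\<rfloor>) <= 1 / real (Suc m)} else UNIV) : sets lam" for N j
    using scurve_dist_measurable[of "real j / real N" "1 / real (Suc m)"] UN by auto
  qed (use UN in simp_all)
  finally show ?thesis .
 qed
 have Wc: "countable W" by (rule countable_subset[of _ "lists D \<times> UNIV"]) (use D in \<open>auto simp: W_def\<close>)
 have "{x : G. class_of x : S} = (\<Union>(ds, m)\<in>W. Q ds m)"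
 proof (intro equalityI subsetI)
  fix x assume "x : (\<Union>(ds, m)\<in>W. Q ds m)"
  thus "x : {x : G. class_of x : S}" by (auto simp: W_def Q_def)
 next
  fix x assume "x : {x : G. class_of x : S}"
  hence x: "x : G" "class_of x : S" by auto
  note gx = G(2)[OF x(1)]
  obtain e where e: "e > 0" "!!y. dist y (class_of x) < e ==> y : S" using S x(2) unfolding open_dist by metis
  obtain m where m: "1 / real (Suc m) < e / 4" using nat_approx_posE[of "e / 4"] e by auto
  \<comment> \<open>Half of the tolerance is for approximating the grid values by points of
    \<open>D\<close>, half for the oscillation over one step.\<close>
  define r where "r = 1 / real (Suc m) / 2"
  have r: "r > 0" by (simp add: r_def)
  obtain n :: nat where n: "slen x / r < real n" using reals_Archimedean2 by blast
  have n0: "n > 0" using n slen_nonneg[OF gx] r by (metis divide_nonneg_pos gr0I not_le of_nat_0)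
  have nr: "slen x / real n < r" using n n0 r by (simp add: field_simps)
  have "EX d. d : D & dist (scurve x (real k / real n)) d < r" for k :: nat
   using scurve_near_D[OF gx _ r, of "real k / real n"] by auto
  then obtain d where d: "!!k. d k : D" "!!k. dist (scurve x (real k / real n)) (d k) < r" by metis
  define ds where "ds = map d [0..<Suc n]"
  have ds: "ds : lists D" "length ds - 1 = n" "!!k. k <= n ==> ds ! k = d k"
   using d(1) by (auto simp: ds_def nth_append less_Suc_eq_le simp del: upt_Suc)
  have xQ: "x : Q ds m" unfolding Q_def
  proof (intro CollectI conjI x allI impI)
   fix N j :: nat assume Nj: "0 < N & j <= N"
   define t where "t = real j / real N"
   have t: "0 <= t" "t <= 1" using Nj by (auto simp: t_def divide_le_eq)
   define k where "k = nat \<lfloor>real n * t\<rfloor>"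
   have nt: "0 <= real n * t" "real n * t <= real n" using t n0 by (auto intro: mult_left_le)
   have rk: "real k = of_int \<lfloor>real n * t\<rfloor>" using nt unfolding k_def by simp
   have k: "real k <= real n * t" "real n * t <= real k + 1" unfolding rk by linarith+
   have kn: "k <= n" using k(1) nt(2) by linarith
   have "t <= (real k + 1) / real n" using k n0 by (simp add: le_divide_eq mult.commute)
   hence kt: "real k / real n <= t" "t - real k / real n <= 1 / real n"
    using k n0 by (auto simp: divide_le_eq mult.commute add_divide_distrib)
   have "dist (scurve x t) (scurve x (real k / real n)) <= slen x * dist t (real k / real n)"
    by (rule lipschitz_onD[OF scurve_lipschitz[OF gx]]) (use t kt kn n0 in auto)
   also have "... <= slen x * (1 / real n)" using kt by (intro mult_left_mono slen_nonneg[OF gx]) (simp add: dist_real_def)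
   finally have "dist (scurve x t) (d k) <= r + r"
    using dist_triangle[of "scurve x t" "d k" "scurve x (real k / real n)"] d(2)[of k] nr by simp
   thus "dist (scurve x (real j / real N)) (ds ! nat \<lfloor>real (length ds - 1) * (real j / real N)\<rfloor>) <= 1 / real (Suc m)"
    unfolding ds(2) t_def[symmetric] k_def[symmetric] ds(3)[OF kn] unfolding r_def field_sum_of_halves .
  qed
  have "class_of x' : S" if x': "x' : Q ds m" for x'
  proof -
   have gx': "x' : G" using x' by (simp add: Q_def)
   note gx'' = G(2)[OF gx']
   have frac: "dist (scurve x' (real j / real N)) (scurve x (real j / real N)) <= e / 2" if "0 < N" "j <= N" for N j :: nat
   proof -
    let ?y = "ds ! nat \<lfloor>real (length ds - 1) * (real j / real N)\<rfloor>"
    have "dist (scurve x' (real j / real N)) ?y <= 1 / real (Suc m)" "dist (scurve x (real j / real N)) ?y <= 1 / real (Suc m)"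
     using x' xQ that unfolding Q_def by blast+
    thus ?thesis using dist_triangle2[of "scurve x' (real j / real N)" "scurve x (real j / real N)" ?y] m by linarith
   qed
   have all: "dist (scurve x' t) (scurve x t) <= e / 2" if t: "t : {0..1}" for t
   proof (rule field_le_epsilon)
    fix eps :: real assume eps: "eps > 0"
    define l where "l = slen x + slen x'"
    have l: "0 <= l" unfolding l_def using slen_nonneg[OF gx] slen_nonneg[OF gx''] by simp
    obtain N :: nat where N: "l / eps < real N" using reals_Archimedean2 by blast
    have N0: "N > 0" using N l eps by (metis divide_nonneg_pos gr0I not_le of_nat_0)
    have lN: "l / real N < eps" using N N0 eps by (simp add: field_simps)
    define j where "j = nat \<lfloor>real N * t\<rfloor>"
    have nt: "0 <= real N * t" "real N * t <= real N" using t N0 by (auto intro: mult_left_le)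
    have rk: "real j = of_int \<lfloor>real N * t\<rfloor>" using nt unfolding j_def by simp
    have k: "real j <= real N * t" "real N * t <= real j + 1" unfolding rk by linarith+
    have jN: "j <= N" using k(1) nt(2) by linarith
    define q where "q = real j / real N"
    have "t <= (real j + 1) / real N" using k N0 by (simp add: le_divide_eq mult.commute)
    hence q: "q <= t" "t - q <= 1 / real N" "q : {0..1}"
     using k N0 jN by (auto simp: q_def divide_le_eq mult.commute add_divide_distrib)
    have "dist (scurve x' t) (scurve x' q) <= slen x' * dist t q" "dist (scurve x t) (scurve x q) <= slen x * dist t q"
     by (rule lipschitz_onD[OF scurve_lipschitz[OF gx'']] lipschitz_onD[OF scurve_lipschitz[OF gx]]; use t q in simp)+
    moreover have "slen x' * dist t q + slen x * dist t q <= l * (1 / real N)"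
     unfolding distrib_right[symmetric] l_def using q slen_nonneg[OF gx] slen_nonneg[OF gx'']
     by (intro mult_mono) (auto simp: dist_real_def)
    ultimately show "dist (scurve x' t) (scurve x t) <= e / 2 + eps"
     using frac[OF N0 jN] lN dist_triangle[of "scurve x' t" "scurve x t" "scurve x' q"]
      dist_triangle2[of "scurve x' q" "scurve x t" "scurve x q"] unfolding q_def[symmetric] by simp
   qed
   have "curve_dist (gcurve x') (gcurve x) <= e / 2"
    by (rule curve_dist_upper[OF gcurve_lip gcurve_lip increasing_bijections_id]) (use all x(1) gx' in \<open>simp add: gcurve_def\<close>)
   hence "dist (class_of x') (class_of x) < e"
    unfolding class_of_def dist_abs_curve[OF gcurve_lip gcurve_lip] using e(1) by simp
   thus ?thesis by (rule e(2))
  qed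
  hence "(ds, m) : W" using ds(1) by (simp add: W_def)
  thus "x : (\<Union>(ds, m)\<in>W. Q ds m)" using xQ by blast
 qed
 also have "... : sets lam" using Wc Qm by (intro sets.countable_UN') auto
 finally have 1: "{x : G. class_of x : S} : sets lam" .
 have "class_of -` S \<inter> space lam = {x : G. class_of x : S} \<union> (if abs_curve (%_. undefined) : S then space lam - G else {})"
  by (auto simp: class_of_def gcurve_def lam(1) split: if_splits)
 thus "class_of -` S \<inter> space lam : sets lam" using 1 G(1) by auto
qed

lemma st_AE:
 assumes "!!x. x : G ==> ((%i. F i (x i)) \<longlongrightarrow> f x) U" shows "AE x in lam. st F x = f x"
 using full
proof eventually_elim
 case (elim x)
 thus ?case unfolding st_def by (intro tendsto_Lim[OF nb] assms)
qed

lemma st_integral_AE: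
 assumes b: "!!i p. \<bar>F i p\<bar> <= K" and lim: "!!x. x : G ==> ((%i. F i (x i)) \<longlongrightarrow> f x) U"
  and f: "f : borel_measurable lam"
 shows "((%i. av i (F i)) \<longlongrightarrow> (LINT x|lam. f x)) U" "integrable lam f"
proof -
 have "(LINT x|lam. st F x) = (LINT x|lam. f x)" by (rule integral_cong_AE[OF st_measurable[OF b] f st_AE[OF lim]])
 thus "((%i. av i (F i)) \<longlongrightarrow> (LINT x|lam. f x)) U" using st_integral(2)[of F K, OF b] by simp
 show "integrable lam f"
  using st_integral(1)[of F K, OF b] integrable_cong_AE[OF st_measurable[OF b] f st_AE[OF lim]] by simp
qed

lemma endpoint_class: "i = 0 \<or> i = 1 ==> endpoint i (class_of x) = gcurve x i"
 unfolding class_of_def by (rule endpoint_abs[OF _ gcurve_lip])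

lemma gcurve_end_measurable: "i = 0 \<or> i = 1 ==> (%x. gcurve x i) : measurable lam borel"
 using measurable_comp[OF class_measurable borel_measurable_continuous_onI[OF endpoint_continuous]]
 by (auto simp: comp_def endpoint_class)

text \<open>The averages of \<open>h (hd p)\<close> and \<open>h (last p)\<close> converge both to
  integrals against \<open>N\<close> and \<open>P\<close> and to integrals of \<open>h\<close> at
  the ends of the limit curves; bounded Lipschitz functions determine the measure.\<close>

lemma marginals: "distr lam borel (%x. gcurve x 0) = N" "distr lam borel (%x. gcurve x 1) = P"
proof -
 interpret L: finite_measure lam by (rule finite_lam)
 have *: "distr lam borel (%x. gcurve x i) = M"
  if i: "i = 0 \<or> i = 1" and M: "fbm M"
   and lim: "!!h. h : Lipb_funs ==> ((%j. av j (%p. h (e p))) \<longlongrightarrow> (LINT x|M. h x)) U"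
   and e: "!!h x. h : Lipb_funs ==> x : G ==> ((%j. h (e (x j))) \<longlongrightarrow> h (scurve x i)) U"
  for i M and e :: "'a list => 'a"
 proof (rule Lipb_integral_eq_imp_measure_eq[OF _ M])
  show "fbm (distr lam borel (%x. gcurve x i))"
   unfolding fbm_def using L.finite_measure_distr[OF gcurve_end_measurable[OF i]] by simp
  fix h :: "'a => real" assume h: "h : Lipb_funs"
  obtain K where K: "!!x. \<bar>h x\<bar> <= K" using LipbE[OF h] by metis
  have hm: "(%x. h (gcurve x i)) : borel_measurable lam"
   using measurable_comp[OF gcurve_end_measurable[OF i] Lipb_measurable[OF h]] by (simp add: comp_def)
  have "((%j. av j (%p. h (e p))) \<longlongrightarrow> (LINT x|lam. h (gcurve x i))) U"
   by (rule st_integral_AE(1)[OF _ _ hm, where K = K]) (use K e[OF h] in \<open>auto simp: gcurve_def\<close>)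
  hence "(LINT x|lam. h (gcurve x i)) = (LINT x|M. h x)" by (rule tendsto_unique[OF nb _ lim[OF h]])
  thus "(LINT x|(distr lam borel (%x. gcurve x i)). h x) = (LINT x|M. h x)"
   by (subst integral_distr[OF gcurve_end_measurable[OF i] Lipb_measurable[OF h]])
 qed
 show "distr lam borel (%x. gcurve x 0) = N"
  by (rule *[OF _ PN(2) lim_start]) (use scurve_ends(1)[OF G(2)] in auto)
 show "distr lam borel (%x. gcurve x 1) = P"
  by (rule *[OF _ PN(1) lim_end]) (use scurve_ends(2)[OF G(2)] in auto)
qed

lemma mR_mono: assumes "0 <= R" "R <= R'" shows "mR R <= mR R'"
 by (rule tendsto_le[OF nb mR mR always_eventually]) (use assms in \<open>auto intro!: av_mono\<close>)

lemma mR_tendsto: "(%n. mR (real n)) \<longlonglongrightarrow> ml"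
proof (rule LIMSEQ_I)
 fix e :: real assume "e > 0"
 then obtain n0 where n0: "ml - e < mR (real n0)" using no_escape by blast
 have "norm (mR (real n) - ml) < e" if "n0 <= n" for n
  using mR_mono[of "real n0" "real n"] mR_le[of "real n"] n0 that by simp
 thus "EX n0. ALL n>=n0. norm (mR (real n) - ml) < e" by blast
qed

definition glen :: "('i => 'a list) => real" where
 "glen x = (if x : G then slen x else 0)"

text \<open>The truncated lengths have integrals \<open>mR n\<close>, which increase to
  \<open>ml\<close> because no length escapes; monotone convergence does the rest.\<close>

lemma glen: "integrable lam glen" "(LINT x|lam. glen x) = ml"
proof -
 define F where "F n i p = min (real n) (plen p)" for n :: nat and i :: 'i and p :: "'a list"
 have F: "\<bar>F n i p\<bar> <= real n" for n i p using plen_nonneg[of p] by (simp add: F_def min_def)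
 define f where "f n x = (if x : G then min (real n) (slen x) else 0)" for n :: nat and x
 have lim: "((%i. F n i (x i)) \<longlongrightarrow> f n x) U" if "x : G" for n x
 proof -
  have "f n x = min (real n) (slen x)" using that by (simp add: f_def)
  thus ?thesis unfolding F_def by (simp only:) (intro tendsto_intros slen[OF G(2)[OF that]])
 qed
 have eq: "f n x = indicator G x * st (F n) x" for n x
  using tendsto_Lim[OF nb lim[of x n]] by (auto simp: f_def st_def)
 have fm: "f n : borel_measurable lam" for n
  unfolding eq[abs_def] using st_measurable[OF F] G(1) by measurable
 have ev: "EX n0. ALL n>=n0. f n x = glen x" for x
 proof -
  obtain n0 :: nat where "slen x <= real n0" using real_arch_simple by blast
  hence "ALL n>=n0. f n x = glen x" by (auto simp: f_def glen_def)
  thus ?thesis by blast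
 qed
 have fl: "(%n. f n x) \<longlonglongrightarrow> glen x" for x
  by (rule tendsto_eventually) (use ev[of x] in \<open>simp add: eventually_sequentially\<close>)
 have gm: "glen : borel_measurable lam" by (rule borel_measurable_LIMSEQ_real[OF fl fm])
 have fi: "integrable lam (f n)" "(LINT x|lam. f n x) = mR (real n)" for n
 proof -
  show "integrable lam (f n)" by (rule st_integral_AE(2)[OF F lim fm])
  have "((%i. av i (F n i)) \<longlongrightarrow> (LINT x|lam. f n x)) U" by (rule st_integral_AE(1)[OF F lim fm])
  moreover have "((%i. av i (F n i)) \<longlongrightarrow> mR (real n)) U" unfolding F_def[abs_def] by (rule mR) simp
  ultimately show "(LINT x|lam. f n x) = mR (real n)" by (rule tendsto_unique[OF nb])
 qed
 have mono: "AE x in lam. mono (%n. f n x)" by (intro AE_I2 monoI) (auto simp: f_def)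
 have il: "(%n. \<integral>x. f n x \<partial>lam) \<longlonglongrightarrow> ml" unfolding fi(2) by (rule mR_tendsto)
 show "integrable lam glen" by (rule integrable_monotone_convergence[OF fi(1) mono _ il gm]) (simp add: fl)
 show "(LINT x|lam. glen x) = ml" by (rule integral_monotone_convergence[OF fi(1) mono _ il gm]) (simp add: fl)
qed

lemma path_form_le:
 assumes f: "!!x. \<bar>f x\<bar> <= b" and pj: "pj : Lip_funs" shows "\<bar>path_form f pj p\<bar> <= b * Lip pj * plen p"
proof -
 have "\<bar>path_form f pj p\<bar> <= (\<Sum>j<length p - 1. b * Lip pj * dist (p ! j) (p ! Suc j))"
  unfolding path_form_def
 proof (rule order_trans[OF sum_abs sum_mono])
  fix j
  have "\<bar>f (p ! j)\<bar> * \<bar>pj (p ! Suc j) - pj (p ! j)\<bar> <= b * (Lip pj * dist (p ! j) (p ! Suc j))"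
   using Lip_bound[OF pj, of "p ! Suc j" "p ! j"] f[of "p ! j"] by (intro mult_mono) (auto simp: dist_commute)
  thus "\<bar>f (p ! j) * (pj (p ! Suc j) - pj (p ! j))\<bar> <= b * Lip pj * dist (p ! j) (p ! Suc j)"
   by (simp add: abs_mult mult.assoc)
 qed
 thus ?thesis by (simp add: psum_def sum_distrib_left)
qed

text \<open>The discrete integrals are not bounded, so they are cut off at length
  \<open>2 n\<close>. The loss on the chains is controlled by \<open>ml - mR n\<close>, and on the
  limit side \<open>K glen\<close> dominates.\<close>

lemma current_integral:
 assumes f: "f : Lipb_funs" and pj: "pj : Lip_funs"
 shows "integrable lam (%x. curve_current (class_of x) f [pj])" "(LINT x|lam. curve_current (class_of x) f [pj]) = T f [pj]"
proof -
 obtain b where b: "0 <= b" "!!x. \<bar>f x\<bar> <= b" using LipbE[OF f] by metis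
 define K where "K = b * Lip pj"
 have K: "0 <= K" "!!p. \<bar>path_form f pj p\<bar> <= K * plen p" unfolding K_def using b Lip_nonneg[OF pj] path_form_le[OF b(2) pj] by auto
 define F where "F n i p = path_form f pj p * indicator {p. plen p <= real n} p" for n :: nat and i :: 'i and p
 have F: "\<bar>F n i p\<bar> <= K * real n" for n i p
  using K(2)[of p] mult_left_mono[OF _ K(1), of "plen p" "real n"] K(1) by (auto simp: F_def indicator_def intro: order_trans)
 define h where "h x = curve_current (class_of x) f [pj]" for x
 have hm: "h : borel_measurable lam"
  unfolding h_def using measurable_comp[OF class_measurable curve_current_measurable[OF f pj]] by (simp add: comp_def)
 have hc: "h x = curve_integral (scurve x) f pj" if "x : G" for x
  unfolding h_def class_of_def using curve_current_abs[OF gcurve_lip f pj, of x] that by (simp add: gcurve_def)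
 have hb: "\<bar>h x\<bar> <= K * glen x" if "x : G" for x
 proof (rule tendsto_le[OF nb])
  show "((%i. K * plen (x i)) \<longlongrightarrow> K * glen x) U" using slen[OF G(2)[OF that]] that by (auto simp: glen_def intro: tendsto_mult_left)
  show "((%i. \<bar>path_form f pj (x i)\<bar>) \<longlongrightarrow> \<bar>h x\<bar>) U" unfolding hc[OF that] by (intro tendsto_rabs scurve_form[OF G(2)[OF that] f pj])
 qed (use K(2) in auto)
 have stF: "st (F n) x = h x" if x: "x : G" and n: "slen x < real n" for n x
 proof -
  have "eventually (%i. plen (x i) < real n) U" by (rule order_tendstoD(2)[OF slen[OF G(2)[OF x]] n])
  hence "eventually (%i. path_form f pj (x i) = F n i (x i)) U" by eventually_elim (simp add: F_def)
  hence "((%i. F n i (x i)) \<longlongrightarrow> h x) U" unfolding hc[OF x] by (rule Lim_transform_eventually[OF scurve_form[OF G(2)[OF x] f pj]])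
  thus ?thesis unfolding st_def by (rule tendsto_Lim[OF nb])
 qed
 have stb: "\<bar>st (F n) x\<bar> <= K * glen x" if x: "x : G" for n x
 proof (rule tendsto_le[OF nb])
  show "((%i. K * plen (x i)) \<longlongrightarrow> K * glen x) U" using slen[OF G(2)[OF x]] x by (auto simp: glen_def intro: tendsto_mult_left)
  show "((%i. \<bar>F n i (x i)\<bar>) \<longlongrightarrow> \<bar>st (F n) x\<bar>) U"
   by (intro tendsto_rabs st[where K = "K * real n"]) (use F in auto)
  have "\<bar>F n i (x i)\<bar> <= K * plen (x i)" for i using K(2)[of "x i"] by (auto simp: F_def indicator_def)
  thus "eventually (%i. \<bar>F n i (x i)\<bar> <= K * plen (x i)) U" by simp
 qed
 have dom: "integrable lam (%x. K * glen x)" using glen(1) by simp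
 have dc: "(%n. \<integral>x. st (F n) x \<partial>lam) \<longlonglongrightarrow> (LINT x|lam. h x)" "integrable lam h"
 proof -
  have m: "st (F n) : borel_measurable lam" for n by (rule st_measurable[OF F])
  have l: "AE x in lam. (%n. st (F n) x) \<longlonglongrightarrow> h x" using full
  proof eventually_elim
   case (elim x)
   obtain n0 :: nat where "slen x < real n0" using reals_Archimedean2 by blast
   hence "ALL n>=n0. st (F n) x = h x" using stF[OF elim] by auto
   thus ?case by (intro tendsto_eventually) (auto simp: eventually_sequentially)
  qed
  have bd: "AE x in lam. norm (st (F n) x) <= K * glen x" for n using full by eventually_elim (use stb in simp)
  show "(%n. \<integral>x. st (F n) x \<partial>lam) \<longlonglongrightarrow> (LINT x|lam. h x)" by (rule integral_dominated_convergence[OF hm m dom l bd])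
  show "integrable lam h" by (rule integrable_dominated_convergence[OF hm m dom l bd])
 qed
 have "\<bar>T f [pj] - (LINT x|lam. st (F (2 * n)) x)\<bar> <= 2 * K * (ml - mR (real n))" for n :: nat
 proof (rule field_le_epsilon)
  fix e :: real assume e: "e > 0"
  have e': "e / (2 * K + 1) > 0" using e K(1) by simp
  have 1: "((%i. \<bar>av i (path_form f pj) - av i (F (2 * n) i)\<bar>) \<longlongrightarrow> \<bar>T f [pj] - (LINT x|lam. st (F (2 * n)) x)\<bar>) U"
   by (intro tendsto_rabs tendsto_diff lim_form f pj st_integral(2)[OF F])
  have 2: "((%i. 2 * K * (ml + e / (2 * K + 1) - av i (%p. min (real n) (plen p)))) \<longlongrightarrow> 2 * K * (ml + e / (2 * K + 1) - mR (real n))) U"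
   by (intro tendsto_intros mR) simp
  have "\<bar>T f [pj] - (LINT x|lam. st (F (2 * n)) x)\<bar> <= 2 * K * (ml + e / (2 * K + 1) - mR (real n))"
  proof (rule tendsto_le[OF nb 2 1], use av_plen[OF e'] in eventually_elim)
   case (elim i)
   have "\<bar>av i (path_form f pj) - av i (F (2 * n) i)\<bar> = \<bar>av i (%p. 1 * path_form f pj p + (-1) * F (2 * n) i p)\<bar>"
    unfolding avg_lin by simp
   also have "... <= av i (%p. \<bar>1 * path_form f pj p + (-1) * F (2 * n) i p\<bar>)" by (rule avg_abs) (rule c0)
   also have "... <= av i (%p. 2 * K * plen p + (- 2 * K) * min (real n) (plen p))"
   proof (rule av_mono)
    fix p
    show "\<bar>1 * path_form f pj p + (-1) * F (2 * n) i p\<bar> <= 2 * K * plen p + (- 2 * K) * min (real n) (plen p)"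
    proof (cases "plen p <= real (2 * n)")
     case True
     hence "\<bar>1 * path_form f pj p + (-1) * F (2 * n) i p\<bar> = 0" by (simp add: F_def)
     also have "... <= 2 * K * (plen p - min (real n) (plen p))" using K(1) by (intro mult_nonneg_nonneg) auto
     finally show ?thesis by (simp add: right_diff_distrib)
    next
     case False
     hence "\<bar>1 * path_form f pj p + (-1) * F (2 * n) i p\<bar> <= K * plen p" using K(2)[of p] by (simp add: F_def)
     \<comment> \<open>Beyond length \<open>2 n\<close> at least half of the length lies above
       \<open>n\<close>; this is the reason for the cutoff \<open>2 n\<close>.\<close>
     also have "... <= K * (2 * (plen p - min (real n) (plen p)))" using False K(1) by (intro mult_left_mono) auto
     finally show ?thesis by (simp add: algebra_simps)
    qed
   qed
   also have "... = 2 * K * av i plen + (- 2 * K) * av i (%p. min (real n) (plen p))" by (rule avg_lin)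
   also have "... <= 2 * K * (ml + e / (2 * K + 1)) + (- 2 * K) * av i (%p. min (real n) (plen p))"
    using elim K(1) by (intro add_right_mono mult_left_mono) auto
   finally show ?case by (simp add: algebra_simps)
  qed
  also have "... = 2 * K * (ml - mR (real n)) + 2 * K * (e / (2 * K + 1))" by (simp add: algebra_simps)
  also have "2 * K * (e / (2 * K + 1)) <= (2 * K + 1) * (e / (2 * K + 1))" using e' by (intro mult_right_mono) auto
  also have "... = e" using K(1) by (subst times_divide_eq_right, subst nonzero_mult_div_cancel_left) auto
  finally show "\<bar>T f [pj] - (LINT x|lam. st (F (2 * n)) x)\<bar> <= 2 * K * (ml - mR (real n)) + e" by simp
 qed
 note close = this
 have "(%n. 2 * K * (ml - mR (real n))) \<longlonglongrightarrow> 2 * K * (ml - ml)" by (intro tendsto_intros mR_tendsto)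
 moreover have "(%n. \<bar>T f [pj] - (LINT x|lam. st (F (2 * n)) x)\<bar>) \<longlonglongrightarrow> \<bar>T f [pj] - (LINT x|lam. h x)\<bar>"
  using LIMSEQ_subseq_LIMSEQ[OF dc(1), of "%n. 2 * n"] by (intro tendsto_rabs tendsto_diff tendsto_const) (auto simp: comp_def strict_mono_def)
 ultimately have "\<bar>T f [pj] - (LINT x|lam. h x)\<bar> <= 2 * K * (ml - ml)" using close by (intro LIMSEQ_le) auto
 thus "(LINT x|lam. curve_current (class_of x) f [pj]) = T f [pj]" unfolding h_def by simp
 show "integrable lam (%x. curve_current (class_of x) f [pj])" using dc(2) unfolding h_def .
qed

end

end

context transport_limit
begin

text \<open>\<open>low\<close>, \<open>mid\<close> and \<open>len\<close> form a circle of
  inequalities. \<open>low\<close> integrates the dual formula for the mass of \<open>T\<close> over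
  the curves; \<open>len\<close> holds because the limit curves are no longer than their
  chains.\<close>

lemma transport_exists:
 "EX eta. transport eta & T = transport_current eta &
   mass 1 (transport_current eta) = (\<integral>\<^sup>+th. mass 1 (curve_current th) \<partial>eta) &
   (\<integral>\<^sup>+th. mass 1 (curve_current th) \<partial>eta) = (\<integral>\<^sup>+th. ennreal (curve_length th) \<partial>eta) &
   transport_marginal 1 eta = P & transport_marginal 0 eta = N & (AE th in eta. is_arc th)"
proof -
 interpret L: finite_measure lam by (rule finite_lam)
 interpret mu: finite_measure mu by (rule fbmD(1)[OF mu])
 obtain D where D: "countable D"
  "AE x in lam. ALL e>0. EX F. finite F & F \<subseteq> D & eventually (%i. ALL y:set (x i). EX z:F. dist y z < e) U"
  by (rule AE_totally_bounded)
 have "AE x in lam. good D x"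
  using D(2) AE_in_A AE_finite_length AE_no_loops by eventually_elim (unfold good_def, blast)
 then obtain Z where Z: "{x : space lam. ~ good D x} \<subseteq> Z" "emeasure lam Z = 0" "Z : sets lam" by (rule AE_E)
 define G where "G = space lam - Z"
 have Gm: "G : sets lam" using Z(3) by (simp add: G_def)
 have full: "AE x in lam. x : G"
  by (rule AE_I[OF _ Z(2,3)]) (auto simp: G_def)
 have Gg: "good D x" if "x : G" for x using that Z(1) by (auto simp: G_def lam(1))
 hence "ALL x:G. good D x" by blast
 note ctx = D(1) Gm this full
 define K where "K = class_of G"
 have Km: "K : measurable lam borel" unfolding K_def by (rule class_measurable[OF ctx])
 define eta where "eta = distr lam borel K"
 have tr: "transport eta" unfolding transport_def eta_def using L.finite_measure_distr[OF Km] by simp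
 have etaint: "(LINT th|eta. h th) = (LINT x|lam. h (K x))" if "h : borel_measurable borel" for h :: "'a curve => real"
  unfolding eta_def by (rule integral_distr[OF Km that])
 have Teq: "transport_current eta = T"
 proof (intro ext)
  fix f and pjs :: "('a => real) list"
  show "transport_current eta f pjs = T f pjs"
  proof (cases "f : Lipb_funs & pjs : Lip_tuples 1")
   case True
   then obtain p where p: "f : Lipb_funs" "p : Lip_funs" "pjs = [p]" using Lip_tuples_1 by blast
   show ?thesis unfolding transport_current_def p(3) etaint[OF curve_current_measurable[OF p(1,2)]] K_def
    by (rule current_integral(2)[OF ctx p(1,2)])
  next
   case False
   hence "T f pjs = 0" using T unfolding currents_def by blast
   moreover have "curve_current th f pjs = 0" for th using False by (auto simp: curve_current_def)
   ultimately show ?thesis by (simp add: transport_current_def)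
  qed
 qed
 have len: "(\<integral>\<^sup>+th. ennreal (curve_length th) \<partial>eta) <= mass 1 T"
 proof -
  have "(\<integral>\<^sup>+th. ennreal (curve_length th) \<partial>eta) = (\<integral>\<^sup>+x. ennreal (curve_length (K x)) \<partial>lam)"
   unfolding eta_def by (rule nn_integral_distr[OF Km]) (use curve_length_measurable in measurable)
  also have "... <= (\<integral>\<^sup>+x. ennreal (glen G x) \<partial>lam)"
  proof (rule nn_integral_mono_AE, use full in eventually_elim)
   case (elim x)
   have "curve_length (K x) = vlen (scurve x) 0 1"
    using curve_length_abs[OF gcurve_lip[OF ctx, of x]] elim by (simp add: K_def class_of_def[OF ctx] gcurve_def[OF ctx])
   also have "... <= glen G x" using scurve_vlen_le[OF Gg[OF elim], of 0 1] elim by (simp add: glen_def[OF ctx])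
   finally show ?case by (rule ennreal_leI)
  qed
  also have "... = ennreal (LINT x|lam. glen G x)"
   by (rule nn_integral_eq_integral[OF glen(1)[OF ctx]]) (intro AE_I2, use slen_nonneg[OF Gg] in \<open>auto simp: glen_def[OF ctx]\<close>)
  also have "... = mass 1 T" unfolding glen(2)[OF ctx] mass_T by (simp add: mu.emeasure_eq_measure)
  finally show ?thesis .
 qed
 have low: "mass 1 T <= (\<integral>\<^sup>+th. mass 1 (curve_current th) \<partial>eta)"
 proof (rule ennreal_le_epsilon)
  fix e :: real assume e: "0 < e"
  note lT = currents_linear_first[OF T]
  obtain ps where ps: "ALL (f, pj):set ps. f : Lipb_funs & pj : Lip_tuples 1" "ALL x. (\<Sum>(f, pj)\<leftarrow>ps. \<bar>f x\<bar>) <= 1"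
   "measure (mass_measure 1 T) UNIV <= (\<Sum>(f, pj)\<leftarrow>ps. T f pj / Lip_prod pj) + e"
   using mass_measure_props(3)[OF lT ctrl e] by blast
  define I where "I th = (\<Sum>(f, pj)\<leftarrow>ps. curve_current th f pj / Lip_prod pj)" for th
  have sums: "integrable lam (%x. \<Sum>(f, pj)\<leftarrow>qs. curve_current (K x) f pj / Lip_prod pj) &
    (LINT x|lam. (\<Sum>(f, pj)\<leftarrow>qs. curve_current (K x) f pj / Lip_prod pj)) = (\<Sum>(f, pj)\<leftarrow>qs. T f pj / Lip_prod pj)"
   if "ALL (f, pj):set qs. f : Lipb_funs & pj : Lip_tuples 1" for qs
   using that
  proof (induct qs)
   case (Cons a qs)
   obtain f pj where a: "a = (f, pj)" by force
   obtain p where p: "f : Lipb_funs" "p : Lip_funs" "pj = [p]" using Cons.prems Lip_tuples_1 unfolding a by auto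
   have 1: "integrable lam (%x. curve_current (K x) f pj / Lip_prod pj)"
    "(LINT x|lam. curve_current (K x) f pj / Lip_prod pj) = T f pj / Lip_prod pj"
    using current_integral[OF ctx p(1,2)] unfolding K_def p(3) by auto
   show ?case using Cons 1 by (simp add: a)
  qed simp
  have nz: "(LINT x|lam. I (K x)) = (\<Sum>(f, pj)\<leftarrow>ps. T f pj / Lip_prod pj)" "integrable lam (%x. I (K x))"
   using sums[OF ps(1)] by (auto simp: I_def)
  have Im: "I : borel_measurable borel"
  proof -
   have "(%th. \<Sum>(f, pj)\<leftarrow>qs. curve_current th f pj / Lip_prod pj) : borel_measurable borel"
    if "ALL (f, pj):set qs. f : Lipb_funs & pj : Lip_tuples 1" for qs
    using that
   proof (induct qs)
    case (Cons a qs)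
    obtain f pj where a: "a = (f, pj)" by force
    obtain p where p: "f : Lipb_funs" "p : Lip_funs" "pj = [p]" using Cons.prems Lip_tuples_1 unfolding a by auto
    show ?case using Cons curve_current_measurable[OF p(1,2)] by (simp add: a p(3))
   qed simp
   from this[OF ps(1)] show ?thesis by (simp add: I_def[abs_def])
  qed
  \<comment> \<open>The sum may be negative at single curves; \<open>ennreal\<close> raises such
    values to \<open>0\<close>, which only enlarges the integral.\<close>
  have "(LINT x|lam. I (K x)) <= (LINT x|lam. max 0 (I (K x)))"
   by (rule integral_mono[OF nz(2)]) (use nz(2) in auto)
  hence "ennreal (LINT x|lam. I (K x)) <= ennreal (LINT x|lam. max 0 (I (K x)))" by (rule ennreal_leI)
  also have "... = (\<integral>\<^sup>+x. ennreal (max 0 (I (K x))) \<partial>lam)"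
   by (rule nn_integral_eq_integral[symmetric]) (use nz(2) in auto)
  also have "... = (\<integral>\<^sup>+x. ennreal (I (K x)) \<partial>lam)" by (rule nn_integral_cong) (simp add: max_def ennreal_neg)
  also have "... = (\<integral>\<^sup>+th. ennreal (I th) \<partial>eta)"
   unfolding eta_def by (rule nn_integral_distr[symmetric, OF Km]) (use Im in measurable)
  also have "... <= (\<integral>\<^sup>+th. mass 1 (curve_current th) \<partial>eta)"
   unfolding I_def by (intro nn_integral_mono dual_le_mass_curve_current ps(1)) (use ps(2) in blast)
  finally have I: "ennreal (\<Sum>(f, pj)\<leftarrow>ps. T f pj / Lip_prod pj) <= (\<integral>\<^sup>+th. mass 1 (curve_current th) \<partial>eta)" unfolding nz(1) .
  have pl: "ennreal (a + e) <= ennreal a + ennreal e" for a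
   using e by (cases "0 <= a") (auto simp: ennreal_neg intro!: ennreal_leI)
  have "mass 1 T <= ennreal ((\<Sum>(f, pj)\<leftarrow>ps. T f pj / Lip_prod pj) + e)"
   unfolding mass_eq[OF lT ctrl] by (rule ennreal_leI[OF ps(3)])
  also have "... <= ennreal (\<Sum>(f, pj)\<leftarrow>ps. T f pj / Lip_prod pj) + ennreal e" by (rule pl)
  also have "... <= (\<integral>\<^sup>+th. mass 1 (curve_current th) \<partial>eta) + ennreal e" by (intro add_right_mono I)
  finally show "mass 1 T <= (\<integral>\<^sup>+th. mass 1 (curve_current th) \<partial>eta) + ennreal e" .
 qed
 have mid: "(\<integral>\<^sup>+th. mass 1 (curve_current th) \<partial>eta) <= (\<integral>\<^sup>+th. ennreal (curve_length th) \<partial>eta)"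
  by (intro nn_integral_mono mass_curve_current_le)
 have marg: "transport_marginal i eta = distr lam borel (%x. gcurve G x i)" if i: "i = 0 \<or> i = 1" for i
  unfolding transport_marginal_def eta_def
  by (subst distr_distr[OF borel_measurable_continuous_onI[OF endpoint_continuous[OF i]] Km])
   (simp add: comp_def K_def endpoint_class[OF ctx i])
 have mP: "transport_marginal 1 eta = P" and mN: "transport_marginal 0 eta = N"
  using marg marginals[OF ctx] by auto
 \<comment> \<open>A Borel condition sufficient for \<open>is_arc\<close>, whose own definition
   quantifies over parameterizations.\<close>
 define W where "W = {th :: 'a curve. 0 < curve_length th & (ALL k::nat. EX m::nat. ~ self_approach (1 / real (Suc k)) (1 / real (Suc m)) (rep_curve th))}"
 have "W = {th. 0 < curve_length th} \<inter> (\<Inter>k::nat. \<Union>m::nat. - {th. self_approach (1 / real (Suc k)) (1 / real (Suc m)) (rep_curve th)})"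
  by (auto simp: W_def)
 also have "... : sets borel"
  by (intro sets.Int sets.countable_INT'' sets.countable_UN borel_open curve_length_open)
   (auto intro!: borel_closed closed_Compl stable_open stable_self_approach)
 finally have Wm: "W : sets borel" .
 have "AE x in lam. K x : W"
 proof -
  obtain S where S: "S : sets borel" "emeasure P (- S) = 0" "emeasure N S = 0" using PN(3) by blast
  have AP: "AE y in P. y : S"
   by (rule AE_I[of _ _ "- S"]) (use S fbmD(2)[OF PN(1)] in \<open>auto simp: fbmD(3)[OF PN(1)]\<close>)
  have AN: "AE y in N. y ~: S"
   by (rule AE_I[of _ _ S]) (use S fbmD(2)[OF PN(2)] in \<open>auto simp: fbmD(3)[OF PN(2)]\<close>)
  have "AE x in lam. gcurve G x 1 : S"
   using AP unfolding marginals(2)[OF ctx, symmetric] by (subst (asm) AE_distr_iff) (use gcurve_end_measurable[OF ctx] S in auto)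
  moreover have "AE x in lam. gcurve G x 0 ~: S"
   using AN unfolding marginals(1)[OF ctx, symmetric] by (subst (asm) AE_distr_iff) (use gcurve_end_measurable[OF ctx] S in auto)
  ultimately show ?thesis using full
  proof eventually_elim
   case (elim x)
   have c: "K x = abs_curve (scurve x)" "gcurve G x = scurve x" using elim(3) by (auto simp: K_def class_of_def[OF ctx] gcurve_def[OF ctx])
   have lc: "lip_curve (scurve x)" using scurve_lipschitz[OF Gg[OF elim(3)]] by (auto simp: lip_curve_def)
   \<comment> \<open>\<open>N\<close> and \<open>P\<close> live on disjoint sets, so the two ends
     differ.\<close>
   have "0 < dist (scurve x 0) (scurve x 1)" using elim(1,2) unfolding c by auto
   also have "... <= vlen (scurve x) 0 1" by (rule vlen_props(4)[OF scurve_lipschitz[OF Gg[OF elim(3)]]]) auto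
   finally have "0 < curve_length (K x)" unfolding c curve_length_abs[OF lc] .
   thus ?case using scurve_no_self_approach[OF Gg[OF elim(3)]]
    unfolding W_def c mem_Collect_eq self_approach_abs[OF lc] by blast
  qed
 qed
 hence "AE th in eta. th : W" unfolding eta_def by (subst AE_distr_iff[OF Km]) (use Wm in auto)
 hence "AE th in eta. is_arc th"
  by eventually_elim (auto simp: W_def intro!: is_arcI)
 moreover have "mass 1 (transport_current eta) = (\<integral>\<^sup>+th. mass 1 (curve_current th) \<partial>eta)" unfolding Teq using low mid len by (intro antisym) auto
 moreover have "(\<integral>\<^sup>+th. mass 1 (curve_current th) \<partial>eta) = (\<integral>\<^sup>+th. ennreal (curve_length th) \<partial>eta)" using low mid len by (intro antisym) auto
 ultimately show ?thesis using tr Teq mP mN by (intro exI[of _ eta]) simp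
qed

end

section \<open>Acyclic currents\<close>

lemma tendsto_two_sided:
 fixes X :: "'i => real"
 assumes "!!e. e > 0 ==> eventually (%i. X i <= x + e) U" "!!e. e > 0 ==> eventually (%i. - X i <= - x + e) U"
 shows "(X \<longlongrightarrow> x) U"
proof (rule tendstoI)
 fix e :: real assume "e > 0"
 hence e: "e / 2 > 0" by simp
 show "eventually (%i. dist (X i) x < e) U" using assms(1)[OF e] assms(2)[OF e]
  by eventually_elim (use e in \<open>unfold dist_real_def, linarith\<close>)
qed

lemma current1_zero: "T : currents 1 ==> f : Lipb_funs ==> T f [%_. 0] = 0"
 using current1_lin[of T f "%_. 0" "%_. 0" 0 0] Lipb_Lip[OF Lipb_const[of 0]] by simp

text \<open>Indices are pairs of a set of tests and a mesh number. An ultrafilter finer than the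
  product of inclusion of finite sets and growth of numbers makes every single test and every mesh
  bound hold eventually, so one system serves all tests.\<close>

lemma chain_system_exists:
 fixes T :: "'a::metric_space functional"
 assumes T: "T : currents 1" and c: "controls 1 T mu"
  and cov: "!!r. r > 0 ==> EX C. countable C & emeasure mu (- (\<Union>x\<in>C. ball x r)) = 0"
  and j: "jordan_decomposition (boundary T) P N"
 obtains U :: "('a path_test set \<times> nat) filter" and A w where
  "loeb_data U snd A w (measure N UNIV + 1)" "!!i p. p : A i ==> chain (1 / real (Suc (snd i))) p"
  "!!t e. t : valid_tests ==> e > 0 ==> eventually (%i. avg A w i (test_value t) <= test_target T mu N P t + e) U"
proof -
 define F0 where "F0 = (finite_subsets_at_top UNIV \<times>\<^sub>F sequentially :: ('a path_test set \<times> nat) filter)"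
 have "F0 ~= bot" unfolding F0_def by (simp add: prod_filter_eq_bot)
 then obtain U where U: "ultra U" "U <= F0" using ultra_exists by blast
 have fbmN: "fbm N" using j by (simp add: jordan_decomposition_def fbm_def)
 interpret N: finite_measure N by (rule fbmD(1)[OF fbmN])
 \<comment> \<open>The test counting starting points has value \<open>1\<close> on every chain;
   always including it bounds the total weight by the mass of \<open>N\<close> plus
   \<open>1\<close>.\<close>
 define t0 :: "'a path_test" where "t0 = ((%_. 0), (%_. 0), (%_. 0), (%_. 1), (%_. 0))"
 have t0: "t0 : valid_tests" by (simp add: t0_def valid_tests_def Lipb_Lip)
 have t0v: "test_value t0 p = 1" for p by (simp add: t0_def test_value_def path_form_def path_cost_def)
 have "T (%_. 0) [%_. 0] = 0" by (rule current1_zero[OF T Lipb_const])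
 hence t0t: "test_target T mu N P t0 = measure N UNIV" by (simp add: t0_def test_target_def fbmD(3)[OF fbmN])
 \<comment> \<open>Indices with an infinite set of tests are negligible for the filter and get the
   empty family.\<close>
 have "EX A w. (ALL p:A. chain (1 / real (Suc n)) p) & (ALL p. 0 <= w p) & (\<Sum>p\<in>A. w p * 1) <= measure N UNIV + 1 &
   (finite F --> (ALL t:F \<inter> valid_tests. (\<Sum>p\<in>A. w p * test_value t p) <= test_target T mu N P t + 1 / real (Suc n)))"
  for F :: "'a path_test set" and n :: nat
 proof (cases "finite F")
  case True
  have I: "finite (insert t0 (F \<inter> valid_tests))" "insert t0 (F \<inter> valid_tests) \<subseteq> valid_tests" using True t0 by auto
  have e: "1 / real (Suc n) > 0" by simp
  obtain A w where A: "finite A" "!!p. p : A ==> chain (1 / real (Suc n)) p" "!!p. 0 <= w p"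
   "!!t. t : insert t0 (F \<inter> valid_tests) ==> (\<Sum>p\<in>A. w p * test_value t p) <= test_target T mu N P t + 1 / real (Suc n)"
   by (rule chain_approximation[OF T c cov j I e e]) (assumption | rule that | blast)+
  have "1 / real (Suc n) <= 1" by simp
  moreover have "(\<Sum>p\<in>A. w p * 1) <= measure N UNIV + 1 / real (Suc n)" using A(4)[of t0] unfolding t0v t0t by blast
  ultimately have "(\<Sum>p\<in>A. w p * 1) <= measure N UNIV + 1" by linarith
  thus ?thesis using A by blast
 next
  case False
  thus ?thesis by (intro exI[of _ "{}"] exI[of _ "%_. 0"]) (simp add: add_nonneg_nonneg)
 qed
 hence "ALL i :: 'a path_test set \<times> nat. EX z. (ALL p:fst z. chain (1 / real (Suc (snd i))) p) & (ALL p. 0 <= snd z p) & (\<Sum>p\<in>fst z. snd z p * 1) <= measure N UNIV + 1 &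
   (finite (fst i) --> (ALL t:fst i \<inter> valid_tests. (\<Sum>p\<in>fst z. snd z p * test_value t p) <= test_target T mu N P t + 1 / real (Suc (snd i))))" by simp
 then obtain z where "ALL i :: 'a path_test set \<times> nat. (ALL p:fst (z i). chain (1 / real (Suc (snd i))) p) & (ALL p. 0 <= snd (z i) p) & (\<Sum>p\<in>fst (z i). snd (z i) p * 1) <= measure N UNIV + 1 &
   (finite (fst i) --> (ALL t:fst i \<inter> valid_tests. (\<Sum>p\<in>fst (z i). snd (z i) p * test_value t p) <= test_target T mu N P t + 1 / real (Suc (snd i))))"
  by (rule choice[THEN exE])
 hence z: "!!i p. p : fst (z i) ==> chain (1 / real (Suc (snd i))) p" "!!i p. 0 <= snd (z i) p"
  "!!i. (\<Sum>p\<in>fst (z i). snd (z i) p * 1) <= measure N UNIV + 1"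
  "!!i t. finite (fst i) ==> t : fst i ==> t : valid_tests ==> (\<Sum>p\<in>fst (z i). snd (z i) p * test_value t p) <= test_target T mu N P t + 1 / real (Suc (snd i))"
  by blast+
 have ev: "eventually (%i. finite (fst i) & t : fst i & n <= snd i) U" for t :: "'a path_test" and n
 proof (rule filter_leD[OF U(2)])
  have 1: "eventually (%F. finite F & t : F) (finite_subsets_at_top UNIV)"
   unfolding eventually_finite_subsets_at_top by (intro exI[of _ "{t}"]) auto
  show "eventually (%i. finite (fst i) & t : fst i & n <= snd i) F0"
   unfolding F0_def eventually_prod_filter using 1 eventually_ge_at_top[of n]
   by (intro exI[of _ "%F. finite F & t : F"] exI[of _ "%k. n <= k"]) auto
 qed
 show ?thesis
 proof (rule that[of U "%i. fst (z i)" "%i. snd (z i)"])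
  show "loeb_data U snd (%i. fst (z i)) (%i. snd (z i)) (measure N UNIV + 1)"
  proof
   show "eventually (%i. n <= snd i) U" for n using ev[of undefined n] by (rule eventually_mono) simp
  qed (use U z in \<open>auto simp: avg_def\<close>)
  fix t :: "'a path_test" and e :: real assume t: "t : valid_tests" and e: "e > 0"
  obtain n where n: "1 / real (Suc n) < e" using nat_approx_posE[OF e] by blast
  show "eventually (%i. avg (%i. fst (z i)) (%i. snd (z i)) i (test_value t) <= test_target T mu N P t + e) U"
   using ev[of t n]
  proof eventually_elim
   case (elim i)
   have "1 / real (Suc (snd i)) <= 1 / real (Suc n)" using elim by (intro divide_left_mono) auto
   thus ?case using z(4)[of i t] elim t n unfolding avg_def by linarith
  qed
 qed (use z in auto)
qed

lemma zero_current: "(%f pj. 0) : currents k"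
proof -
 have "controls k (%f pj. 0) (null_measure borel)"
  unfolding controls_iff by (auto simp: fbm_def intro!: finite_measureI mult_nonneg_nonneg Lip_prod_nonneg)
 thus ?thesis by (auto simp: currents_def multilinear_on_forms_def continuous_on_forms_def local_on_forms_def)
qed

lemma mass_zero: "mass k (%f pj. 0) = 0"
proof -
 have "controls k (%f pj. 0) (null_measure borel)"
  unfolding controls_iff by (auto simp: fbm_def intro!: finite_measureI mult_nonneg_nonneg Lip_prod_nonneg)
 from mass_le_control[OF currents_linear_first[OF zero_current] this] show ?thesis by simp
qed

theorem theorem5p1:
  fixes T :: "'a::complete_space functional"
  assumes ulam_density: "\<And>D :: 'a set. realizes_density_character D \<Longrightarrow> ulam D"
    and normal: "normal_current 1 T"
    and acyclic: "acyclic_current 1 T"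
  shows "decomposable_in_curves T \<and>
    (\<exists>\<eta> :: 'a curve measure. transport \<eta> \<and> T = transport_current \<eta> \<and>
       mass 1 (transport_current \<eta>) = (\<integral>\<^sup>+\<theta>. mass 1 (curve_current \<theta>) \<partial>\<eta>) \<and>
       (\<integral>\<^sup>+\<theta>. mass 1 (curve_current \<theta>) \<partial>\<eta>) = (\<integral>\<^sup>+\<theta>. ennreal (curve_length \<theta>) \<partial>\<eta>) \<and>
       transport_marginal 1 \<eta> = pos_part (boundary T) \<and>
       transport_marginal 0 \<eta> = neg_part (boundary T) \<and>
       (AE \<theta> in \<eta>. is_arc \<theta>))"
proof -
 have T: "T : currents 1" using normal by (simp add: normal_current_def)
 note lT = currents_linear_first[OF T]
 obtain mu0 where "controls 1 T mu0" using T by (auto simp: currents_def)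
 hence ctrl: "controls 1 T (mass_measure 1 T)" by (rule mass_measure_props(1)[OF lT])
 \<comment> \<open>The minimal controlling measure, so that the total cost is bounded by the mass of
   \<open>T\<close> itself.\<close>
 define mu where "mu = mass_measure 1 T"
 have c: "controls 1 T mu" and mT: "mass 1 T = emeasure mu UNIV" using ctrl by (auto simp: mu_def mass_def)
 have fbmmu: "fbm mu" using c by (simp add: controls_iff)
 have "linear_first 0 (boundary T)"
  unfolding linear_first_def
 proof (intro ballI allI)
  fix f g :: "'a => real" and pj :: "('a => real) list" and a b :: real
  assume "f : Lipb_funs" "g : Lipb_funs" "pj : Lip_tuples 0"
  thus "boundary T (%x. a * f x + b * g x) pj = a * boundary T f pj + b * boundary T g pj"
   using current1_lin[OF T Lipb_const[of 1], of f g a b] by (simp add: boundary_def Lipb_lin Lipb_Lip Lip_tuples_def)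
 qed
 moreover have "EX nu. controls 0 (boundary T) nu"
  using normal by (auto simp: normal_current_def mass_def split: if_splits)
 ultimately have j: "jordan_decomposition (boundary T) (pos_part (boundary T)) (neg_part (boundary T))"
  using jordan_parts by blast
 define P where "P = pos_part (boundary T)"
 define N where "N = neg_part (boundary T)"
 have jd: "jordan_decomposition (boundary T) P N" using j by (simp add: P_def N_def)
 have PN: "fbm P" "fbm N" "EX S:sets borel. emeasure P (- S) = 0 & emeasure N S = 0"
  using jd by (auto simp: jordan_decomposition_def fbm_def)
 have cov: "EX C. countable C & emeasure M (- (\<Union>x\<in>C. ball x r)) = 0" if "fbm M" "r > 0" for M :: "'a measure" and r
  by (rule ulam_countable_cover[OF that(1) ulam_density that(2)]) blast+
 obtain U :: "('a path_test set \<times> nat) filter" and A w where sys: "loeb_data U snd A w (measure N UNIV + 1)"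
  "!!i p. p : A i ==> chain (1 / real (Suc (snd i))) p"
  "!!t e. t : valid_tests ==> e > 0 ==> eventually (%i. avg A w i (test_value t) <= test_target T mu N P t + e) U"
  by (rule chain_system_exists[OF T c cov[OF fbmmu] jd]) (assumption | rule that | blast)+
 have zero: "T f [%_. 0] = 0" if "f : Lipb_funs" for f
  by (rule current1_zero[OF T that])
 have neg: "T (%x. - f x) [pj] = - T f [pj]" if f: "f : Lipb_funs" and pj: "pj : Lip_funs" for f pj
 proof -
  have "[pj] : Lip_tuples 1" using pj Lip_tuples_1 by blast
  hence "T (%x. (-1) * f x + 0 * f x) [pj] = (-1) * T f [pj] + 0 * T f [pj]"
   using lT f unfolding linear_first_def by blast
  thus ?thesis by simp
 qed
 have avn: "avg A w i (%p. - F p) = - avg A w i F" for i F using avg_lin[of A w i "-1" F 0 F] by simp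
 note simps = valid_tests_def test_value_def test_target_def path_form_def path_cost_def Lipb_uminus Lipb_Lip
 interpret transport_limit U snd A w "measure N UNIV + 1" T mu P N
 proof (intro transport_limit.intro sys(1) transport_limit_axioms.intro)
  show "((%i. avg A w i (path_form f pj)) \<longlongrightarrow> T f [pj]) U" if f: "f : Lipb_funs" and pj: "pj : Lip_funs" for f pj
  proof (rule tendsto_two_sided)
   fix e :: real assume e: "e > 0"
   \<comment> \<open>The tests with \<open>f\<close> and with \<open>- f\<close> turn one-sided
     bounds into convergence.\<close>
   have v: "(f, pj, (%_. 0), (%_. 0), (%_. 0)) : valid_tests" "((%x. - f x), pj, (%_. 0), (%_. 0), (%_. 0)) : valid_tests"
    using f pj by (auto simp: simps)
   have q: "path_form (%x. - f x) pj = (%p. - path_form f pj p)" by (rule ext) (simp add: path_form_def sum_negf)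
   have cz: "path_cost (%_. 0) = (%p :: 'a list. 0)" by (rule ext) (simp add: path_cost_def)
   show "eventually (%i. avg A w i (path_form f pj) <= T f [pj] + e) U"
    using sys(3)[OF v(1) e] by (simp add: test_value_def test_target_def cz)
   show "eventually (%i. - avg A w i (path_form f pj) <= - T f [pj] + e) U"
    using sys(3)[OF v(2) e] by (simp add: test_value_def test_target_def cz q avn neg[OF f pj])
  qed
  have pz: "path_form (%_. 0) pj = (%p :: 'a list. 0)" "path_cost (%_. 0) = (%p :: 'a list. 0)" for pj
   by (rule ext, simp add: path_form_def, rule ext, simp add: path_cost_def)
  show "eventually (%i. avg A w i (path_cost ph) <= (LINT x|mu. ph x) + e) U"
   if "ph : Lipb_funs" "!!x. 0 <= ph x" "e > 0" for ph e
  proof -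
   have "((%_. 0), (%_. 0), ph, (%_. 0), (%_. 0)) : valid_tests" using that by (auto simp: simps)
   from sys(3)[OF this that(3)] show ?thesis by (simp add: test_value_def test_target_def pz zero)
  qed
  show "((%i. avg A w i (%p. g (hd p))) \<longlongrightarrow> (LINT x|N. g x)) U" if g: "g : Lipb_funs" for g
  proof (rule tendsto_two_sided)
   fix e :: real assume e: "e > 0"
   have v: "((%_. 0), (%_. 0), (%_. 0), g, (%_. 0)) : valid_tests" "((%_. 0), (%_. 0), (%_. 0), (%x. - g x), (%_. 0)) : valid_tests"
    using g by (auto simp: simps)
   show "eventually (%i. avg A w i (%p. g (hd p)) <= (LINT x|N. g x) + e) U"
    using sys(3)[OF v(1) e] by (simp add: test_value_def test_target_def pz zero)
   show "eventually (%i. - avg A w i (%p. g (hd p)) <= - (LINT x|N. g x) + e) U"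
    using sys(3)[OF v(2) e] by (simp add: test_value_def test_target_def pz zero avn)
  qed
  show "((%i. avg A w i (%p. g (last p))) \<longlongrightarrow> (LINT x|P. g x)) U" if g: "g : Lipb_funs" for g
  proof (rule tendsto_two_sided)
   fix e :: real assume e: "e > 0"
   have v: "((%_. 0), (%_. 0), (%_. 0), (%_. 0), g) : valid_tests" "((%_. 0), (%_. 0), (%_. 0), (%_. 0), (%x. - g x)) : valid_tests"
    using g by (auto simp: simps)
   show "eventually (%i. avg A w i (%p. g (last p)) <= (LINT x|P. g x) + e) U"
    using sys(3)[OF v(1) e] by (simp add: test_value_def test_target_def pz zero)
   show "eventually (%i. - avg A w i (%p. g (last p)) <= - (LINT x|P. g x) + e) U"
    using sys(3)[OF v(2) e] by (simp add: test_value_def test_target_def pz zero avn)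
  qed
  show "EX K. compact K & K ~= {} & measure mu (- K) <= e & measure N (- K) <= e" if e: "e > 0" for e
  proof -
   obtain K1 where K1: "compact K1" "measure mu (- K1) <= e" by (rule tight_of_cover[OF fbmmu cov[OF fbmmu] e]) (assumption | rule that | blast)+
   obtain K2 where K2: "compact K2" "measure N (- K2) <= e" by (rule tight_of_cover[OF PN(2) cov[OF PN(2)] e]) (assumption | rule that | blast)+
   \<comment> \<open>A point is added to make \<open>K\<close> nonempty: \<open>infdist\<close> to
     the empty set is \<open>0\<close> and would not measure distance.\<close>
   define K where "K = insert undefined (K1 \<union> K2)"
   have K: "compact K" "K ~= {}" unfolding K_def using K1(1) K2(1) by (auto intro: compact_insert compact_Un)
   have "measure M (- K) <= e" if M: "fbm M" "measure M (- K') <= e" "compact K'" "K' \<subseteq> K" for M K'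
   proof -
    have "measure M (- K) <= measure M (- K')"
     by (rule finite_measure.finite_measure_mono[OF fbmD(1)[OF M(1)]])
      (use M(4) compact_imp_closed[OF M(3)] in \<open>auto simp: fbmD(2)[OF M(1)]\<close>)
    thus ?thesis using M(2) by simp
   qed
   hence "measure mu (- K) <= e" "measure N (- K) <= e" using K1 K2 fbmmu PN(2) unfolding K_def by blast+
   thus ?thesis using K by blast
  qed
 qed (use T c mT acyclic PN sys(2) in auto)
 note eta = transport_exists[unfolded P_def N_def]
 \<comment> \<open>The transport reproduces all of \<open>T\<close>, so the cycle in the
   decomposition is \<open>0\<close> and \<open>T_\<eta> \<le> T\<close> holds with
   equality.\<close>
 have "cycle_of 1 (%f pj. 0) T" unfolding cycle_of_def subcurrent_def
  using T zero_current by (simp add: mass_zero boundary_def fun_eq_iff)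
 moreover have "subcurrent 1 T T" unfolding subcurrent_def using T by (simp add: mass_zero)
 ultimately have "decomposable_in_curves T"
  unfolding decomposable_in_curves_def using normal eta
  by (elim exE, rename_tac eta, intro conjI, simp, rule_tac x = eta in exI, intro exI[of _ "%f pj. 0"]) simp
 thus ?thesis using eta by blast
qed

end
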